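(* Let $Y\subset\mathbb{P}^6$ be a general cubic $5$-fold over $\mathbb{C}$. Then the moduli space $\Sigma$ of planes in $Y$ is a smooth projective surface.
   Context: A cubic $5$-fold is a degree-$3$ hypersurface $Y=\{f=0\}\subset\mathbb{P}^6$ over $\mathbb{C}$. "General" means that the defining polynomial $f$ lies in a suitable nonempty Zariski-open subset of the space of homogeneous cubic polynomials on $\mathbb{C}^7$. Let $\mathrm{Gr}(3,7)$ be the Grassmannian of $3$-dimensional linear subspaces of $\mathbb{C}^7$ (equivalently, planes in $\mathbb{P}^6$), with tautological rank-$3$ subbundle $\mathcal{U}$. The polynomial $f$ induces by restriction a global section $\sigma_f$ of $\mathrm{Sym}^3\mathcal{U}^\vee$, and $\Sigma\subset\mathrm{Gr}(3,7)$ is the zero locus of $\sigma_f$, i.e. the locus of planes contained in $Y$. *)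

theory Defs
  imports "HOL-Analysis.Analysis" "HOL-Library.Poly_Mapping"
begin

subsection \<open>Multivariate polynomials\<close>

text \<open>
  The polynomial ring \<open>R[x\<^sub>i | i \<in> 'i]\<close> is the monoid ring on the monomials \<open>'i \<Rightarrow>\<^sub>0 nat\<close>;
  its ring structure is the convolution product of \<^theory>\<open>HOL-Library.Poly_Mapping\<close>.
\<close>

type_synonym ('i, 'a) mpoly = "('i \<Rightarrow>\<^sub>0 nat) \<Rightarrow>\<^sub>0 'a"

definition mp_const :: "'a::zero \<Rightarrow> ('i, 'a) mpoly" where
  "mp_const c = Poly_Mapping.single 0 c"

definition mp_var :: "'i \<Rightarrow> ('i, 'a::zero_neq_one) mpoly" where
  "mp_var i = Poly_Mapping.single (Poly_Mapping.single i 1) 1"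

text \<open>Apply \<open>h\<close> (in practice a ring homomorphism) to the coefficients and substitute \<open>x i\<close> for
  the \<open>i\<close>-th variable.\<close>

definition mp_subst ::
    "('a::zero \<Rightarrow> 'b::comm_ring_1) \<Rightarrow> ('i \<Rightarrow> 'b) \<Rightarrow> ('i, 'a) mpoly \<Rightarrow> 'b" where
  "mp_subst h x p = (\<Sum>m\<in>Poly_Mapping.keys p.
     h (Poly_Mapping.lookup p m) * (\<Prod>i\<in>Poly_Mapping.keys m. x i ^ Poly_Mapping.lookup m i))"

definition mp_eval :: "('i, 'a::comm_ring_1) mpoly \<Rightarrow> ('i \<Rightarrow> 'a) \<Rightarrow> 'a" where
  "mp_eval p x = mp_subst (\<lambda>c. c) x p"

definition mon_degree :: "('i \<Rightarrow>\<^sub>0 nat) \<Rightarrow> nat" where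
  "mon_degree m = (\<Sum>i\<in>Poly_Mapping.keys m. Poly_Mapping.lookup m i)"

definition homogeneous :: "nat \<Rightarrow> ('i, 'a::zero) mpoly \<Rightarrow> bool" where
  "homogeneous d p \<longleftrightarrow> (\<forall>m\<in>Poly_Mapping.keys p. mon_degree m = d)"

definition mp_pderiv :: "'i \<Rightarrow> ('i, 'a::comm_semiring_1) mpoly \<Rightarrow> ('i, 'a) mpoly" where
  "mp_pderiv i p = (\<Sum>m\<in>Poly_Mapping.keys p.
     Poly_Mapping.single (m - Poly_Mapping.single i 1)
       (of_nat (Poly_Mapping.lookup m i) * Poly_Mapping.lookup p m))"

definition ideal_gen :: "'a::comm_ring_1 set \<Rightarrow> 'a set" where
  "ideal_gen G = module.span (*) G"


subsection \<open>Smoothness and irreducibility\<close>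

text \<open>
  \<open>smooth_at G d p\<close>: the closed subscheme \<open>Spec \<complex>[x]/(G)\<close> of affine \<open>n\<close>-space is smooth of
  relative dimension \<open>d\<close> over \<open>\<complex>\<close> at its point \<open>p\<close>.  As in EGA IV or Bosch-Luetkebohmert-Raynaud,
  this means that near \<open>p\<close> the ideal \<open>(G)\<close> is generated by \<open>n - d\<close> elements whose
  differentials are linearly independent at \<open>p\<close>.  The polynomial \<open>h\<close> is the denominator of the
  localisation in which \<open>(G)\<close> and the ideal generated by these elements agree.
  Smoothness is a property of the scheme, so it includes reducedness.
\<close>

definition smooth_at ::
    "('i::finite, complex) mpoly set \<Rightarrow> nat \<Rightarrow> ('i \<Rightarrow> complex) \<Rightarrow> bool" where
  "smooth_at G d p \<longleftrightarrow>
     (\<forall>q\<in>G. mp_eval q p = 0) \<and> d \<le> CARD('i) \<and>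
     (\<exists>(g :: nat \<Rightarrow> ('i, complex) mpoly) h.
        (\<forall>j < CARD('i) - d. g j \<in> ideal_gen G) \<and>
        mp_eval h p \<noteq> 0 \<and>
        (\<forall>q\<in>G. h * q \<in> ideal_gen (g ` {..<CARD('i) - d})) \<and>
        (\<forall>a :: nat \<Rightarrow> complex.
           (\<forall>i. (\<Sum>j < CARD('i) - d. a j * mp_eval (mp_pderiv i (g j)) p) = 0) \<longrightarrow>
           (\<forall>j < CARD('i) - d. a j = 0)))"

definition irreducible_space :: "'a topology \<Rightarrow> bool" where
  "irreducible_space X \<longleftrightarrow> topspace X \<noteq> {} \<and>
     (\<forall>A B. closedin X A \<longrightarrow> closedin X B \<longrightarrow> A \<union> B = topspace X \<longrightarrow>
        A = topspace X \<or> B = topspace X)"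


subsection \<open>Cubic forms on \<open>\<complex>\<^sup>7\<close>\<close>

definition cubic_forms :: "(7, complex) mpoly set" where
  "cubic_forms = {f. homogeneous 3 f}"

text \<open>The affine coordinates on the space of cubic forms are the coefficients, so the variables of
  \<open>\<Phi>\<close> are monomials; those of degree other than 3 evaluate to 0.\<close>

definition cubic_zariski :: "(7, complex) mpoly topology" where
  "cubic_zariski = topology_generated_by
     (range (\<lambda>\<Phi> :: (7 \<Rightarrow>\<^sub>0 nat, complex) mpoly.
        {f \<in> cubic_forms. mp_eval \<Phi> (Poly_Mapping.lookup f) \<noteq> 0}))"


subsection \<open>The Grassmannian \<open>Gr(3,7)\<close>\<close>

definition Gr37 :: "(complex ^ 7) set set" where
  "Gr37 = {W. vec.subspace W \<and> vec.dim W = 3}"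

text \<open>
  A bijection \<open>\<pi>\<close> from \<open>3 + 4\<close> to the coordinates of \<open>\<complex>\<^sup>7\<close> selects three pivot coordinates
  \<open>\<pi> (Inl i)\<close>.  The corresponding standard affine chart \<open>\<complex>\<^sup>1\<^sup>2 \<rightarrow> Gr(3,7)\<close> sends \<open>A\<close> to the row space
  of the \<open>3 \<times> 7\<close> matrix that is the identity in the pivot columns and \<open>A\<close> in the others.
  The entries of this matrix are \<open>gr_entry \<pi> i k\<close>, with the 12 entries of \<open>A\<close> as variables.
\<close>

type_synonym chart_var = "3 \<times> 4"

definition gr_entry :: "(3 + 4 \<Rightarrow> 7) \<Rightarrow> 3 \<Rightarrow> 7 \<Rightarrow> (chart_var, complex) mpoly" where
  "gr_entry \<pi> i k = (case inv \<pi> k of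
       Inl i' \<Rightarrow> (if i' = i then 1 else 0)
     | Inr j \<Rightarrow> mp_var (i, j))"

definition gr_row :: "(3 + 4 \<Rightarrow> 7) \<Rightarrow> (chart_var \<Rightarrow> complex) \<Rightarrow> 3 \<Rightarrow> complex ^ 7" where
  "gr_row \<pi> A i = (\<chi> k. mp_eval (gr_entry \<pi> i k) A)"

definition gr_chart :: "(3 + 4 \<Rightarrow> 7) \<Rightarrow> (chart_var \<Rightarrow> complex) \<Rightarrow> (complex ^ 7) set" where
  "gr_chart \<pi> A = vec.span (range (gr_row \<pi> A))"

definition gr_zariski :: "(complex ^ 7) set topology" where
  "gr_zariski = topology_generated_by
     {gr_chart \<pi> ` {A. mp_eval F A \<noteq> 0} | \<pi> F. bij \<pi>}"

text \<open>
  The Pluecker embedding.  The coordinates are the minors of a \<open>3 \<times> 7\<close> matrix with row space \<open>W\<close>,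
  indexed by arbitrary maps \<open>K :: 3 \<Rightarrow> 7\<close> instead of increasing ones.  They are alternating in \<open>K\<close>,
  so the image lies in the linear subspace \<open>\<bbbP>(\<Lambda>\<^sup>3 \<complex>\<^sup>7) = \<bbbP>\<^sup>3\<^sup>4\<close> of the projective space on all \<open>K\<close>.
  Changing the basis of \<open>W\<close> rescales the coordinates by any nonzero factor, so that \<open>plucker_cone X\<close>
  is the set of all homogeneous coordinate vectors of the points of \<open>X\<close>.
\<close>

definition plucker :: "(3 \<Rightarrow> complex ^ 7) \<Rightarrow> (3 \<Rightarrow> 7) \<Rightarrow> complex" where
  "plucker B K = det (\<chi> i j. B i $ K j)"

definition plucker_cone :: "(complex ^ 7) set set \<Rightarrow> ((3 \<Rightarrow> 7) \<Rightarrow> complex) set" where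
  "plucker_cone X = {plucker B | B. vec.span (range B) \<in> X}"

definition proj_zero_locus :: "('i, complex) mpoly set \<Rightarrow> ('i \<Rightarrow> complex) set" where
  "proj_zero_locus S = {x. x \<noteq> (\<lambda>_. 0) \<and> (\<forall>F\<in>S. mp_eval F x = 0)}"

text \<open>\<open>X\<close> is closed in \<open>Gr(3,7)\<close> embedded in projective space.\<close>

definition plucker_projective :: "(complex ^ 7) set set \<Rightarrow> bool" where
  "plucker_projective X \<longleftrightarrow> X \<subseteq> Gr37 \<and>
     (\<exists>S. (\<forall>F\<in>S. \<exists>d. homogeneous d F) \<and> plucker_cone X = proj_zero_locus S)"


subsection \<open>The scheme of planes in a cubic\<close>

definition planes :: "(7, complex) mpoly \<Rightarrow> (complex ^ 7) set set" where
  "planes f = {W \<in> Gr37. \<forall>w\<in>W. mp_eval f (\<lambda>k. w $ k) = 0}"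

text \<open>
  Over a chart the rows of the matrix trivialise the tautological subbundle; with \<open>t\<^sub>1, t\<^sub>2, t\<^sub>3\<close>
  the dual frame, the section \<open>\<sigma>\<^sub>f\<close> of \<open>Sym\<^sup>3 U\<^sup>\<or>\<close> is the cubic form \<open>f(\<Sum>\<^sub>i t\<^sub>i row\<^sub>i)\<close> in \<open>t\<close> with
  coefficients in the coordinate ring of the chart.  Its 10 coefficients generate the ideal of the
  zero scheme of \<open>\<sigma>\<^sub>f\<close>.
\<close>

definition planes_section ::
    "(3 + 4 \<Rightarrow> 7) \<Rightarrow> (7, complex) mpoly \<Rightarrow> (3, (chart_var, complex) mpoly) mpoly" where
  "planes_section \<pi> f = mp_subst (\<lambda>c. mp_const (mp_const c))
     (\<lambda>k. \<Sum>i\<in>UNIV. mp_const (gr_entry \<pi> i k) * mp_var i) f"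

definition planes_eqs ::
    "(3 + 4 \<Rightarrow> 7) \<Rightarrow> (7, complex) mpoly \<Rightarrow> (chart_var, complex) mpoly set" where
  "planes_eqs \<pi> f = {Poly_Mapping.lookup (planes_section \<pi> f) m | m. mon_degree m = 3}"

text \<open>A surface is understood to be irreducible, in particular nonempty; its dimension is the
  relative dimension in the smoothness condition.\<close>

definition planes_smooth_projective_surface :: "(7, complex) mpoly \<Rightarrow> bool" where
  "planes_smooth_projective_surface f \<longleftrightarrow>
     plucker_projective (planes f) \<and>
     irreducible_space (subtopology gr_zariski (planes f)) \<and>
     (\<forall>W\<in>planes f. \<exists>\<pi> A. bij \<pi> \<and> W = gr_chart \<pi> A \<and> smooth_at (planes_eqs \<pi> f) 2 A)"

end

(*
  Write a cubic as a tensor c with polar form F.  By a parameter count, two closed conditions on c fail generically: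
  F is singular, or F(B, B, v) = 0 for a plane B in the cubic and some v outside B.  A family of tensors that is
  parametrised by fewer variables than there are cubic coefficients satisfies an algebraic relation, so the count
  needs no dimension theory.  If both conditions fail, a linear form on the ternary cubics that kills the image of
  the differential of the equations of the planes vanishes.  Hence the planes in the cubic are the transversal zeros of
  10 equations in 12 chart coordinates, and by the inverse function theorem they form a local product over the space
  of cubics.

  Nonemptiness propagates from one explicit pair of a cubic and a plane, since the set of generic cubics is connected
  and the planes form a proper family.  For connectedness consider triples of a generic cubic and two of its planes.
  The triples with disjoint planes in general position are parametrised by a coordinate change and a tensor in a linear
  space, minus the zeros of a polynomial, so they form a connected set; it is dense because two
  planes that meet can be moved apart.  So the space of all triples is connected, and a locally constant
  relation on it, lying in the same component, must hold everywhere.  Irreducibility then follows from the identity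
  theorem for holomorphic functions on the connected manifold of planes.
*)
theory Submission
  imports Defs "HOL-Complex_Analysis.Complex_Analysis"
begin

text \<open>Planes are represented by frames, that is 3 x 7 matrices of rank 3, so no quotient
  manifold is needed; connectedness and irreducibility are proved for \<open>plane_frames c\<close>
  and passed down along \<open>fspan\<close>. The compactness that frames lose is recovered by
  orthonormalising into \<open>stiefel\<close>.

  The counts behind genericity: a singular point has 6 parameters and costs 7 coefficients; a plane
  with a tangent direction has 12 + 3 parameters and costs 10 + 6 coefficients.

  Without a tangent direction, the 4-dimensional quotient of C^7 by the plane embeds into the
  6-dimensional space of ternary quadrics. If a linear form on ternary cubics kills the image of the
  differential, its three contractions annihilate this subspace, so they are dependent (4 + 3 > 6).
  The form then lives on binary cubics, where the annihilated quadrics share a zero, and that zero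
  would be a singular point.

  Nonvanishing of polynomials is exploited along complex lines: an entire function that is not
  identically zero has countably many zeros, and the complex plane minus a countable set is path
  connected.\<close>

no_notation fps_nth (infixl "$" 75)

section \<open>Evaluation of polynomials\<close>

definition mon_val :: "('i \<Rightarrow> 'b::comm_ring_1) \<Rightarrow> ('i \<Rightarrow>\<^sub>0 nat) \<Rightarrow> 'b" where
  "mon_val x m = (\<Prod>i\<in>Poly_Mapping.keys m. x i ^ Poly_Mapping.lookup m i)"

lemma mon_val_superset:
  assumes "finite S" "Poly_Mapping.keys m \<subseteq> S"
  shows "mon_val x m = (\<Prod>i\<in>S. x i ^ Poly_Mapping.lookup m i)"
  unfolding mon_val_def
  by (rule prod.mono_neutral_left) (use assms in \<open>auto simp: in_keys_iff\<close>)

lemma mon_val_0 [simp]: "mon_val x 0 = 1"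
  by (simp add: mon_val_def)

lemma mon_val_single [simp]: "mon_val x (Poly_Mapping.single i n) = x i ^ n"
  by (cases "n = 0") (auto simp: mon_val_def)

lemma mon_val_add: "mon_val x (m + n) = mon_val x m * mon_val x n"
proof -
  let ?S = "Poly_Mapping.keys m \<union> Poly_Mapping.keys n"
  have "Poly_Mapping.keys (m + n) \<subseteq> ?S" by (rule Poly_Mapping.keys_add)
  then show ?thesis
    by (subst (1 2 3) mon_val_superset[of ?S])
       (auto simp: lookup_add power_add prod.distrib)
qed

definition ring_map :: "('a::comm_ring_1 \<Rightarrow> 'b::comm_ring_1) \<Rightarrow> bool" where
  "ring_map h \<longleftrightarrow> h 0 = 0 \<and> h 1 = 1 \<and> (\<forall>a b. h (a + b) = h a + h b) \<and> (\<forall>a b. h (a * b) = h a * h b)"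

lemma ring_map_id [simp]: "ring_map (\<lambda>c. c)"
  by (simp add: ring_map_def)

lemma mp_subst_superset:
  assumes "ring_map h" "finite S" "Poly_Mapping.keys p \<subseteq> S"
  shows "mp_subst h x p = (\<Sum>m\<in>S. h (Poly_Mapping.lookup p m) * mon_val x m)"
  unfolding mp_subst_def mon_val_def
  by (rule sum.mono_neutral_left) (use assms in \<open>auto simp: in_keys_iff ring_map_def\<close>)

lemma mp_subst_0 [simp]: "mp_subst h x 0 = 0"
  by (simp add: mp_subst_def)

lemma mp_subst_single:
  assumes "ring_map h"
  shows "mp_subst h x (Poly_Mapping.single m a) = h a * mon_val x m"
  by (subst mp_subst_superset[of h "{m}"]) (use assms in auto)

lemma mp_subst_add:
  assumes "ring_map h"
  shows "mp_subst h x (p + q) = mp_subst h x p + mp_subst h x q"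
proof -
  let ?S = "Poly_Mapping.keys p \<union> Poly_Mapping.keys q"
  have "Poly_Mapping.keys (p + q) \<subseteq> ?S" by (rule Poly_Mapping.keys_add)
  then show ?thesis using assms
    by (subst (1 2 3) mp_subst_superset[of h ?S])
       (auto simp: lookup_add ring_map_def sum.distrib algebra_simps)
qed

lemma mp_subst_sum:
  assumes "ring_map h"
  shows "mp_subst h x (sum p A) = (\<Sum>i\<in>A. mp_subst h x (p i))"
  by (induction A rule: infinite_finite_induct) (auto simp: mp_subst_add assms)

lemma poly_mapping_eq_sum_single:
  "p = (\<Sum>m\<in>Poly_Mapping.keys p. Poly_Mapping.single m (Poly_Mapping.lookup p m))"
proof (rule poly_mapping_eqI)
  fix k
  have "(\<Sum>m\<in>Poly_Mapping.keys p. Poly_Mapping.lookup p m when m = k) = Poly_Mapping.lookup p k"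
    by (simp add: when_def in_keys_iff)
  then show "Poly_Mapping.lookup p k = Poly_Mapping.lookup
     (\<Sum>m\<in>Poly_Mapping.keys p. Poly_Mapping.single m (Poly_Mapping.lookup p m)) k"
    by (simp add: lookup_sum lookup_single)
qed

lemma mp_subst_mult:
  fixes p q :: "('c, 'a::comm_ring_1) mpoly"
  assumes "ring_map h"
  shows "mp_subst h x (p * q) = mp_subst h x p * mp_subst h x q"
proof -
  have h: "h (a * b) = h a * h b" for a b
    using assms by (simp add: ring_map_def)
  have 1: "mp_subst h x (Poly_Mapping.single m a * Poly_Mapping.single n b) =
     mp_subst h x (Poly_Mapping.single m a) * mp_subst h x (Poly_Mapping.single n b)" for m n a b
    by (simp add: mult_single mp_subst_single assms mon_val_add h algebra_simps)
  have 2: "mp_subst h x (sum P A * sum Q B) = mp_subst h x (sum P A) * mp_subst h x (sum Q B)"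
    if "\<And>i j. mp_subst h x (P i * Q j) = mp_subst h x (P i) * mp_subst h x (Q j)" 
      for P Q :: "('c \<Rightarrow>\<^sub>0 nat) \<Rightarrow> ('c, 'a) mpoly" and A B
    by (simp add: sum_product mp_subst_sum assms that)
  show ?thesis
    using 2[OF 1, of "\<lambda>m. m" "Poly_Mapping.lookup p" "Poly_Mapping.keys p"
        "\<lambda>m. m" "Poly_Mapping.lookup q" "Poly_Mapping.keys q"]
    unfolding poly_mapping_eq_sum_single[symmetric] .
qed

lemma mp_subst_1 [simp]: "ring_map h \<Longrightarrow> mp_subst h x 1 = 1"
  using mp_subst_single[of h x 0 1] by (simp add: ring_map_def)

lemma mp_eval_eq: "mp_eval p x = (\<Sum>m\<in>Poly_Mapping.keys p. Poly_Mapping.lookup p m * mon_val x m)"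
  by (simp add: mp_eval_def mp_subst_def mon_val_def)

lemma mp_eval_0 [simp]: "mp_eval 0 x = 0"
  and mp_eval_1 [simp]: "mp_eval 1 x = 1"
  and mp_eval_single [simp]: "mp_eval (Poly_Mapping.single m a) x = a * mon_val x m"
  and mp_eval_add [simp]: "mp_eval (p + q) x = mp_eval p x + mp_eval q x"
  and mp_eval_mult [simp]: "mp_eval (p * q) x = mp_eval p x * mp_eval q x"
  and mp_eval_sum [simp]: "mp_eval (sum P A) x = (\<Sum>i\<in>A. mp_eval (P i) x)"
  and mp_eval_const [simp]: "mp_eval (mp_const a) x = a"
  and mp_eval_var [simp]: "mp_eval (mp_var i) x = x i"
  by (simp_all add: mp_eval_def mp_subst_single mp_subst_add mp_subst_mult mp_subst_sum
      mp_const_def mp_var_def)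

lemma mp_eval_prod [simp]: "mp_eval (prod P A) x = (\<Prod>i\<in>A. mp_eval (P i) x)"
  by (induction A rule: infinite_finite_induct) auto

lemma holomorphic_on_mp_eval:
  fixes p :: "('i, complex) mpoly"
  assumes "\<And>i. (\<lambda>z. x z i) holomorphic_on S"
  shows "(\<lambda>z. mp_eval p (x z)) holomorphic_on S"
  unfolding mp_eval_eq mon_val_def by (intro holomorphic_intros assms)

text \<open>This lets the formal Jacobian in \<open>smooth_at\<close> be computed by differentiating
  polar forms along one chart coordinate.\<close>

lemma mp_pderiv_eval:
  fixes p :: "('i, complex) mpoly"
  shows "((\<lambda>z. mp_eval p (x(i := z))) has_field_derivative mp_eval (mp_pderiv i p) x) (at (x i))"
proof -
  have mono: "((\<lambda>z. mon_val (x(i := z)) m) has_field_derivative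
      of_nat (Poly_Mapping.lookup m i) * mon_val x (m - Poly_Mapping.single i 1)) (at (x i))" for m
  proof -
    let ?S = "Poly_Mapping.keys m - {i}"
    let ?n = "Poly_Mapping.lookup m i"
    define C where "C = (\<Prod>j\<in>?S. x j ^ Poly_Mapping.lookup m j)"
    have 1: "mon_val (x(i := z)) m = z ^ ?n * C" for z
    proof -
      have "mon_val (x(i := z)) m = (\<Prod>j\<in>insert i ?S. (x(i := z)) j ^ Poly_Mapping.lookup m j)"
        by (rule mon_val_superset) auto
      also have "\<dots> = z ^ ?n * C"
        unfolding C_def by (subst prod.insert) (auto intro!: prod.cong)
      finally show ?thesis .
    qed
    \<comment> \<open>If i does not occur in m, the truncated subtractions leave exponent 0, and the
      factor \<open>of_nat 0\<close> makes the derivative vanish as it should.\<close>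
    have 2: "mon_val x (m - Poly_Mapping.single i 1) = x i ^ (?n - 1) * C"
    proof -
      have "mon_val x (m - Poly_Mapping.single i 1) =
         (\<Prod>j\<in>insert i ?S. x j ^ Poly_Mapping.lookup (m - Poly_Mapping.single i 1) j)"
        by (rule mon_val_superset) (auto simp: in_keys_iff lookup_minus)
      also have "\<dots> = x i ^ (?n - 1) * C"
        unfolding C_def
        by (subst prod.insert) (auto simp: lookup_minus lookup_single when_def intro!: prod.cong)
      finally show ?thesis .
    qed
    show ?thesis unfolding 1 2
      by (auto intro!: derivative_eq_intros)
  qed
  have "((\<lambda>z. \<Sum>m\<in>Poly_Mapping.keys p. Poly_Mapping.lookup p m * mon_val (x(i := z)) m)
     has_field_derivative (\<Sum>m\<in>Poly_Mapping.keys p. Poly_Mapping.lookup p m *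
      (of_nat (Poly_Mapping.lookup m i) * mon_val x (m - Poly_Mapping.single i 1)))) (at (x i))"
    by (intro DERIV_sum DERIV_cmult mono)
  moreover have "mp_eval (mp_pderiv i p) x = (\<Sum>m\<in>Poly_Mapping.keys p. Poly_Mapping.lookup p m *
      (of_nat (Poly_Mapping.lookup m i) * mon_val x (m - Poly_Mapping.single i 1)))"
    unfolding mp_pderiv_def mp_eval_sum mp_eval_single by (simp add: algebra_simps)
  ultimately show ?thesis by (simp add: mp_eval_eq)
qed

section \<open>Cubic tensors and cubic forms\<close>

definition mon3 :: "'i \<Rightarrow> 'i \<Rightarrow> 'i \<Rightarrow> ('i \<Rightarrow>\<^sub>0 nat)" where
  "mon3 a b d = Poly_Mapping.single a 1 + Poly_Mapping.single b 1 + Poly_Mapping.single d 1"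

lemma mon_val_mon3 [simp]: "mon_val x (mon3 a b d) = x a * x b * x d"
  by (simp add: mon3_def mon_val_add)

lemma mon3_perm: "mon3 a b d = mon3 b a d" "mon3 a b d = mon3 a d b"
  by (simp_all add: mon3_def algebra_simps)

lemma mon3_eq_iff: "mon3 a b d = mon3 a' b' d' \<longleftrightarrow> {#a, b, d#} = {#a', b', d'#}"
proof
  assume eq: "mon3 a b d = mon3 a' b' d'"
  show "{#a, b, d#} = {#a', b', d'#}"
  proof (rule multiset_eqI)
    fix x
    have "Poly_Mapping.lookup (mon3 a b d) x = Poly_Mapping.lookup (mon3 a' b' d') x"
      using eq by simp
    then show "count {#a, b, d#} x = count {#a', b', d'#} x"
      by (simp add: mon3_def lookup_add lookup_single when_def split: if_splits)
  qed
next
  assume eq: "{#a, b, d#} = {#a', b', d'#}"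
  show "mon3 a b d = mon3 a' b' d'"
  proof (rule poly_mapping_eqI)
    fix x
    have "count {#a, b, d#} x = count {#a', b', d'#} x"
      using eq by simp
    then show "Poly_Mapping.lookup (mon3 a b d) x = Poly_Mapping.lookup (mon3 a' b' d') x"
      by (simp add: mon3_def lookup_add lookup_single when_def split: if_splits)
  qed
qed

lemma mon3_eqD:
  assumes "mon3 a b d = mon3 a' b' d'"
  shows "(a, b, d) \<in> {(a', b', d'), (a', d', b'), (b', a', d'), (b', d', a'), (d', a', b'), (d', b', a')}"
  using assms unfolding mon3_eq_iff by (auto simp: add_eq_conv_ex add_mset_eq_singleton_iff)

lemma mon_degree_superset:
  assumes "finite S" "Poly_Mapping.keys m \<subseteq> S"
  shows "mon_degree m = (\<Sum>i\<in>S. Poly_Mapping.lookup m i)"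
  unfolding mon_degree_def
  by (rule sum.mono_neutral_left) (use assms in \<open>auto simp: in_keys_iff\<close>)

lemma mon_degree_add: "mon_degree (m + n) = mon_degree m + mon_degree n"
proof -
  let ?S = "Poly_Mapping.keys m \<union> Poly_Mapping.keys n"
  have "Poly_Mapping.keys (m + n) \<subseteq> ?S" by (rule Poly_Mapping.keys_add)
  then show ?thesis
    by (subst (1 2 3) mon_degree_superset[of ?S]) (auto simp: lookup_add sum.distrib)
qed

lemma mon_degree_single [simp]: "mon_degree (Poly_Mapping.single i n) = n"
  by (cases "n = 0") (auto simp: mon_degree_def)

lemma mon_degree_mon3 [simp]: "mon_degree (mon3 a b d) = 3"
  by (simp add: mon3_def mon_degree_add)

lemma mon_degree_0_iff: "mon_degree m = 0 \<longleftrightarrow> m = 0"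
proof
  assume "mon_degree m = 0"
  then have "\<forall>i\<in>Poly_Mapping.keys m. Poly_Mapping.lookup m i = 0"
    unfolding mon_degree_def by auto
  then show "m = 0" by (intro poly_mapping_eqI) (metis in_keys_iff lookup_zero)
qed (simp add: mon_degree_def)

lemma mon_degree_SucE:
  assumes "mon_degree m = Suc n"
  obtains i m' where "m = Poly_Mapping.single i 1 + m'" "mon_degree m' = n"
proof -
  have "m \<noteq> 0" using assms mon_degree_0_iff[of m] by auto
  then obtain i where i: "i \<in> Poly_Mapping.keys m" by (metis all_not_in_conv keys_eq_empty)
  have eq: "m = Poly_Mapping.single i 1 + (m - Poly_Mapping.single i 1)"
    by (rule poly_mapping_eqI) (use i in \<open>auto simp: lookup_add lookup_minus lookup_single in_keys_iff when_def\<close>)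
  then have "mon_degree m = 1 + mon_degree (m - Poly_Mapping.single i 1)"
    by (metis mon_degree_add mon_degree_single)
  with assms eq show ?thesis by (intro that[of i "m - Poly_Mapping.single i 1"]) auto
qed

lemma mon_degree_3E:
  assumes "mon_degree m = 3"
  obtains a b d where "m = mon3 a b d"
proof -
  have "mon_degree m = Suc (Suc (Suc 0))" using assms by simp
  then obtain a m1 where 1: "m = Poly_Mapping.single a 1 + m1" "mon_degree m1 = Suc (Suc 0)"
    by (rule mon_degree_SucE)
  obtain b m2 where 2: "m1 = Poly_Mapping.single b 1 + m2" "mon_degree m2 = Suc 0"
    using 1(2) by (rule mon_degree_SucE)
  obtain d m3 where 3: "m2 = Poly_Mapping.single d 1 + m3" "mon_degree m3 = 0"
    using 2(2) by (rule mon_degree_SucE)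
  then have "m = mon3 a b d"
    using 1 2 by (simp add: mon3_def mon_degree_0_iff add.assoc)
  then show ?thesis by (rule that)
qed

text \<open>Arbitrary coefficient arrays, not only symmetric ones: they form a plain Euclidean
  space, which supplies topology and complex lines, and every cubic still comes from some
  array.\<close>

type_synonym tensor = "complex ^ 7 ^ 7 ^ 7"

definition tri :: "tensor \<Rightarrow> complex ^ 7 \<Rightarrow> complex ^ 7 \<Rightarrow> complex ^ 7 \<Rightarrow> complex" where
  "tri c x y z = (\<Sum>a\<in>UNIV. \<Sum>b\<in>UNIV. \<Sum>d\<in>UNIV. c $ a $ b $ d * (x $ a * y $ b * z $ d))"

definition polar :: "tensor \<Rightarrow> complex ^ 7 \<Rightarrow> complex ^ 7 \<Rightarrow> complex ^ 7 \<Rightarrow> complex" where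
  "polar c x y z = (tri c x y z + tri c x z y + tri c y x z + tri c y z x + tri c z x y + tri c z y x) / 6"

definition form :: "tensor \<Rightarrow> (7, complex) mpoly" where
  "form c = (\<Sum>a\<in>UNIV. \<Sum>b\<in>UNIV. \<Sum>d\<in>UNIV. Poly_Mapping.single (mon3 a b d) (c $ a $ b $ d))"

definition sym_tensor :: "tensor \<Rightarrow> bool" where
  "sym_tensor c \<longleftrightarrow> (\<forall>a b d. c $ a $ b $ d = c $ b $ a $ d \<and> c $ a $ b $ d = c $ a $ d $ b)"

lemma tri_add:
  "tri c (x + x') y z = tri c x y z + tri c x' y z"
  "tri c x (y + y') z = tri c x y z + tri c x y' z"
  "tri c x y (z + z') = tri c x y z + tri c x y z'"
  "tri (c + c') x y z = tri c x y z + tri c' x y z"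
  by (simp_all add: tri_def algebra_simps sum.distrib)

lemma tri_scale:
  "tri c (r *s x) y z = r * tri c x y z"
  "tri c x (r *s y) z = r * tri c x y z"
  "tri c x y (r *s z) = r * tri c x y z"
  by (simp_all add: tri_def sum_distrib_left algebra_simps)

lemma polar_commute: "polar c x y z = polar c y x z" "polar c x y z = polar c x z y"
  by (simp_all add: polar_def algebra_simps)

lemma polar_add:
  "polar c (x + x') y z = polar c x y z + polar c x' y z"
  "polar c x (y + y') z = polar c x y z + polar c x y' z"
  "polar c x y (z + z') = polar c x y z + polar c x y z'"
  "polar (c + c') x y z = polar c x y z + polar c' x y z"
  by (simp_all add: polar_def tri_add add_divide_distrib)

lemma polar_scale:
  "polar c (r *s x) y z = r * polar c x y z"
  "polar c x (r *s y) z = r * polar c x y z"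
  "polar c x y (r *s z) = r * polar c x y z"
  by (simp_all add: polar_def tri_scale algebra_simps add_divide_distrib)

lemma polar_0 [simp]: "polar c 0 y z = 0" "polar c x 0 z = 0" "polar c x y 0 = 0"
  using polar_scale[where r=0 and c=c] by simp_all

lemma polar_minus:
  "polar c (- x) y z = - polar c x y z"
  "polar c x (- y) z = - polar c x y z"
  "polar c x y (- z) = - polar c x y z"
  using polar_scale[where r="-1" and c=c] by simp_all

lemma polar_diff:
  "polar c (x - x') y z = polar c x y z - polar c x' y z"
  "polar c x (y - y') z = polar c x y z - polar c x y' z"
  "polar c x y (z - z') = polar c x y z - polar c x y z'"
  using polar_add(1)[of c x "-x'"] polar_add(2)[of c x y "-y'"] polar_add(3)[of c x y z "-z'"]
  by (simp_all add: polar_minus)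

lemma polar_sum:
  "polar c (sum X A) y z = (\<Sum>i\<in>A. polar c (X i) y z)"
  "polar c x (sum X A) z = (\<Sum>i\<in>A. polar c x (X i) z)"
  "polar c x y (sum X A) = (\<Sum>i\<in>A. polar c x y (X i))"
  by (induction A rule: infinite_finite_induct, auto simp: polar_add)+

lemma polar_same: "polar c x x x = tri c x x x"
  by (simp add: polar_def)

text \<open>Polarisation: 6 F(x, y, z) is the alternating sum of the values of the cubic at the
  seven partial sums of x, y, z.\<close>

lemma polar_eq_0_from_cubic:
  assumes "\<And>t u v. polar c (t *s x + u *s y + v *s z) (t *s x + u *s y + v *s z) (t *s x + u *s y + v *s z) = 0"
  shows "polar c x y z = 0"
proof -
  let ?g = "\<lambda>t u v. polar c (t *s x + u *s y + v *s z) (t *s x + u *s y + v *s z) (t *s x + u *s y + v *s z)"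
  have "6 * polar c x y z = ?g 1 1 1 - ?g 1 1 0 - ?g 1 0 1 - ?g 0 1 1 + ?g 1 0 0 + ?g 0 1 0 + ?g 0 0 1"
    by (simp add: polar_add polar_scale algebra_simps)
       (simp add: polar_commute(1)[of c y x] polar_commute(1)[of c z x] polar_commute(1)[of c z y]
          polar_commute(2)[of c _ y x] polar_commute(2)[of c _ z x] polar_commute(2)[of c _ z y])
  also have "\<dots> = 0" unfolding assms by simp
  finally show ?thesis by simp
qed

lemma mp_eval_form: "mp_eval (form c) (\<lambda>k. x $ k) = polar c x x x"
  by (simp add: form_def polar_same tri_def algebra_simps)

lemma tri_axis: "tri c (axis a 1) (axis b 1) (axis d 1) = c $ a $ b $ d"
  by (simp add: tri_def axis_def mult_delta_left mult_delta_right)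

lemma polar_axis:
  assumes "sym_tensor c"
  shows "polar c (axis a 1) (axis b 1) (axis d 1) = c $ a $ b $ d"
proof -
  have s: "c $ a $ b $ d = c $ b $ a $ d" "c $ a $ b $ d = c $ a $ d $ b" for a b d
    using assms by (auto simp: sym_tensor_def)
  have "c $ a $ d $ b = c $ a $ b $ d" "c $ b $ a $ d = c $ a $ b $ d" "c $ b $ d $ a = c $ a $ b $ d"
    "c $ d $ a $ b = c $ a $ b $ d" "c $ d $ b $ a = c $ a $ b $ d"
    using s(1)[of a b d] s(2)[of a b d] s(2)[of b a d] s(1)[of d a b] s(2)[of d a b] by simp_all
  then show ?thesis by (simp add: polar_def tri_axis)
qed

lemma lookup_form: "Poly_Mapping.lookup (form c) m =
    (\<Sum>a\<in>UNIV. \<Sum>b\<in>UNIV. \<Sum>d\<in>UNIV. c $ a $ b $ d when mon3 a b d = m)"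
  by (simp add: form_def lookup_sum lookup_single)

lemma form_cubic: "form c \<in> cubic_forms"
proof -
  have "mon_degree m = 3" if "m \<in> Poly_Mapping.keys (form c)" for m
  proof (rule ccontr)
    assume "mon_degree m \<noteq> 3"
    then have "mon3 a b d \<noteq> m" for a b d by auto
    then have "Poly_Mapping.lookup (form c) m = 0" by (simp add: lookup_form)
    with that show False by (simp add: in_keys_iff)
  qed
  then show ?thesis by (simp add: cubic_forms_def homogeneous_def)
qed

lemma cubic_form_eq_form:
  assumes "f \<in> cubic_forms"
  obtains c where "sym_tensor c" "f = form c"
proof -
  \<comment> \<open>\<open>N m\<close> is the number of orderings of the monomial m; dividing by it
    spreads a coefficient evenly, so that the orderings add up to it again.\<close>
  define N where "N = (\<lambda>m. card {(a::7, b::7, d::7). mon3 a b d = m})"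
  define c where "c = (\<chi> a b d. Poly_Mapping.lookup f (mon3 a b d) / of_nat (N (mon3 a b d)))"
  have "sym_tensor c"
    unfolding sym_tensor_def c_def by (simp add: mon3_perm(1)) (metis mon3_perm(2))
  moreover have "f = form c"
  proof (rule poly_mapping_eqI)
    fix m
    let ?S = "{(a::7, b::7, d::7). mon3 a b d = m}"
    have "Poly_Mapping.lookup (form c) m =
       (\<Sum>(a,b,d)\<in>UNIV. Poly_Mapping.lookup f m / of_nat (N m) when mon3 a b d = m)"
      unfolding lookup_form by (simp add: sum.cartesian_product c_def when_def cong: if_cong)
    also have "\<dots> = (\<Sum>(a,b,d)\<in>?S. Poly_Mapping.lookup f m / of_nat (N m))"
      by (rule sum.mono_neutral_cong_right) (auto simp: when_def split: if_splits)
    also have "\<dots> = of_nat (N m) * (Poly_Mapping.lookup f m / of_nat (N m))"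
      unfolding N_def by (simp add: case_prod_unfold)
    also have "\<dots> = Poly_Mapping.lookup f m"
    proof (cases "mon_degree m = 3")
      case True
      then obtain a b d where "m = mon3 a b d" by (rule mon_degree_3E)
      then have "(a,b,d) \<in> ?S" by simp
      then have "N m \<noteq> 0" unfolding N_def by (simp add: card_eq_0_iff) blast
      then show ?thesis by simp
    next
      case False
      then have "m \<notin> Poly_Mapping.keys f"
        using assms by (auto simp: cubic_forms_def homogeneous_def)
      then show ?thesis by (simp add: in_keys_iff)
    qed
    finally show "Poly_Mapping.lookup f m = Poly_Mapping.lookup (form c) m" by simp
  qed
  ultimately show ?thesis by (rule that)
qed

section \<open>Algebraic dependence\<close>

text \<open>Gaussian elimination: an equation with a nonzero coefficient removes one unknown, one
  without is void. Arbitrary finite index sets are allowed so that the dimension counts below need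
  no numbering.\<close>

lemma homogeneous_system:
  fixes a :: "'i \<Rightarrow> 'j \<Rightarrow> 'f::field"
  assumes "finite I" "finite J" "card I < card J"
  shows "\<exists>x. (\<exists>j\<in>J. x j \<noteq> 0) \<and> (\<forall>i\<in>I. (\<Sum>j\<in>J. a i j * x j) = 0)"
  using assms
proof (induction I arbitrary: J a rule: finite_induct)
  case empty
  then have "J \<noteq> {}" by auto
  then show ?case by (intro exI[of _ "\<lambda>_. 1"]) auto
next
  case (insert i0 I)
  show ?case
  proof (cases "\<forall>j\<in>J. a i0 j = 0")
    case True
    obtain x where "\<exists>j\<in>J. x j \<noteq> 0" "\<forall>i\<in>I. (\<Sum>j\<in>J. a i j * x j) = 0"
      using insert.IH[of J a] insert.prems insert.hyps by auto
    then show ?thesis using True by (intro exI[of _ x]) auto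
  next
    case False
    then obtain j0 where j0: "j0 \<in> J" "a i0 j0 \<noteq> 0" by blast
    let ?J = "J - {j0}"
    have "card I < card ?J" using insert j0 by (simp add: card_Diff_singleton)
    then obtain x where x: "\<exists>j\<in>?J. x j \<noteq> 0"
      "\<forall>i\<in>I. (\<Sum>j\<in>?J. (a i j - a i j0 * a i0 j / a i0 j0) * x j) = 0"
      using insert.IH[of ?J "\<lambda>i j. a i j - a i j0 * a i0 j / a i0 j0"] insert.prems by auto
    define s where "s = (\<Sum>j\<in>?J. a i0 j * x j)"
    \<comment> \<open>The eliminated unknown is recovered from the equation
      \<open>i0\<close>.\<close>
    define y where "y = x(j0 := - s / a i0 j0)"
    have split: "(\<Sum>j\<in>J. a i j * y j) = - (a i j0 * s / a i0 j0) + (\<Sum>j\<in>?J. a i j * x j)" for i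
      using j0 insert.prems unfolding y_def
      by (subst sum.remove[of J j0]) (auto intro!: sum.cong)
    have "(\<Sum>j\<in>J. a i j * y j) = 0" if "i \<in> insert i0 I" for i
    proof (cases "i = i0")
      case True
      then show ?thesis using j0 by (simp add: split s_def)
    next
      case False
      then have "(\<Sum>j\<in>?J. (a i j - a i j0 * a i0 j / a i0 j0) * x j) = 0" using x that by auto
      moreover have "(\<Sum>j\<in>?J. (a i j - a i j0 * a i0 j / a i0 j0) * x j) =
          (\<Sum>j\<in>?J. a i j * x j) - a i j0 * s / a i0 j0"
        unfolding s_def by (simp add: algebra_simps sum_subtractf sum_distrib_left sum_divide_distrib)
      ultimately show ?thesis by (simp add: split)
    qed
    moreover have "\<exists>j\<in>J. y j \<noteq> 0" using x by (auto simp: y_def)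
    ultimately show ?thesis by blast
  qed
qed

text \<open>The degree bound is in each variable separately: the exponent vectors then form a box of
  known cardinality, and the bounds add under products.\<close>

definition poly_fun :: "'p set \<Rightarrow> nat \<Rightarrow> (('p \<Rightarrow> complex) \<Rightarrow> complex) \<Rightarrow> bool" where
  "poly_fun X D g \<longleftrightarrow> (\<exists>k. \<forall>u. g u = (\<Sum>e\<in>PiE X (\<lambda>_. {..D}). k e * (\<Prod>i\<in>X. u i ^ e i)))"

lemma poly_fun_monomial:
  assumes "finite X" "\<And>i. i \<in> X \<Longrightarrow> e i \<le> D"
  shows "poly_fun X D (\<lambda>u. \<Prod>i\<in>X. u i ^ e i)"
proof -
  let ?e = "restrict e X"
  have "(\<Sum>e'\<in>PiE X (\<lambda>_. {..D}). (if e' = ?e then 1 else 0) * (\<Prod>i\<in>X. u i ^ e' i)) = (\<Prod>i\<in>X. u i ^ e i)"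
    for u :: "'a \<Rightarrow> complex"
  proof -
    have "?e \<in> PiE X (\<lambda>_. {..D})" using assms by auto
    then show ?thesis
      using assms by (simp add: mult_delta_left finite_PiE)
  qed
  then show ?thesis unfolding poly_fun_def by (intro exI[of _ "\<lambda>e'. if e' = ?e then 1 else 0"]) simp
qed

lemma poly_fun_0: "poly_fun X D (\<lambda>u. 0)"
  unfolding poly_fun_def by (intro exI[of _ "\<lambda>_. 0"]) simp

lemma poly_fun_const: "finite X \<Longrightarrow> poly_fun X D (\<lambda>u. r)"
  and poly_fun_scale: "poly_fun X D g \<Longrightarrow> poly_fun X D (\<lambda>u. r * g u)"
  and poly_fun_add: "poly_fun X D g \<Longrightarrow> poly_fun X D h \<Longrightarrow> poly_fun X D (\<lambda>u. g u + h u)"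
proof -
  show scale: "poly_fun X D (\<lambda>u. r * g u)" if g: "poly_fun X D g" for g r
  proof -
    obtain k where "\<forall>u. g u = (\<Sum>e\<in>PiE X (\<lambda>_. {..D}). k e * (\<Prod>i\<in>X. u i ^ e i))"
      using g unfolding poly_fun_def by blast
    then show ?thesis unfolding poly_fun_def
      by (intro exI[of _ "\<lambda>e. r * k e"]) (simp add: sum_distrib_left mult.assoc)
  qed
  show "poly_fun X D (\<lambda>u. r)" if "finite X"
    using scale[OF poly_fun_monomial[OF that, of "\<lambda>_. 0" D], of r] by simp
  show "poly_fun X D (\<lambda>u. g u + h u)" if g: "poly_fun X D g" and h: "poly_fun X D h"
  proof -
    obtain k where "\<forall>u. g u = (\<Sum>e\<in>PiE X (\<lambda>_. {..D}). k e * (\<Prod>i\<in>X. u i ^ e i))"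
      using g unfolding poly_fun_def by blast
    moreover obtain l where "\<forall>u. h u = (\<Sum>e\<in>PiE X (\<lambda>_. {..D}). l e * (\<Prod>i\<in>X. u i ^ e i))"
      using h unfolding poly_fun_def by blast
    ultimately show ?thesis unfolding poly_fun_def
      by (intro exI[of _ "\<lambda>e. k e + l e"]) (simp add: distrib_right sum.distrib)
  qed
qed

lemma poly_fun_var:
  assumes "finite X" "i \<in> X"
  shows "poly_fun X 1 (\<lambda>u. u i)"
proof -
  have "(\<Prod>j\<in>X. u j ^ (if j = i then 1 else 0)) = u i" for u :: "'a \<Rightarrow> complex"
  proof -
    have "(\<Prod>j\<in>X. u j ^ (if j = i then 1 else 0)) = (\<Prod>j\<in>X. if j = i then u j else 1)"
      by (rule prod.cong) auto
    then show ?thesis using assms by simp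
  qed
  then show ?thesis using poly_fun_monomial[OF assms(1), of "\<lambda>j. if j = i then 1 else 0" 1] by simp
qed

lemma poly_fun_sum: "(\<And>j. j \<in> A \<Longrightarrow> poly_fun X D (g j)) \<Longrightarrow> poly_fun X D (\<lambda>u. \<Sum>j\<in>A. g j u)"
  by (induction A rule: infinite_finite_induct) (auto intro: poly_fun_0 poly_fun_add)

lemma poly_fun_mult:
  assumes "finite X" "poly_fun X D g" "poly_fun X E h"
  shows "poly_fun X (D + E) (\<lambda>u. g u * h u)"
proof -
  let ?P = "\<lambda>D. PiE X (\<lambda>_. {..D::nat})"
  obtain k where k: "\<forall>u. g u = (\<Sum>e\<in>?P D. k e * (\<Prod>i\<in>X. u i ^ e i))"
    using assms unfolding poly_fun_def by blast
  obtain l where l: "\<forall>u. h u = (\<Sum>e\<in>?P E. l e * (\<Prod>i\<in>X. u i ^ e i))"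
    using assms unfolding poly_fun_def by blast
  have eq: "(\<lambda>u. g u * h u) = (\<lambda>u. \<Sum>e\<in>?P D. \<Sum>e'\<in>?P E. (k e * l e') * (\<Prod>i\<in>X. u i ^ (e i + e' i)))"
    unfolding k[rule_format] l[rule_format] sum_product
    by (intro ext sum.cong refl) (simp only: power_add prod.distrib mult_ac)
  show ?thesis unfolding eq
    by (intro poly_fun_sum poly_fun_scale poly_fun_monomial assms)
       (auto intro!: add_mono simp: PiE_def Pi_def)
qed

lemma poly_fun_mono:
  assumes "finite X" "poly_fun X D g" "D \<le> E"
  shows "poly_fun X E g"
  using poly_fun_mult[OF assms(1,2) poly_fun_const[OF assms(1), of "E - D" 1]] assms(3) by simp

lemma poly_fun_diff:
  assumes "poly_fun X D g" "poly_fun X D h"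
  shows "poly_fun X D (\<lambda>u. g u - h u)"
  using poly_fun_add[OF assms(1) poly_fun_scale[OF assms(2), of "-1"]] by simp

lemma poly_fun_power:
  assumes "finite X" "poly_fun X D g"
  shows "poly_fun X (n * D) (\<lambda>u. g u ^ n)"
proof (induction n)
  case 0
  then show ?case using poly_fun_const[OF assms(1)] by simp
next
  case (Suc n)
  then show ?case using poly_fun_mult[OF assms(1,2) Suc] by simp
qed

lemma poly_fun_prod:
  assumes "finite X" "finite A" "\<And>j. j \<in> A \<Longrightarrow> poly_fun X D (g j)"
  shows "poly_fun X (card A * D) (\<lambda>u. \<Prod>j\<in>A. g j u)"
  using assms(2,3)
proof (induction A rule: finite_induct)
  case empty
  then show ?case using poly_fun_const[OF assms(1)] by simp
next
  case (insert j A)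
  have "poly_fun X (D + card A * D) (\<lambda>u. g j u * (\<Prod>j\<in>A. g j u))"
    by (rule poly_fun_mult) (use assms insert in auto)
  then show ?case using insert by simp
qed

text \<open>Induction on the variables: a vanishing sum, read as a polynomial in the new variable,
  has vanishing coefficients, and these are sums of the same kind in the remaining
  variables.\<close>

lemma monomials_independent:
  fixes x :: "('m \<Rightarrow> nat) \<Rightarrow> complex"
  assumes "finite M" "\<And>y. (\<Sum>e\<in>PiE M (\<lambda>_. {..N}). x e * (\<Prod>\<mu>\<in>M. y \<mu> ^ e \<mu>)) = 0"
    and "e \<in> PiE M (\<lambda>_. {..N})"
  shows "x e = 0"
  using assms
proof (induction M arbitrary: x e rule: finite_induct)
  case empty
  then show ?case by simp
next
  case (insert \<mu> M)
  let ?P = "PiE M (\<lambda>_. {..N})"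
  have inj: "inj_on (\<lambda>(k, g). g(\<mu> := k)) ({..N} \<times> ?P)"
  proof (rule inj_onI, clarify)
    fix k g k' g'
    assume g: "g \<in> ?P" "g' \<in> ?P" and eq: "g(\<mu> := k) = g'(\<mu> := k')"
    have "g z = g' z" for z
    proof (cases "z = \<mu>")
      case True
      then show ?thesis using g insert.hyps by (auto simp: PiE_def extensional_def)
    next
      case False
      then show ?thesis using fun_cong[OF eq, of z] by simp
    qed
    then show "k = k' \<and> g = g'" using fun_cong[OF eq, of \<mu>] by auto
  qed
  have "(\<Sum>g\<in>?P. x (g(\<mu> := k)) * (\<Prod>\<nu>\<in>M. y \<nu> ^ g \<nu>)) = 0" if "k \<le> N" for k y
  proof -
    let ?c = "\<lambda>k. \<Sum>g\<in>?P. x (g(\<mu> := k)) * (\<Prod>\<nu>\<in>M. y \<nu> ^ g \<nu>)"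
    have "(\<Sum>k\<le>N. ?c k * t ^ k) = 0" for t
    proof -
      have "0 = (\<Sum>e\<in>PiE (insert \<mu> M) (\<lambda>_. {..N}). x e * (\<Prod>\<nu>\<in>insert \<mu> M. (y(\<mu> := t)) \<nu> ^ e \<nu>))"
        using insert.prems by simp
      also have "\<dots> = (\<Sum>(k,g)\<in>{..N} \<times> ?P. x (g(\<mu> := k)) * (t ^ k * (\<Prod>\<nu>\<in>M. y \<nu> ^ g \<nu>)))"
        unfolding PiE_insert_eq
      proof (subst sum.reindex[OF inj], rule sum.cong, simp, clarify)
        fix k g
        have "(\<Prod>\<nu>\<in>M. (y(\<mu> := t)) \<nu> ^ (g(\<mu> := k)) \<nu>) = (\<Prod>\<nu>\<in>M. y \<nu> ^ g \<nu>)"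
          by (rule prod.cong) (use insert.hyps in auto)
        then show "((\<lambda>e. x e * (\<Prod>\<nu>\<in>insert \<mu> M. (y(\<mu> := t)) \<nu> ^ e \<nu>)) \<circ> (\<lambda>(k, g). g(\<mu> := k))) (k, g) =
          x (g(\<mu> := k)) * (t ^ k * (\<Prod>\<nu>\<in>M. y \<nu> ^ g \<nu>))"
          using insert.hyps by simp
      qed
      also have "\<dots> = (\<Sum>k\<le>N. ?c k * t ^ k)"
        unfolding sum.cartesian_product[symmetric]
        by (intro sum.cong refl) (simp add: sum_distrib_left sum_distrib_right mult_ac)
      finally show ?thesis by simp
    qed
    then show ?thesis using polyfun_eq_0[of ?c N] that by simp
  qed
  then have *: "x (g(\<mu> := k)) = 0" if "k \<le> N" "g \<in> ?P" for k g
    using insert.IH[of "\<lambda>g. x (g(\<mu> := k))" g] that by auto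
  obtain k g where "k \<le> N" "g \<in> ?P" "e = g(\<mu> := k)"
    using insert.prems(2) unfolding PiE_insert_eq by auto
  then show ?case using *[of k g] by (simp only:)
qed

lemma mon_val_sum_single:
  assumes "finite M"
  shows "mon_val y (\<Sum>\<mu>\<in>M. Poly_Mapping.single \<mu> (e \<mu>)) = (\<Prod>\<mu>\<in>M. y \<mu> ^ e \<mu>)"
  using assms by (induction M rule: finite_induct) (auto simp: mon_val_add)

text \<open>There are \<open>(N + 1)\<^bsup>card M\<^esup>\<close> monomials of degree at most \<open>N\<close> in each \<open>P \<mu>\<close>, and they lie in a space
  of dimension \<open>O(N\<^bsup>card X\<^esup>)\<close>.\<close>

lemma algebraic_dependence:
  fixes P :: "'m \<Rightarrow> ('p \<Rightarrow> complex) \<Rightarrow> complex"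
  assumes M: "finite M" and X: "finite X" and less: "card X < card M"
    and P: "\<And>\<mu>. \<mu> \<in> M \<Longrightarrow> poly_fun X D (P \<mu>)"
  obtains \<Phi> :: "('m, complex) mpoly" and y where
    "\<And>u y. (\<And>\<mu>. \<mu> \<in> M \<Longrightarrow> y \<mu> = P \<mu> u) \<Longrightarrow> mp_eval \<Phi> y = 0"
    "\<And>\<mu>. \<mu> \<notin> M \<Longrightarrow> y \<mu> = 0" "mp_eval \<Phi> y \<noteq> 0"
proof -
  define n m where "n = card M" and "m = card X"
  \<comment> \<open>This value makes ((n * D + 1) * N) ^ m equal to N ^ Suc m, which lies below the
    number (N + 1) ^ n of monomials.\<close>
  define N where "N = (n * D + 1) ^ m"
  define K where "K = n * (N * D)"
  let ?E = "PiE M (\<lambda>_. {..N})" and ?I = "PiE X (\<lambda>_. {..K})"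
  have "poly_fun X K (\<lambda>u. \<Prod>\<mu>\<in>M. P \<mu> u ^ e \<mu>)" if e: "e \<in> ?E" for e
    unfolding K_def n_def
  proof (rule poly_fun_prod[OF X M])
    fix \<mu> assume \<mu>: "\<mu> \<in> M"
    then have "e \<mu> * D \<le> N * D" using e by (auto simp: PiE_def Pi_def)
    then show "poly_fun X (N * D) (\<lambda>u. P \<mu> u ^ e \<mu>)"
      using poly_fun_mono[OF X poly_fun_power[OF X P[OF \<mu>]]] by blast
  qed
  then have "\<exists>k. \<forall>e\<in>?E. \<forall>u. (\<Prod>\<mu>\<in>M. P \<mu> u ^ e \<mu>) = (\<Sum>i\<in>?I. k e i * (\<Prod>j\<in>X. u j ^ i j))"
    unfolding poly_fun_def by (intro bchoice ballI)
  then obtain k where k: "\<And>e u. e \<in> ?E \<Longrightarrow>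
      (\<Prod>\<mu>\<in>M. P \<mu> u ^ e \<mu>) = (\<Sum>i\<in>?I. k e i * (\<Prod>j\<in>X. u j ^ i j))"
    by blast
  have "card ?I < card ?E"
  proof -
    have N1: "N \<ge> 1" by (simp add: N_def)
    have "K + 1 \<le> (n * D + 1) * N" using N1 by (simp add: K_def algebra_simps)
    then have "(K + 1) ^ m \<le> ((n * D + 1) * N) ^ m" by (rule power_mono) simp
    also have "\<dots> = N ^ Suc m" by (simp only: power_mult_distrib) (simp add: N_def)
    also have "\<dots> < (N + 1) ^ Suc m" by (rule power_strict_mono) auto
    also have "\<dots> \<le> (N + 1) ^ n" by (rule power_increasing) (use less in \<open>auto simp: n_def m_def\<close>)
    finally show ?thesis using M X by (simp add: card_PiE n_def m_def)
  qed
  then obtain x where x: "\<exists>e\<in>?E. x e \<noteq> 0" "\<forall>i\<in>?I. (\<Sum>e\<in>?E. k e i * x e) = 0"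
    using homogeneous_system[of ?I ?E "\<lambda>i e. k e i"] M X by (auto simp: finite_PiE)
  define \<Phi> where "\<Phi> = (\<Sum>e\<in>?E. Poly_Mapping.single (\<Sum>\<mu>\<in>M. Poly_Mapping.single \<mu> (e \<mu>)) (x e))"
  have \<Phi>: "mp_eval \<Phi> y = (\<Sum>e\<in>?E. x e * (\<Prod>\<mu>\<in>M. y \<mu> ^ e \<mu>))" for y
    by (simp add: \<Phi>_def mon_val_sum_single M)
  have "mp_eval \<Phi> y = 0" if y: "\<And>\<mu>. \<mu> \<in> M \<Longrightarrow> y \<mu> = P \<mu> u" for u y
  proof -
    have "mp_eval \<Phi> y = (\<Sum>e\<in>?E. x e * (\<Prod>\<mu>\<in>M. P \<mu> u ^ e \<mu>))"
      unfolding \<Phi> by (intro sum.cong prod.cong arg_cong2[where f="(*)"] refl) (simp add: y)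
    also have "\<dots> = (\<Sum>e\<in>?E. \<Sum>i\<in>?I. (k e i * x e) * (\<Prod>j\<in>X. u j ^ i j))"
      by (simp add: k sum_distrib_left mult_ac)
    also have "\<dots> = (\<Sum>i\<in>?I. (\<Sum>e\<in>?E. k e i * x e) * (\<Prod>j\<in>X. u j ^ i j))"
      by (subst sum.swap) (simp add: sum_distrib_right)
    also have "\<dots> = 0" using x by simp
    finally show ?thesis .
  qed
  moreover obtain y where "mp_eval \<Phi> y \<noteq> 0"
  proof -
    obtain e where "e \<in> ?E" "x e \<noteq> 0" using x by blast
    then show ?thesis using monomials_independent[OF M, of x N e] that unfolding \<Phi> by blast
  qed
  \<comment> \<open>Values outside \<open>M\<close> do not affect \<open>\<Phi>\<close>. Setting
    them to 0 lets the point be read later as the coefficient function of a cubic.\<close>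
  moreover have "mp_eval \<Phi> (\<lambda>\<mu>. if \<mu> \<in> M then y \<mu> else 0) = mp_eval \<Phi> y" for y
    unfolding \<Phi> by (intro sum.cong prod.cong arg_cong2[where f="(*)"] refl) simp
  ultimately show ?thesis
    by (intro that[of \<Phi> "\<lambda>\<mu>. if \<mu> \<in> M then y \<mu> else 0"]) auto
qed

lemma finite_degree_3: "finite {m :: 'i::finite \<Rightarrow>\<^sub>0 nat. mon_degree m = 3}"
proof (rule finite_subset)
  show "{m. mon_degree m = 3} \<subseteq> range (\<lambda>(a, b, d). mon3 a b (d::'i))"
  proof
    fix m :: "'i \<Rightarrow>\<^sub>0 nat" assume "m \<in> {m. mon_degree m = 3}"
    then obtain a b d where "m = mon3 a b d" by (auto elim: mon_degree_3E)
    then have "m = (\<lambda>(a, b, d). mon3 a b d) (a, b, d)" by simp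
    then show "m \<in> range (\<lambda>(a, b, d). mon3 a b d)" by blast
  qed
qed simp

text \<open>The parameter count. A cubic whose coefficients at the monomials of \<open>Bad\<close>
  vanish in some basis is determined by the base change, with \<open>card X\<close> parameters, and
  by its coefficients outside \<open>Bad\<close>. If \<open>card X < card Bad\<close>, these are
  fewer parameters than cubic coefficients, so an algebraic relation holds on the whole family but
  not on all cubics.\<close>

lemma tensor_family_not_dense:
  fixes \<sigma> :: "7 \<Rightarrow> 7 \<Rightarrow> ('p \<Rightarrow> complex) \<Rightarrow> complex"
  assumes X: "finite X" and Bad: "Bad \<subseteq> {m. mon_degree m = 3}" and less: "card X < card Bad"
    and \<sigma>: "\<And>a x Y. finite Y \<Longrightarrow> Inl ` X \<subseteq> Y \<Longrightarrow>
        poly_fun Y D (\<lambda>u :: 'p + (7 \<Rightarrow>\<^sub>0 nat) \<Rightarrow> complex. \<sigma> a x (\<lambda>i. u (Inl i)))"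
  obtains \<Phi> :: "(7 \<Rightarrow>\<^sub>0 nat, complex) mpoly" and f where
    "f \<in> cubic_forms" "mp_eval \<Phi> (Poly_Mapping.lookup f) \<noteq> 0"
    "\<And>c \<theta> d. (\<And>m. m \<in> Bad \<Longrightarrow> d m = 0) \<Longrightarrow>
       (\<And>x y z. c $ x $ y $ z = (\<Sum>a\<in>UNIV. \<Sum>b\<in>UNIV. \<Sum>e\<in>UNIV.
           d (mon3 a b e) * \<sigma> a x \<theta> * \<sigma> b y \<theta> * \<sigma> e z \<theta>)) \<Longrightarrow>
       mp_eval \<Phi> (Poly_Mapping.lookup (form c)) = 0"
proof -
  let ?M = "{m :: 7 \<Rightarrow>\<^sub>0 nat. mon_degree m = 3}"
  \<comment> \<open>\<open>Inl\<close> carries the parameters of the base change, \<open>Inr\<close>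
    the coefficients that remain free.\<close>
  define Y :: "('p + (7 \<Rightarrow>\<^sub>0 nat)) set" where "Y = Inl ` X \<union> Inr ` (?M - Bad)"
  have Y: "finite Y" using X finite_degree_3 by (auto simp: Y_def)
  have "card Y = card X + (card ?M - card Bad)"
  proof -
    have "card Y = card X + card (?M - Bad)"
      unfolding Y_def using X finite_degree_3 by (subst card_Un_disjoint) (auto simp: card_image)
    moreover have "card (?M - Bad) = card ?M - card Bad"
      by (rule card_Diff_subset[OF finite_subset[OF Bad finite_degree_3] Bad])
    ultimately show ?thesis by simp
  qed
  moreover have "card Bad \<le> card ?M" by (rule card_mono) (use Bad finite_degree_3 in auto)
  ultimately have cardY: "card Y < card ?M" using less by linarith
  define P where "P = (\<lambda>m (u :: 'p + (7 \<Rightarrow>\<^sub>0 nat) \<Rightarrow> complex).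
     \<Sum>x\<in>UNIV. \<Sum>y\<in>UNIV. \<Sum>z\<in>UNIV. \<Sum>a\<in>UNIV. \<Sum>b\<in>UNIV. \<Sum>e\<in>UNIV.
       if mon3 x y z = m \<and> mon3 a b e \<notin> Bad
       then u (Inr (mon3 a b e)) * \<sigma> a x (\<lambda>i. u (Inl i)) * \<sigma> b y (\<lambda>i. u (Inl i)) * \<sigma> e z (\<lambda>i. u (Inl i)) else 0)"
  have s: "poly_fun Y D (\<lambda>u. \<sigma> a x (\<lambda>i. u (Inl i)))" for a x
    by (rule \<sigma>[OF Y]) (auto simp: Y_def)
  have "poly_fun Y (1 + D + D + D) (\<lambda>u. if mon3 x y z = m \<and> mon3 a b e \<notin> Bad
       then u (Inr (mon3 a b e)) * \<sigma> a x (\<lambda>i. u (Inl i)) * \<sigma> b y (\<lambda>i. u (Inl i)) * \<sigma> e z (\<lambda>i. u (Inl i)) else 0)"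
    for x y z m a b e
  proof (cases "mon3 x y z = m \<and> mon3 a b e \<notin> Bad")
    case True
    then have "Inr (mon3 a b e) \<in> Y" by (auto simp: Y_def)
    then have "poly_fun Y (1 + D + D + D) (\<lambda>u. u (Inr (mon3 a b e)) * \<sigma> a x (\<lambda>i. u (Inl i)) *
        \<sigma> b y (\<lambda>i. u (Inl i)) * \<sigma> e z (\<lambda>i. u (Inl i)))"
      by (intro poly_fun_mult poly_fun_var s Y)
    then show ?thesis by (simp only: if_P[OF True])
  next
    case False
    then show ?thesis by (simp only: if_not_P[OF False] if_False poly_fun_0)
  qed
  then have "poly_fun Y (1 + D + D + D) (P m)" for m
    unfolding P_def by (intro poly_fun_sum)
  then obtain \<Phi> y where \<Phi>: "\<And>u y. (\<And>m. m \<in> ?M \<Longrightarrow> y m = P m u) \<Longrightarrow> mp_eval \<Phi> y = 0"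
    and y: "\<And>m. m \<notin> ?M \<Longrightarrow> y m = 0" "mp_eval \<Phi> y \<noteq> 0"
    using algebraic_dependence[OF finite_degree_3 Y cardY, of "1 + D + D + D" P] by blast
  \<comment> \<open>The witness has finite support because it vanishes off the cubic monomials, so
    it really is a polynomial.\<close>
  have look: "Poly_Mapping.lookup (Abs_poly_mapping y) = y"
    by (rule lookup_Abs_poly_mapping)
      (use y in \<open>auto intro!: finite_subset[OF _ finite_degree_3]\<close>)
  show ?thesis
  proof (rule that[of "Abs_poly_mapping y" \<Phi>])
    show "Abs_poly_mapping y \<in> cubic_forms"
      using y(1) by (auto simp: cubic_forms_def homogeneous_def in_keys_iff look) blast
    show "mp_eval \<Phi> (Poly_Mapping.lookup (Abs_poly_mapping y)) \<noteq> 0"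
      by (simp add: look y)
  next
    fix c \<theta> d
    assume d: "\<And>m. m \<in> Bad \<Longrightarrow> d m = 0"
      and c: "\<And>x y z. c $ x $ y $ z = (\<Sum>a\<in>UNIV. \<Sum>b\<in>UNIV. \<Sum>e\<in>UNIV.
           d (mon3 a b e) * \<sigma> a x \<theta> * \<sigma> b y \<theta> * \<sigma> e z \<theta>)"
    show "mp_eval \<Phi> (Poly_Mapping.lookup (form c)) = 0"
    proof (rule \<Phi>[of _ "case_sum \<theta> d"])
      fix m
      show "Poly_Mapping.lookup (form c) m = P m (case_sum \<theta> d)"
        unfolding lookup_form P_def c
        by (intro sum.cong refl) (auto simp: when_def d intro!: sum.cong)
    qed
  qed
qed

section \<open>Generic cubics\<close>

lemma poly_fun_uminus: "poly_fun X D g \<Longrightarrow> poly_fun X D (\<lambda>u. - g u)"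
  using poly_fun_scale[of X D g "-1"] by simp

lemma polar_sum3:
  "polar c (sum X A) (sum Y B) (sum Z C) = (\<Sum>a\<in>A. \<Sum>b\<in>B. \<Sum>e\<in>C. polar c (X a) (Y b) (Z e))"
  by (simp only: polar_sum(1)) (simp only: polar_sum(2), simp only: polar_sum(3))

section \<open>Frames of planes and the two genericity conditions\<close>

definition frame :: "complex ^ 7 ^ 3 \<Rightarrow> bool" where
  "frame B \<longleftrightarrow> (\<forall>t :: 3 \<Rightarrow> complex. (\<Sum>i\<in>UNIV. t i *s B $ i) = 0 \<longrightarrow> (\<forall>i. t i = 0))"

definition vanishes :: "tensor \<Rightarrow> complex ^ 7 ^ 3 \<Rightarrow> bool" where
  "vanishes c B \<longleftrightarrow> (\<forall>i j k. polar c (B $ i) (B $ j) (B $ k) = 0)"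

text \<open>F(p, p, x) is one third of the derivative of the cubic at p in the direction x, so a
  nonzero p excluded here is a singular point.\<close>

definition nonsingular :: "tensor \<Rightarrow> bool" where
  "nonsingular c \<longleftrightarrow> (\<forall>p. (\<forall>x. polar c p p x = 0) \<longrightarrow> p = 0)"

text \<open>No 3-space of \<open>\<bbbP>\<^sup>6\<close> is tangent to the cubic along a plane contained in the cubic.\<close>

definition tangency_free :: "tensor \<Rightarrow> bool" where
  "tangency_free c \<longleftrightarrow> (\<forall>B v. frame B \<longrightarrow> vanishes c B \<longrightarrow> (\<forall>i j. polar c (B $ i) (B $ j) v = 0) \<longrightarrow>
     (\<exists>t :: 3 \<Rightarrow> complex. v = (\<Sum>i\<in>UNIV. t i *s B $ i)))"

lemma frame_iff_right_inverse: "frame B \<longleftrightarrow> (\<exists>C. B ** C = mat 1)"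
  unfolding matrix_right_invertible_independent_rows frame_def by (simp add: row_def vec_nth_inverse)

text \<open>The columns of a frame span C^3, so three of them are independent. \<open>T\<close>
  inverts that block, and the other four columns complete the numbering
  \<open>\<pi>\<close>.\<close>

lemma frame_pivots:
  assumes "frame B"
  obtains \<pi> T T' where "bij (\<pi> :: 3 + 4 \<Rightarrow> 7)" "T ** T' = mat 1" "T' ** T = mat 1"
    "\<And>i j. (T ** B) $ i $ \<pi> (Inl j) = (if i = j then 1 else 0)"
proof -
  have span: "vec.span (columns B) = UNIV"
    using assms by (simp add: frame_iff_right_inverse matrix_right_invertible_span_columns)
  obtain S where S: "S \<subseteq> columns B" "vec.independent S" "columns B \<subseteq> vec.span S" "card S = vec.dim (columns B)"
    by (rule vec.basis_exists)
  have "vec.dim (columns B) = vec.dim (UNIV :: (complex ^ 3) set)"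
    using span by (metis vec.dim_span)
  then have card: "card S = 3" using S(4) by (simp only: vec_dim_card) simp
  then have finS: "finite S" by (metis card.infinite zero_neq_numeral)
  obtain h where h: "bij_betw h (UNIV :: 3 set) S"
    using finite_same_card_bij[of "UNIV :: 3 set" S] finS card by auto
  have "\<exists>k. column k B = h i" for i
  proof -
    have "h i \<in> columns B" using h S(1) by (auto simp: bij_betw_def)
    then show ?thesis by (auto simp: columns_def)
  qed
  then obtain K where K: "\<And>i. column (K i) B = h i" by metis
  define M where "M = (\<chi> i j. B $ i $ K j)"
  have colM: "column j M = h j" for j
    using K[of j] by (simp add: M_def column_def vec_eq_iff)
  have "\<exists>T. T ** M = mat 1"
    unfolding matrix_left_invertible_independent_columns colM
  proof (intro allI impI)
    fix t :: "3 \<Rightarrow> complex" and i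
    assume "(\<Sum>i\<in>UNIV. t i *s h i) = 0"
    then have "(\<Sum>v\<in>S. t (inv_into UNIV h v) *s v) = 0"
      using sum.reindex_bij_betw[OF h, of "\<lambda>v. t (inv_into UNIV h v) *s v"] bij_betw_imp_inj_on[OF h]
      by (simp add: inv_into_f_f)
    then have "t (inv_into UNIV h (h i)) = 0"
      using vec.independentD[OF S(2) finS order_refl, of "\<lambda>v. t (inv_into UNIV h v)" "h i"] h
      by (auto simp: bij_betw_def)
    then show "t i = 0" using bij_betw_imp_inj_on[OF h] by (simp add: inv_into_f_f)
  qed
  then obtain T where T: "T ** M = mat 1" by blast
  have T2: "M ** T = mat 1" using T matrix_left_right_inverse by blast
  have TB: "(T ** B) $ i $ K j = (if i = j then 1 else 0)" for i j
  proof -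
    have "(T ** B) $ i $ K j = (T ** M) $ i $ j" by (simp add: matrix_matrix_mult_def M_def)
    then show ?thesis by (simp add: T mat_def)
  qed
  have injK: "inj K"
  proof (rule injI)
    fix i j assume "K i = K j"
    then show "i = j" using TB[of i i] TB[of i j] by (auto split: if_splits)
  qed
  have "card (UNIV - range K) = 4"
    using injK by (subst card_Diff_subset) (auto simp: card_image)
  then obtain L where L: "bij_betw L (UNIV :: 4 set) (UNIV - range K)"
    using finite_same_card_bij[of "UNIV :: 4 set" "UNIV - range K"] by auto
  have "bij (case_sum K L)"
  proof (rule bijI)
    show "inj (case_sum K L)"
    proof (rule injI)
      fix x y assume "case_sum K L x = case_sum K L y"
      then show "x = y" using injK L
        by (cases x; cases y) (auto simp: bij_betw_def inj_def, metis DiffD2 rangeI, metis DiffD2 rangeI)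
    qed
    have "y \<in> range (case_sum K L)" for y
    proof (cases "y \<in> range K")
      case True
      then obtain i where "y = K i" by blast
      then have "y = case_sum K L (Inl i)" by simp
      then show ?thesis by blast
    next
      case False
      then have "y \<in> range L" using L by (auto simp: bij_betw_def)
      then obtain i where "y = L i" by blast
      then have "y = case_sum K L (Inr i)" by simp
      then show ?thesis by blast
    qed
    then show "surj (case_sum K L)" by blast
  qed
  then show ?thesis by (rule that[OF _ T T2]) (simp add: TB)
qed

lemma vanishes_matrix_mult:
  assumes "vanishes c B"
  shows "vanishes c (T ** B)"
proof -
  have row: "(T ** B) $ i = (\<Sum>j\<in>UNIV. T $ i $ j *s B $ j)" for i
    by (simp add: vec_eq_iff matrix_matrix_mult_def)
  show ?thesis using assms by (simp add: vanishes_def row polar_sum polar_scale)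
qed

text \<open>\<open>\<sigma>\<close> holds the coordinates of the standard basis in the basis
  \<open>\<beta>\<close>. Since the polar form is symmetric, the coefficients in the new basis
  depend only on the monomial, which is what the parameter count needs.\<close>

lemma tensor_base_change:
  fixes c :: tensor and \<sigma> :: "7 \<Rightarrow> 7 \<Rightarrow> complex"
  assumes c: "sym_tensor c" and \<beta>: "\<And>x. axis x 1 = (\<Sum>a\<in>UNIV. \<sigma> a x *s (\<beta> a :: complex ^ 7))"
  obtains d where "\<And>a b e. d (mon3 a b e) = polar c (\<beta> a) (\<beta> b) (\<beta> e)"
    "\<And>x y z. c $ x $ y $ z = (\<Sum>a\<in>UNIV. \<Sum>b\<in>UNIV. \<Sum>e\<in>UNIV. d (mon3 a b e) * \<sigma> a x * \<sigma> b y * \<sigma> e z)"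
proof -
  define d where "d = (\<lambda>m. SOME r. \<exists>a b e. m = mon3 a b e \<and> r = polar c (\<beta> a) (\<beta> b) (\<beta> e))"
  have d: "d (mon3 a b e) = polar c (\<beta> a) (\<beta> b) (\<beta> e)" for a b e
  proof -
    have "\<exists>a' b' e'. mon3 a b e = mon3 a' b' e' \<and> d (mon3 a b e) = polar c (\<beta> a') (\<beta> b') (\<beta> e')"
      unfolding d_def by (rule someI_ex) blast
    then obtain a' b' e' where eq: "mon3 a b e = mon3 a' b' e'"
      and "d (mon3 a b e) = polar c (\<beta> a') (\<beta> b') (\<beta> e')" by blast
    moreover have "polar c (\<beta> a') (\<beta> b') (\<beta> e') = polar c (\<beta> a) (\<beta> b) (\<beta> e)"
      using mon3_eqD[OF eq] by (auto, (metis polar_commute)+)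
    ultimately show ?thesis by simp
  qed
  have "c $ x $ y $ z = (\<Sum>a\<in>UNIV. \<Sum>b\<in>UNIV. \<Sum>e\<in>UNIV. d (mon3 a b e) * \<sigma> a x * \<sigma> b y * \<sigma> e z)" for x y z
    unfolding polar_axis[OF c, symmetric] \<beta> d
    by (simp add: polar_sum3 polar_scale mult_ac)
  with d show ?thesis by (rule that)
qed

text \<open>After scaling, a singular point with nonzero k-th coordinate has 6 free coordinates.
  Used as the k-th basis vector, it forces the 7 coefficients of x_k^2 x_a to vanish.\<close>

lemma singular_not_dense:
  obtains \<Phi> :: "(7 \<Rightarrow>\<^sub>0 nat, complex) mpoly" and f where
    "f \<in> cubic_forms" "mp_eval \<Phi> (Poly_Mapping.lookup f) \<noteq> 0"
    "\<And>c p. sym_tensor c \<Longrightarrow> (\<And>x. polar c p p x = 0) \<Longrightarrow> p $ k \<noteq> 0 \<Longrightarrow>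
       mp_eval \<Phi> (Poly_Mapping.lookup (form c)) = 0"
proof -
  \<comment> \<open>The scaled point is axis k plus the sum of the \<open>\<theta> a\<close> times
    axis a; solving for axis k gives the entries with a minus sign.\<close>
  define \<sigma> where "\<sigma> = (\<lambda>a x (\<theta> :: 7 \<Rightarrow> complex).
     if a = k then (if x = k then 1 else 0) else (if x = a then 1 else 0) - (if x = k then \<theta> a else 0))"
  define Bad where "Bad = range (mon3 k k)"
  have "inj (mon3 k k)" by (rule injI) (simp add: mon3_eq_iff)
  then have "card Bad = 7" by (simp add: Bad_def card_image)
  then have less: "card (UNIV - {k}) < card Bad" by simp
  have pf: "poly_fun Y 1 (\<lambda>u :: 7 + (7 \<Rightarrow>\<^sub>0 nat) \<Rightarrow> complex. \<sigma> a x (\<lambda>i. u (Inl i)))"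
    if Y: "finite Y" "Inl ` (UNIV - {k}) \<subseteq> Y" for a x Y
  proof (cases "a = k")
    case True
    then show ?thesis using poly_fun_const[OF Y(1)] by (simp add: \<sigma>_def)
  next
    case False
    then have "Inl a \<in> Y" using Y by auto
    then show ?thesis using False Y
      by (cases "x = k") (auto simp: \<sigma>_def simp del: One_nat_def
          intro!: poly_fun_const poly_fun_uminus poly_fun_diff poly_fun_var)
  qed
  have Bad3: "Bad \<subseteq> {m. mon_degree m = 3}" by (auto simp: Bad_def)
  obtain \<Phi> f where f: "f \<in> cubic_forms" "mp_eval \<Phi> (Poly_Mapping.lookup f) \<noteq> 0"
    and \<Phi>: "\<And>c \<theta> d. (\<And>m. m \<in> Bad \<Longrightarrow> d m = 0) \<Longrightarrow>
       (\<And>x y z. c $ x $ y $ z = (\<Sum>a\<in>UNIV. \<Sum>b\<in>UNIV. \<Sum>e\<in>UNIV.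
           d (mon3 a b e) * \<sigma> a x \<theta> * \<sigma> b y \<theta> * \<sigma> e z \<theta>)) \<Longrightarrow>
       mp_eval \<Phi> (Poly_Mapping.lookup (form c)) = 0"
    by (rule tensor_family_not_dense[where \<sigma>=\<sigma> and D=1, OF _ Bad3 less pf]) auto
  show ?thesis
  proof (rule that[OF f])
    fix c p
    assume c: "sym_tensor c" and p: "\<And>x. polar c p p x = 0" and pk: "p $ k \<noteq> 0"
    define \<theta> where "\<theta> = (\<lambda>a. p $ a / p $ k)"
    define \<beta> where "\<beta> = (\<lambda>a. if a = k then (1 / p $ k) *s p else axis a 1)"
    have \<beta>: "axis x 1 = (\<Sum>a\<in>UNIV. \<sigma> a x \<theta> *s \<beta> a)" for x
    proof (cases "x = k")
      case False
      then have "(\<Sum>a\<in>UNIV. \<sigma> a x \<theta> *s \<beta> a) = (\<Sum>a\<in>UNIV. if a = x then axis x 1 else 0)"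
        by (intro sum.cong refl) (auto simp: \<sigma>_def \<beta>_def)
      then show ?thesis by simp
    next
      case True
      have "(\<Sum>a\<in>UNIV. \<sigma> a x \<theta> *s \<beta> a) = \<beta> k + (\<Sum>a\<in>UNIV - {k}. (- \<theta> a) *s axis a 1)"
        using True by (subst sum.remove[of _ k]) (auto simp: \<sigma>_def \<beta>_def intro!: sum.cong)
      also have "\<dots> = axis k 1"
      proof (rule vec_eq_iff[THEN iffD2], rule allI)
        fix i
        have "(\<Sum>a\<in>UNIV - {k}. - \<theta> a * axis a 1 $ i) = (\<Sum>a\<in>UNIV - {k}. if a = i then - \<theta> i else 0)"
          by (intro sum.cong refl) (auto simp: axis_def)
        then show "(\<beta> k + (\<Sum>a\<in>UNIV - {k}. (- \<theta> a) *s axis a 1)) $ i = axis k 1 $ i"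
          using pk by (auto simp: \<beta>_def \<theta>_def axis_def)
      qed
      finally show ?thesis using True by simp
    qed
    obtain d where d: "\<And>a b e. d (mon3 a b e) = polar c (\<beta> a) (\<beta> b) (\<beta> e)"
      and cd: "\<And>x y z. c $ x $ y $ z = (\<Sum>a\<in>UNIV. \<Sum>b\<in>UNIV. \<Sum>e\<in>UNIV.
           d (mon3 a b e) * \<sigma> a x \<theta> * \<sigma> b y \<theta> * \<sigma> e z \<theta>)"
      using tensor_base_change[OF c, of "\<lambda>a x. \<sigma> a x \<theta>" \<beta>] \<beta> by blast
    have "d m = 0" if "m \<in> Bad" for m
      using that p by (auto simp: Bad_def d \<beta>_def polar_scale)
    then show "mp_eval \<Phi> (Poly_Mapping.lookup (form c)) = 0" by (rule \<Phi>[OF _ cd])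
  qed
qed

text \<open>16 = 10 + 6: the cubic monomials in three variables, and q times the quadratic ones.
  Exponents are at most 3, so the base-4 code \<open>g\<close> separates these monomials.\<close>

lemma card_mon3_ge:
  fixes p1 :: 'i
  assumes "distinct [p1, p2, p3, q]"
  shows "16 \<le> card {m. \<exists>a b e. a \<in> {p1, p2, p3} \<and> b \<in> {p1, p2, p3} \<and> e \<in> {p1, p2, p3, q} \<and> m = mon3 a b e}"
    (is "_ \<le> card ?B")
proof -
  define g where "g = (\<lambda>m :: 'i \<Rightarrow>\<^sub>0 nat. Poly_Mapping.lookup m p1 + 4 * Poly_Mapping.lookup m p2 +
     16 * Poly_Mapping.lookup m p3 + 64 * Poly_Mapping.lookup m q)"
  define w where "w = (\<lambda>a. if a = p1 then 1 else if a = p2 then 4 else if a = p3 then 16 else if a = q then 64 else 0 :: nat)"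
  have g: "g (mon3 a b e) = w a + w b + w e" for a b e
  proof -
    have "g (m + n) = g m + g n" for m n by (simp add: g_def lookup_add)
    moreover have "g (Poly_Mapping.single a 1) = w a" for a
      using assms by (simp add: g_def w_def lookup_single when_def)
    ultimately show ?thesis by (simp only: mon3_def)
  qed
  have w: "w p1 = 1" "w p2 = 4" "w p3 = 16" "w q = 64" using assms by (auto simp: w_def)
  define G where "G = g ` ?B"
  have in1: "w a + w b + w e \<in> G" if "a \<in> {p1, p2, p3}" "b \<in> {p1, p2, p3}" "e \<in> {p1, p2, p3, q}" for a b e
  proof -
    have "mon3 a b e \<in> ?B" unfolding mem_Collect_eq
      by (rule exI[of _ a], rule exI[of _ b], rule exI[of _ e]) (simp only: that simp_thms)
    then have "g (mon3 a b e) \<in> G" unfolding G_def by (rule imageI)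
    then show ?thesis by (simp only: g)
  qed
  have "{3, 6, 18, 66, 9, 21, 69, 33, 81, 12, 24, 72, 36, 84, 48, 96} \<subseteq> g ` ?B"
    unfolding G_def[symmetric]
    using in1[of p1 p1 p1] in1[of p1 p1 p2] in1[of p1 p1 p3] in1[of p1 p1 q]
      in1[of p1 p2 p2] in1[of p1 p2 p3] in1[of p1 p2 q] in1[of p1 p3 p3] in1[of p1 p3 q]
      in1[of p2 p2 p2] in1[of p2 p2 p3] in1[of p2 p2 q] in1[of p2 p3 p3] in1[of p2 p3 q]
      in1[of p3 p3 p3] in1[of p3 p3 q]
    by (simp add: w numeral_3_eq_3)
  moreover have fin: "finite ?B"
    by (rule finite_subset[of _ "(\<lambda>(a, b, e). mon3 a b e) ` ({p1, p2, p3} \<times> {p1, p2, p3} \<times> {p1, p2, p3, q})"]) auto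
  ultimately have "card {3, 6, 18, 66, 9, 21, 69, 33, 81, 12, 24, 72, 36, 84, 48, 96 :: nat} \<le> card (g ` ?B)"
    by (intro card_mono) auto
  also have "\<dots> \<le> card ?B" by (rule card_image_le[OF fin])
  finally show ?thesis by simp
qed

lemma UNIV_3: "(UNIV :: 3 set) = {1, 2, 3}"
  using exhaust_3 by auto

text \<open>The plane has 12 chart coordinates. The tangent direction is normalised to vanish at the
  pivots and to be 1 at \<open>j0\<close>, which leaves 3 coordinates. In a basis starting with the
  rows of b and v, the 10 coefficients of cubics on the plane and the 6 of quadrics times v vanish:
  15 < 16.\<close>

lemma tangent_not_dense:
  fixes \<pi> :: "3 + 4 \<Rightarrow> 7" and j0 :: 4
  assumes "bij \<pi>"
  obtains \<Phi> :: "(7 \<Rightarrow>\<^sub>0 nat, complex) mpoly" and f where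
    "f \<in> cubic_forms" "mp_eval \<Phi> (Poly_Mapping.lookup f) \<noteq> 0"
    "\<And>c b v. sym_tensor c \<Longrightarrow> vanishes c b \<Longrightarrow> (\<And>i j. polar c (b $ i) (b $ j) v = 0) \<Longrightarrow>
       (\<And>i j. b $ i $ \<pi> (Inl j) = (if i = j then 1 else 0)) \<Longrightarrow> (\<And>j. v $ \<pi> (Inl j) = 0) \<Longrightarrow> v $ \<pi> (Inr j0) = 1 \<Longrightarrow>
       mp_eval \<Phi> (Poly_Mapping.lookup (form c)) = 0"
proof -
  define \<rho> where "\<rho> = inv \<pi>"
  have inj: "inj \<pi>" and \<rho>: "\<rho> (\<pi> s) = s" "\<pi> (\<rho> a) = a" for s a
    using assms by (auto simp: \<rho>_def bij_def surj_f_inv_f)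
  have eq: "\<pi> s = \<pi> s' \<longleftrightarrow> s = s'" for s s' using inj by (auto simp: inj_def)
  \<comment> \<open>\<open>\<sigma>0\<close> is the coefficient of v, and \<open>\<sigma>1\<close>
    covers all basis vectors. A row of b is solved for its pivot axis, and the axis
    \<open>j0\<close> in it is then replaced through v; this substitution creates the product and
    hence the degree 2.\<close>
  define \<sigma>0 where "\<sigma>0 = (\<lambda>(x :: 3 + 4) (\<theta> :: (3 \<times> 4) + 4 \<Rightarrow> complex).
     (if x = Inr j0 then 1 else 0) - (case x of Inl i \<Rightarrow> \<theta> (Inl (i, j0)) | Inr _ \<Rightarrow> 0))"
  define \<sigma>1 where "\<sigma>1 = (\<lambda>(a :: 3 + 4) x \<theta>. case a of
       Inl i \<Rightarrow> if x = a then 1 else 0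
     | Inr j \<Rightarrow> if j = j0 then \<sigma>0 x \<theta>
        else (if x = a then 1 else 0) - (case x of Inl i \<Rightarrow> \<theta> (Inl (i, j)) | Inr _ \<Rightarrow> 0) - \<theta> (Inr j) * \<sigma>0 x \<theta>)"
  define \<sigma> where "\<sigma> = (\<lambda>a x. \<sigma>1 (\<rho> a) (\<rho> x))"
  define X :: "((3 \<times> 4) + 4) set" where "X = range Inl \<union> Inr ` (UNIV - {j0})"
  define p where "p = (\<lambda>i. \<pi> (Inl i))"
  define q where "q = \<pi> (Inr j0)"
  define Bad where "Bad = {m. \<exists>a b e. a \<in> {p 1, p 2, p 3} \<and> b \<in> {p 1, p 2, p 3} \<and> e \<in> {p 1, p 2, p 3, q} \<and> m = mon3 a b e}"
  have "distinct [p 1, p 2, p 3, q]" by (simp add: p_def q_def eq)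
  then have "16 \<le> card Bad" unfolding Bad_def by (rule card_mon3_ge)
  moreover have "card X = 15"
    unfolding X_def by (subst card_Un_disjoint) (auto simp: card_image)
  ultimately have less: "card X < card Bad" by simp
  have pf0: "poly_fun Y 1 (\<lambda>u :: ((3 \<times> 4) + 4) + (7 \<Rightarrow>\<^sub>0 nat) \<Rightarrow> complex. \<sigma>0 x (\<lambda>i. u (Inl i)))"
    if Y: "finite Y" "Inl ` X \<subseteq> Y" for x Y
  proof (cases x)
    case (Inl i)
    then have "Inl (Inl (i, j0)) \<in> Y" using Y by (auto simp: X_def)
    then show ?thesis using Inl Y
      by (auto simp: \<sigma>0_def simp del: One_nat_def intro!: poly_fun_uminus poly_fun_var)
  next
    case (Inr j)
    then show ?thesis using poly_fun_const[OF Y(1)] by (simp add: \<sigma>0_def)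
  qed
  have pf: "poly_fun Y 2 (\<lambda>u :: ((3 \<times> 4) + 4) + (7 \<Rightarrow>\<^sub>0 nat) \<Rightarrow> complex. \<sigma> a x (\<lambda>i. u (Inl i)))"
    if Y: "finite Y" "Inl ` X \<subseteq> Y" for a x Y
  proof (cases "\<rho> a")
    case (Inl i)
    then show ?thesis using poly_fun_const[OF Y(1)] by (simp add: \<sigma>_def \<sigma>1_def)
  next
    case (Inr j)
    show ?thesis
    proof (cases "j = j0")
      case True
      then show ?thesis using Inr poly_fun_mono[OF Y(1) pf0[OF Y]] by (simp add: \<sigma>_def \<sigma>1_def)
    next
      case False
      have "Inl (Inr j) \<in> Y" using Y False by (auto simp: X_def)
      then have 1: "poly_fun Y (1 + 1) (\<lambda>u. u (Inl (Inr j)) * \<sigma>0 (\<rho> x) (\<lambda>i. u (Inl i)))"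
        by (intro poly_fun_mult poly_fun_var pf0 Y)
      have 2: "poly_fun Y 2 (\<lambda>u :: ((3 \<times> 4) + 4) + (7 \<Rightarrow>\<^sub>0 nat) \<Rightarrow> complex.
         case \<rho> x of Inl i \<Rightarrow> u (Inl (Inl (i, j))) | Inr _ \<Rightarrow> 0)"
      proof (cases "\<rho> x")
        case (Inl i)
        then have "Inl (Inl (i, j)) \<in> Y" using Y by (auto simp: X_def)
        then show ?thesis using Inl poly_fun_mono[OF Y(1) poly_fun_var[OF Y(1)]] by simp
      qed (simp add: poly_fun_0)
      have "poly_fun Y 2 (\<lambda>u. (if \<rho> x = \<rho> a then 1 else 0) -
         (case \<rho> x of Inl i \<Rightarrow> u (Inl (Inl (i, j))) | Inr _ \<Rightarrow> 0) - u (Inl (Inr j)) * \<sigma>0 (\<rho> x) (\<lambda>i. u (Inl i)))"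
        using 1 by (intro poly_fun_diff 2 poly_fun_const Y) (simp add: numeral_2_eq_2)
      then show ?thesis using Inr False by (simp add: \<sigma>_def \<sigma>1_def)
    qed
  qed
  have Bad3: "Bad \<subseteq> {m. mon_degree m = 3}" by (auto simp: Bad_def)
  have finX: "finite X" by simp
  obtain \<Phi> f where f: "f \<in> cubic_forms" "mp_eval \<Phi> (Poly_Mapping.lookup f) \<noteq> 0"
    and \<Phi>: "\<And>c \<theta> d. (\<And>m. m \<in> Bad \<Longrightarrow> d m = 0) \<Longrightarrow>
       (\<And>x y z. c $ x $ y $ z = (\<Sum>a\<in>UNIV. \<Sum>b\<in>UNIV. \<Sum>e\<in>UNIV.
           d (mon3 a b e) * \<sigma> a x \<theta> * \<sigma> b y \<theta> * \<sigma> e z \<theta>)) \<Longrightarrow>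
       mp_eval \<Phi> (Poly_Mapping.lookup (form c)) = 0"
    by (rule tensor_family_not_dense[where \<sigma>=\<sigma> and D=2, OF finX Bad3 less pf]) auto
  show ?thesis
  proof (rule that[OF f])
    fix c b v
    assume c: "sym_tensor c" and b: "vanishes c b" and bv: "\<And>i j. polar c (b $ i) (b $ j) v = 0"
      and piv: "\<And>i j. b $ i $ \<pi> (Inl j) = (if i = j then 1 else 0)"
      and v: "\<And>j. v $ \<pi> (Inl j) = 0" "v $ \<pi> (Inr j0) = 1"
    define \<theta> where "\<theta> = (\<lambda>s. case s of Inl (i, j) \<Rightarrow> b $ i $ \<pi> (Inr j) | Inr j \<Rightarrow> v $ \<pi> (Inr j))"
    define \<beta>1 where "\<beta>1 = (\<lambda>s. case s of Inl i \<Rightarrow> b $ i | Inr j \<Rightarrow> if j = j0 then v else axis (\<pi> (Inr j)) 1)"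
    define \<beta> where "\<beta> = (\<lambda>a. \<beta>1 (\<rho> a))"
    have bij: "bij_betw \<pi> UNIV UNIV" using assms by simp
    have \<beta>: "axis x 1 = (\<Sum>a\<in>UNIV. \<sigma> a x \<theta> *s \<beta> a)" for x
    proof -
      obtain s where s: "x = \<pi> s" using assms by (metis bij_def surjD)
      have "(\<Sum>a\<in>UNIV. \<sigma> a x \<theta> *s \<beta> a) = (\<Sum>r\<in>UNIV. \<sigma>1 r s \<theta> *s \<beta>1 r)"
        using sum.reindex_bij_betw[OF bij, of "\<lambda>a. \<sigma> a x \<theta> *s \<beta> a"] by (simp add: \<sigma>_def \<beta>_def s \<rho>)
      also have "\<dots> = axis x 1"
      proof (rule vec_eq_iff[THEN iffD2], rule allI)
        fix y
        obtain r where r: "y = \<pi> r" using assms by (metis bij_def surjD)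
        have "(\<Sum>r'\<in>UNIV. \<sigma>1 r' s \<theta> *s \<beta>1 r') $ y =
           (\<Sum>i\<in>UNIV. \<sigma>1 (Inl i) s \<theta> * \<beta>1 (Inl i) $ y) + (\<Sum>j\<in>UNIV. \<sigma>1 (Inr j) s \<theta> * \<beta>1 (Inr j) $ y)"
          by (simp add: UNIV_Plus_UNIV[symmetric] sum.Plus del: UNIV_Plus_UNIV)
        also have "(\<Sum>j\<in>UNIV. \<sigma>1 (Inr j) s \<theta> * \<beta>1 (Inr j) $ y) =
           \<sigma>0 s \<theta> * v $ y + (\<Sum>j\<in>UNIV - {j0}. \<sigma>1 (Inr j) s \<theta> * (if y = \<pi> (Inr j) then 1 else 0))"
          by (subst sum.remove[of _ j0]) (auto simp: \<sigma>1_def \<beta>1_def axis_def intro!: sum.cong)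
        also have "(\<Sum>j\<in>UNIV - {j0}. \<sigma>1 (Inr j) s \<theta> * (if y = \<pi> (Inr j) then 1 else 0)) =
           (case r of Inl _ \<Rightarrow> 0 | Inr j \<Rightarrow> if j = j0 then 0 else \<sigma>1 (Inr j) s \<theta>)"
          by (cases r) (auto simp: r eq mult_delta_right intro!: sum.neutral)
        also have "(\<Sum>i\<in>UNIV. \<sigma>1 (Inl i) s \<theta> * \<beta>1 (Inl i) $ y) = (case s of Inl i \<Rightarrow> b $ i $ y | Inr _ \<Rightarrow> 0)"
          by (cases s) (auto simp: \<sigma>1_def \<beta>1_def mult_delta_left)
        finally show "(\<Sum>r'\<in>UNIV. \<sigma>1 r' s \<theta> *s \<beta>1 r') $ y = axis x 1 $ y"
          by (cases s; cases r) (auto simp: axis_def s r eq piv v \<sigma>0_def \<sigma>1_def \<theta>_def)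
      qed
      finally show ?thesis by simp
    qed
    obtain d where d: "\<And>a b e. d (mon3 a b e) = polar c (\<beta> a) (\<beta> b) (\<beta> e)"
      and cd: "\<And>x y z. c $ x $ y $ z = (\<Sum>a\<in>UNIV. \<Sum>b\<in>UNIV. \<Sum>e\<in>UNIV.
           d (mon3 a b e) * \<sigma> a x \<theta> * \<sigma> b y \<theta> * \<sigma> e z \<theta>)"
      using tensor_base_change[OF c, of "\<lambda>a x. \<sigma> a x \<theta>" \<beta>] \<beta> by blast
    have \<beta>p: "\<beta> (p i) = b $ i" "\<beta> q = v" for i
      by (simp_all add: \<beta>_def \<beta>1_def p_def q_def \<rho>)
    have "d m = 0" if "m \<in> Bad" for m
      using that b bv by (auto simp: Bad_def d \<beta>p vanishes_def)
    then show "mp_eval \<Phi> (Poly_Mapping.lookup (form c)) = 0" by (rule \<Phi>[OF _ cd])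
  qed
qed

section \<open>Avoiding finitely many bad loci along complex lines\<close>

lemma countable_zeros_entire:
  assumes "g holomorphic_on UNIV" "g z0 \<noteq> 0"
  shows "countable {z. g z = 0}"
proof (cases "g constant_on UNIV")
  case True
  then have "{z. g z = 0} = {}" using assms(2) by (auto simp: constant_on_def)
  then show ?thesis by simp
next
  case False
  then show ?thesis using holomorphic_countable_zeros[of g UNIV] assms(1) connected_UNIV by auto
qed

lemma holomorphic_on_lookup_form:
  fixes c :: "complex \<Rightarrow> tensor"
  assumes "\<And>a b d. (\<lambda>z. c z $ a $ b $ d) holomorphic_on S"
  shows "(\<lambda>z. Poly_Mapping.lookup (form (c z)) m) holomorphic_on S"
proof -
  have "(\<lambda>z. c z $ a $ b $ d when mon3 a b d = m) holomorphic_on S" for a b d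
    by (cases "mon3 a b d = m") (use assms in auto)
  then show ?thesis unfolding lookup_form by (intro holomorphic_intros)
qed

text \<open>On the complex line through a cubic good for I and one good for i, every polynomial
  involved is an entire function that is not identically zero. The bad parameters are therefore
  countable.\<close>

lemma generic_cubic_form:
  assumes "finite I" "\<And>i. i \<in> I \<Longrightarrow> \<exists>f\<in>cubic_forms. mp_eval (\<Phi> i) (Poly_Mapping.lookup f) \<noteq> 0"
  shows "\<exists>f\<in>cubic_forms. \<forall>i\<in>I. mp_eval (\<Phi> i) (Poly_Mapping.lookup f) \<noteq> 0"
  using assms
proof (induction I rule: finite_induct)
  case empty
  have "form 0 \<in> cubic_forms" by (rule form_cubic)
  then show ?case by blast
next
  case (insert i I)
  obtain f f' where f: "f \<in> cubic_forms" "\<forall>i\<in>I. mp_eval (\<Phi> i) (Poly_Mapping.lookup f) \<noteq> 0"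
    and f': "f' \<in> cubic_forms" "mp_eval (\<Phi> i) (Poly_Mapping.lookup f') \<noteq> 0"
    using insert by blast
  obtain c where c1: "f = form c" using f(1) by (rule cubic_form_eq_form)
  obtain c' where c2: "f' = form c'" using f'(1) by (rule cubic_form_eq_form)
  note c = c1 c2
  define g where "g = (\<lambda>z. \<chi> a b d. (1 - z) * c $ a $ b $ d + z * c' $ a $ b $ d)"
  have g01: "g 0 = c" "g 1 = c'" by (simp_all add: g_def vec_eq_iff)
  have hol: "(\<lambda>z. mp_eval (\<Phi> j) (Poly_Mapping.lookup (form (g z)))) holomorphic_on UNIV" for j
    unfolding g_def
    by (intro holomorphic_on_mp_eval holomorphic_on_lookup_form) (auto intro!: holomorphic_intros)
  have "countable {z. mp_eval (\<Phi> j) (Poly_Mapping.lookup (form (g z))) = 0}" if "j \<in> insert i I" for j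
  proof (cases "j = i")
    case True
    then show ?thesis using countable_zeros_entire[OF hol[of i], of 1] f' c g01 by simp
  next
    case False
    then show ?thesis using countable_zeros_entire[OF hol[of j], of 0] f c g01 that by simp
  qed
  then have "countable (\<Union>j\<in>insert i I. {z. mp_eval (\<Phi> j) (Poly_Mapping.lookup (form (g z))) = 0})"
    using insert.hyps by (intro countable_UN) (auto intro: countable_finite)
  then have "(\<Union>j\<in>insert i I. {z. mp_eval (\<Phi> j) (Poly_Mapping.lookup (form (g z))) = 0}) \<noteq> (UNIV :: complex set)"
    using uncountable_UNIV_complex by (metis (no_types, lifting))
  then obtain z where "\<forall>j\<in>insert i I. mp_eval (\<Phi> j) (Poly_Mapping.lookup (form (g z))) \<noteq> 0" by blast
  then show ?case using form_cubic by blast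
qed

text \<open>By polarisation, everything phrased through \<open>polar\<close> is a property of the
  cubic and not of the tensor chosen for it.\<close>

lemma polar_cong_form:
  assumes "form c = form c'"
  shows "polar c = polar c'"
proof (intro ext)
  fix x y z
  have "polar c w w w = polar c' w w w" for w
    using arg_cong[OF assms, of "\<lambda>f. mp_eval f (\<lambda>k. w $ k)"] by (simp only: mp_eval_form)
  then have "polar (c - c') w w w = 0" for w
    using polar_add(4)[of "c - c'" c' w w w] by simp
  then have "polar (c - c') x y z = 0" by (rule polar_eq_0_from_cubic)
  then show "polar c x y z = polar c' x y z"
    using polar_add(4)[of "c - c'" c' x y z] by simp
qed

text \<open>The two conditions have been excluded only in normal form, by one polynomial per normal
  form. There are finitely many normal forms, so the product of these polynomials serves.\<close>

theorem generic_nonsingular_tangency_free: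
  obtains \<Phi> :: "(7 \<Rightarrow>\<^sub>0 nat, complex) mpoly" and f where
    "f \<in> cubic_forms" "mp_eval \<Phi> (Poly_Mapping.lookup f) \<noteq> 0"
    "\<And>c. mp_eval \<Phi> (Poly_Mapping.lookup (form c)) \<noteq> 0 \<Longrightarrow> nonsingular c \<and> tangency_free c"
proof -
  define Q1 where "Q1 = (\<lambda>(k :: 7) \<Phi>. (\<exists>f\<in>cubic_forms. mp_eval \<Phi> (Poly_Mapping.lookup f) \<noteq> 0) \<and>
    (\<forall>c p. sym_tensor c \<longrightarrow> (\<forall>x. polar c p p x = 0) \<longrightarrow> p $ k \<noteq> 0 \<longrightarrow>
       mp_eval \<Phi> (Poly_Mapping.lookup (form c)) = 0))"
  define Q2 where "Q2 = (\<lambda>(s :: (3 + 4 \<Rightarrow> 7) \<times> 4) \<Phi>. bij (fst s) \<longrightarrow>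
    ((\<exists>f\<in>cubic_forms. mp_eval \<Phi> (Poly_Mapping.lookup f) \<noteq> 0) \<and>
    (\<forall>c b v. sym_tensor c \<longrightarrow> vanishes c b \<longrightarrow> (\<forall>i j. polar c (b $ i) (b $ j) v = 0) \<longrightarrow>
       (\<forall>i j. b $ i $ fst s (Inl j) = (if i = j then 1 else 0)) \<longrightarrow> (\<forall>j. v $ fst s (Inl j) = 0) \<longrightarrow>
       v $ fst s (Inr (snd s)) = 1 \<longrightarrow>
       mp_eval \<Phi> (Poly_Mapping.lookup (form c)) = 0)))"
  have "\<forall>k. \<exists>\<Phi>. Q1 k \<Phi>"
  proof
    fix k :: 7
    obtain \<Phi> f where "f \<in> cubic_forms" "mp_eval \<Phi> (Poly_Mapping.lookup f) \<noteq> 0"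
      "\<And>c p. sym_tensor c \<Longrightarrow> (\<And>x. polar c p p x = 0) \<Longrightarrow> p $ k \<noteq> 0 \<Longrightarrow>
         mp_eval \<Phi> (Poly_Mapping.lookup (form c)) = 0"
      by (rule singular_not_dense[of k]) (rule that; blast)
    then show "\<exists>\<Phi>. Q1 k \<Phi>"
      unfolding Q1_def by (intro exI[of _ \<Phi>] bexI[of _ f] conjI allI impI) auto
  qed
  then have "\<exists>\<Phi>1. \<forall>k. Q1 k (\<Phi>1 k)" by (rule choice)
  then obtain \<Phi>1 where \<Phi>1: "\<And>k. Q1 k (\<Phi>1 k)" by blast
  have "\<forall>s. \<exists>\<Phi>. Q2 s \<Phi>"
  proof
    fix s :: "(3 + 4 \<Rightarrow> 7) \<times> 4"
    show "\<exists>\<Phi>. Q2 s \<Phi>"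
    proof (cases "bij (fst s)")
      case True
      obtain \<Phi> f where "f \<in> cubic_forms" "mp_eval \<Phi> (Poly_Mapping.lookup f) \<noteq> 0"
        "\<And>c b v. sym_tensor c \<Longrightarrow> vanishes c b \<Longrightarrow> (\<And>i j. polar c (b $ i) (b $ j) v = 0) \<Longrightarrow>
          (\<And>i j. b $ i $ fst s (Inl j) = (if i = j then 1 else 0)) \<Longrightarrow> (\<And>j. v $ fst s (Inl j) = 0) \<Longrightarrow>
          v $ fst s (Inr (snd s)) = 1 \<Longrightarrow> mp_eval \<Phi> (Poly_Mapping.lookup (form c)) = 0"
        by (rule tangent_not_dense[OF True, of "snd s"]) (rule that; blast)
      then show ?thesis
        unfolding Q2_def by (intro exI[of _ \<Phi>] impI conjI bexI[of _ f] allI) auto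
    qed (simp add: Q2_def)
  qed
  then have "\<exists>\<Phi>2. \<forall>s. Q2 s (\<Phi>2 s)" by (rule choice)
  then obtain \<Phi>2 where \<Phi>2: "\<And>s. Q2 s (\<Phi>2 s)" by blast
  \<comment> \<open>One index for each coordinate in which a singular point can be nonzero, and one
    for each chart and each nonpivot coordinate in which a tangent direction can be nonzero.\<close>
  define I :: "(7 + ((3 + 4 \<Rightarrow> 7) \<times> 4)) set" where "I = range Inl \<union> Inr ` {s. bij (fst s)}"
  define \<Phi> where "\<Phi> = (\<Prod>i\<in>I. case_sum \<Phi>1 \<Phi>2 i)"
  have fin: "finite I" by simp
  have "\<exists>f\<in>cubic_forms. \<forall>i\<in>I. mp_eval (case_sum \<Phi>1 \<Phi>2 i) (Poly_Mapping.lookup f) \<noteq> 0"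
    by (rule generic_cubic_form[OF fin]) (use \<Phi>1 \<Phi>2 in \<open>auto simp: I_def Q1_def Q2_def\<close>)
  then obtain f where f: "f \<in> cubic_forms" "\<forall>i\<in>I. mp_eval (case_sum \<Phi>1 \<Phi>2 i) (Poly_Mapping.lookup f) \<noteq> 0"
    by blast
  show ?thesis
  proof (rule that[OF f(1), of \<Phi>])
    show "mp_eval \<Phi> (Poly_Mapping.lookup f) \<noteq> 0" using f fin by (simp add: \<Phi>_def)
  next
    fix c0 assume nz0: "mp_eval \<Phi> (Poly_Mapping.lookup (form c0)) \<noteq> 0"
    obtain c where c: "sym_tensor c" "form c0 = form c" using form_cubic by (rule cubic_form_eq_form)
    have nz: "mp_eval (case_sum \<Phi>1 \<Phi>2 i) (Poly_Mapping.lookup (form c)) \<noteq> 0" if "i \<in> I" for i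
      using nz0 fin that by (auto simp: \<Phi>_def c(2))
    have "nonsingular c"
      unfolding nonsingular_def
    proof (intro allI impI)
      fix p assume p: "\<forall>x. polar c p p x = 0"
      have "p $ k = 0" for k
      proof (rule ccontr)
        assume "p $ k \<noteq> 0"
        then have "mp_eval (\<Phi>1 k) (Poly_Mapping.lookup (form c)) = 0" 
          using \<Phi>1[of k] c(1) p unfolding Q1_def by blast
        then show False using nz[of "Inl k"] by (simp add: I_def)
      qed
      then show "p = 0" by (simp add: vec_eq_iff)
    qed
    moreover have "tangency_free c"
      unfolding tangency_free_def
    proof (intro allI impI)
      fix B v
      assume B: "frame B" "vanishes c B" and Bv: "\<forall>i j. polar c (B $ i) (B $ j) v = 0"
      obtain \<pi> T T' where \<pi>: "bij (\<pi> :: 3 + 4 \<Rightarrow> 7)" and T: "T ** T' = mat 1" "T' ** T = mat 1"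
        and piv: "\<And>i j. (T ** B) $ i $ \<pi> (Inl j) = (if i = j then 1 else 0)"
        using frame_pivots[OF B(1)] by metis
      define b where "b = T ** B"
      have row: "b $ i = (\<Sum>j\<in>UNIV. T $ i $ j *s B $ j)" for i
        by (simp add: b_def vec_eq_iff matrix_matrix_mult_def)
      have b: "vanishes c b" unfolding b_def by (rule vanishes_matrix_mult[OF B(2)])
      \<comment> \<open>Subtracting the combination of rows with the same pivot coordinates keeps
        the polar values zero. A nonzero remainder, scaled to 1 at some \<open>j0\<close>, has the
        normal form of \<open>tangent_not_dense\<close>.\<close>
      define w where "w = v - (\<Sum>i\<in>UNIV. v $ \<pi> (Inl i) *s b $ i)"
      have bv: "polar c (b $ i) (b $ j) v = 0" for i j
        using Bv by (simp add: row polar_sum polar_scale)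
      then have bw: "polar c (b $ i) (b $ j) w = 0" for i j
        using b by (simp add: w_def polar_diff polar_sum polar_scale vanishes_def)
      have w0: "w $ \<pi> (Inl j) = 0" for j
        using piv by (simp add: w_def b_def mult_delta_right)
      have "w = 0"
      proof (rule ccontr)
        assume "w \<noteq> 0"
        then obtain a where "w $ a \<noteq> 0" by (auto simp: vec_eq_iff)
        moreover obtain s where "a = \<pi> s" using \<pi> by (metis bij_def surjD)
        ultimately obtain j0 where j0: "w $ \<pi> (Inr j0) \<noteq> 0" using w0 by (cases s) auto
        let ?u = "(1 / w $ \<pi> (Inr j0)) *s w"
        have "mp_eval (\<Phi>2 (\<pi>, j0)) (Poly_Mapping.lookup (form c)) = 0"
          using \<Phi>2[of "(\<pi>, j0)"] c(1) b \<pi> unfolding Q2_def fst_conv snd_conv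
          by (elim impE conjE allE[of _ c] allE[of _ b] allE[of _ ?u])
            (use bw w0 j0 piv in \<open>auto simp: polar_scale b_def\<close>)
        then show False using nz[of "Inr (\<pi>, j0)"] \<pi> by (auto simp: I_def)
      qed
      then have "v = (\<Sum>i\<in>UNIV. v $ \<pi> (Inl i) *s b $ i)" by (simp add: w_def)
      also have "\<dots> = (\<Sum>i\<in>UNIV. \<Sum>j\<in>UNIV. (v $ \<pi> (Inl i) * T $ i $ j) *s B $ j)"
        unfolding row by (simp add: vec.scale_sum_right)
      also have "\<dots> = (\<Sum>j\<in>UNIV. (\<Sum>i\<in>UNIV. v $ \<pi> (Inl i) * T $ i $ j) *s B $ j)"
        by (subst sum.swap) (simp add: vec.scale_sum_left)
      finally show "\<exists>t :: 3 \<Rightarrow> complex. v = (\<Sum>i\<in>UNIV. t i *s B $ i)" by (intro exI)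
    qed
    ultimately show "nonsingular c0 \<and> tangency_free c0"
      using polar_cong_form[OF c(2)] by (simp add: nonsingular_def tangency_free_def vanishes_def)
  qed
qed

section \<open>Surjectivity of the differential\<close>

text \<open>With \<open>B\<close> spanning a plane of the cubic \<open>c\<close>, this says that no linear form on ternary cubics vanishes
  on the image of the differential of the section \<open>\<sigma>\<^sub>f\<close> at that plane.\<close>

definition regular_point :: "tensor \<Rightarrow> complex ^ 7 ^ 3 \<Rightarrow> bool" where
  "regular_point c B \<longleftrightarrow> (\<forall>a :: 3 \<Rightarrow> 3 \<Rightarrow> 3 \<Rightarrow> complex.
     (\<forall>i j k. a i j k = a j i k \<and> a i j k = a i k j) \<longrightarrow>
     (\<forall>k v. (\<Sum>i\<in>UNIV. \<Sum>j\<in>UNIV. a i j k * polar c (B $ i) (B $ j) v) = 0) \<longrightarrow>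
     (\<forall>i j k. a i j k = 0))"

lemma vec7_expansion: "(v :: complex ^ 7) = (\<Sum>x\<in>UNIV. v $ x *s axis x 1)"
  by (simp add: vec_eq_iff axis_def mult_delta_right)

lemma UNIV_3_split: "\<exists>i j. i \<noteq> j \<and> i \<noteq> k \<and> j \<noteq> k \<and> (UNIV :: 3 set) = {i, j, k}"
proof -
  have "k = 1 \<or> k = 2 \<or> k = 3" by (rule exhaust_3)
  then show ?thesis
  proof (elim disjE)
    assume "k = 1" then show ?thesis using UNIV_3 by (intro exI[of _ 2] exI[of _ 3]) auto
  next
    assume "k = 2" then show ?thesis using UNIV_3 by (intro exI[of _ 1] exI[of _ 3]) auto
  next
    assume "k = 3" then show ?thesis using UNIV_3 by (intro exI[of _ 1] exI[of _ 2]) auto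
  qed
qed

lemma binary_quadratic_zero:
  fixes n1 n2 n3 :: complex
  assumes "n1 \<noteq> 0"
  obtains x where "x ^ 2 * n1 + x * n2 + n3 = 0"
proof -
  define d where "d = csqrt (n2 ^ 2 - 4 * n1 * n3)"
  have d: "d ^ 2 = n2 ^ 2 - 4 * n1 * n3" by (simp add: d_def)
  have "((- n2 + d) / (2 * n1)) ^ 2 * n1 + ((- n2 + d) / (2 * n1)) * n2 + n3 =
      (d ^ 2 - (n2 ^ 2 - 4 * n1 * n3)) / (4 * n1)"
    using assms by (simp add: field_simps power2_eq_square)
  also have "\<dots> = 0" by (simp add: d)
  finally show ?thesis by (rule that)
qed

text \<open>A linear form on binary cubics with coefficients \<open>\<alpha>, \<beta>, \<gamma>, \<delta>\<close> has a \<open>2 \<times> 3\<close> Hankel matrix; the binary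
  quadratic forms annihilated by its partials all share a zero.\<close>

lemma binary_common_zero:
  fixes A M C :: "'v \<Rightarrow> complex"
  assumes nz: "\<alpha> \<noteq> 0 \<or> \<beta> \<noteq> 0 \<or> \<gamma> \<noteq> 0 \<or> \<delta> \<noteq> 0"
    and 1: "\<And>v. \<alpha> * A v + 2 * \<beta> * M v + \<gamma> * C v = 0"
    and 2: "\<And>v. \<beta> * A v + 2 * \<gamma> * M v + \<delta> * C v = 0"
  obtains x y where "x \<noteq> 0 \<or> y \<noteq> 0" "\<And>v. x ^ 2 * A v + 2 * x * y * M v + y ^ 2 * C v = 0"
proof -
  \<comment> \<open>The cross product of the rows of the Hankel matrix. In rank 2 each (A v, 2 M v,
    C v) is a multiple of it, so one zero of the quadric with these coefficients serves for all
    v.\<close>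
  define n1 n2 n3 where "n1 = \<beta> * \<delta> - \<gamma> ^ 2" and "n2 = \<gamma> * \<beta> - \<alpha> * \<delta>" and "n3 = \<alpha> * \<gamma> - \<beta> ^ 2"
  have An2: "A v * n2 = 2 * M v * n1" for v
  proof -
    have "2 * M v * n1 - A v * n2 =
      \<delta> * (\<alpha> * A v + 2 * \<beta> * M v + \<gamma> * C v) - \<gamma> * (\<beta> * A v + 2 * \<gamma> * M v + \<delta> * C v)"
      by (simp add: n1_def n2_def algebra_simps power2_eq_square)
    then show ?thesis by (simp add: 1 2)
  qed
  have An3: "A v * n3 = C v * n1" for v
  proof -
    have "A v * n3 - C v * n1 =
      \<gamma> * (\<alpha> * A v + 2 * \<beta> * M v + \<gamma> * C v) - \<beta> * (\<beta> * A v + 2 * \<gamma> * M v + \<delta> * C v)"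
      by (simp add: n1_def n3_def algebra_simps power2_eq_square)
    then show ?thesis by (simp add: 1 2)
  qed
  show ?thesis
  proof (cases "n1 = 0")
    case False
    obtain x where x: "x ^ 2 * n1 + x * n2 + n3 = 0" using binary_quadratic_zero[OF False] .
    have "x ^ 2 * A v + 2 * x * 1 * M v + 1 ^ 2 * C v = 0" for v
    proof -
      have "n1 * (x ^ 2 * A v + 2 * x * M v + C v) = x ^ 2 * n1 * A v + x * (2 * M v * n1) + C v * n1"
        by (simp add: algebra_simps)
      also have "\<dots> = A v * (x ^ 2 * n1 + x * n2 + n3)"
        unfolding An2[symmetric] An3[symmetric] by (simp add: algebra_simps)
      finally show ?thesis using False by (simp add: x)
    qed
    then show ?thesis by (intro that[of x 1]) auto
  next
    case True
    show ?thesis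
    proof (cases "n2 = 0 \<and> n3 = 0")
      case False
      then have "A v = 0" for v using An2[of v] An3[of v] True by auto
      then show ?thesis by (intro that[of 1 0]) auto
    next
      case deg: True
      show ?thesis
      proof (cases "\<alpha> = 0")
        case False
        \<comment> \<open>In rank 1 the coefficients form a geometric progression, so the linear
          form is a multiple of evaluation at (\<alpha>, \<beta>), and this point is the common
          zero.\<close>
        have "\<alpha> ^ 2 * A v + 2 * \<alpha> * \<beta> * M v + \<beta> ^ 2 * C v = 0" for v
        proof -
          have "\<beta> ^ 2 = \<alpha> * \<gamma>" using deg by (simp add: n3_def)
          then have "\<alpha> ^ 2 * A v + 2 * \<alpha> * \<beta> * M v + \<beta> ^ 2 * C v = \<alpha> * (\<alpha> * A v + 2 * \<beta> * M v + \<gamma> * C v)"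
            by (simp add: algebra_simps power2_eq_square)
          then show ?thesis by (simp add: 1)
        qed
        then show ?thesis using False by (intro that[of \<alpha> \<beta>]) auto
      next
        case a: True
        then have b: "\<beta> = 0" using deg by (simp add: n3_def)
        then have g: "\<gamma> = 0" using True by (simp add: n1_def)
        then have "C v = 0" for v using 2[of v] nz a b by simp
        then show ?thesis by (intro that[of 0 1]) auto
      qed
    qed
  qed
qed

lemma hermitian_eq_0:
  fixes v :: "'n::finite \<Rightarrow> complex"
  assumes "(\<Sum>x\<in>UNIV. v x * cnj (v x)) = 0"
  shows "v x = 0"
proof -
  have "(\<Sum>x\<in>UNIV. v x * cnj (v x)) = of_real (\<Sum>x\<in>UNIV. (cmod (v x)) ^ 2)"
    by (simp only: complex_norm_square[symmetric] of_real_sum)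
  then have "(\<Sum>x\<in>UNIV. (cmod (v x)) ^ 2) = 0" using assms by (metis of_real_eq_0_iff)
  then have "\<forall>x\<in>UNIV. (cmod (v x)) ^ 2 = 0" by (subst (asm) sum_nonneg_eq_0_iff) auto
  then show ?thesis by simp
qed

text \<open>F(B, B, .) maps the 4-dimensional quotient of C^7 by the plane injectively into the
  6-dimensional space of ternary quadrics. The three contractions of \<open>a\<close> annihilate the
  image, and 4 + 3 > 6 makes them dependent. In the proof this is one system of 9 equations in 10
  unknowns, with Hermitian pairings keeping the two subspaces apart.\<close>

lemma tangency_free_imp_degenerate:
  fixes a :: "3 \<Rightarrow> 3 \<Rightarrow> 3 \<Rightarrow> complex"
  assumes tf: "tangency_free c" and B: "frame B" "vanishes c B"
    and sym: "\<And>i j k. a i j k = a j i k"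
    and kill: "\<And>k v. (\<Sum>i\<in>UNIV. \<Sum>j\<in>UNIV. a i j k * polar c (B $ i) (B $ j) v) = 0"
  shows "\<exists>l. (\<exists>k. l k \<noteq> 0) \<and> (\<forall>i j. (\<Sum>k\<in>UNIV. l k * a i j k) = 0)"
proof (rule ccontr)
  assume contra: "\<not> ?thesis"
  define P :: "(3 \<times> 3) set" where "P = {(1,1), (1,2), (1,3), (2,2), (2,3), (3,3)}"
  have P: "(i, j) \<in> P \<or> (j, i) \<in> P" for i j
    using exhaust_3[of i] exhaust_3[of j] unfolding P_def by auto
  define I :: "((3 \<times> 3) + 3) set" where "I = Inl ` P \<union> range Inr"
  \<comment> \<open>The unknowns are v and the conjugate of l. Six equations say that F(B_i, B_j, v)
    is minus the conjugate of the contraction of \<open>a\<close> with l, and three say that v is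
    orthogonal to the plane.\<close>
  define m where "m = (\<lambda>(s :: (3 \<times> 3) + 3) (u :: 7 + 3). case s of
      Inl (i, j) \<Rightarrow> (case u of Inl x \<Rightarrow> polar c (B $ i) (B $ j) (axis x 1) | Inr k \<Rightarrow> cnj (a i j k))
    | Inr i \<Rightarrow> (case u of Inl x \<Rightarrow> cnj (B $ i $ x) | Inr k \<Rightarrow> 0))"
  have "card P \<le> 6" unfolding P_def by (simp add: card_insert_if)
  moreover have "card I \<le> card P + 3"
    unfolding I_def by (rule order_trans[OF card_Un_le]) (auto simp: card_image)
  ultimately have "card I < card (UNIV :: (7 + 3) set)" by simp
  then obtain u where u: "\<exists>s. u s \<noteq> 0" "\<forall>i\<in>I. (\<Sum>s\<in>UNIV. m i s * u s) = 0"
    using homogeneous_system[of I "UNIV :: (7 + 3) set" m] by auto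
  define v :: "complex ^ 7" where "v = (\<chi> x. u (Inl x))"
  define l where "l = (\<lambda>k. cnj (u (Inr k)))"
  define D where "D = (\<lambda>i j. \<Sum>k\<in>UNIV. l k * a i j k)"
  have split: "(\<Sum>s\<in>UNIV. m i s * u s) = (\<Sum>x\<in>UNIV. m i (Inl x) * v $ x) + (\<Sum>k\<in>UNIV. m i (Inr k) * cnj (l k))" for i
    by (simp add: UNIV_Plus_UNIV[symmetric] sum.Plus v_def l_def del: UNIV_Plus_UNIV)
  have q: "polar c (B $ i) (B $ j) v = - cnj (D i j)" if "(i, j) \<in> P" for i j
  proof -
    have "(\<Sum>s\<in>UNIV. m (Inl (i, j)) s * u s) = 0" using u that by (auto simp: I_def)
    moreover have "(\<Sum>x\<in>UNIV. m (Inl (i, j)) (Inl x) * v $ x) = polar c (B $ i) (B $ j) v"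
      by (subst (2) vec7_expansion) (simp add: m_def polar_sum polar_scale mult.commute)
    moreover have "(\<Sum>k\<in>UNIV. m (Inl (i, j)) (Inr k) * cnj (l k)) = cnj (D i j)"
      by (simp add: m_def D_def mult.commute)
    ultimately show ?thesis by (simp add: split eq_neg_iff_add_eq_0)
  qed
  have q: "polar c (B $ i) (B $ j) v = - cnj (D i j)" for i j
  proof -
    have "D i j = D j i" using sym by (simp add: D_def)
    then show ?thesis using P[of i j] q polar_commute(1) by metis
  qed
  \<comment> \<open>Pairing the relation \<open>kill\<close> with l gives minus the sum of all |D i
    j|^2.\<close>
  have "0 = (\<Sum>k\<in>UNIV. l k * (\<Sum>i\<in>UNIV. \<Sum>j\<in>UNIV. a i j k * polar c (B $ i) (B $ j) v))"
    by (simp add: kill)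
  also have "\<dots> = (\<Sum>k\<in>UNIV. \<Sum>i\<in>UNIV. \<Sum>j\<in>UNIV. l k * a i j k * - cnj (D i j))"
    by (simp only: sum_distrib_left q mult.assoc)
  also have "\<dots> = (\<Sum>i\<in>UNIV. \<Sum>j\<in>UNIV. \<Sum>k\<in>UNIV. l k * a i j k * - cnj (D i j))"
    using sum.swap[of "\<lambda>k i. \<Sum>j\<in>UNIV. l k * a i j k * - cnj (D i j)" UNIV UNIV]
      sum.swap[of "\<lambda>k j. l k * a i j k * - cnj (D i j)" UNIV UNIV for i] by (simp only:)
  also have "\<dots> = (\<Sum>i\<in>UNIV. \<Sum>j\<in>UNIV. - (D i j * cnj (D i j)))"
  proof (intro sum.cong refl)
    fix i j
    have "(\<Sum>k\<in>UNIV. l k * a i j k * - cnj (D i j)) = (\<Sum>k\<in>UNIV. l k * a i j k) * - cnj (D i j)"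
      by (rule sum_distrib_right[symmetric])
    then show "(\<Sum>k\<in>UNIV. l k * a i j k * - cnj (D i j)) = - (D i j * cnj (D i j))"
      by (simp only: D_def mult_minus_right)
  qed
  also have "\<dots> = - (\<Sum>s\<in>UNIV. (\<lambda>(i, j). D i j) s * cnj ((\<lambda>(i, j). D i j) s))"
    by (simp add: sum_negf sum.cartesian_product case_prod_unfold)
  finally have "(\<Sum>s\<in>UNIV. (\<lambda>(i, j). D i j) s * cnj ((\<lambda>(i, j). D i j) s)) = 0" by simp
  from hermitian_eq_0[OF this] have D0: "D i j = 0" for i j by (metis case_prod_conv)
  then have l0: "l k = 0" for k using contra unfolding D_def by blast
  then have "u (Inr k) = 0" for k unfolding l_def by (metis complex_cnj_zero_iff)
  then have "v \<noteq> 0" using u(1) by (auto simp: v_def vec_eq_iff) (metis sum.exhaust)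
  have "\<forall>i j. polar c (B $ i) (B $ j) v = 0" by (simp add: q D0)
  then obtain t where t: "v = (\<Sum>i\<in>UNIV. t i *s B $ i)"
    using tf B unfolding tangency_free_def by blast
  have orth: "(\<Sum>x\<in>UNIV. cnj (B $ i $ x) * v $ x) = 0" for i
  proof -
    have "(\<Sum>s\<in>UNIV. m (Inr i) s * u s) = 0" using u by (auto simp: I_def)
    then show ?thesis unfolding split by (simp add: m_def)
  qed
  have "(\<Sum>x\<in>UNIV. v $ x * cnj (v $ x)) = (\<Sum>x\<in>UNIV. \<Sum>i\<in>UNIV. cnj (t i) * (cnj (B $ i $ x) * v $ x))"
    by (subst (2) t) (simp add: sum_distrib_left mult_ac)
  also have "\<dots> = (\<Sum>i\<in>UNIV. cnj (t i) * (\<Sum>x\<in>UNIV. cnj (B $ i $ x) * v $ x))"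
    by (subst sum.swap) (simp add: sum_distrib_left)
  also have "\<dots> = 0" by (simp add: orth)
  finally have "v $ x = 0" for x by (rule hermitian_eq_0)
  then show False using \<open>v \<noteq> 0\<close> by (simp add: vec_eq_iff)
qed

text \<open>A linear form \<open>a\<close> killing the image is degenerate by
  \<open>tangency_free_imp_degenerate\<close>, so it is a symmetric tensor on the 2-dimensional
  kernel of l in the plane. On that kernel all quadrics F(., ., v) are annihilated by a nonzero
  linear form on binary cubics. By \<open>binary_common_zero\<close> they share a zero, which is a
  singular point of the cubic.\<close>

lemma regular_point_if_generic:
  assumes ns: "nonsingular c" and tf: "tangency_free c" and B: "frame B" "vanishes c B"
  shows "regular_point c B"
  unfolding regular_point_def
proof (intro allI impI, rule ccontr)
  fix a :: "3 \<Rightarrow> 3 \<Rightarrow> 3 \<Rightarrow> complex" and i1 j1 k1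
  assume sym0: "\<forall>i j k. a i j k = a j i k \<and> a i j k = a i k j"
    and kill: "\<forall>k v. (\<Sum>i\<in>UNIV. \<Sum>j\<in>UNIV. a i j k * polar c (B $ i) (B $ j) v) = 0"
    and nz: "a i1 j1 k1 \<noteq> 0"
  have sym: "a i j k = a j i k" "a i j k = a i k j" for i j k using sym0 by auto
  obtain l k0 where l: "l k0 \<noteq> 0" "\<And>i j. (\<Sum>k\<in>UNIV. l k * a i j k) = 0"
  proof -
    have "\<exists>l. (\<exists>k. l k \<noteq> 0) \<and> (\<forall>i j. (\<Sum>k\<in>UNIV. l k * a i j k) = 0)"
      by (rule tangency_free_imp_degenerate[OF tf B sym(1) kill[rule_format]])
    then show ?thesis using that by blast
  qed
  obtain i0 j0 where dist: "i0 \<noteq> j0" "i0 \<noteq> k0" "j0 \<noteq> k0" and U: "(UNIV :: 3 set) = {i0, j0, k0}"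
    using UNIV_3_split by blast
  have sum3: "(\<Sum>i\<in>UNIV. g i) = g i0 + g j0 + g k0" for g :: "3 \<Rightarrow> complex"
    unfolding U using dist by (simp add: add.assoc)
  define r s where "r = l i0 / l k0" and "s = l j0 / l k0"
  have ak0: "a i j k0 = - (r * a i j i0 + s * a i j j0)" for i j
  proof -
    have "l k0 * a i j k0 = - (l i0 * a i j i0 + l j0 * a i j j0)"
      using l(2)[of i j] unfolding sum3 by (simp add: algebra_simps eq_neg_iff_add_eq_0)
    then show ?thesis using l(1) by (simp add: r_def s_def field_simps)
  qed
  define \<alpha> \<beta> \<gamma> \<delta> where "\<alpha> = a i0 i0 i0" and "\<beta> = a i0 i0 j0" and "\<gamma> = a i0 j0 j0" and "\<delta> = a j0 j0 j0"
  have a8: "a i0 i0 i0 = \<alpha>" "a i0 i0 j0 = \<beta>" "a i0 j0 i0 = \<beta>" "a j0 i0 i0 = \<beta>"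
     "a i0 j0 j0 = \<gamma>" "a j0 i0 j0 = \<gamma>" "a j0 j0 i0 = \<gamma>" "a j0 j0 j0 = \<delta>"
    using sym(2)[of i0 i0 j0] sym(1)[of i0 j0 i0] sym(1)[of i0 j0 j0] sym(2)[of j0 i0 j0]
    by (simp_all add: \<alpha>_def \<beta>_def \<gamma>_def \<delta>_def)
  define u1 u2 u3 where "u1 = - (r * \<alpha> + s * \<beta>)" and "u2 = - (r * \<beta> + s * \<gamma>)" and "u3 = - (r * \<gamma> + s * \<delta>)"
  define w1 w2 where "w1 = - (r * u1 + s * u2)" and "w2 = - (r * u2 + s * u3)"
  have v1: "a i0 i0 k0 = u1" "a i0 j0 k0 = u2" "a j0 i0 k0 = u2" "a j0 j0 k0 = u3"
    unfolding ak0[of i0 i0] ak0[of i0 j0] ak0[of j0 i0] ak0[of j0 j0] a8 u1_def u2_def u3_def by (rule refl)+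
  have v2: "a i0 k0 i0 = u1" "a i0 k0 j0 = u2" "a j0 k0 i0 = u2" "a j0 k0 j0 = u3"
    using sym(2)[of i0 k0 i0] sym(2)[of i0 k0 j0] sym(2)[of j0 k0 i0] sym(2)[of j0 k0 j0] by (simp_all only: v1)
  have v3: "a k0 i0 i0 = u1" "a k0 i0 j0 = u2" "a k0 j0 i0 = u2" "a k0 j0 j0 = u3"
    using sym(1)[of k0 i0 i0] sym(1)[of k0 i0 j0] sym(1)[of k0 j0 i0] sym(1)[of k0 j0 j0] by (simp_all only: v2)
  have v4: "a i0 k0 k0 = w1" "a j0 k0 k0 = w2"
    unfolding ak0[of i0 k0] ak0[of j0 k0] v2 w1_def w2_def by (rule refl)+
  have v5: "a k0 i0 k0 = w1" "a k0 j0 k0 = w2"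
    using sym(1)[of k0 i0 k0] sym(1)[of k0 j0 k0] by (simp_all only: v4)
  have v6: "a k0 k0 i0 = w1" "a k0 k0 j0 = w2"
    using sym(2)[of k0 k0 i0] sym(2)[of k0 k0 j0] by (simp_all only: v5)
  have v7: "a k0 k0 k0 = - (r * w1 + s * w2)"
    unfolding ak0[of k0 k0] v6 by (rule refl)
  note vals = a8 v1 v2 v3 v4 v5 v6 v7
  have nz': "\<alpha> \<noteq> 0 \<or> \<beta> \<noteq> 0 \<or> \<gamma> \<noteq> 0 \<or> \<delta> \<noteq> 0"
  proof (rule ccontr)
    assume "\<not> ?thesis"
    then have z: "\<alpha> = 0" "\<beta> = 0" "\<gamma> = 0" "\<delta> = 0" by auto
    then have z': "u1 = 0" "u2 = 0" "u3 = 0" "w1 = 0" "w2 = 0"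
      by (simp_all add: u1_def u2_def u3_def w1_def w2_def)
    have "i1 \<in> {i0, j0, k0}" "j1 \<in> {i0, j0, k0}" "k1 \<in> {i0, j0, k0}" using U by blast+
    then have "a i1 j1 k1 = 0" by (auto simp: vals z z')
    then show False using nz by simp
  qed
  \<comment> \<open>A basis of the kernel of l in the plane. The equations \<open>e1\<close> and
    \<open>e2\<close> are \<open>kill\<close> rewritten in this basis.\<close>
  define p q where "p = B $ i0 - r *s B $ k0" and "q = B $ j0 - s *s B $ k0"
  define X where "X = (\<lambda>i j v. polar c (B $ i) (B $ j) v)"
  have X: "polar c (B $ i) (B $ j) v = X i j v" "X j0 i0 v = X i0 j0 v" "X k0 i0 v = X i0 k0 v" "X k0 j0 v = X j0 k0 v"
    for i j v
    unfolding X_def by (rule refl polar_commute)+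
  have pq: "polar c p p v = X i0 i0 v - 2 * r * X i0 k0 v + r * r * X k0 k0 v"
    "polar c p q v = X i0 j0 v - s * X i0 k0 v - r * X j0 k0 v + r * s * X k0 k0 v"
    "polar c q q v = X j0 j0 v - 2 * s * X j0 k0 v + s * s * X k0 k0 v" for v
    unfolding p_def q_def polar_diff polar_scale X by (simp_all add: algebra_simps)
  have e1: "\<alpha> * polar c p p v + 2 * \<beta> * polar c p q v + \<gamma> * polar c q q v = 0" for v
  proof -
    have "0 = \<alpha> * X i0 i0 v + 2 * \<beta> * X i0 j0 v + \<gamma> * X j0 j0 v + 2 * u1 * X i0 k0 v + 2 * u2 * X j0 k0 v + w1 * X k0 k0 v"
      using kill[rule_format, of i0 v] unfolding sum3 X vals by (simp add: algebra_simps)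
    also have "\<dots> = \<alpha> * polar c p p v + 2 * \<beta> * polar c p q v + \<gamma> * polar c q q v"
      unfolding pq w1_def u1_def u2_def by (simp add: algebra_simps)
    finally show ?thesis by simp
  qed
  have e2: "\<beta> * polar c p p v + 2 * \<gamma> * polar c p q v + \<delta> * polar c q q v = 0" for v
  proof -
    have "0 = \<beta> * X i0 i0 v + 2 * \<gamma> * X i0 j0 v + \<delta> * X j0 j0 v + 2 * u2 * X i0 k0 v + 2 * u3 * X j0 k0 v + w2 * X k0 k0 v"
      using kill[rule_format, of j0 v] unfolding sum3 X vals by (simp add: algebra_simps)
    also have "\<dots> = \<beta> * polar c p p v + 2 * \<gamma> * polar c p q v + \<delta> * polar c q q v"
      unfolding pq w2_def u2_def u3_def by (simp add: algebra_simps)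
    finally show ?thesis by simp
  qed
  obtain x y where xy: "x \<noteq> 0 \<or> y \<noteq> 0"
    and zero: "\<And>v. x ^ 2 * polar c p p v + 2 * x * y * polar c p q v + y ^ 2 * polar c q q v = 0"
    by (rule binary_common_zero[of \<alpha> \<beta> \<gamma> \<delta> "polar c p p" "polar c p q" "polar c q q", OF nz' e1 e2]) (rule that)
  have "polar c (x *s p + y *s q) (x *s p + y *s q) v = 0" for v
  proof -
    have "polar c (x *s p + y *s q) (x *s p + y *s q) v =
      x ^ 2 * polar c p p v + 2 * x * y * polar c p q v + y ^ 2 * polar c q q v"
      unfolding polar_add polar_scale polar_commute(1)[of c q p v]
      by (simp add: algebra_simps power2_eq_square)
    then show ?thesis by (simp only: zero)
  qed
  then have w: "x *s p + y *s q = 0" using ns unfolding nonsingular_def by blast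
  define t where "t = (\<lambda>i. if i = i0 then x else if i = j0 then y else - (x * r + y * s))"
  have tv: "t i0 = x" "t j0 = y" "t k0 = - (x * r + y * s)" using dist by (auto simp: t_def)
  have "(\<Sum>i\<in>UNIV. t i *s B $ i) = x *s p + y *s q"
  proof (rule vec_eq_iff[THEN iffD2], rule allI)
    fix h
    have "(\<Sum>i\<in>UNIV. t i *s B $ i) $ h = (\<Sum>i\<in>UNIV. t i * B $ i $ h)" by simp
    also have "\<dots> = (x *s p + y *s q) $ h"
      unfolding sum3 tv by (simp add: p_def q_def algebra_simps)
    finally show "(\<Sum>i\<in>UNIV. t i *s B $ i) $ h = (x *s p + y *s q) $ h" .
  qed
  then have "\<forall>i. t i = 0" using B(1) w unfolding frame_def by simp
  then have "t i0 = 0" "t j0 = 0" by blast+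
  then show False using xy dist by (auto simp: t_def)
qed

section \<open>Local structure of the family of planes\<close>

text \<open>Complex scaling of nested vectors, beside their real vector space structure. Complex
  linearity of differentials is expressed by it.\<close>

definition cs2 :: "complex \<Rightarrow> complex ^ 'a ^ 'b \<Rightarrow> complex ^ 'a ^ 'b" where
  "cs2 z B = (\<chi> i. z *s B $ i)"

definition cs3 :: "complex \<Rightarrow> complex ^ 'a ^ 'b ^ 'c \<Rightarrow> complex ^ 'a ^ 'b ^ 'c" where
  "cs3 z T = (\<chi> i. cs2 z (T $ i))"

lemma cs_nth [simp]: "cs2 z B $ i = z *s B $ i" "cs3 z T $ i = cs2 z (T $ i)"
  by (simp_all add: cs2_def cs3_def)

lemma cs2_Complex: "cs2 z B = Re z *\<^sub>R B + Im z *\<^sub>R cs2 \<i> B"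
  by (simp add: vec_eq_iff complex_eq_iff)

lemma cs3_Complex: "cs3 z T = Re z *\<^sub>R T + Im z *\<^sub>R cs3 \<i> T"
  by (simp add: vec_eq_iff complex_eq_iff)

lemma has_derivative_tri:
  assumes "(f has_derivative f') (at p)" "(x has_derivative x') (at p)" "(y has_derivative y') (at p)"
    "(z has_derivative z') (at p)"
  shows "((\<lambda>t. tri (f t) (x t) (y t) (z t)) has_derivative
     (\<lambda>h. tri (f' h) (x p) (y p) (z p) + tri (f p) (x' h) (y p) (z p) + tri (f p) (x p) (y' h) (z p)
        + tri (f p) (x p) (y p) (z' h))) (at p)"
proof -
  have vn: "((\<lambda>t. g t $ i) has_derivative (\<lambda>h. g' h $ i)) (at p)" if "(g has_derivative g') (at p)"
    for g :: "'a \<Rightarrow> 'b::real_normed_vector ^ 7" and g' i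
    by (rule bounded_linear.has_derivative[OF bounded_linear_vec_nth that])
  have 1: "((\<lambda>t. f t $ a $ b $ d * (x t $ a * y t $ b * z t $ d)) has_derivative
      (\<lambda>h. f' h $ a $ b $ d * (x p $ a * y p $ b * z p $ d) + f p $ a $ b $ d * (x' h $ a * y p $ b * z p $ d)
         + f p $ a $ b $ d * (x p $ a * y' h $ b * z p $ d) + f p $ a $ b $ d * (x p $ a * y p $ b * z' h $ d))) (at p)"
    for a b d
    using vn[OF vn[OF vn[OF assms(1), of a], of b], of d] vn[OF assms(2), of a] vn[OF assms(3), of b] vn[OF assms(4), of d]
    by (auto intro!: derivative_eq_intros simp: algebra_simps)
  show ?thesis
    unfolding tri_def sum.distrib[symmetric]
    by (intro has_derivative_sum) (use 1 in \<open>simp add: algebra_simps\<close>)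
qed

lemma has_derivative_polar:
  assumes "(f has_derivative f') (at p)" "(x has_derivative x') (at p)" "(y has_derivative y') (at p)"
    "(z has_derivative z') (at p)"
  shows "((\<lambda>t. polar (f t) (x t) (y t) (z t)) has_derivative
     (\<lambda>h. polar (f' h) (x p) (y p) (z p) + polar (f p) (x' h) (y p) (z p) + polar (f p) (x p) (y' h) (z p)
        + polar (f p) (x p) (y p) (z' h))) (at p)"
proof -
  have *: "polar c x y z = 1 / 6 * (tri c x y z + tri c x z y + tri c y x z + tri c y z x + tri c z x y + tri c z y x)"
    for c x y z by (simp add: polar_def)
  note T = has_derivative_tri[OF assms(1)]
  note d = has_derivative_add[OF has_derivative_add[OF has_derivative_add[OF has_derivative_add[OF has_derivative_add[OF
     T[OF assms(2) assms(3) assms(4)] T[OF assms(2) assms(4) assms(3)]] T[OF assms(3) assms(2) assms(4)]]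
     T[OF assms(3) assms(4) assms(2)]] T[OF assms(4) assms(2) assms(3)]] T[OF assms(4) assms(3) assms(2)]]
  show ?thesis unfolding *
    by (rule has_derivative_eq_rhs[OF has_derivative_mult_right[OF d, of "1 / 6"]])
       (simp add: fun_eq_iff distrib_left add_ac)
qed

lemma continuous_on_tri:
  assumes "continuous_on S f" "continuous_on S x" "continuous_on S y" "continuous_on S z"
  shows "continuous_on S (\<lambda>t. tri (f t) (x t) (y t) (z t))"
  unfolding tri_def by (intro continuous_intros assms)

lemma continuous_on_polar:
  assumes "continuous_on S f" "continuous_on S x" "continuous_on S y" "continuous_on S z"
  shows "continuous_on S (\<lambda>t. polar (f t) (x t) (y t) (z t))"
  unfolding polar_def by (intro continuous_intros continuous_on_tri assms) auto

lemma polar_tensor_scale: "polar (cs3 r c) x y z = r * polar c x y z"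
  by (simp add: polar_def tri_def sum_distrib_left algebra_simps add_divide_distrib)

lemma polar_scaleR:
  "polar c (r *\<^sub>R x) y z = r *\<^sub>R polar c x y z"
  "polar c x (r *\<^sub>R y) z = r *\<^sub>R polar c x y z"
  "polar c x y (r *\<^sub>R z) = r *\<^sub>R polar c x y z"
proof -
  have "r *\<^sub>R w = complex_of_real r *s w" for w :: "complex ^ 7" by (simp add: vec_eq_iff complex_eq_iff)
  then show "polar c (r *\<^sub>R x) y z = r *\<^sub>R polar c x y z"
    "polar c x (r *\<^sub>R y) z = r *\<^sub>R polar c x y z"
    "polar c x y (r *\<^sub>R z) = r *\<^sub>R polar c x y z"
    by (simp_all add: polar_scale scaleR_conv_of_real)
qed

text \<open>All 27 polar values are kept instead of 10 independent ones; the redundancy is absorbed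
  by the target space \<open>sym3\<close>.\<close>

definition equations :: "tensor \<Rightarrow> complex ^ 7 ^ 3 \<Rightarrow> complex ^ 3 ^ 3 ^ 3" where
  "equations c B = (\<chi> i j k. polar c (B $ i) (B $ j) (B $ k))"

definition equations_deriv :: "tensor \<Rightarrow> complex ^ 7 ^ 3 \<Rightarrow> complex ^ 7 ^ 3 \<Rightarrow> complex ^ 3 ^ 3 ^ 3" where
  "equations_deriv c B V = (\<chi> i j k. polar c (V $ i) (B $ j) (B $ k) + polar c (B $ i) (V $ j) (B $ k)
     + polar c (B $ i) (B $ j) (V $ k))"

definition sym3 :: "(complex ^ 3 ^ 3 ^ 3) set" where
  "sym3 = {g. \<forall>i j k. g $ i $ j $ k = g $ j $ i $ k \<and> g $ i $ j $ k = g $ i $ k $ j}"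

lemma vanishes_iff: "vanishes c B \<longleftrightarrow> equations c B = 0"
  by (simp add: vanishes_def equations_def vec_eq_iff)

lemma equations_sym3: "equations c B \<in> sym3" "equations_deriv c B V \<in> sym3"
  by (simp_all add: sym3_def equations_def equations_deriv_def polar_commute add_ac)

lemma linear_equations_deriv: "linear (equations_deriv c B)"
  by (rule linearI) (simp_all add: equations_deriv_def vec_eq_iff polar_add polar_scaleR algebra_simps)

lemma equations_deriv_cs: "equations_deriv c B (cs2 z V) = cs3 z (equations_deriv c B V)"
  by (simp add: equations_deriv_def vec_eq_iff polar_scale algebra_simps)

text \<open>An element of \<open>sym3\<close> orthogonal to the image becomes, after conjugation, a
  symmetric \<open>a\<close>. Orthogonality is real and gives only a vanishing real part, but
  applying it to i V as well makes the pairing vanish. Then \<open>regular_point\<close> forces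
  \<open>a\<close> to be 0.\<close>

lemma equations_deriv_surj:
  assumes reg: "regular_point c B"
  shows "range (equations_deriv c B) = sym3"
proof
  show "range (equations_deriv c B) \<subseteq> sym3" using equations_sym3 by auto
  show "sym3 \<subseteq> range (equations_deriv c B)"
  proof
    fix g assume g: "g \<in> sym3"
    let ?R = "range (equations_deriv c B)"
    have sub: "subspace ?R" using linear_equations_deriv linear_subspace_image subspace_UNIV by blast
    obtain y z where y: "y \<in> span ?R" and z: "\<And>w. w \<in> span ?R \<Longrightarrow> orthogonal z w" and gyz: "g = y + z"
      using orthogonal_subspace_decomp_exists[of ?R g] by metis
    have spanR: "span ?R = ?R" using sub by (simp add: span_eq_iff)
    have "y \<in> sym3" using y spanR equations_sym3 by auto
    then have zs: "z \<in> sym3" using g gyz unfolding sym3_def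
      by (auto simp: vec_eq_iff)
    define a where "a = (\<lambda>i j k. cnj (z $ i $ j $ k))"
    have asym: "a i j k = a j i k" "a i j k = a i k j" for i j k
      using zs unfolding sym3_def a_def by (metis (mono_tags, lifting) mem_Collect_eq)+
    define L where "L = (\<lambda>V. \<Sum>i\<in>UNIV. \<Sum>j\<in>UNIV. \<Sum>k\<in>UNIV. a i j k * equations_deriv c B V $ i $ j $ k)"
    have ReL: "Re (L V) = 0" for V
    proof -
      have "inner z (equations_deriv c B V) = 0" using z spanR by (auto simp: orthogonal_def)
      moreover have "inner z (equations_deriv c B V) = Re (L V)"
        unfolding inner_vec_def L_def a_def by (simp add: inner_complex_def)
      ultimately show ?thesis by simp
    qed
    have L0: "L V = 0" for V
    proof -
      have "L (cs2 \<i> V) = \<i> * L V"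
        by (simp add: L_def equations_deriv_cs sum_distrib_left algebra_simps)
      then have "Im (L V) = 0" using ReL[of "cs2 \<i> V"] by simp
      then show ?thesis using ReL[of V] by (simp add: complex_eq_iff)
    qed
    have "(\<Sum>i\<in>UNIV. \<Sum>j\<in>UNIV. a i j k0 * polar c (B $ i) (B $ j) v) = 0" for k0 v
    proof -
      \<comment> \<open>Only the row \<open>k0\<close> moves. By symmetry all three Leibniz terms
        equal S.\<close>
      define V :: "complex ^ 7 ^ 3" where "V = (\<chi> k. if k = k0 then v else 0)"
      define S where "S = (\<Sum>i\<in>UNIV. \<Sum>j\<in>UNIV. a i j k0 * polar c (B $ i) (B $ j) v)"
      have V: "polar c x y (V $ k) = (if k = k0 then polar c x y v else 0)"
        "polar c x (V $ k) y = (if k = k0 then polar c x y v else 0)"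
        "polar c (V $ k) x y = (if k = k0 then polar c x y v else 0)" for x y k
        using polar_commute by (auto simp: V_def)
      have "(\<Sum>i\<in>UNIV. \<Sum>j\<in>UNIV. \<Sum>k\<in>UNIV. a i j k * polar c (B $ i) (B $ j) (V $ k)) = S"
        by (simp add: V S_def mult_delta_right)
      moreover have "(\<Sum>i\<in>UNIV. \<Sum>j\<in>UNIV. \<Sum>k\<in>UNIV. a i j k * polar c (B $ i) (V $ j) (B $ k)) = S"
      proof -
        have "(\<Sum>j\<in>UNIV. \<Sum>k\<in>UNIV. a i j k * polar c (B $ i) (V $ j) (B $ k)) =
          (\<Sum>k\<in>UNIV. a i k k0 * polar c (B $ i) (B $ k) v)" for i
          by (subst sum.swap) (simp add: V mult_delta_right asym(2)[of i k0])
        then show ?thesis by (simp add: S_def)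
      qed
      moreover have "(\<Sum>i\<in>UNIV. \<Sum>j\<in>UNIV. \<Sum>k\<in>UNIV. a i j k * polar c (V $ i) (B $ j) (B $ k)) = S"
      proof -
        have "(\<Sum>i\<in>UNIV. \<Sum>j\<in>UNIV. \<Sum>k\<in>UNIV. a i j k * polar c (V $ i) (B $ j) (B $ k)) =
           (\<Sum>i\<in>UNIV. if i = k0 then (\<Sum>j\<in>UNIV. \<Sum>k\<in>UNIV. a k0 j k * polar c (B $ j) (B $ k) v) else 0)"
          by (intro sum.cong refl) (auto simp: V)
        also have "\<dots> = (\<Sum>j\<in>UNIV. \<Sum>k\<in>UNIV. a k0 j k * polar c (B $ j) (B $ k) v)" by simp
        also have "\<dots> = S" unfolding S_def
        proof (intro sum.cong refl)
          fix j k
          have "a k0 j k = a j k k0" using asym(1)[of k0 j k] asym(2)[of j k0 k] by simp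
          then show "a k0 j k * polar c (B $ j) (B $ k) v = a j k k0 * polar c (B $ j) (B $ k) v" by simp
        qed
        finally show ?thesis .
      qed
      moreover have "L V = (\<Sum>i\<in>UNIV. \<Sum>j\<in>UNIV. \<Sum>k\<in>UNIV. a i j k * polar c (V $ i) (B $ j) (B $ k)) +
        (\<Sum>i\<in>UNIV. \<Sum>j\<in>UNIV. \<Sum>k\<in>UNIV. a i j k * polar c (B $ i) (V $ j) (B $ k)) +
        (\<Sum>i\<in>UNIV. \<Sum>j\<in>UNIV. \<Sum>k\<in>UNIV. a i j k * polar c (B $ i) (B $ j) (V $ k))"
        by (simp add: L_def equations_deriv_def distrib_left sum.distrib)
      ultimately have "3 * S = 0" using L0[of V] by simp
      then show ?thesis by (simp add: S_def)
    qed
    then have "a i j k = 0" for i j k using reg asym unfolding regular_point_def by blast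
    then have "z = 0" by (simp add: a_def vec_eq_iff)
    then show "g \<in> ?R" using gyz y spanR by simp
  qed
qed

text \<open>A real linear right inverse exists by linear algebra; averaging it with its conjugate
  under multiplication by i makes it complex linear.\<close>

lemma equations_right_inverse:
  assumes reg: "regular_point c B"
  obtains J where "linear J" "\<And>z g. J (cs3 z g) = cs2 z (J g)" "\<And>g. g \<in> sym3 \<Longrightarrow> equations_deriv c B (J g) = g"
proof -
  let ?A = "equations_deriv c B"
  obtain J' where J': "linear J'" "\<forall>v\<in>?A ` UNIV. ?A (J' v) = v"
    using linear_exists_right_inverse_on[OF linear_equations_deriv subspace_UNIV, of c B] by blast
  have A: "?A (J' v) = v" if "v \<in> sym3" for v using J' that equations_deriv_surj[OF reg] by auto
  define J where "J = (\<lambda>g. (1/2) *\<^sub>R (J' g - cs2 \<i> (J' (cs3 \<i> g))))"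
  have cs_lin: "cs2 z (x + y) = cs2 z x + cs2 z y" "cs2 z (r *\<^sub>R x) = r *\<^sub>R cs2 z x"
    "cs2 z (x - y) = cs2 z x - cs2 z y" for z r and x y :: "complex ^ 7 ^ 3"
    by (simp_all add: vec_eq_iff algebra_simps)
  have cs3_lin: "cs3 z (x + y) = cs3 z x + cs3 z y" "cs3 z (r *\<^sub>R x) = r *\<^sub>R cs3 z x"
    for z r and x y :: "complex ^ 3 ^ 3 ^ 3"
    by (simp_all add: vec_eq_iff algebra_simps)
  have ii: "cs2 \<i> (cs2 \<i> x) = - x" "cs3 \<i> (cs3 \<i> g) = - g" for x :: "complex ^ 7 ^ 3" and g :: "complex ^ 3 ^ 3 ^ 3"
    by (simp_all add: vec_eq_iff)
  have lin: "linear J"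
    by (rule linearI) (simp_all add: J_def cs_lin cs3_lin linear_add[OF J'(1)] linear_cmul[OF J'(1)] algebra_simps)
  have Ji: "J (cs3 \<i> g) = cs2 \<i> (J g)" for g
    by (simp add: J_def cs_lin ii linear_neg[OF J'(1)] algebra_simps)
       (simp add: vec_eq_iff)
  have Jz: "J (cs3 z g) = cs2 z (J g)" for z g
    by (subst cs3_Complex, subst cs2_Complex) (simp add: linear_add[OF lin] linear_cmul[OF lin] Ji)
  have AJ: "?A (J g) = g" if g: "g \<in> sym3" for g
  proof -
    have ig: "cs3 \<i> g \<in> sym3" using g by (simp add: sym3_def)
    have "?A (J g) = (1/2) *\<^sub>R (?A (J' g) - cs3 \<i> (?A (J' (cs3 \<i> g))))"
      by (simp add: J_def linear_cmul[OF linear_equations_deriv] linear_diff[OF linear_equations_deriv] equations_deriv_cs)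
    also have "\<dots> = g" unfolding A[OF g] A[OF ig] ii by (simp add: vec_eq_iff)
    finally show ?thesis .
  qed
  show ?thesis by (rule that[OF lin Jz AJ])
qed

text \<open>Implicit function theorem with the cubic as a parameter: near (c0, B0) the plane frames
  of every c are parametrised by the same ball in the complex subspace K, continuously in all
  variables and holomorphically along complex lines in K.\<close>

lemma local_product:
  fixes N :: "(tensor \<times> (complex ^ 7 ^ 3)) set"
  assumes reg: "regular_point c0 B0" and van: "vanishes c0 B0" and N: "open N" "(c0, B0) \<in> N"
  obtains \<delta> b0 O' h and K :: "(complex ^ 7 ^ 3) set" where "\<delta> > 0" "subspace K" "\<And>z b. b \<in> K \<Longrightarrow> cs2 z b \<in> K" "b0 \<in> K"
    "open O'" "O' \<subseteq> N" "(c0, B0) \<in> O'"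
    "\<And>c b. c \<in> ball c0 \<delta> \<Longrightarrow> b \<in> K \<inter> ball b0 \<delta> \<Longrightarrow> (c, h (c, b)) \<in> O' \<and> vanishes c (h (c, b))"
    "\<And>c B. (c, B) \<in> O' \<Longrightarrow> vanishes c B \<Longrightarrow> c \<in> ball c0 \<delta> \<and> (\<exists>b\<in>K \<inter> ball b0 \<delta>. B = h (c, b))"
    "continuous_on (ball c0 \<delta> \<times> ball b0 \<delta>) h"
    "\<And>c b d i x. c \<in> ball c0 \<delta> \<Longrightarrow> (\<lambda>z. h (c, b + cs2 z d) $ i $ x) holomorphic_on {z. b + cs2 z d \<in> ball b0 \<delta>}"
proof -
  let ?A = "equations_deriv c0 B0"
  obtain J where J: "linear J" "\<And>z g. J (cs3 z g) = cs2 z (J g)" "\<And>g. g \<in> sym3 \<Longrightarrow> ?A (J g) = g"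
    by (rule equations_right_inverse[OF reg]) (rule that)
  have linA: "linear ?A" by (rule linear_equations_deriv)
  have blJ: "bounded_linear J" using J(1) by (simp add: linear_conv_bounded_linear)
  have blA: "bounded_linear ?A" using linA by (simp add: linear_conv_bounded_linear)
  \<comment> \<open>J is a right inverse of the differential A, so A maps the second component of
    \<open>\<Theta>\<close> to the equations, and their zeros become the kernel K of A for all c at
    once. At (c0, B0) the derivative differs from the identity only by a term in c, so
    \<open>inv0\<close> inverts it.\<close>
  define \<Theta> where "\<Theta> = (\<lambda>p :: tensor \<times> (complex ^ 7 ^ 3). (fst p, snd p - J (?A (snd p)) + J (equations (fst p) (snd p))))"
  define D where "D = (\<lambda>(p :: tensor \<times> (complex ^ 7 ^ 3)) q.
     (fst q, snd q - J (?A (snd q)) + J (equations (fst q) (snd p) + equations_deriv (fst p) (snd p) (snd q))))"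
  have der: "(\<Theta> has_derivative D p) (at p)" for p
  proof -
    have "((\<lambda>p. polar (fst p) (snd p $ i) (snd p $ j) (snd p $ k)) has_derivative
       (\<lambda>q. polar (fst q) (snd p $ i) (snd p $ j) (snd p $ k) + polar (fst p) (snd q $ i) (snd p $ j) (snd p $ k)
         + polar (fst p) (snd p $ i) (snd q $ j) (snd p $ k) + polar (fst p) (snd p $ i) (snd p $ j) (snd q $ k))) (at p)"
      for i j k
      by (intro has_derivative_polar bounded_linear.has_derivative[OF bounded_linear_vec_nth]
            has_derivative_fst has_derivative_snd has_derivative_ident)
    then have e: "((\<lambda>p. equations (fst p) (snd p) $ i $ j $ k) has_derivative
       (\<lambda>q. (equations (fst q) (snd p) + equations_deriv (fst p) (snd p) (snd q)) $ i $ j $ k)) (at p)" for i j k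
      by (simp add: equations_def equations_deriv_def add.assoc)
    have e2: "((\<lambda>p. equations (fst p) (snd p)) has_derivative
       (\<lambda>q. equations (fst q) (snd p) + equations_deriv (fst p) (snd p) (snd q))) (at p)"
    proof (subst has_derivative_componentwise_within, intro ballI)
      fix b :: "complex ^ 3 ^ 3 ^ 3" assume "b \<in> Basis"
      have in3: "inner (g :: complex ^ 3 ^ 3 ^ 3) b = (\<Sum>i\<in>UNIV. \<Sum>j\<in>UNIV. \<Sum>k\<in>UNIV. inner (g $ i $ j $ k) (b $ i $ j $ k))" for g
        by (simp add: inner_vec_def)
      show "((\<lambda>p. inner (equations (fst p) (snd p)) b) has_derivative
         (\<lambda>q. inner (equations (fst q) (snd p) + equations_deriv (fst p) (snd p) (snd q)) b)) (at p)"
        unfolding in3 by (intro has_derivative_sum has_derivative_inner_left e)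
    qed
    show ?thesis unfolding \<Theta>_def D_def
      by (intro has_derivative_Pair has_derivative_add has_derivative_diff has_derivative_fst has_derivative_snd
          has_derivative_ident bounded_linear.has_derivative[OF blJ] bounded_linear.has_derivative[OF blA] e2)
  qed
  have blD: "bounded_linear (D p)" for p using der by (rule has_derivative_bounded_linear)
  define D' where "D' = (\<lambda>p. Blinfun (D p))"
  have D': "blinfun_apply (D' p) = D p" for p
    unfolding D'_def by (rule bounded_linear_Blinfun_apply[OF blD])
  have contJ: "continuous_on S (\<lambda>t. J (g t))" if "continuous_on S g" for S and g :: "tensor \<times> (complex ^ 7 ^ 3) \<Rightarrow> _"
    by (rule bounded_linear.continuous_on[OF blJ that])
  have contD: "continuous_on UNIV D'"
  proof (rule continuous_on_blinfun_componentwise)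
    fix q :: "tensor \<times> (complex ^ 7 ^ 3)" assume "q \<in> Basis"
    have c1: "continuous_on UNIV (\<lambda>p :: tensor \<times> (complex ^ 7 ^ 3).
       equations (fst q) (snd p) + equations_deriv (fst p) (snd p) (snd q))"
      unfolding equations_def equations_deriv_def
      by (intro continuous_intros continuous_on_polar)
    show "continuous_on UNIV (\<lambda>p. blinfun_apply (D' p) q)"
      unfolding D' D_def by (intro continuous_on_Pair continuous_on_add continuous_on_const contJ[OF c1])
  qed
  define inv0 where "inv0 = (\<lambda>q :: tensor \<times> (complex ^ 7 ^ 3). (fst q, snd q - J (equations (fst q) B0)))"
  have lin_eq: "linear (\<lambda>c. equations c B0)"
  proof (rule linearI)
    show "equations (c + c') B0 = equations c B0 + equations c' B0" for c c'
      by (simp add: equations_def vec_eq_iff polar_add)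
    show "equations (r *\<^sub>R c) B0 = r *\<^sub>R equations c B0" for r c
    proof -
      have e: "r *\<^sub>R c = cs3 (complex_of_real r) c" by (simp add: vec_eq_iff complex_eq_iff)
      show ?thesis unfolding e by (simp add: equations_def vec_eq_iff polar_tensor_scale complex_eq_iff)
    qed
  qed
  have bl_inv0: "bounded_linear inv0"
  proof -
    have "linear inv0" unfolding inv0_def
      by (rule linearI) (simp_all add: linear_add[OF lin_eq] linear_cmul[OF lin_eq] linear_add[OF J(1)] linear_cmul[OF J(1)] algebra_simps)
    then show ?thesis by (simp add: linear_conv_bounded_linear)
  qed
  have inv0: "Blinfun inv0 o\<^sub>L D' (c0, B0) = id_blinfun"
  proof (rule blinfun_eqI)
    fix q
    have "J (equations (fst q) B0 + ?A (snd q)) = J (equations (fst q) B0) + J (?A (snd q))"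
      by (rule linear_add[OF J(1)])
    then have "inv0 (D (c0, B0) q) = q" by (simp add: D_def inv0_def prod_eq_iff)
    then show "blinfun_apply (Blinfun inv0 o\<^sub>L D' (c0, B0)) q = blinfun_apply id_blinfun q"
      by (simp only: blinfun_apply_blinfun_compose bounded_linear_Blinfun_apply[OF bl_inv0] D' blinfun_apply_id_blinfun)
  qed
  obtain U' V g g' where U': "open U'" "(c0, B0) \<in> U'" and V: "open V" "\<Theta> (c0, B0) \<in> V" and hom: "homeomorphism U' V \<Theta> g"
    and derg: "\<And>y. y \<in> V \<Longrightarrow> (g has_derivative (g' y)) (at y)"
    and g': "\<And>y. y \<in> V \<Longrightarrow> g' y = inv (blinfun_apply (D' (g y)))"
    and bij: "\<And>y. y \<in> V \<Longrightarrow> bij (blinfun_apply (D' (g y)))"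
    by (rule inverse_function_theorem[OF open_UNIV _ contD UNIV_I inv0, of \<Theta>]) (use der in \<open>simp_all add: D'\<close>)
  have g\<Theta>: "g (\<Theta> p) = p" if "p \<in> U'" for p using hom that by (simp add: homeomorphism_def)
  have \<Theta>g: "\<Theta> (g y) = y" and gU: "g y \<in> U'" if "y \<in> V" for y using hom that by (auto simp: homeomorphism_def)
  have contg: "continuous_on V g" using hom by (simp add: homeomorphism_def)
  have cont\<Theta>: "continuous_on UNIV \<Theta>" 
    by (intro continuous_at_imp_continuous_on ballI has_derivative_continuous[OF der])
  define K where "K = {b. ?A b = 0}"
  define b0 where "b0 = snd (\<Theta> (c0, B0))"
  have A\<Theta>: "?A (snd (\<Theta> p)) = equations (fst p) (snd p)" for p
    by (simp add: \<Theta>_def linear_add[OF linA] linear_diff[OF linA] J(3) equations_sym3)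
  have \<Theta>0: "\<Theta> (c0, B0) = (c0, b0)" by (simp add: b0_def \<Theta>_def)
  define V1 where "V1 = {y \<in> V. g y \<in> N}"
  have V1: "open V1"
    using continuous_open_preimage[OF contg V(1) N(1)] by (simp add: V1_def vimage_def Int_def)
  have "(c0, b0) \<in> V1" using V(2) g\<Theta>[OF U'(2)] N(2) by (simp add: V1_def \<Theta>0)
  then obtain X Y where XY: "open X" "open Y" "c0 \<in> X" "b0 \<in> Y" "X \<times> Y \<subseteq> V1"
    using V1 by (metis open_prod_elim mem_Sigma_iff)
  obtain \<delta>1 where d1: "\<delta>1 > 0" "ball c0 \<delta>1 \<subseteq> X" using XY openE by blast
  obtain \<delta>2 where d2: "\<delta>2 > 0" "ball b0 \<delta>2 \<subseteq> Y" using XY openE by blast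
  define \<delta> where "\<delta> = min \<delta>1 \<delta>2"
  have \<delta>: "\<delta> > 0" using d1 d2 by (simp add: \<delta>_def)
  let ?box = "ball c0 \<delta> \<times> ball b0 \<delta>"
  have box: "?box \<subseteq> V1" using d1 d2 XY(5) by (auto simp: \<delta>_def subset_iff)
  then have boxV: "?box \<subseteq> V" by (auto simp: V1_def)
  define O' where "O' = U' \<inter> N \<inter> \<Theta> -` ?box"
  define h where "h = (\<lambda>y. snd (g y))"
  have gy: "g (c, b) = (c, h (c, b))" if "(c, b) \<in> V" for c b
  proof -
    have "fst (g (c, b)) = fst (\<Theta> (g (c, b)))" by (simp add: \<Theta>_def)
    then have "fst (g (c, b)) = c" using \<Theta>g[OF that] by simp
    then show ?thesis by (simp add: h_def prod_eq_iff)
  qed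
  show ?thesis
  proof (rule that[of \<delta> K b0 O' h])
    show "\<delta> > 0" by (rule \<delta>)
    show "subspace K" unfolding K_def by (rule linear_subspace_kernel[OF linA])
    show "cs2 z b \<in> K" if "b \<in> K" for z b
      using that by (simp add: K_def equations_deriv_cs) (simp add: vec_eq_iff)
    show "b0 \<in> K" using van by (simp add: K_def b0_def A\<Theta> vanishes_iff)
    show "open O'" unfolding O'_def
      by (intro open_Int U' N open_vimage[OF _ cont\<Theta>] open_Times open_ball)
    show "O' \<subseteq> N" by (auto simp: O'_def)
    show "(c0, B0) \<in> O'" using U' N \<delta> by (simp add: O'_def \<Theta>0)
    show "(c, h (c, b)) \<in> O' \<and> vanishes c (h (c, b))" if "c \<in> ball c0 \<delta>" "b \<in> K \<inter> ball b0 \<delta>" for c b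
    proof -
      have in_box: "(c, b) \<in> ?box" using that by simp
      then have v: "(c, b) \<in> V" using boxV by blast
      have "g (c, b) \<in> N" using in_box box unfolding V1_def by blast
      then have "g (c, b) \<in> O'" using in_box gU[OF v] \<Theta>g[OF v] by (simp add: O'_def)
      moreover have "equations c (h (c, b)) = ?A b"
        using A\<Theta>[of "g (c, b)"] \<Theta>g[OF v] gy[OF v] by simp
      ultimately show ?thesis using that gy[OF v] by (simp add: K_def vanishes_iff)
    qed
    show "c \<in> ball c0 \<delta> \<and> (\<exists>b\<in>K \<inter> ball b0 \<delta>. B = h (c, b))" if "(c, B) \<in> O'" "vanishes c B" for c B
    proof -
      let ?b = "snd (\<Theta> (c, B))"
      have \<Theta>c: "\<Theta> (c, B) = (c, ?b)" by (simp add: \<Theta>_def)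
      have "(c, ?b) \<in> ?box" using that \<Theta>c by (auto simp: O'_def)
      moreover have "?b \<in> K" using that(2) by (simp add: K_def A\<Theta> vanishes_iff)
      moreover have "B = h (c, ?b)"
        using g\<Theta>[of "(c, B)"] that(1) \<Theta>c by (simp add: O'_def h_def)
      ultimately show ?thesis by auto
    qed
    show "continuous_on ?box h" unfolding h_def
      by (intro continuous_on_snd continuous_on_subset[OF contg boxV])
    show "(\<lambda>z. h (c, b + cs2 z d) $ i $ x) holomorphic_on {z. b + cs2 z d \<in> ball b0 \<delta>}"
      if c: "c \<in> ball c0 \<delta>" for c b d i x
    proof -
      have "\<exists>w. ((\<lambda>z. h (c, b + cs2 z d) $ i $ x) has_field_derivative w) (at z within S)"
        if z: "b + cs2 z d \<in> ball b0 \<delta>" for z S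
      proof -
        define y where "y = (c, b + cs2 z d)"
        have y: "y \<in> V" using c z boxV by (auto simp: y_def)
        define E where "E = D (g y)"
        have bijE: "bij E" using bij[OF y] by (simp add: E_def D')
        have g'E: "g' y = inv E" using g'[OF y] by (simp add: E_def D')
        \<comment> \<open>The inverse function theorem yields a real derivative. It commutes with
          complex scaling in the B direction because J and the differential of the equations do, and
          this makes h holomorphic.\<close>
        have Ez: "E (0, cs2 \<zeta> w) = (0, cs2 \<zeta> (snd (E (0, w))))" for \<zeta> w
        proof -
          have eq0: "equations 0 B = 0" for B
            by (simp add: equations_def polar_def tri_def vec_eq_iff)
          have "cs2 \<zeta> u - cs2 \<zeta> u' + cs2 \<zeta> u'' = cs2 \<zeta> (u - u' + u'')" for u u' u'' :: "complex ^ 7 ^ 3"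
            by (simp add: vec_eq_iff algebra_simps)
          then show ?thesis by (simp add: E_def D_def eq0 equations_deriv_cs J(2))
        qed
        have Efst: "fst (E q) = fst q" for q by (simp add: E_def D_def)
        define w where "w = g' y (0, d)"
        have Ew: "E w = (0, d)" using bijE by (simp add: w_def g'E bij_is_surj surj_f_inv_f)
        have w0: "fst w = 0" using Efst[of w] Ew by simp
        have g'z: "g' y (0, cs2 \<zeta> d) = (0, cs2 \<zeta> (snd w))" for \<zeta>
        proof -
          have "E (0, cs2 \<zeta> (snd w)) = (0, cs2 \<zeta> (snd (E w)))" using Ez[of \<zeta> "snd w"] w0 by (cases w) auto
          then have "E (0, cs2 \<zeta> (snd w)) = (0, cs2 \<zeta> d)" by (simp add: Ew)
          then show ?thesis using bijE unfolding g'E by (metis bij_inv_eq_iff)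
        qed
        have dcs: "((\<lambda>z. cs2 z d) has_derivative (\<lambda>\<zeta>. cs2 \<zeta> d)) (at z)"
        proof (rule bounded_linear_imp_has_derivative)
          have "linear (\<lambda>\<zeta>. cs2 \<zeta> d)"
            by (rule linearI) (simp_all add: vec_eq_iff algebra_simps)
          then show "bounded_linear (\<lambda>\<zeta>. cs2 \<zeta> d)" by (simp add: linear_conv_bounded_linear)
        qed
        have "((\<lambda>z. (c, b + cs2 z d)) has_derivative (\<lambda>\<zeta>. (0, cs2 \<zeta> d))) (at z)"
          by (auto intro!: derivative_eq_intros dcs)
        then have "((\<lambda>z. g (c, b + cs2 z d)) has_derivative (\<lambda>\<zeta>. g' y (0, cs2 \<zeta> d))) (at z)"
          using has_derivative_compose[of "\<lambda>z. (c, b + cs2 z d)" _ z UNIV g "g' y"] derg[OF y] by (simp add: y_def)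
        then have "((\<lambda>z. snd (g (c, b + cs2 z d)) $ i $ x) has_derivative (\<lambda>\<zeta>. snd (g' y (0, cs2 \<zeta> d)) $ i $ x)) (at z)"
          by (intro bounded_linear.has_derivative[OF bounded_linear_vec_nth] has_derivative_snd)
        then have "((\<lambda>z. h (c, b + cs2 z d) $ i $ x) has_derivative (\<lambda>\<zeta>. snd w $ i $ x * \<zeta>)) (at z)"
          by (simp add: h_def g'z mult.commute)
        then show ?thesis
          by (intro exI[of _ "snd w $ i $ x"]) (simp add: has_field_derivative_def has_derivative_at_withinI)
      qed
      then show ?thesis by (auto simp: holomorphic_on_def field_differentiable_def)
    qed
  qed
qed

section \<open>Frames and orthonormalisation\<close>

definition minor :: "complex ^ 7 ^ 3 \<Rightarrow> (3 \<Rightarrow> 7) \<Rightarrow> complex" where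
  "minor B K = det (\<chi> i j. B $ i $ K j)"

lemma frame_iff_minor: "frame B \<longleftrightarrow> (\<exists>K. minor B K \<noteq> 0)"
proof
  assume "frame B"
  then obtain \<pi> T T' where \<pi>: "bij (\<pi> :: 3 + 4 \<Rightarrow> 7)" and T: "T ** T' = mat 1" "T' ** T = mat 1"
    and piv: "\<And>i j. (T ** B) $ i $ \<pi> (Inl j) = (if i = j then 1 else 0)"
    by (rule frame_pivots) (rule that)
  have "T ** (\<chi> i j. B $ i $ \<pi> (Inl j)) = mat 1"
    using piv by (simp add: vec_eq_iff matrix_matrix_mult_def mat_def)
  then have "det T * det (\<chi> i j. B $ i $ \<pi> (Inl j)) = 1"
    by (metis det_mul det_I)
  then show "\<exists>K. minor B K \<noteq> 0" unfolding minor_def by (intro exI[of _ "\<lambda>j. \<pi> (Inl j)"]) auto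
next
  assume "\<exists>K. minor B K \<noteq> 0"
  then obtain K where K: "det (\<chi> i j. B $ i $ K j) \<noteq> 0" by (auto simp: minor_def)
  let ?M = "\<chi> i j. B $ i $ K j"
  have "\<exists>C. ?M ** C = mat 1" using K by (simp add: invertible_det_nz[symmetric] invertible_right_inverse)
  then have ind: "(\<Sum>i\<in>UNIV. t i *s row i ?M) = 0 \<Longrightarrow> t i = 0" for t i
    unfolding matrix_right_invertible_independent_rows by blast
  show "frame B"
    unfolding frame_def
  proof (intro allI impI)
    fix t :: "3 \<Rightarrow> complex" and i
    assume t: "(\<Sum>i\<in>UNIV. t i *s B $ i) = 0"
    have "(\<Sum>i\<in>UNIV. t i *s row i ?M) = 0"
    proof (rule vec_eq_iff[THEN iffD2], rule allI)
      fix j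
      have "(\<Sum>i\<in>UNIV. t i *s B $ i) $ K j = 0" using t by simp
      then show "(\<Sum>i\<in>UNIV. t i *s row i ?M) $ j = (0 :: complex ^ 3) $ j" by (simp add: row_def)
    qed
    then show "t i = 0" by (rule ind)
  qed
qed

lemma open_frame: "open {B. frame B}"
proof -
  have "{B. frame B} = (\<Union>K. {B. minor B K \<noteq> 0})" by (auto simp: frame_iff_minor)
  moreover have "open {B. minor B K \<noteq> 0}" for K
    unfolding minor_def det_3 by (intro open_Collect_neq continuous_intros)
  ultimately show ?thesis by auto
qed

lemma frame_mult:
  assumes "frame B" "T ** T' = mat 1"
  shows "frame (T ** B)"
proof -
  obtain C where "B ** C = mat 1" using assms(1) frame_iff_right_inverse by blast
  then have "(T ** B) ** (C ** T') = mat 1"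
    using assms(2) by (metis matrix_mul_assoc matrix_mul_rid)
  then show ?thesis unfolding frame_iff_right_inverse by blast
qed

section \<open>Gram-Schmidt orthonormalisation of frames\<close>

definition herm :: "complex ^ 7 \<Rightarrow> complex ^ 7 \<Rightarrow> complex" where
  "herm x y = (\<Sum>k\<in>UNIV. x $ k * cnj (y $ k))"

lemma herm_linear:
  "herm (x - x') y = herm x y - herm x' y" "herm (r *s x) y = r * herm x y"
  "herm x (y - y') = herm x y - herm x y'" "herm x (r *s y) = cnj r * herm x y"
  by (simp_all add: herm_def algebra_simps sum_subtractf sum_distrib_left)

lemma herm_sum: "herm (sum X A) y = (\<Sum>i\<in>A. herm (X i) y)"
  by (simp add: herm_def sum_distrib_right) (rule sum.swap)

lemma herm_commute: "herm y x = cnj (herm x y)"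
  by (simp add: herm_def mult.commute)

lemma herm_same: "herm x x = of_real ((norm x)\<^sup>2)"
proof -
  have "(norm x)\<^sup>2 = (\<Sum>k\<in>UNIV. (cmod (x $ k))\<^sup>2)"
    by (simp add: norm_vec_def L2_set_def sum_nonneg)
  then show ?thesis
    by (simp only: herm_def complex_norm_square[symmetric] of_real_sum)
qed

definition unit_vec :: "complex ^ 7 \<Rightarrow> complex ^ 7" where
  "unit_vec x = of_real (inverse (norm x)) *s x"

lemma herm_unit_vec: "x \<noteq> 0 \<Longrightarrow> herm (unit_vec x) (unit_vec x) = 1"
  unfolding unit_vec_def herm_linear unfolding herm_same by (simp add: power2_eq_square field_simps)

lemma continuous_on_cmul_vec:
  fixes x :: "'t::topological_space \<Rightarrow> complex ^ 'n"
  assumes "continuous_on S r" "continuous_on S x"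
  shows "continuous_on S (\<lambda>t. r t *s x t)"
  unfolding vector_scalar_mult_def by (intro continuous_intros assms)

lemma continuous_on_unit_vec:
  assumes "continuous_on S x" "\<And>t. t \<in> S \<Longrightarrow> x t \<noteq> 0"
  shows "continuous_on S (\<lambda>t. unit_vec (x t))"
  unfolding unit_vec_def by (intro continuous_on_cmul_vec continuous_intros assms) (use assms in auto)

lemma continuous_on_herm:
  assumes "continuous_on S x" "continuous_on S y"
  shows "continuous_on S (\<lambda>t. herm (x t) (y t))"
  unfolding herm_def by (intro continuous_intros assms)

text \<open>Gram-Schmidt is written out for three rows, so that continuity and the triangular change
  of basis in \<open>gs_segment\<close> can be read off.\<close>

definition gs2 :: "complex ^ 7 ^ 3 \<Rightarrow> complex ^ 7" where
  "gs2 B = B $ 2 - herm (B $ 2) (unit_vec (B $ 1)) *s unit_vec (B $ 1)"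

definition gs3 :: "complex ^ 7 ^ 3 \<Rightarrow> complex ^ 7" where
  "gs3 B = B $ 3 - herm (B $ 3) (unit_vec (B $ 1)) *s unit_vec (B $ 1)
      - herm (B $ 3) (unit_vec (gs2 B)) *s unit_vec (gs2 B)"

definition gs :: "complex ^ 7 ^ 3 \<Rightarrow> complex ^ 7 ^ 3" where
  "gs B = (\<chi> i. if i = 1 then unit_vec (B $ 1) else if i = 2 then unit_vec (gs2 B) else unit_vec (gs3 B))"

text \<open>Orthonormal frames form a compact set containing a frame of every plane. This replaces
  compactness of the Grassmannian in all arguments that need the family of planes to be
  proper.\<close>

definition stiefel :: "(complex ^ 7 ^ 3) set" where
  "stiefel = {B. \<forall>i j. herm (B $ i) (B $ j) = (if i = j then 1 else 0)}"

lemma sum_UNIV_3: "(\<Sum>i\<in>UNIV. g i) = g 1 + g 2 + g (3 :: 3)"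
  by (rule sum_3)

lemma neq_3 [simp]: "(1 :: 3) \<noteq> 2" "(1 :: 3) \<noteq> 3" "(2 :: 3) \<noteq> 3" "(2 :: 3) \<noteq> 1" "(3 :: 3) \<noteq> 1" "(3 :: 3) \<noteq> 2"
  by simp_all

lemma gs_nth: "gs B $ 1 = unit_vec (B $ 1)" "gs B $ 2 = unit_vec (gs2 B)" "gs B $ 3 = unit_vec (gs3 B)"
  by (simp_all add: gs_def)

lemma frame_gs_nonzero:
  assumes "frame B"
  shows "B $ 1 \<noteq> 0" "gs2 B \<noteq> 0" "gs3 B \<noteq> 0"
proof -
  have ind: "t1 *s B $ 1 + t2 *s B $ 2 + t3 *s B $ 3 = 0 \<Longrightarrow> t1 = 0 \<and> t2 = 0 \<and> t3 = 0" for t1 t2 t3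
  proof -
    assume a: "t1 *s B $ 1 + t2 *s B $ 2 + t3 *s B $ 3 = 0"
    let ?t = "\<lambda>i :: 3. if i = 1 then t1 else if i = 2 then t2 else t3"
    have "(\<Sum>i\<in>UNIV. ?t i *s B $ i) = 0" using a by (simp add: sum_UNIV_3)
    then have "\<forall>i. ?t i = 0" using assms[unfolded frame_def, THEN spec, of ?t] by (rule rev_mp)
    from spec[OF this, of 1] spec[OF this, of 2] spec[OF this, of 3] show ?thesis by simp
  qed
  show "B $ 1 \<noteq> 0" using ind[of 1 0 0] by auto
  show "gs2 B \<noteq> 0"
  proof
    assume "gs2 B = 0"
    then have "(- (herm (B $ 2) (unit_vec (B $ 1)) * of_real (inverse (norm (B $ 1))))) *s B $ 1 + 1 *s B $ 2 + 0 *s B $ 3 = 0"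
      by (simp add: gs2_def unit_vec_def vec_eq_iff algebra_simps)
    from ind[OF this] show False by simp
  qed
  show "gs3 B \<noteq> 0"
  proof
    assume a: "gs3 B = 0"
    define r1 where "r1 = complex_of_real (inverse (norm (B $ 1)))"
    define r2 where "r2 = complex_of_real (inverse (norm (gs2 B)))"
    define h where "h = herm (B $ 2) (unit_vec (B $ 1))"
    define h1 where "h1 = herm (B $ 3) (unit_vec (B $ 1))"
    define h2 where "h2 = herm (B $ 3) (unit_vec (gs2 B))"
    have u: "unit_vec (B $ 1) = r1 *s B $ 1" "unit_vec (gs2 B) = r2 *s gs2 B"
      by (simp_all only: unit_vec_def r1_def r2_def)
    have "gs2 B = B $ 2 - h *s unit_vec (B $ 1)" by (simp only: gs2_def h_def)
    then have g2: "gs2 B = B $ 2 - (h * r1) *s B $ 1" unfolding u vector_smult_assoc .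
    have "gs3 B = B $ 3 - h1 *s unit_vec (B $ 1) - h2 *s unit_vec (gs2 B)" by (simp only: gs3_def h1_def h2_def)
    then have g3: "gs3 B = B $ 3 - (h1 * r1) *s B $ 1 - (h2 * r2) *s gs2 B" unfolding u vector_smult_assoc .
    have "(- h1 * r1 + h2 * r2 * h * r1) *s B $ 1 + (- h2 * r2) *s B $ 2 + 1 *s B $ 3 = gs3 B"
      unfolding g3 g2 by (simp add: vec_eq_iff algebra_simps)
    then have "(- h1 * r1 + h2 * r2 * h * r1) *s B $ 1 + (- h2 * r2) *s B $ 2 + 1 *s B $ 3 = 0"
      by (simp only: a)
    from ind[OF this] show False by simp
  qed
qed

lemma gs_stiefel:
  assumes "frame B"
  shows "gs B \<in> stiefel"
proof -
  note nz = frame_gs_nonzero[OF assms]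
  define u1 where "u1 = unit_vec (B $ 1)"
  define u2 where "u2 = unit_vec (gs2 B)"
  define u3 where "u3 = unit_vec (gs3 B)"
  have u: "herm u1 u1 = 1" "herm u2 u2 = 1" "herm u3 u3 = 1"
    using nz by (simp_all add: u1_def u2_def u3_def herm_unit_vec)
  have "herm (gs2 B) u1 = 0" using u by (simp add: gs2_def u1_def[symmetric] herm_linear)
  then have 21: "herm u2 u1 = 0" by (simp add: u2_def unit_vec_def herm_linear)
  then have 12: "herm u1 u2 = 0" using herm_commute[of u1 u2] by simp
  have g3: "gs3 B = B $ 3 - herm (B $ 3) u1 *s u1 - herm (B $ 3) u2 *s u2"
    by (simp add: gs3_def u1_def u2_def)
  have "herm (gs3 B) u1 = 0" "herm (gs3 B) u2 = 0" unfolding g3 by (simp_all add: herm_linear u 21 12)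
  then have 3: "herm u3 u1 = 0" "herm u3 u2 = 0" by (simp_all add: u3_def unit_vec_def herm_linear)
  then have 4: "herm u1 u3 = 0" "herm u2 u3 = 0" using herm_commute[of u1 u3] herm_commute[of u2 u3] by simp_all
  have g: "gs B $ 1 = u1" "gs B $ 2 = u2" "gs B $ 3 = u3" by (simp_all add: gs_nth u1_def u2_def u3_def)
  show ?thesis
    unfolding stiefel_def mem_Collect_eq forall_3 g by (simp only: u 21 12 3 4 neq_3 if_True if_False simp_thms)
qed

lemma norm_stiefel:
  assumes "B \<in> stiefel"
  shows "norm (B $ i) = 1"
proof -
  have "herm (B $ i) (B $ i) = 1" using assms by (simp add: stiefel_def)
  then have "of_real ((norm (B $ i))\<^sup>2) = (1 :: complex)" by (simp only: herm_same)
  then have "(norm (B $ i))\<^sup>2 = 1" by (simp only: of_real_eq_1_iff)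
  then show ?thesis by (simp add: abs_square_eq_1)
qed

lemma gs_fixes_stiefel:
  assumes "B \<in> stiefel"
  shows "gs B = B"
proof -
  have h: "herm (B $ i) (B $ j) = (if i = j then 1 else 0)" for i j using assms by (simp add: stiefel_def)
  have n: "norm (B $ i) = 1" for i by (rule norm_stiefel[OF assms])
  have u: "unit_vec (B $ i) = B $ i" for i by (simp add: unit_vec_def n)
  have g2: "gs2 B = B $ 2" by (simp add: gs2_def u h)
  have g3: "gs3 B = B $ 3" by (simp add: gs3_def u h g2)
  show ?thesis unfolding vec_eq_iff[of "gs B" B] forall_3 gs_nth g2 g3 u by simp
qed

lemma stiefel_frame:
  assumes "B \<in> stiefel"
  shows "frame B"
  unfolding frame_def
proof (intro allI impI)
  fix t :: "3 \<Rightarrow> complex" and i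
  assume t: "(\<Sum>i\<in>UNIV. t i *s B $ i) = 0"
  have "herm (\<Sum>j\<in>UNIV. t j *s B $ j) (B $ i) = t i"
    using assms by (simp add: herm_sum herm_linear stiefel_def mult_delta_right)
  moreover have "herm 0 (B $ i) = 0" by (simp add: herm_def)
  ultimately show "t i = 0" using t by simp
qed

lemma compact_stiefel: "compact stiefel"
proof -
  have "closed stiefel"
  proof -
    have eq: "stiefel = (\<Inter>i. \<Inter>j. {B. herm (B $ i) (B $ j) = (if i = j then 1 else 0)})"
      by (auto simp: stiefel_def)
    have cl: "closed {B :: complex ^ 7 ^ 3. herm (B $ i) (B $ j) = (if i = j then 1 else 0)}" for i j
      by (intro closed_Collect_eq continuous_on_herm continuous_intros)
    show ?thesis unfolding eq by (intro closed_INT ballI cl)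
  qed
  moreover have "norm B \<le> 3" if "B \<in> stiefel" for B :: "complex ^ 7 ^ 3"
  proof -
    have n: "norm (B $ i) = 1" for i by (rule norm_stiefel[OF that])
    have "norm B \<le> (\<Sum>i\<in>UNIV. norm (B $ i))" unfolding norm_vec_def by (rule L2_set_le_sum) simp
    then show ?thesis by (simp add: n)
  qed
  then have "bounded stiefel" unfolding bounded_iff by blast
  ultimately show ?thesis by (simp add: compact_eq_bounded_closed)
qed

lemma continuous_on_gs: "continuous_on {B. frame B} gs"
proof -
  have 1: "continuous_on {B. frame B} (\<lambda>B. unit_vec (B $ 1))"
    by (intro continuous_on_unit_vec continuous_intros) (simp add: frame_gs_nonzero)
  have "continuous_on {B. frame B} (\<lambda>B. gs2 B)"
    unfolding gs2_def by (intro continuous_intros continuous_on_cmul_vec continuous_on_herm 1)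
  then have 2: "continuous_on {B. frame B} (\<lambda>B. unit_vec (gs2 B))"
    by (rule continuous_on_unit_vec) (simp add: frame_gs_nonzero)
  have "continuous_on {B. frame B} (\<lambda>B. gs3 B)"
    unfolding gs3_def by (intro continuous_intros continuous_on_cmul_vec continuous_on_herm 1 2)
  then have 3: "continuous_on {B. frame B} (\<lambda>B. unit_vec (gs3 B))"
    by (rule continuous_on_unit_vec) (simp add: frame_gs_nonzero)
  have "continuous_on {B. frame B} (\<lambda>B. if i = 1 then unit_vec (B $ 1) else if i = 2 then unit_vec (gs2 B) else unit_vec (gs3 B))"
    for i :: 3
  proof (cases "i = 1")
    case True
    then show ?thesis by (simp add: 1)
  next
    case False
    then show ?thesis by (cases "i = 2") (simp_all add: 2 3)
  qed
  then show ?thesis unfolding gs_def by (rule continuous_on_vec_lambda)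
qed

definition plane_frames :: "tensor \<Rightarrow> (complex ^ 7 ^ 3) set" where
  "plane_frames c = {B. frame B \<and> vanishes c B}"

text \<open>The change of basis from \<open>B\<close> to \<open>gs B\<close> is lower triangular with positive diagonal, so it can be joined to the
  identity by a segment of invertible matrices.\<close>

lemma gs_segment:
  assumes B: "frame B"
  obtains T :: "complex ^ 3 ^ 3" where "gs B = T ** B"
    "\<And>s. 0 \<le> s \<Longrightarrow> s \<le> 1 \<Longrightarrow> \<exists>T'. ((1 - s) *\<^sub>R mat 1 + s *\<^sub>R T) ** T' = mat 1"
proof -
  note nz = frame_gs_nonzero[OF B]
  define r1 where "r1 = inverse (norm (B $ 1))"
  define r2 where "r2 = inverse (norm (gs2 B))"
  define r3 where "r3 = inverse (norm (gs3 B))"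
  have pos: "r1 > 0" "r2 > 0" "r3 > 0" using nz by (simp_all add: r1_def r2_def r3_def)
  define h where "h = herm (B $ 2) (unit_vec (B $ 1))"
  define h1 where "h1 = herm (B $ 3) (unit_vec (B $ 1))"
  define h2 where "h2 = herm (B $ 3) (unit_vec (gs2 B))"
  define T :: "complex ^ 3 ^ 3" where "T = (\<chi> i j. if i = 1 then (if j = 1 then r1 else 0)
     else if i = 2 then (if j = 1 then - (r2 * h * r1) else if j = 2 then r2 else 0)
     else (if j = 1 then r3 * (- h1 * r1 + h2 * r2 * h * r1) else if j = 2 then - (r3 * h2 * r2) else r3))"
  have u: "unit_vec (B $ 1) = of_real r1 *s B $ 1" "unit_vec (gs2 B) = of_real r2 *s gs2 B"
    "unit_vec (gs3 B) = of_real r3 *s gs3 B"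
    by (simp_all only: unit_vec_def r1_def r2_def r3_def)
  have "gs2 B = B $ 2 - h *s unit_vec (B $ 1)" by (simp only: gs2_def h_def)
  then have g2: "gs2 B = B $ 2 - (h * r1) *s B $ 1" unfolding u vector_smult_assoc .
  have "gs3 B = B $ 3 - h1 *s unit_vec (B $ 1) - h2 *s unit_vec (gs2 B)" by (simp only: gs3_def h1_def h2_def)
  then have g3: "gs3 B = B $ 3 - (h1 * r1) *s B $ 1 - (h2 * r2) *s gs2 B" unfolding u vector_smult_assoc .
  have g: "gs B $ 1 = of_real r1 *s B $ 1" "gs B $ 2 = of_real r2 *s gs2 B" "gs B $ 3 = of_real r3 *s gs3 B"
    by (simp_all only: gs_nth u)
  have eq: "gs B = T ** B"
    unfolding vec_eq_iff[of "gs B"] forall_3 g g3 g2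
    by (simp add: vec_eq_iff matrix_matrix_mult_def sum_UNIV_3 T_def algebra_simps)
  have "\<exists>T'. ((1 - s) *\<^sub>R mat 1 + s *\<^sub>R T) ** T' = mat 1" if s: "0 \<le> s" "s \<le> 1" for s :: real
  proof -
    let ?M = "(1 - s) *\<^sub>R mat 1 + s *\<^sub>R T"
    have p: "(1 - s) + s * r > 0" if "r > 0" for r :: real
      using s that by (cases "s = 0") (auto intro: add_nonneg_pos)
    have "det ?M = of_real (((1 - s) + s * r1) * ((1 - s) + s * r2) * ((1 - s) + s * r3))"
      unfolding det_3 by (simp add: T_def mat_def scaleR_conv_of_real[where 'a = complex])
    then have "det ?M \<noteq> 0" using p[OF pos(1)] p[OF pos(2)] p[OF pos(3)]
      by (simp only: of_real_eq_0_iff mult_eq_0_iff) auto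
    then show ?thesis by (simp add: invertible_det_nz[symmetric] invertible_right_inverse)
  qed
  with eq show ?thesis by (rule that)
qed

lemma gs_in_component:
  assumes B: "B \<in> plane_frames c"
  shows "connected_component (plane_frames c) B (gs B)"
proof -
  have fr: "frame B" and va: "vanishes c B" using B by (auto simp: plane_frames_def)
  obtain T :: "complex ^ 3 ^ 3" where T: "gs B = T ** B"
    "\<And>s. 0 \<le> s \<Longrightarrow> s \<le> 1 \<Longrightarrow> \<exists>T'. ((1 - s) *\<^sub>R mat 1 + s *\<^sub>R T) ** T' = mat 1"
    by (rule gs_segment[OF fr]) (rule that)
  have "closed_segment B (gs B) \<subseteq> plane_frames c"
  proof
    fix x assume "x \<in> closed_segment B (gs B)"
    then obtain s where s: "0 \<le> s" "s \<le> 1" "x = (1 - s) *\<^sub>R B + s *\<^sub>R gs B" by (auto simp: closed_segment_def)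
    have x: "x = ((1 - s) *\<^sub>R mat 1 + s *\<^sub>R T) ** B"
      unfolding s(3) T(1)
      by (simp add: vec_eq_iff matrix_matrix_mult_def sum_UNIV_3 forall_3 mat_def algebra_simps)
    then show "x \<in> plane_frames c"
      using T(2)[OF s(1,2)] frame_mult[OF fr] vanishes_matrix_mult[OF va] by (auto simp: plane_frames_def)
  qed
  then show ?thesis unfolding connected_component_def
    by (intro exI[of _ "closed_segment B (gs B)"]) auto
qed

section \<open>Components of the planes in a varying cubic\<close>

definition same_component :: "tensor \<Rightarrow> complex ^ 7 ^ 3 \<Rightarrow> complex ^ 7 ^ 3 \<Rightarrow> bool" where
  "same_component c = connected_component (plane_frames c)"

lemma same_component_sym: "same_component c x y \<Longrightarrow> same_component c y x"
  unfolding same_component_def by (rule connected_component_sym)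

lemma same_component_trans: "same_component c x y \<Longrightarrow> same_component c y z \<Longrightarrow> same_component c x z"
  unfolding same_component_def by (rule connected_component_trans)

text \<open>In the local product the fibre over each nearby cubic is the continuous image of a
  convex set, with a neighbourhood that does not depend on the cubic.\<close>

lemma locally_same_component:
  assumes reg: "regular_point c0 B0" and B0: "B0 \<in> plane_frames c0"
  obtains V W where "open V" "c0 \<in> V" "open W" "B0 \<in> W"
    "\<And>c x y. c \<in> V \<Longrightarrow> x \<in> W \<Longrightarrow> y \<in> W \<Longrightarrow> x \<in> plane_frames c \<Longrightarrow> y \<in> plane_frames c \<Longrightarrow> same_component c x y"
proof -
  have van: "vanishes c0 B0" and fr: "frame B0" using B0 by (auto simp: plane_frames_def)
  have N: "open ((UNIV :: tensor set) \<times> {B. frame B})" "(c0, B0) \<in> (UNIV :: tensor set) \<times> {B. frame B}"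
    using open_frame fr by (auto intro: open_Times)
  obtain \<delta> b0 O' h and K :: "(complex ^ 7 ^ 3) set" where d: "\<delta> > 0" "subspace K" and
    O': "open O'" "O' \<subseteq> UNIV \<times> {B. frame B}" "(c0, B0) \<in> O'"
    and h1: "\<And>c b. c \<in> ball c0 \<delta> \<Longrightarrow> b \<in> K \<inter> ball b0 \<delta> \<Longrightarrow> (c, h (c, b)) \<in> O' \<and> vanishes c (h (c, b))"
    and h2: "\<And>c B. (c, B) \<in> O' \<Longrightarrow> vanishes c B \<Longrightarrow> c \<in> ball c0 \<delta> \<and> (\<exists>b\<in>K \<inter> ball b0 \<delta>. B = h (c, b))"
    and cont: "continuous_on (ball c0 \<delta> \<times> ball b0 \<delta>) h"
    by (rule local_product[OF reg van N]) (rule that)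
  obtain V W where VW: "open V" "open W" "c0 \<in> V" "B0 \<in> W" "V \<times> W \<subseteq> O'"
    using O'(1,3) by (rule open_prod_elim) auto
  show ?thesis
  proof (rule that[OF VW(1,3,2,4)])
    fix c x y
    assume a: "c \<in> V" "x \<in> W" "y \<in> W" "x \<in> plane_frames c" "y \<in> plane_frames c"
    have O: "(c, x) \<in> O'" "(c, y) \<in> O'" using a VW(5) by auto
    obtain bx where bx: "c \<in> ball c0 \<delta>" "bx \<in> K \<inter> ball b0 \<delta>" "x = h (c, bx)"
      using h2[OF O(1)] a by (auto simp: plane_frames_def)
    obtain byy where byy: "byy \<in> K \<inter> ball b0 \<delta>" "y = h (c, byy)"
      using h2[OF O(2)] a by (auto simp: plane_frames_def)
    let ?S = "(\<lambda>b. h (c, b)) ` (K \<inter> ball b0 \<delta>)"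
    have "convex (K \<inter> ball b0 \<delta>)" by (intro convex_Int subspace_imp_convex d convex_ball)
    then have "connected (K \<inter> ball b0 \<delta>)" by (rule convex_connected)
    moreover have "continuous_on (K \<inter> ball b0 \<delta>) (\<lambda>b. h (c, b))"
      by (rule continuous_on_compose2[OF cont]) (use bx(1) in \<open>auto intro!: continuous_intros\<close>)
    ultimately have "connected ?S" by (intro connected_continuous_image)
    moreover have "?S \<subseteq> plane_frames c"
    proof
      fix z assume "z \<in> ?S"
      then obtain b where b: "b \<in> K \<inter> ball b0 \<delta>" "z = h (c, b)" by blast
      have "(c, z) \<in> O'" "vanishes c z" using h1[OF bx(1) b(1)] b(2) by auto
      then show "z \<in> plane_frames c" using O'(2) by (auto simp: plane_frames_def)
    qed
    moreover have "x \<in> ?S" "y \<in> ?S" using bx byy by auto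
    ultimately show "same_component c x y"
      unfolding same_component_def connected_component_def by blast
  qed
qed

text \<open>A regular plane survives small changes of the cubic: fix the coordinate
  \<open>b0\<close> in the local product and vary c.\<close>

lemma plane_frames_persist:
  assumes reg: "regular_point c0 B0" and B0: "B0 \<in> plane_frames c0"
    and W: "open W" "B0 \<in> W"
  obtains V where "open V" "c0 \<in> V" "\<And>c. c \<in> V \<Longrightarrow> \<exists>B\<in>W. B \<in> plane_frames c"
proof -
  have van: "vanishes c0 B0" and fr: "frame B0" using B0 by (auto simp: plane_frames_def)
  have N: "open ((UNIV :: tensor set) \<times> ({B. frame B} \<inter> W))" "(c0, B0) \<in> (UNIV :: tensor set) \<times> ({B. frame B} \<inter> W)"
    using open_frame fr W by (auto intro!: open_Times)
  obtain \<delta> b0 O' h and K :: "(complex ^ 7 ^ 3) set" where d: "\<delta> > 0" "b0 \<in> K" and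
    O': "O' \<subseteq> UNIV \<times> ({B. frame B} \<inter> W)"
    and h1: "\<And>c b. c \<in> ball c0 \<delta> \<Longrightarrow> b \<in> K \<inter> ball b0 \<delta> \<Longrightarrow> (c, h (c, b)) \<in> O' \<and> vanishes c (h (c, b))"
    by (rule local_product[OF reg van N]) (rule that)
  show ?thesis
  proof (rule that[of "ball c0 \<delta>"])
    show "open (ball c0 \<delta>)" "c0 \<in> ball c0 \<delta>" using d by auto
    fix c assume "c \<in> ball c0 \<delta>"
    then have "(c, h (c, b0)) \<in> O' \<and> vanishes c (h (c, b0))" using h1 d by simp
    then show "\<exists>B\<in>W. B \<in> plane_frames c" using O' by (auto simp: plane_frames_def)
  qed
qed

text \<open>The property \<open>Q\<close> says that B0 and b stay in one component for all nearby
  data. It is carried along a connected set of plane frames from B0 to B1.\<close>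

lemma same_component_open:
  assumes reg: "\<And>B. B \<in> plane_frames c0 \<Longrightarrow> regular_point c0 B"
    and same: "same_component c0 B0 B1"
  obtains V W0 W1 where "open V" "c0 \<in> V" "open W0" "B0 \<in> W0" "open W1" "B1 \<in> W1"
    "\<And>c x y. c \<in> V \<Longrightarrow> x \<in> W0 \<Longrightarrow> y \<in> W1 \<Longrightarrow> x \<in> plane_frames c \<Longrightarrow> y \<in> plane_frames c \<Longrightarrow> same_component c x y"
proof -
  define Q where "Q = (\<lambda>b. \<exists>V W0 W1. open V \<and> c0 \<in> V \<and> open W0 \<and> B0 \<in> W0 \<and> open W1 \<and> b \<in> W1 \<and>
    (\<forall>c\<in>V. \<forall>x\<in>W0. \<forall>y\<in>W1. x \<in> plane_frames c \<longrightarrow> y \<in> plane_frames c \<longrightarrow> same_component c x y))"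
  obtain C where C: "connected C" "C \<subseteq> plane_frames c0" "B0 \<in> C" "B1 \<in> C"
    using same unfolding same_component_def connected_component_def by blast
  have "Q B1"
  proof (rule connected_induction_simple[OF C(1,3,4)])
    obtain V W where "open V" "c0 \<in> V" "open W" "B0 \<in> W"
      "\<And>c x y. c \<in> V \<Longrightarrow> x \<in> W \<Longrightarrow> y \<in> W \<Longrightarrow> x \<in> plane_frames c \<Longrightarrow> y \<in> plane_frames c \<Longrightarrow> same_component c x y"
      by (rule locally_same_component[OF reg]) (use C in auto)
    then show "Q B0" unfolding Q_def by (intro exI[of _ V] exI[of _ W]) auto
  next
    fix a assume a: "a \<in> C"
    then have a': "a \<in> plane_frames c0" using C by auto
    obtain V W where VW: "open V" "c0 \<in> V" "open W" "a \<in> W"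
      and loc: "\<And>c x y. c \<in> V \<Longrightarrow> x \<in> W \<Longrightarrow> y \<in> W \<Longrightarrow> x \<in> plane_frames c \<Longrightarrow> y \<in> plane_frames c \<Longrightarrow> same_component c x y"
      by (rule locally_same_component[OF reg[OF a'] a']) (rule that)
    have "Q y" if x: "x \<in> W \<inter> C" and y: "y \<in> W \<inter> C" and Qx: "Q x" for x y
    proof -
      obtain V' W0 W1 where Q: "open V'" "c0 \<in> V'" "open W0" "B0 \<in> W0" "open W1" "x \<in> W1"
        "\<forall>c\<in>V'. \<forall>x\<in>W0. \<forall>y\<in>W1. x \<in> plane_frames c \<longrightarrow> y \<in> plane_frames c \<longrightarrow> same_component c x y"
        using Qx unfolding Q_def by (elim exE conjE)
      have x': "x \<in> plane_frames c0" using x C by auto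
      have "open (W \<inter> W1)" "x \<in> W \<inter> W1" using VW Q x by auto
      \<comment> \<open>The neighbourhoods of B0 and of y are linked by a plane frame of c in the
        overlap of W and W1. It exists for c near c0 because x persists.\<close>
      then obtain V2 where V2: "open V2" "c0 \<in> V2" "\<And>c. c \<in> V2 \<Longrightarrow> \<exists>B\<in>W \<inter> W1. B \<in> plane_frames c"
        by (rule plane_frames_persist[OF reg[OF x'] x']) (rule that)
      have 1: "same_component c p q" if c: "c \<in> V \<inter> V' \<inter> V2" and pq: "p \<in> W0" "q \<in> W" "p \<in> plane_frames c" "q \<in> plane_frames c"
        for c p q
      proof -
        obtain z where z: "z \<in> W" "z \<in> W1" "z \<in> plane_frames c" using V2(3)[of c] c by auto
        have "same_component c p z" using Q(7) c pq z by blast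
        moreover have "same_component c z q" using loc[of c z q] c z pq by auto
        ultimately show ?thesis by (rule same_component_trans)
      qed
      show ?thesis unfolding Q_def
      proof (rule exI[of _ "V \<inter> V' \<inter> V2"], rule exI[of _ W0], rule exI[of _ W], intro conjI ballI impI)
        show "open (V \<inter> V' \<inter> V2)" by (intro open_Int VW(1) Q(1) V2(1))
        show "c0 \<in> V \<inter> V' \<inter> V2" by (intro IntI VW(2) Q(2) V2(2))
        show "open W0" by (rule Q(3))
        show "B0 \<in> W0" by (rule Q(4))
        show "open W" by (rule VW(3))
        show "y \<in> W" using y by (rule IntD1)
        fix c p q
        assume "c \<in> V \<inter> V' \<inter> V2" "p \<in> W0" "q \<in> W" "p \<in> plane_frames c" "q \<in> plane_frames c"
        then show "same_component c p q" by (rule 1)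
      qed
    qed
    moreover have "openin (top_of_set C) (W \<inter> C)" using VW(3) by (subst Int_commute) (rule openin_open_Int)
    moreover have "a \<in> W \<inter> C" using VW(4) a by (rule IntI)
    ultimately show "\<exists>T. openin (top_of_set C) T \<and> a \<in> T \<and> (\<forall>x\<in>T. \<forall>y\<in>T. Q x \<longrightarrow> Q y)"
      by (intro exI[of _ "W \<inter> C"] conjI ballI impI)
  qed
  then obtain V W0 W1 where "open V" "c0 \<in> V" "open W0" "B0 \<in> W0" "open W1" "B1 \<in> W1"
    "\<forall>c\<in>V. \<forall>x\<in>W0. \<forall>y\<in>W1. x \<in> plane_frames c \<longrightarrow> y \<in> plane_frames c \<longrightarrow> same_component c x y"
    unfolding Q_def by (elim exE conjE)
  then show ?thesis by (intro that[of V W0 W1]) (assumption | blast)+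
qed

lemma connected_sign_change:
  fixes d :: "'a::topological_space \<Rightarrow> real"
  assumes "connected S" "continuous_on S d" "x \<in> S" "y \<in> S" "d x < 0" "d y > 0"
  obtains z where "z \<in> S" "d z = 0"
proof -
  have "connected (d ` S)" by (rule connected_continuous_image[OF assms(2,1)])
  then have "0 \<in> d ` S"
    by (rule connectedD_interval[of _ "d x" "d y"]) (use assms(3-) in auto)
  then obtain z where "z \<in> S" "0 = d z" by (rule imageE)
  then show ?thesis by (intro that[of z]) simp_all
qed

lemma closed_vanishes: "closed {B. vanishes c B}"
proof -
  have "{B. vanishes c B} = (\<Inter>i. \<Inter>j. \<Inter>k. {B. polar c (B $ i) (B $ j) (B $ k) = 0})"
    by (auto simp: vanishes_def)
  moreover have "closed {B. polar c (B $ i) (B $ j) (B $ k) = 0}" for i j k :: 3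
    by (intro closed_Collect_eq continuous_on_polar continuous_intros)
  ultimately show ?thesis by (auto intro!: closed_INT)
qed

lemma compact_vanishing_persist:
  assumes Z: "compact Z" and none: "\<And>z. z \<in> Z \<Longrightarrow> \<not> vanishes c0 z"
  obtains V where "open V" "c0 \<in> V" "\<And>c z. c \<in> V \<Longrightarrow> z \<in> Z \<Longrightarrow> \<not> vanishes c z"
proof -
  define W where "W = {p :: tensor \<times> (complex ^ 7 ^ 3). equations (fst p) (snd p) \<noteq> 0}"
  have "open W" unfolding W_def equations_def
    by (intro open_Collect_neq continuous_intros continuous_on_polar)
  moreover have "{c0} \<times> Z \<subseteq> W" using none by (auto simp: W_def vanishes_iff)
  ultimately have "\<exists>X0. c0 \<in> X0 \<and> open X0 \<and> X0 \<times> Z \<subseteq> W"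
    by (intro Elementary_Topology.tube_lemma Z)
  then obtain V where "c0 \<in> V" "open V" "V \<times> Z \<subseteq> W" by blast
  then show ?thesis by (intro that[of V]) (auto simp: W_def vanishes_iff)
qed

lemma vanishes_gs: "B \<in> plane_frames c \<Longrightarrow> vanishes c (gs B)"
  using connected_component_in[OF gs_in_component] by (auto simp: plane_frames_def)

lemma openin_component_frames:
  assumes reg: "\<And>B. B \<in> plane_frames c0 \<Longrightarrow> regular_point c0 B"
    and P: "\<And>x y. same_component c0 x y \<Longrightarrow> P x \<Longrightarrow> P y"
  shows "openin (top_of_set (plane_frames c0)) {B \<in> plane_frames c0. P B}"
proof (subst openin_subopen, intro ballI)
  fix B assume B: "B \<in> {B \<in> plane_frames c0. P B}"
  then have B': "B \<in> plane_frames c0" by auto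
  obtain V W where VW: "open V" "c0 \<in> V" "open W" "B \<in> W"
    and loc: "\<And>c x y. c \<in> V \<Longrightarrow> x \<in> W \<Longrightarrow> y \<in> W \<Longrightarrow> x \<in> plane_frames c \<Longrightarrow> y \<in> plane_frames c \<Longrightarrow> same_component c x y"
    by (rule locally_same_component[OF reg[OF B'] B']) (rule that)
  have "plane_frames c0 \<inter> W \<subseteq> {B \<in> plane_frames c0. P B}"
    using P B loc[OF VW(2,4) _ B'] by blast
  then show "\<exists>T. openin (top_of_set (plane_frames c0)) T \<and> B \<in> T \<and> T \<subseteq> {B \<in> plane_frames c0. P B}"
    using VW B' by (intro exI[of _ "plane_frames c0 \<inter> W"]) auto
qed

text \<open>Here properness enters. The orthonormal frames in the component of B0 and those outside
  it are disjoint compact sets, separated by the sign of a continuous function. For c near c0 no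
  plane frame lies on its zero set, so no component crosses from one side to the other.\<close>

lemma not_same_component_open:
  assumes reg: "\<And>B. B \<in> plane_frames c0 \<Longrightarrow> regular_point c0 B"
    and B: "B0 \<in> plane_frames c0" "B1 \<in> plane_frames c0" and nsame: "\<not> same_component c0 B0 B1"
  obtains V W0 W1 where "open V" "c0 \<in> V" "open W0" "B0 \<in> W0" "open W1" "B1 \<in> W1"
    "\<And>c x y. c \<in> V \<Longrightarrow> x \<in> W0 \<Longrightarrow> y \<in> W1 \<Longrightarrow> x \<in> plane_frames c \<Longrightarrow> y \<in> plane_frames c \<Longrightarrow> \<not> same_component c x y"
proof -
  let ?F = "plane_frames c0"
  define A where "A = {B \<in> ?F. same_component c0 B0 B}"
  define A' where "A' = {B \<in> ?F. \<not> same_component c0 B0 B}"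
  have "openin (top_of_set ?F) A" unfolding A_def
    by (rule openin_component_frames[OF reg]) (blast intro: same_component_trans)+
  moreover have "openin (top_of_set ?F) A'" unfolding A'_def
    by (rule openin_component_frames[OF reg]) (blast intro: same_component_trans same_component_sym)+
  moreover have "A = ?F - A'" "A' = ?F - A" by (auto simp: A_def A'_def)
  ultimately have "closedin (top_of_set ?F) A" "closedin (top_of_set ?F) A'"
    by (metis Diff_subset closedin_def topspace_euclidean_subtopology double_diff subset_refl)+
  then obtain T T' where T: "closed T" "A = ?F \<inter> T" "closed T'" "A' = ?F \<inter> T'"
    by (auto simp: closedin_closed)
  have St: "?F \<inter> stiefel = {B. vanishes c0 B} \<inter> stiefel"
    using stiefel_frame by (auto simp: plane_frames_def)
  define K where "K = A \<inter> stiefel"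
  define K' where "K' = A' \<inter> stiefel"
  have KK: "K = stiefel \<inter> ({B. vanishes c0 B} \<inter> T)" "K' = stiefel \<inter> ({B. vanishes c0 B} \<inter> T')"
    using St T by (auto simp: K_def K'_def)
  have cl: "closed K" "closed K'"
    unfolding KK by (intro closed_Int closed_vanishes T compact_imp_closed compact_stiefel)+
  have gsF: "gs B \<in> ?F" "gs B \<in> stiefel" "same_component c0 B (gs B)" if "B \<in> ?F" for B
    using that gs_in_component[OF that] connected_component_in[OF gs_in_component[OF that]] gs_stiefel
    by (auto simp: same_component_def plane_frames_def)
  have g0: "gs B0 \<in> K" using gsF[OF B(1)] by (auto simp: K_def A_def)
  have g1: "gs B1 \<in> K'" using gsF[OF B(2)] nsame
    by (auto simp: K'_def A'_def) (blast intro: same_component_trans same_component_sym)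
  have disj: "K \<inter> K' = {}" by (auto simp: K_def K'_def A_def A'_def)
  \<comment> \<open>Composing with \<open>gs\<close> defines the separating function on all frames,
    not only on orthonormal ones.\<close>
  define d where "d = (\<lambda>B. infdist (gs B) K - infdist (gs B) K')"
  have contd: "continuous_on {B. frame B} d"
    unfolding d_def by (intro continuous_intros continuous_on_gs)
  have neg: "d B < 0" if "gs B \<in> K" for B
  proof -
    have "infdist (gs B) K' > 0" using that disj g1 cl by (intro infdist_pos_not_in_closed) auto
    then show ?thesis using that by (simp add: d_def)
  qed
  have pos: "d B > 0" if "gs B \<in> K'" for B
  proof -
    have "infdist (gs B) K > 0" using that disj g0 cl by (intro infdist_pos_not_in_closed) auto
    then show ?thesis using that by (simp add: d_def)
  qed
  \<comment> \<open>On the compact set Z the equations of c0 do not all vanish, and by the tube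
    lemma this remains true for nearby cubics.\<close>
  define Z where "Z = {z \<in> stiefel. d z = 0}"
  have "continuous_on stiefel d" by (rule continuous_on_subset[OF contd]) (auto simp: stiefel_frame)
  then have "closedin (top_of_set stiefel) {z \<in> stiefel. d z = 0}"
    by (rule continuous_closedin_preimage_constant)
  then have "compact Z" unfolding Z_def by (rule closedin_compact[OF compact_stiefel])
  moreover have "\<not> vanishes c0 z" if "z \<in> Z" for z
  proof
    assume "vanishes c0 z"
    then have "z \<in> K \<union> K'" using that stiefel_frame
      by (auto simp: Z_def K_def K'_def A_def A'_def plane_frames_def)
    then have "d z \<noteq> 0" using neg[of z] pos[of z] that by (auto simp: Z_def gs_fixes_stiefel)
    then show False using that by (simp add: Z_def)
  qed
  ultimately obtain V where V: "open V" "c0 \<in> V" "\<And>c z. c \<in> V \<Longrightarrow> z \<in> Z \<Longrightarrow> \<not> vanishes c z"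
    by (rule compact_vanishing_persist) (assumption, rule that)
  define W0 where "W0 = {B \<in> {B. frame B}. d B \<in> {..<0}}"
  define W1 where "W1 = {B \<in> {B. frame B}. d B \<in> {0<..}}"
  have op: "open W0" "open W1"
    using continuous_open_preimage[OF contd open_frame, of "{..<0}"] continuous_open_preimage[OF contd open_frame, of "{0<..}"]
    by (auto simp: W0_def W1_def vimage_def Int_def)
  have "B0 \<in> W0" "B1 \<in> W1" using neg[OF g0] pos[OF g1] B by (auto simp: W0_def W1_def plane_frames_def)
  moreover have "\<not> same_component c x y"
    if c: "c \<in> V" and xy: "x \<in> W0" "y \<in> W1" "x \<in> plane_frames c" "y \<in> plane_frames c" for c x y
  proof
    assume "same_component c x y"
    then obtain C where C: "connected C" "C \<subseteq> plane_frames c" "x \<in> C" "y \<in> C"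
      unfolding same_component_def connected_component_def by blast
    have "continuous_on C d" by (rule continuous_on_subset[OF contd]) (use C in \<open>auto simp: plane_frames_def\<close>)
    then obtain z where z: "z \<in> C" "d z = 0"
      using connected_sign_change[OF C(1) _ C(3,4)] xy by (auto simp: W0_def W1_def)
    have z': "z \<in> plane_frames c" using z C by auto
    then have gz: "gs z \<in> stiefel" by (auto simp: plane_frames_def gs_stiefel)
    then have "d (gs z) = 0" using z(2) by (simp add: d_def gs_fixes_stiefel)
    then have "gs z \<in> Z" using gz by (simp add: Z_def)
    then show False using V(3)[OF c] vanishes_gs[OF z'] by blast
  qed
  ultimately show ?thesis by (intro that[OF V(1,2) op(1) _ op(2)])
qed

lemma plane_frames_connected_if:
  fixes U :: "tensor set"
  defines "E \<equiv> {(c, x, y). c \<in> U \<and> x \<in> plane_frames c \<and> y \<in> plane_frames c}"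
  assumes reg: "\<And>c B. c \<in> U \<Longrightarrow> B \<in> plane_frames c \<Longrightarrow> regular_point c B"
    and conn: "connected E" and c: "c \<in> U"
  shows "connected (plane_frames c)"
proof (cases "plane_frames c = {}")
  case False
  then obtain B where B: "B \<in> plane_frames c" by blast
  let ?P = "\<lambda>p. same_component (fst p) (fst (snd p)) (snd (snd p))"
  have "same_component c x y" if xy: "x \<in> plane_frames c" "y \<in> plane_frames c" for x y
  proof -
    have mem: "(c, B, B) \<in> E" "(c, x, y) \<in> E" using c B xy by (auto simp: E_def)
    \<comment> \<open>A diagonal triple, where the locally constant relation is known to
      hold.\<close>
    have start: "?P (c, B, B)" using B by (simp add: same_component_def)
    have "?P (c, x, y)"
    proof (rule connected_induction_simple[where P = ?P, OF conn mem start])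
      fix p assume p: "p \<in> E"
      obtain c0 B0 B1 where p_eq: "p = (c0, B0, B1)" by (cases p)
      have m: "c0 \<in> U" "B0 \<in> plane_frames c0" "B1 \<in> plane_frames c0" using p by (auto simp: E_def p_eq)
      note reg0 = reg[OF m(1)]
      show "\<exists>T. openin (top_of_set E) T \<and> p \<in> T \<and> (\<forall>x\<in>T. \<forall>y\<in>T. ?P x \<longrightarrow> ?P y)"
      proof (cases "same_component c0 B0 B1")
        case True
        obtain V W0 W1 where V: "open V" "c0 \<in> V" "open W0" "B0 \<in> W0" "open W1" "B1 \<in> W1"
          and s: "\<And>c x y. c \<in> V \<Longrightarrow> x \<in> W0 \<Longrightarrow> y \<in> W1 \<Longrightarrow> x \<in> plane_frames c \<Longrightarrow> y \<in> plane_frames c \<Longrightarrow> same_component c x y"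
          by (rule same_component_open[OF reg0 True]) (assumption, rule that)
        have "open (V \<times> W0 \<times> W1)" using V by (intro open_Times)
        moreover have "\<forall>q\<in>E \<inter> (V \<times> W0 \<times> W1). ?P q" using s by (auto simp: E_def)
        ultimately show ?thesis using p V
          by (intro exI[of _ "E \<inter> (V \<times> W0 \<times> W1)"]) (auto simp: p_eq)
      next
        case False
        obtain V W0 W1 where V: "open V" "c0 \<in> V" "open W0" "B0 \<in> W0" "open W1" "B1 \<in> W1"
          and s: "\<And>c x y. c \<in> V \<Longrightarrow> x \<in> W0 \<Longrightarrow> y \<in> W1 \<Longrightarrow> x \<in> plane_frames c \<Longrightarrow> y \<in> plane_frames c \<Longrightarrow> \<not> same_component c x y"
          by (rule not_same_component_open[OF reg0 m(2,3) False]) (assumption, rule that)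
        have "open (V \<times> W0 \<times> W1)" using V by (intro open_Times)
        moreover have "\<forall>q\<in>E \<inter> (V \<times> W0 \<times> W1). \<not> ?P q" using s by (auto simp: E_def)
        ultimately show ?thesis using p V
          by (intro exI[of _ "E \<inter> (V \<times> W0 \<times> W1)"]) (auto simp: p_eq)
      qed
    qed
    then show ?thesis by simp
  qed
  then show ?thesis unfolding connected_iff_connected_component same_component_def by blast
qed simp

section \<open>Separating two planes of a cubic\<close>

definition fspan :: "complex ^ 7 ^ 3 \<Rightarrow> (complex ^ 7) set" where
  "fspan B = range (\<lambda>t :: 3 \<Rightarrow> complex. \<Sum>i\<in>UNIV. t i *s B $ i)"

lemma fspanI: "(\<Sum>i\<in>UNIV. t i *s B $ i) \<in> fspan B"
  unfolding fspan_def by (rule rangeI)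

lemma fspan_nth: "B $ i \<in> fspan B"
proof -
  have "(\<Sum>j\<in>UNIV. (if j = i then 1 else 0) *s B $ j) = (\<Sum>j\<in>UNIV. if j = i then B $ j else 0)"
    by (intro sum.cong refl) auto
  then have "B $ i = (\<Sum>j\<in>UNIV. (if j = i then 1 else 0) *s B $ j)" by simp
  then show ?thesis using fspanI[of "\<lambda>j. if j = i then 1 else 0" B] by simp
qed

lemma subspace_fspan: "vec.subspace (fspan B)"
proof (rule vec.subspaceI)
  show "0 \<in> fspan B" using fspanI[of "\<lambda>_. 0" B] by simp
next
  fix x y assume "x \<in> fspan B" "y \<in> fspan B"
  then obtain t u where "x = (\<Sum>i\<in>UNIV. t i *s B $ i)" "y = (\<Sum>i\<in>UNIV. u i *s B $ i)"
    by (auto simp: fspan_def)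
  then have "x + y = (\<Sum>i\<in>UNIV. (t i + u i) *s B $ i)"
    by (simp add: vec.scale_left_distrib sum.distrib)
  then show "x + y \<in> fspan B" by (simp only: fspanI)
next
  fix r x assume "x \<in> fspan B"
  then obtain t where "x = (\<Sum>i\<in>UNIV. t i *s B $ i)" by (auto simp: fspan_def)
  then have "r *s x = (\<Sum>i\<in>UNIV. (r * t i) *s B $ i)" by (simp add: vec.scale_sum_right)
  then show "r *s x \<in> fspan B" by (simp only: fspanI)
qed

lemma span_frame: "vec.span (range (($) B)) = fspan B"
proof
  show "vec.span (range (($) B)) \<subseteq> fspan B"
    by (rule vec.span_minimal) (use fspan_nth subspace_fspan in auto)
  show "fspan B \<subseteq> vec.span (range (($) B))"
    unfolding fspan_def by (rule image_subsetI) (intro vec.span_sum vec.span_scale vec.span_base rangeI)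
qed

lemma dim_fspan:
  assumes "frame B"
  shows "vec.dim (fspan B) = 3"
proof -
  have inj: "inj (($) B)"
  proof (rule injI, rule ccontr)
    fix i j assume eq: "B $ i = B $ j" and ne: "i \<noteq> j"
    let ?t = "\<lambda>k. if k = i then 1 else if k = j then - 1 else (0 :: complex)"
    have "(\<Sum>k\<in>UNIV. ?t k *s B $ k) = (\<Sum>k\<in>UNIV. (if k = i then B $ i else 0) - (if k = j then B $ j else 0))"
      using ne by (intro sum.cong refl) (auto simp: vec_eq_iff)
    also have "\<dots> = 0" by (simp add: sum_subtractf eq)
    finally have "\<forall>k. ?t k = 0" using assms[unfolded frame_def, THEN spec, of ?t] by (rule rev_mp)
    then have "?t i = 0" by (rule spec)
    then show False by simp
  qed
  have "vec.independent (range (($) B))"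
  proof (rule ccontr)
    assume "\<not> ?thesis"
    then obtain u where u: "\<exists>v\<in>range (($) B). u v \<noteq> 0" "(\<Sum>v\<in>range (($) B). u v *s v) = 0"
      by (auto simp: vec.dependent_finite)
    have "(\<Sum>i\<in>UNIV. u (B $ i) *s B $ i) = 0" using u(2) by (simp add: sum.reindex[OF inj])
    then have "\<forall>i. u (B $ i) = 0" using assms[unfolded frame_def, THEN spec, of "\<lambda>i. u (B $ i)"] by (rule rev_mp)
    then show False using u(1) by auto
  qed
  then have "vec.dim (range (($) B)) = card (range (($) B))" by (rule vec.dim_eq_card_independent)
  also have "\<dots> = 3" using inj by (simp add: card_image)
  finally show ?thesis by (metis span_frame vec.dim_span)
qed

lemma polar_fspan:
  assumes "vanishes c B" "x \<in> fspan B" "y \<in> fspan B" "z \<in> fspan B"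
  shows "polar c x y z = 0"
  using assms by (auto simp: fspan_def vanishes_def polar_sum3 polar_scale)

lemma vanishes_if_cubic:
  assumes "\<And>w. w \<in> fspan B \<Longrightarrow> polar c w w w = 0"
  shows "vanishes c B"
  unfolding vanishes_def
proof (intro allI)
  fix i j k
  show "polar c (B $ i) (B $ j) (B $ k) = 0"
    by (rule polar_eq_0_from_cubic)
      (intro assms vec.subspace_add[OF subspace_fspan] vec.subspace_scale[OF subspace_fspan] fspan_nth)
qed

text \<open>A basis of C^7 made of R for the intersection W of B with that of B', K completing R to
  the span of B', vectors completing R to the span of B, and N outside both. The sum of the two
  spans has dimension 6 - r, so N has 7 - (6 - r) = r + 1 elements. \<open>\<rho>\<close> is the
  family of coordinate functionals.\<close>

lemma adapted_coordinates:
  assumes B: "frame B" and B': "frame B'" and r: "vec.dim (fspan B \<inter> fspan B') = r"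
  obtains R K N :: "(complex ^ 7) set" and \<rho> where
    "finite R" "finite K" "finite N" "R \<inter> K = {}" "R \<inter> N = {}" "K \<inter> N = {}" "card R = r" "card N = Suc r"
    "R \<subseteq> fspan B \<inter> fspan B'" "K \<subseteq> fspan B'"
    "\<And>b x y. \<rho> b (x + y) = \<rho> b x + \<rho> b y" "\<And>b s x. \<rho> b (s *s x) = s * \<rho> b x"
    "\<And>b b'. b' \<in> R \<union> K \<union> N \<Longrightarrow> \<rho> b b' = (if b = b' then 1 else 0)"
    "\<And>x. x \<in> fspan B' \<Longrightarrow> x = (\<Sum>b\<in>R. \<rho> b x *s b) + (\<Sum>b\<in>K. \<rho> b x *s b)"
    "\<And>x b. x \<in> fspan B' \<Longrightarrow> b \<in> N \<Longrightarrow> \<rho> b x = 0"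
    "\<And>x b. x \<in> fspan B \<Longrightarrow> b \<in> K \<union> N \<Longrightarrow> \<rho> b x = 0"
proof -
  let ?W = "fspan B" and ?W' = "fspan B'"
  have subR: "vec.subspace (?W \<inter> ?W')" by (intro vec.subspace_inter subspace_fspan)
  obtain R where R: "R \<subseteq> ?W \<inter> ?W'" "vec.independent R" "?W \<inter> ?W' \<subseteq> vec.span R" "card R = r"
    using vec.basis_exists[of "?W \<inter> ?W'"] unfolding r by metis
  obtain C' where C': "R \<subseteq> C'" "C' \<subseteq> ?W'" "vec.independent C'" "?W' \<subseteq> vec.span C'"
    using vec.maximal_independent_subset_extend[of R ?W'] R by auto
  obtain C where C: "R \<subseteq> C" "C \<subseteq> ?W" "vec.independent C" "?W \<subseteq> vec.span C"
    using vec.maximal_independent_subset_extend[of R ?W] R by auto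
  have spanC: "vec.span C = ?W" "vec.span C' = ?W'"
    using C(4) C'(4) vec.span_minimal[OF C(2) subspace_fspan] vec.span_minimal[OF C'(2) subspace_fspan] by auto
  have fin: "finite C" "finite C'" using C(3) C'(3) by (auto intro: vec.finiteI_independent)
  have cards: "card C = 3" "card C' = 3"
    using vec.dim_eq_card_independent[OF C(3)] vec.dim_eq_card_independent[OF C'(3)] dim_fspan[OF B] dim_fspan[OF B']
      vec.dim_span[of C] vec.dim_span[of C'] by (simp_all add: spanC)
  have finR: "finite R" using C(1) fin by (auto intro: finite_subset)
  let ?S = "{x + y | x y. x \<in> ?W \<and> y \<in> ?W'}"
  have dimS: "vec.dim ?S + r = 6"
    using vec.dim_sums_Int[OF subspace_fspan subspace_fspan, of B B'] dim_fspan[OF B] dim_fspan[OF B'] r by simp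
  have spanU: "vec.span (C \<union> C') = ?S" unfolding vec.span_Un spanC ..
  \<comment> \<open>C and C' together span a space of dimension 6 - r. They overlap at least in R,
    so they have at most 6 - r elements and must be independent.\<close>
  have "card (C \<union> C') + card (C \<inter> C') = 6" using card_Un_Int[OF fin] cards by simp
  moreover have "card R \<le> card (C \<inter> C')" using C(1) C'(1) fin by (intro card_mono) auto
  moreover have "vec.dim (C \<union> C') + r = 6" using dimS spanU vec.dim_span[of "C \<union> C'"] by simp
  ultimately have "card (C \<union> C') \<le> vec.dim (C \<union> C')" using R(4) by linarith
  then have ind: "vec.independent (C \<union> C')"
    using fin by (intro vec.card_le_dim_spanning[of "C \<union> C'" "C \<union> C'"]) (auto intro: vec.span_base)
  have cardU: "card (C \<union> C') + r = 6"
    using vec.dim_eq_card_independent[OF ind] dimS spanU vec.dim_span[of "C \<union> C'"] by simp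
  then have "card (C \<inter> C') = r" using \<open>card (C \<union> C') + card (C \<inter> C') = 6\<close> by simp
  then have RCC: "C \<inter> C' = R" using C(1) C'(1) fin R(4) by (intro card_subset_eq[symmetric]) auto
  obtain A where A: "C \<union> C' \<subseteq> A" "vec.independent A" "UNIV \<subseteq> vec.span A"
    using vec.maximal_independent_subset_extend[of "C \<union> C'" UNIV] ind by auto
  have finA: "finite A" using A(2) by (rule vec.finiteI_independent)
  have spanA: "vec.span A = UNIV" using A(3) by auto
  have "vec.dim A = vec.dim (UNIV :: (complex ^ 7) set)" using spanA by (metis vec.dim_span)
  then have cardA: "card A = 7" using vec.dim_eq_card_independent[OF A(2)] by (simp only: vec_dim_card) simp
  define N where "N = A - (C \<union> C')"
  define K where "K = C' - C"
  define \<rho> where "\<rho> = (\<lambda>b x. vec.representation A x b)"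
  have "card N = card A - card (C \<union> C')" unfolding N_def using fin A(1) by (intro card_Diff_subset) auto
  then have cardN: "card N = Suc r" using cardA cardU by simp
  have rep: "vec.representation A x = vec.representation C' x" if "x \<in> ?W'" for x
    by (rule vec.representation_extend[OF A(2)]) (use that A(1) in \<open>auto simp: spanC\<close>)
  have rep2: "vec.representation A x = vec.representation C x" if "x \<in> ?W" for x
    by (rule vec.representation_extend[OF A(2)]) (use that A(1) in \<open>auto simp: spanC\<close>)
  show ?thesis
  proof (rule that[of R K N \<rho>])
    show "finite R" "finite K" "finite N" using finR fin finA by (auto simp: K_def N_def)
    show "R \<inter> K = {}" "R \<inter> N = {}" "K \<inter> N = {}" using C C' by (auto simp: K_def N_def)
    show "card R = r" "card N = Suc r" by (rule R(4) cardN)+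
    show "R \<subseteq> ?W \<inter> ?W'" by (rule R(1))
    show "K \<subseteq> ?W'" using C' by (auto simp: K_def)
    show "\<rho> b (x + y) = \<rho> b x + \<rho> b y" for b x y
      by (simp add: \<rho>_def vec.representation_add[OF A(2)] spanA)
    show "\<rho> b (s *s x) = s * \<rho> b x" for b s x
      by (simp add: \<rho>_def vec.representation_scale[OF A(2)] spanA)
    show "\<rho> b b' = (if b = b' then 1 else 0)" if "b' \<in> R \<union> K \<union> N" for b b'
    proof -
      have "b' \<in> A" using that A(1) C(1) by (auto simp: K_def N_def)
      then show ?thesis by (simp add: \<rho>_def vec.representation_basis[OF A(2)])
    qed
    show "x = (\<Sum>b\<in>R. \<rho> b x *s b) + (\<Sum>b\<in>K. \<rho> b x *s b)" if "x \<in> ?W'" for x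
    proof -
      have "(\<Sum>b\<in>C'. \<rho> b x *s b) = x"
        unfolding \<rho>_def rep[OF that]
        by (rule vec.sum_representation_eq[OF C'(3) _ fin(2)]) (use that in \<open>auto simp: spanC\<close>)
      moreover have CRK: "C' = R \<union> K" "R \<inter> K = {}" using C'(1) RCC C(1) by (auto simp: K_def)
      moreover have "finite K" using fin(2) by (simp add: K_def)
      ultimately show ?thesis using sum.union_disjoint[OF finR \<open>finite K\<close> CRK(2), of "\<lambda>b. \<rho> b x *s b"] by simp
    qed
    show "\<rho> b x = 0" if "x \<in> ?W'" "b \<in> N" for x b
      using vec.representation_ne_zero[of C' x b] that by (auto simp: \<rho>_def rep N_def)
    show "\<rho> b x = 0" if "x \<in> ?W" "b \<in> K \<union> N" for x b
      using vec.representation_ne_zero[of C x b] that by (auto simp: \<rho>_def rep2 N_def K_def)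
  qed
qed

text \<open>A nonzero homomorphism from \<open>R\<close> to the \<open>(r + 1)\<close>-dimensional complement of \<open>W + W'\<close> with \<open>F(x, x, \<phi> x) = 0\<close> exists
  because \<open>r (r + 1)\<close> exceeds the dimension of the ternary cubics on \<open>R\<close>, for \<open>r = 1, 2, 3\<close>.\<close>

lemma triple_representatives:
  assumes "finite R" "card R = r" "1 \<le> r" "r \<le> 3"
  obtains L :: "('v \<times> 'v \<times> 'v) set" where "finite L" "card L < r * Suc r"
    "\<And>i j k. i \<in> R \<Longrightarrow> j \<in> R \<Longrightarrow> k \<in> R \<Longrightarrow> (i, j, k) \<in> L \<or> (i, k, j) \<in> L \<or> (j, i, k) \<in> L \<or> (j, k, i) \<in> L \<or> (k, i, j) \<in> L \<or> (k, j, i) \<in> L"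
proof -
  consider "r = 1" | "r = 2" | "r = 3" using assms by linarith
  then show ?thesis
  proof cases
    case 1
    then obtain a where R: "R = {a}" using assms(2) card_1_singletonE by blast
    show ?thesis by (rule that[of "{(a, a, a)}"]) (auto simp: R 1)
  next
    case 2
    then obtain a b where R: "R = {a, b}" using assms(2) card_2_iff by metis
    have "card {(a, a, a), (a, a, b), (a, b, b), (b, b, b)} \<le> 4" by (simp add: card_insert_if)
    then show ?thesis
    proof (intro that[of "{(a, a, a), (a, a, b), (a, b, b), (b, b, b)}"], goal_cases)
      case (3 i j k)
      then show ?case unfolding R by (elim insertE emptyE) simp_all
    qed (simp_all add: 2)
  next
    case 3
    then obtain a b d where R: "R = {a, b, d}" using assms(2) card_3_iff by metis
    let ?L = "{(a, a, a), (a, a, b), (a, a, d), (a, b, b), (a, b, d), (a, d, d), (b, b, b), (b, b, d), (b, d, d), (d, d, d)}"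
    have "card ?L \<le> 10" by (simp add: card_insert_if)
    then show ?thesis
    proof (intro that[of ?L], goal_cases)
      case (3 i j k)
      then show ?case unfolding R by (elim insertE emptyE) simp_all
    qed (simp_all add: 3)
  qed
qed

lemma tangent_direction_exists:
  assumes fin: "finite R" "finite N" and card: "card R = r" "card N = Suc r" "1 \<le> r" "r \<le> 3"
  obtains X where "\<exists>i\<in>R. \<exists>n\<in>N. X i n \<noteq> 0"
    "\<And>i j k. i \<in> R \<Longrightarrow> j \<in> R \<Longrightarrow> k \<in> R \<Longrightarrow>
       polar c i j (\<Sum>n\<in>N. X k n *s n) + polar c i k (\<Sum>n\<in>N. X j n *s n) + polar c j k (\<Sum>n\<in>N. X i n *s n) = 0"
proof -
  obtain L where L: "finite L" "card L < r * Suc r"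
    and cov: "\<And>i j k. i \<in> R \<Longrightarrow> j \<in> R \<Longrightarrow> k \<in> R \<Longrightarrow> (i, j, k) \<in> L \<or> (i, k, j) \<in> L \<or> (j, i, k) \<in> L \<or> (j, k, i) \<in> L \<or> (k, i, j) \<in> L \<or> (k, j, i) \<in> L"
    by (rule triple_representatives[OF fin(1) card(1,3,4)]) (rule that)
  have "card (R \<times> N) = r * Suc r" by (simp add: card_cartesian_product card)
  then have "card L < card (R \<times> N)" using L(2) by simp
  \<comment> \<open>The unknowns are the entries of the homomorphism from R to N, and there is one
    polarised equation per unordered triple from R.\<close>
  then obtain x where x: "\<exists>p\<in>R \<times> N. x p \<noteq> 0"
    "\<forall>l\<in>L. (\<Sum>p\<in>R \<times> N. (case l of (i, j, k) \<Rightarrow> case p of (q, n) \<Rightarrow>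
       (if q = k then polar c i j n else 0) + (if q = j then polar c i k n else 0) + (if q = i then polar c j k n else 0)) * x p) = 0"
    using homogeneous_system[of L "R \<times> N" "\<lambda>l p. case l of (i, j, k) \<Rightarrow> case p of (q, n) \<Rightarrow>
       (if q = k then polar c i j n else 0) + (if q = j then polar c i k n else 0) + (if q = i then polar c j k n else 0)"]
      L(1) fin by auto
  define X where "X = (\<lambda>i n. x (i, n))"
  define S where "S = (\<lambda>i j k. polar c i j (\<Sum>n\<in>N. X k n *s n) + polar c i k (\<Sum>n\<in>N. X j n *s n) + polar c j k (\<Sum>n\<in>N. X i n *s n))"
  have one: "(\<Sum>p\<in>R \<times> N. (case p of (q, n) \<Rightarrow> if q = k then polar c i j n else 0) * x p) = polar c i j (\<Sum>n\<in>N. X k n *s n)"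
    if "k \<in> R" for i j k
  proof -
    have "(\<Sum>p\<in>R \<times> N. (case p of (q, n) \<Rightarrow> if q = k then polar c i j n else 0) * x p) =
        (\<Sum>q\<in>R. \<Sum>n\<in>N. (if q = k then polar c i j n else 0) * x (q, n))"
      by (simp add: sum.cartesian_product case_prod_unfold)
    also have "\<dots> = (\<Sum>q\<in>R. if q = k then (\<Sum>n\<in>N. polar c i j n * x (q, n)) else 0)"
      by (intro sum.cong refl) auto
    also have "\<dots> = (\<Sum>n\<in>N. polar c i j n * x (k, n))" using that fin by simp
    finally show ?thesis by (simp add: polar_sum polar_scale X_def mult.commute)
  qed
  have SL: "S i j k = 0" if "(i, j, k) \<in> L" "i \<in> R" "j \<in> R" "k \<in> R" for i j k
  proof -
    have "(\<Sum>p\<in>R \<times> N. ((case p of (q, n) \<Rightarrow> if q = k then polar c i j n else 0) * x p +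
       (case p of (q, n) \<Rightarrow> if q = j then polar c i k n else 0) * x p) +
       (case p of (q, n) \<Rightarrow> if q = i then polar c j k n else 0) * x p) = 0"
      using x(2)[rule_format, OF that(1), unfolded prod.case] by (simp add: case_prod_unfold distrib_right cong: if_cong)
    then show ?thesis unfolding sum.distrib one[OF that(4)] one[OF that(3)] one[OF that(2)] S_def .
  qed
  have Ssym: "S i j k = S j i k" "S i j k = S i k j" for i j k
    using polar_commute(1)[of c] by (simp_all add: S_def algebra_simps)
  have "S i j k = 0" if "i \<in> R" "j \<in> R" "k \<in> R" for i j k
    using cov[OF that]
  proof (elim disjE)
    assume "(i, j, k) \<in> L" then show ?thesis using SL that by blast
  next
    assume "(i, k, j) \<in> L" then show ?thesis using SL that Ssym(2)[of i j k] by simp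
  next
    assume "(j, i, k) \<in> L" then show ?thesis using SL that Ssym(1)[of i j k] by simp
  next
    assume "(j, k, i) \<in> L" then show ?thesis using SL that Ssym(1)[of i j k] Ssym(2)[of j i k] by simp
  next
    assume "(k, i, j) \<in> L" then show ?thesis using SL that Ssym(2)[of i j k] Ssym(1)[of i k j] by simp
  next
    assume "(k, j, i) \<in> L" then show ?thesis using SL that Ssym(2)[of i j k] Ssym(1)[of i k j] Ssym(2)[of k i j] by simp
  qed
  then show ?thesis using x(1) by (intro that[of X]) (auto simp: S_def X_def)
qed

section \<open>Deforming a cubic together with one of its planes\<close>

definition clinear :: "(complex ^ 7 \<Rightarrow> complex ^ 7) \<Rightarrow> bool" where
  "clinear f \<longleftrightarrow> (\<forall>x y. f (x + y) = f x + f y) \<and> (\<forall>s x. f (s *s x) = s *s f x)"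

lemma clinear_sum:
  assumes "clinear f"
  shows "f (sum X A) = (\<Sum>i\<in>A. f (X i))"
proof -
  have "f 0 = 0" using assms unfolding clinear_def by (metis vec.scale_zero_left)
  then show ?thesis using assms by (induction A rule: infinite_finite_induct) (auto simp: clinear_def)
qed

lemma clinear_axis:
  assumes "clinear f"
  shows "f x = (\<Sum>a\<in>UNIV. x $ a *s f (axis a 1))"
proof -
  have "f x = f (\<Sum>a\<in>UNIV. x $ a *s axis a 1)" using vec7_expansion[of x] by simp
  also have "\<dots> = (\<Sum>a\<in>UNIV. x $ a *s f (axis a 1))"
    unfolding clinear_sum[OF assms] using assms by (simp add: clinear_def)
  finally show ?thesis .
qed

text \<open>Not symmetrised, since only the cubic form matters: on the diagonal its polar form is
  F(f x, g x, h x).\<close>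

definition pull3 :: "tensor \<Rightarrow> (complex ^ 7 \<Rightarrow> complex ^ 7) \<Rightarrow> (complex ^ 7 \<Rightarrow> complex ^ 7) \<Rightarrow> (complex ^ 7 \<Rightarrow> complex ^ 7) \<Rightarrow> tensor" where
  "pull3 c f g h = (\<chi> a b d. polar c (f (axis a 1)) (g (axis b 1)) (h (axis d 1)))"

lemma polar_pull3_same:
  assumes "clinear f" "clinear g" "clinear h"
  shows "polar (pull3 c f g h) x x x = polar c (f x) (g x) (h x)"
  unfolding polar_same clinear_axis[OF assms(1), of x] clinear_axis[OF assms(2), of x] clinear_axis[OF assms(3), of x]
    polar_sum3 polar_scale
  by (simp add: tri_def pull3_def mult_ac)

lemma polar_tensor_diff: "polar (c - c') x y z = polar c x y z - polar c' x y z"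
  using polar_add(4)[of "c - c'" c' x y z] by simp

text \<open>W' is tilted by the graph map 1 + t \<Psi>, where \<Psi> sends the intersection into a
  complement of W + W'. This shrinks the intersection to the part that \<Psi> kills. The cubic is
  corrected by terms that restore its vanishing on W and on the tilted plane and that tend to 0 with
  t; such a correction exists because F(x, x, \<Psi> x) = 0 on the intersection.\<close>

lemma pair_perturb:
  assumes B: "frame B" "vanishes c B" and B': "frame B'" "vanishes c B'"
    and r: "vec.dim (fspan B \<inter> fspan B') = r" "r \<ge> 1" and N: "open N" "(c, B') \<in> N"
  obtains c' B'' where "(c', B'') \<in> N" "vanishes c' B" "vanishes c' B''" "frame B''"
    "vec.dim (fspan B \<inter> fspan B'') < r"
proof -
  let ?W = "fspan B" and ?W' = "fspan B'"
  have "vec.dim (?W \<inter> ?W') \<le> vec.dim ?W" by (rule vec.dim_subset) simp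
  then have r3: "r \<le> 3" using dim_fspan[OF B(1)] r by simp
  obtain R K M :: "(complex ^ 7) set" and \<rho> where
    fin: "finite R" "finite K" "finite M" and disj: "R \<inter> K = {}" "R \<inter> M = {}" "K \<inter> M = {}"
    and card: "card R = r" "card M = Suc r" and sub: "R \<subseteq> ?W \<inter> ?W'" "K \<subseteq> ?W'"
    and radd: "\<And>b x y. \<rho> b (x + y) = \<rho> b x + \<rho> b y" and rscale: "\<And>b s x. \<rho> b (s *s x) = s * \<rho> b x"
    and rdelta: "\<And>b b'. b' \<in> R \<union> K \<union> M \<Longrightarrow> \<rho> b b' = (if b = b' then 1 else 0)"
    and W'exp: "\<And>x. x \<in> ?W' \<Longrightarrow> x = (\<Sum>b\<in>R. \<rho> b x *s b) + (\<Sum>b\<in>K. \<rho> b x *s b)"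
    and W'0: "\<And>x b. x \<in> ?W' \<Longrightarrow> b \<in> M \<Longrightarrow> \<rho> b x = 0"
    and W0: "\<And>x b. x \<in> ?W \<Longrightarrow> b \<in> K \<union> M \<Longrightarrow> \<rho> b x = 0"
    by (rule adapted_coordinates[OF B(1) B'(1) r(1)]) (rule that)
  obtain X where Xnz: "\<exists>i\<in>R. \<exists>n\<in>M. X i n \<noteq> 0"
    and X: "\<And>i j k. i \<in> R \<Longrightarrow> j \<in> R \<Longrightarrow> k \<in> R \<Longrightarrow>
       polar c i j (\<Sum>n\<in>M. X k n *s n) + polar c i k (\<Sum>n\<in>M. X j n *s n) + polar c j k (\<Sum>n\<in>M. X i n *s n) = 0"
    by (rule tangent_direction_exists[OF fin(1,3) card r(2) r3]) (rule that)
  have r0: "\<rho> b 0 = 0" for b using rscale[of b 0 0] by simp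
  have rsum: "\<rho> b (sum Z A) = (\<Sum>i\<in>A. \<rho> b (Z i))" for b Z and A :: "(complex ^ 7) set"
    by (induction A rule: infinite_finite_induct) (auto simp: radd r0)
  define \<phi> where "\<phi> = (\<lambda>i. \<Sum>n\<in>M. X i n *s n)"
  define pR where "pR = (\<lambda>x. \<Sum>b\<in>R. \<rho> b x *s b)"
  define pK where "pK = (\<lambda>x. \<Sum>b\<in>K. \<rho> b x *s b)"
  define pM where "pM = (\<lambda>x. \<Sum>b\<in>M. \<rho> b x *s b)"
  define \<Psi> where "\<Psi> = (\<lambda>x. \<Sum>b\<in>R. \<rho> b x *s \<phi> b)"
  have lin: "clinear pR" "clinear pK" "clinear pM" "clinear \<Psi>"
    unfolding clinear_def pR_def pK_def pM_def \<Psi>_def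
    by (simp_all add: radd rscale vec.scale_left_distrib sum.distrib vec.scale_sum_right)
  have rM: "\<rho> b (\<phi> i) = 0" if "b \<in> R \<union> K" for b i
    unfolding \<phi>_def rsum rscale using that disj by (intro sum.neutral ballI) (auto simp: rdelta)
  have rPsi: "\<rho> b (\<Psi> x) = 0" if "b \<in> R \<union> K" for b x
    unfolding \<Psi>_def rsum rscale using rM[OF that] by simp
  have rM': "\<rho> n (\<phi> i) = X i n" if "n \<in> M" for n i
  proof -
    have "\<rho> n (\<phi> i) = (\<Sum>n'\<in>M. if n' = n then X i n else 0)"
      unfolding \<phi>_def rsum rscale by (intro sum.cong refl) (auto simp: rdelta)
    then show ?thesis using that fin by simp
  qed
  have pPsi: "pR (\<Psi> x) = 0" "pK (\<Psi> x) = 0" "pM (\<Psi> x) = \<Psi> x" for x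
  proof -
    show "pR (\<Psi> x) = 0" "pK (\<Psi> x) = 0" unfolding pR_def pK_def by (simp_all add: rPsi)
    have phi: "pM (\<phi> i) = \<phi> i" for i unfolding pM_def by (subst \<phi>_def) (simp add: rM')
    show "pM (\<Psi> x) = \<Psi> x" unfolding \<Psi>_def clinear_sum[OF lin(3)] using lin(3) phi by (simp add: clinear_def)
  qed
  have Wp: "pK x = 0" "pM x = 0" if "x \<in> ?W" for x
    using W0[OF that] by (simp_all add: pK_def pM_def)
  have W'p: "pR x + pK x = x" "pM x = 0" if "x \<in> ?W'" for x
    using W'exp[OF that] W'0[OF that] by (simp_all add: pR_def pK_def pM_def)
  have rangeW': "pR x \<in> ?W'" "pK x \<in> ?W'" for x
    unfolding pR_def pK_def using sub
    by (auto intro!: vec.subspace_sum[OF subspace_fspan] vec.subspace_scale[OF subspace_fspan])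
  have rangeW: "pR x \<in> ?W" for x
    unfolding pR_def using sub
    by (auto intro!: vec.subspace_sum[OF subspace_fspan] vec.subspace_scale[OF subspace_fspan])
  have PsiR: "\<Psi> x = \<Psi> (pR x)" for x
  proof -
    have "\<rho> b (pR x) = \<rho> b x" if "b \<in> R" for b
    proof -
      have "\<rho> b (pR x) = (\<Sum>b'\<in>R. if b' = b then \<rho> b x else 0)"
        unfolding pR_def rsum rscale by (intro sum.cong refl) (auto simp: rdelta)
      then show ?thesis using that fin by simp
    qed
    then show ?thesis unfolding \<Psi>_def by (intro sum.cong refl) simp
  qed
  have tangent: "polar c (pR x) (pR x) (\<Psi> x) = 0" for x
  proof -
    define g where "g = (\<lambda>i j k. \<rho> i x * \<rho> j x * \<rho> k x * polar c i j (\<phi> k))"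
    have e: "polar c (pR x) (pR x) (\<Psi> x) = (\<Sum>i\<in>R. \<Sum>j\<in>R. \<Sum>k\<in>R. g i j k)"
      unfolding pR_def \<Psi>_def polar_sum3 polar_scale g_def by (simp add: mult_ac)
    have s2: "(\<Sum>i\<in>R. \<Sum>j\<in>R. \<Sum>k\<in>R. g i k j) = (\<Sum>i\<in>R. \<Sum>j\<in>R. \<Sum>k\<in>R. g i j k)"
      by (intro sum.cong refl sum.swap)
    have s3: "(\<Sum>i\<in>R. \<Sum>j\<in>R. \<Sum>k\<in>R. g j k i) = (\<Sum>i\<in>R. \<Sum>j\<in>R. \<Sum>k\<in>R. g i j k)"
    proof -
      have "(\<Sum>i\<in>R. \<Sum>j\<in>R. \<Sum>k\<in>R. g j k i) = (\<Sum>j\<in>R. \<Sum>i\<in>R. \<Sum>k\<in>R. g j k i)" by (rule sum.swap)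
      also have "\<dots> = (\<Sum>j\<in>R. \<Sum>k\<in>R. \<Sum>i\<in>R. g j k i)" by (intro sum.cong refl sum.swap)
      finally show ?thesis .
    qed
    \<comment> \<open>Summing the polarised equations over all triples counts F(x, x, \<Psi> x)
      three times.\<close>
    have "(\<Sum>i\<in>R. \<Sum>j\<in>R. \<Sum>k\<in>R. g i j k + g i k j + g j k i) = 0"
    proof (intro sum.neutral ballI)
      fix i j k assume ijk: "i \<in> R" "j \<in> R" "k \<in> R"
      have "g i j k + g i k j + g j k i = \<rho> i x * \<rho> j x * \<rho> k x *
         (polar c i j (\<phi> k) + polar c i k (\<phi> j) + polar c j k (\<phi> i))"
        by (simp add: g_def algebra_simps)
      then show "g i j k + g i k j + g j k i = 0" using X[OF ijk] by (simp add: \<phi>_def)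
    qed
    then have "3 * (\<Sum>i\<in>R. \<Sum>j\<in>R. \<Sum>k\<in>R. g i j k) = 0"
      unfolding sum.distrib s2 s3 by simp
    then show ?thesis unfolding e by simp
  qed
  define L where "L = (\<lambda>t x. pR x + pK x + t *s \<Psi> x)"
  define Q where "Q = (\<lambda>t x. pR x + t *s \<Psi> x)"
  have linLQ: "clinear (L t)" "clinear (Q t)" for t
    using lin unfolding clinear_def L_def Q_def by (simp_all add: algebra_simps vec.scale_right_distrib)
  \<comment> \<open>\<open>L t\<close> is the identity on the tilted plane, so subtracting F o L
    kills F there; on W it agrees with \<open>Q t\<close>, so adding F o Q restores the zero. On the
    tilted plane F o Q leaves only terms in t^2 and t^3. The last two summands cancel these and
    vanish on W because they contain \<open>pM\<close>.\<close>
  define ct where "ct = (\<lambda>t. c - pull3 c (L t) (L t) (L t) + pull3 c (Q t) (Q t) (Q t)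
      - cs3 (3 * t) (pull3 c pR \<Psi> pM) - cs3 (t ^ 2) (pull3 c \<Psi> \<Psi> pM))"
  define Bt where "Bt = (\<lambda>t. \<chi> i. B' $ i + t *s \<Psi> (B' $ i))"
  have ctx: "polar (ct t) x x x = polar c x x x - polar c (L t x) (L t x) (L t x) + polar c (Q t x) (Q t x) (Q t x)
      - 3 * t * polar c (pR x) (\<Psi> x) (pM x) - t ^ 2 * polar c (\<Psi> x) (\<Psi> x) (pM x)" for t x
    unfolding ct_def polar_tensor_diff polar_add(4) polar_tensor_scale
    by (simp add: polar_pull3_same linLQ lin)
  have v1: "vanishes (ct t) B" for t
  proof (rule vanishes_if_cubic)
    fix w assume w: "w \<in> ?W"
    show "polar (ct t) w w w = 0"
      unfolding ctx using Wp[OF w] polar_fspan[OF B(2) w w w] by (simp add: L_def Q_def)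
  qed
  have inBt: "\<exists>w\<in>?W'. x = w + t *s \<Psi> w" if "x \<in> fspan (Bt t)" for x t
  proof -
    obtain u where u: "x = (\<Sum>i\<in>UNIV. u i *s Bt t $ i)" using \<open>x \<in> fspan (Bt t)\<close> by (auto simp: fspan_def)
    define w where "w = (\<Sum>i\<in>UNIV. u i *s B' $ i)"
    have "\<Psi> w = (\<Sum>i\<in>UNIV. u i *s \<Psi> (B' $ i))"
      unfolding w_def clinear_sum[OF lin(4)] using lin(4) by (simp add: clinear_def)
    then have "x = w + t *s \<Psi> w"
      by (simp add: u w_def Bt_def vec.scale_right_distrib sum.distrib vec.scale_sum_right mult.commute)
    moreover have "w \<in> ?W'" unfolding w_def by (rule fspanI)
    ultimately show ?thesis by blast
  qed
  have proj: "pR (w + t *s \<Psi> w) = pR w" "pK (w + t *s \<Psi> w) = pK w" "pM (w + t *s \<Psi> w) = t *s \<Psi> w"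
    "\<Psi> (w + t *s \<Psi> w) = \<Psi> w" if w: "w \<in> ?W'" for w t
  proof -
    show "pR (w + t *s \<Psi> w) = pR w" "pK (w + t *s \<Psi> w) = pK w" "pM (w + t *s \<Psi> w) = t *s \<Psi> w"
      using lin(1-3) W'p[OF w] by (simp_all add: clinear_def pPsi)
    then show "\<Psi> (w + t *s \<Psi> w) = \<Psi> w" using PsiR by metis
  qed
  have v2: "vanishes (ct t) (Bt t)" for t
  proof (rule vanishes_if_cubic)
    fix x assume "x \<in> fspan (Bt t)"
    then obtain w where w: "w \<in> ?W'" and x: "x = w + t *s \<Psi> w" using inBt by blast
    have Lx: "L t x = x" unfolding L_def x proj[OF w] using W'p(1)[OF w] by simp
    define p where "p = pR w"
    define s where "s = \<Psi> w"
    have p0: "polar c p p p = 0" unfolding p_def by (rule polar_fspan[OF B'(2) rangeW'(1) rangeW'(1) rangeW'(1)])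
    have ps0: "polar c p p s = 0" unfolding p_def s_def by (rule tangent)
    have sp: "polar c s p p = 0" "polar c p s p = 0" using ps0 polar_commute by metis+
    have ssp: "polar c s p s = polar c p s s" "polar c s s p = polar c p s s"
      using polar_commute by metis+
    have QQ: "polar c (p + t *s s) (p + t *s s) (p + t *s s) = 3 * t ^ 2 * polar c p s s + t ^ 3 * polar c s s s"
      unfolding polar_add polar_scale
      by (simp add: p0 ps0 sp ssp power2_eq_square power3_eq_cube algebra_simps)
    have "polar (ct t) x x x = polar c (p + t *s s) (p + t *s s) (p + t *s s) - 3 * t * (t * polar c p s s) - t ^ 2 * (t * polar c s s s)"
    proof -
      have e1: "pR x = p" "\<Psi> x = s" "pM x = t *s s" by (simp_all only: x proj[OF w] p_def s_def)
      have e2: "Q t x = p + t *s s" by (simp only: Q_def e1)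
      show ?thesis unfolding ctx Lx e1 e2 polar_scale by simp
    qed
    then show "polar (ct t) x x x = 0"
      unfolding QQ by (simp add: power2_eq_square power3_eq_cube algebra_simps)
  qed
  have fr: "frame (Bt t)" for t
    unfolding frame_def
  proof (intro allI impI)
    fix u :: "3 \<Rightarrow> complex" and i
    assume u: "(\<Sum>i\<in>UNIV. u i *s Bt t $ i) = 0"
    define w where "w = (\<Sum>i\<in>UNIV. u i *s B' $ i)"
    have w: "w \<in> ?W'" unfolding w_def by (rule fspanI)
    have "\<Psi> w = (\<Sum>i\<in>UNIV. u i *s \<Psi> (B' $ i))"
      unfolding w_def clinear_sum[OF lin(4)] using lin(4) by (simp add: clinear_def)
    then have z: "w + t *s \<Psi> w = 0"
      using u by (simp add: w_def Bt_def vec.scale_right_distrib sum.distrib vec.scale_sum_right mult.commute)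
    have "pM 0 = 0" by (simp add: pM_def r0)
    then have "t *s \<Psi> w = 0" using proj(3)[OF w, of t] z by simp
    then have "w = 0" using z by (simp only: add_0_right)
    then have "\<forall>i. u i = 0" using B'(1)[unfolded frame_def, THEN spec, of u] unfolding w_def by (rule rev_mp)
    then show "u i = 0" by blast
  qed
  have smaller: "vec.dim (?W \<inter> fspan (Bt t)) < r" if t: "t \<noteq> 0" for t
  proof -
    obtain i n where i: "i \<in> R" "n \<in> M" "X i n \<noteq> 0" using Xnz by blast
    have "\<rho> n (\<Psi> i) = X i n"
    proof -
      have "\<Psi> i = (\<Sum>b\<in>R. if b = i then \<phi> i else 0)"
        unfolding \<Psi>_def using i(1) by (intro sum.cong refl) (auto simp: rdelta)
      then have "\<Psi> i = \<phi> i" using i(1) fin by simp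
      then show ?thesis using rM'[OF i(2)] by simp
    qed
    then have Psi_i: "\<Psi> i \<noteq> 0" using i(3) r0 by auto
    \<comment> \<open>A common vector has no component along M, so the tilt of w vanishes and x = w.
      Hence the new intersection misses the vector i, which \<Psi> does not kill.\<close>
    have key: "x \<in> ?W' \<and> \<Psi> x = 0" if x: "x \<in> ?W" "x \<in> fspan (Bt t)" for x
    proof -
      obtain w where w: "w \<in> ?W'" and xw: "x = w + t *s \<Psi> w" using inBt x(2) by blast
      have "t *s \<Psi> w = 0" using proj(3)[OF w, of t] Wp(2)[OF x(1)] xw by simp
      then have "\<Psi> w = 0" using t by (simp add: vec_eq_iff)
      then show ?thesis using w xw by simp
    qed
    have "vec.subspace (?W \<inter> fspan (Bt t))" "vec.subspace (?W \<inter> ?W')"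
      by (intro vec.subspace_inter subspace_fspan)+
    then have "vec.span (?W \<inter> fspan (Bt t)) = ?W \<inter> fspan (Bt t)" "vec.span (?W \<inter> ?W') = ?W \<inter> ?W'"
      by (simp_all add: vec.span_eq_iff)
    moreover have "?W \<inter> fspan (Bt t) \<subset> ?W \<inter> ?W'"
    proof
      show "?W \<inter> fspan (Bt t) \<subseteq> ?W \<inter> ?W'" using key by blast
      have "i \<in> ?W \<inter> ?W'" using i sub by blast
      moreover have "i \<notin> ?W \<inter> fspan (Bt t)" using key Psi_i by blast
      ultimately show "?W \<inter> fspan (Bt t) \<noteq> ?W \<inter> ?W'" by blast
    qed
    ultimately have "vec.dim (?W \<inter> fspan (Bt t)) < vec.dim (?W \<inter> ?W')" by (intro vec.dim_psubset) (simp only:)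
    then show ?thesis using r by simp
  qed
  \<comment> \<open>\<open>L 0\<close> and \<open>Q 0\<close> take values in W', where F vanishes,
    so their pullbacks are zero as tensors and not only as cubics.\<close>
  have c0: "ct 0 = c"
  proof -
    have "pull3 c (L 0) (L 0) (L 0) = 0" "pull3 c (Q 0) (Q 0) (Q 0) = 0"
      unfolding pull3_def L_def Q_def using rangeW' polar_fspan[OF B'(2)]
      by (simp_all add: vec_eq_iff vec.subspace_add[OF subspace_fspan])
    then show ?thesis by (simp add: ct_def vec_eq_iff)
  qed
  have B0: "Bt 0 = B'" by (simp add: Bt_def vec_eq_iff)
  have "continuous_on UNIV (\<lambda>t. (ct t, Bt t))"
    unfolding ct_def Bt_def pull3_def L_def Q_def cs3_def cs2_def
    by (intro continuous_intros continuous_on_polar continuous_on_cmul_vec continuous_on_vec_lambda)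
  then have "open ((\<lambda>t. (ct t, Bt t)) -` N)" by (intro open_vimage[OF N(1)])
  moreover have "0 \<in> (\<lambda>t. (ct t, Bt t)) -` N" using N(2) c0 B0 by simp
  ultimately obtain e where e: "e > 0" "ball 0 e \<subseteq> (\<lambda>t. (ct t, Bt t)) -` N" by (rule openE)
  define t :: complex where "t = of_real (e / 2)"
  have t: "t \<noteq> 0" "t \<in> ball 0 e" using e by (auto simp: t_def)
  then have "(ct t, Bt t) \<in> N" using e by blast
  then show ?thesis using v1 v2 fr smaller[OF t(1)] by (rule that)
qed

lemma pair_perturb_disjoint:
  assumes "frame B" "vanishes c B" "frame B'" "vanishes c B'" "open N" "(c, B') \<in> N"
  shows "\<exists>c' B''. (c', B'') \<in> N \<and> vanishes c' B \<and> vanishes c' B'' \<and> frame B'' \<and> vec.dim (fspan B \<inter> fspan B'') = 0"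
  using assms
proof (induction "vec.dim (fspan B \<inter> fspan B')" arbitrary: c B' rule: less_induct)
  case less
  show ?case
  proof (cases "vec.dim (fspan B \<inter> fspan B') = 0")
    case True
    then show ?thesis using less.prems by blast
  next
    case False
    then have ge: "vec.dim (fspan B \<inter> fspan B') \<ge> 1" by linarith
    obtain c' B'' where 1: "(c', B'') \<in> N" "vanishes c' B" "vanishes c' B''" "frame B''"
      "vec.dim (fspan B \<inter> fspan B'') < vec.dim (fspan B \<inter> fspan B')"
      by (rule pair_perturb[OF less.prems(1-4) refl ge less.prems(5,6)]) (rule that)
    show ?thesis by (rule less.hyps[OF 1(5) less.prems(1) 1(2) 1(4) 1(3) less.prems(5) 1(1)])
  qed
qed

definition plane_pairs :: "tensor set \<Rightarrow> (tensor \<times> (complex ^ 7 ^ 3) \<times> (complex ^ 7 ^ 3)) set" where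
  "plane_pairs U = {(c, x, y). c \<in> U \<and> x \<in> plane_frames c \<and> y \<in> plane_frames c}"

definition disjoint_pairs :: "tensor set \<Rightarrow> (tensor \<times> (complex ^ 7 ^ 3) \<times> (complex ^ 7 ^ 3)) set" where
  "disjoint_pairs U = {(c, x, y) \<in> plane_pairs U. vec.dim (fspan x \<inter> fspan y) = 0}"

lemma disjoint_pairs_dense:
  assumes U: "open U"
  shows "plane_pairs U \<subseteq> closure (disjoint_pairs U)"
proof
  fix p assume p: "p \<in> plane_pairs U"
  obtain c x y where pe: "p = (c, x, y)" by (cases p)
  have m: "c \<in> U" "frame x" "vanishes c x" "frame y" "vanishes c y"
    using p by (auto simp: pe plane_pairs_def plane_frames_def)
  have "disjoint_pairs U \<inter> T \<noteq> {}" if T: "open T" "p \<in> T" for T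
  proof -
    obtain T1 T2 where T12: "open T1" "open T2" "c \<in> T1" "(x, y) \<in> T2" "T1 \<times> T2 \<subseteq> T"
      using T(1) T(2)[unfolded pe] by (rule open_prod_elim) auto
    obtain T3 T4 where T34: "open T3" "open T4" "x \<in> T3" "y \<in> T4" "T3 \<times> T4 \<subseteq> T2"
      using T12(2,4) by (rule open_prod_elim) auto
    have "open ((T1 \<inter> U) \<times> T4)" using T12 T34 U by (intro open_Times open_Int)
    moreover have "(c, y) \<in> (T1 \<inter> U) \<times> T4" using T12 T34 m by simp
    ultimately obtain c' B'' where "(c', B'') \<in> (T1 \<inter> U) \<times> T4" "vanishes c' x" "vanishes c' B''" "frame B''"
      "vec.dim (fspan x \<inter> fspan B'') = 0"
      using pair_perturb_disjoint[OF m(2-5)] by blast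
    then have "(c', x, B'') \<in> disjoint_pairs U \<inter> T"
      using m T12(5) T34 by (auto simp: disjoint_pairs_def plane_pairs_def plane_frames_def)
    then show ?thesis by blast
  qed
  then show "p \<in> closure (disjoint_pairs U)" unfolding closure_iff_nhds_not_empty by blast
qed

section \<open>Connectedness of the surface of planes\<close>

text \<open>The analytic stand-in for connectedness of the complement of a hypersurface: two points
  are joined inside a complex line from which only countably many parameters are removed.\<close>

lemma connected_nonzero_set:
  fixes S :: "'a::topological_space set" and \<Psi> :: "'a \<Rightarrow> complex"
  assumes line: "\<And>x y. x \<in> S \<Longrightarrow> y \<in> S \<Longrightarrow> \<exists>l. l 0 = x \<and> l 1 = y \<and> (\<forall>z. l z \<in> S) \<and> continuous_on UNIV l \<and>
     (\<lambda>z. \<Psi> (l z)) holomorphic_on UNIV"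
  shows "connected {x \<in> S. \<Psi> x \<noteq> 0}"
  unfolding connected_iff_connected_component
proof (intro ballI)
  fix x y assume xy: "x \<in> {x \<in> S. \<Psi> x \<noteq> 0}" "y \<in> {x \<in> S. \<Psi> x \<noteq> 0}"
  then obtain l where l: "l 0 = x" "l 1 = y" "\<forall>z. l z \<in> S" "continuous_on UNIV l"
     "(\<lambda>z. \<Psi> (l z)) holomorphic_on UNIV"
    using line[of x y] by blast
  have "countable {z. \<Psi> (l z) = 0}"
    by (rule countable_zeros_entire[OF l(5), of 0]) (use l xy in simp)
  then have "path_connected (- {z. \<Psi> (l z) = 0})"
    by (intro path_connected_complement_countable) auto
  then have "connected (- {z. \<Psi> (l z) = 0})" by (rule path_connected_imp_connected)
  then have "connected (l ` (- {z. \<Psi> (l z) = 0}))"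
    by (intro connected_continuous_image continuous_on_subset[OF l(4)]) auto
  moreover have "l ` (- {z. \<Psi> (l z) = 0}) \<subseteq> {x \<in> S. \<Psi> x \<noteq> 0}" using l(3) by auto
  moreover have "x \<in> l ` (- {z. \<Psi> (l z) = 0})" "y \<in> l ` (- {z. \<Psi> (l z) = 0})"
    using xy l(1,2) by (auto intro: image_eqI[of _ _ 0] image_eqI[of _ _ 1])
  ultimately show "connected_component {x \<in> S. \<Psi> x \<noteq> 0} x y"
    unfolding connected_component_def by blast
qed

text \<open>Matrices act on row vectors from the right.\<close>

definition pullm :: "tensor \<Rightarrow> complex ^ 7 ^ 7 \<Rightarrow> tensor" where
  "pullm c M = (\<chi> a b d. tri c (M $ a) (M $ b) (M $ d))"

definition rmul :: "complex ^ 7 \<Rightarrow> complex ^ 7 ^ 7 \<Rightarrow> complex ^ 7" where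
  "rmul x M = (\<Sum>a\<in>UNIV. x $ a *s M $ a)"

lemma tri_sum3:
  "tri c (\<Sum>i\<in>A. r i *s X i) (\<Sum>j\<in>B. s j *s Y j) (\<Sum>k\<in>C. t k *s Z k) =
     (\<Sum>i\<in>A. \<Sum>j\<in>B. \<Sum>k\<in>C. r i * s j * t k * tri c (X i) (Y j) (Z k))"
proof -
  have t0: "tri c 0 y z = 0" "tri c x 0 z = 0" "tri c x y 0 = 0" for x y z by (simp_all add: tri_def)
  have s1: "tri c (sum f A) y z = (\<Sum>i\<in>A. tri c (f i) y z)" for f :: "'a \<Rightarrow> _" and A y z
    by (induction A rule: infinite_finite_induct) (auto simp: tri_add t0)
  have s2: "tri c x (sum f A) z = (\<Sum>i\<in>A. tri c x (f i) z)" for f :: "'b \<Rightarrow> _" and A x z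
    by (induction A rule: infinite_finite_induct) (auto simp: tri_add t0)
  have s3: "tri c x y (sum f A) = (\<Sum>i\<in>A. tri c x y (f i))" for f :: "'c \<Rightarrow> _" and A x y
    by (induction A rule: infinite_finite_induct) (auto simp: tri_add t0)
  show ?thesis unfolding s1 unfolding s2 unfolding s3 unfolding tri_scale by (simp add: mult_ac)
qed

lemma tri_pullm: "tri (pullm c M) x y z = tri c (rmul x M) (rmul y M) (rmul z M)"
  unfolding rmul_def tri_sum3 tri_def[of "pullm c M"] by (simp add: pullm_def mult_ac)

lemma polar_pullm: "polar (pullm c M) x y z = polar c (rmul x M) (rmul y M) (rmul z M)"
  by (simp add: polar_def tri_pullm)

lemma rmul_row: "rmul (M $ a) M' = (M ** M') $ a"
  by (simp add: rmul_def vec_eq_iff matrix_matrix_mult_def)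

lemma rmul_axis: "rmul (axis a 1) M = M $ a"
proof -
  have "rmul (axis a 1) M = (\<Sum>b\<in>UNIV. if b = a then M $ b else 0)"
    unfolding rmul_def by (intro sum.cong refl) (auto simp: axis_def)
  then show ?thesis by simp
qed

lemma pullm_pullm: "pullm (pullm c M) M' = pullm c (M' ** M)"
  by (simp add: pullm_def[of "pullm c M"] tri_pullm rmul_row) (simp add: pullm_def)

lemma tri_tensor_scale: "tri (cs3 r c) x y z = r * tri c x y z"
  by (simp add: tri_def sum_distrib_left mult_ac)

text \<open>The adjugate replaces the inverse because it is polynomial in the matrix: along a
  complex line it stays entire even where the matrix becomes singular.\<close>

definition adj :: "complex ^ 7 ^ 7 \<Rightarrow> complex ^ 7 ^ 7" where
  "adj g = (\<chi> b a. det (\<chi> k. if k = a then axis b 1 else g $ k))"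

lemma mult_adj: "g ** adj g = mat (det g)"
proof (rule vec_eq_iff[THEN iffD2], rule allI, rule vec_eq_iff[THEN iffD2], rule allI)
  fix k a
  have "(g ** adj g) $ k $ a = (\<Sum>b\<in>UNIV. g $ k $ b * det (\<chi> l. if l = a then axis b 1 else g $ l))"
    by (simp add: matrix_matrix_mult_def adj_def)
  also have "\<dots> = (\<Sum>b\<in>UNIV. det (\<chi> l. if l = a then g $ k $ b *s axis b 1 else g $ l))"
    unfolding det_row_mul ..
  also have "\<dots> = det (\<chi> l. if l = a then (\<Sum>b\<in>UNIV. g $ k $ b *s axis b 1) else g $ l)"
    by (rule det_linear_row_sum[symmetric]) simp
  also have "\<dots> = det (\<chi> l. if l = a then g $ k else g $ l)"
    unfolding vec7_expansion[of "g $ k", symmetric] ..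
  also have "\<dots> = mat (det g) $ k $ a"
  proof (cases "k = a")
    case True
    then have "(\<chi> l. if l = a then g $ k else g $ l) = g" by (simp add: vec_eq_iff)
    then show ?thesis using True by (simp add: mat_def)
  next
    case False
    then have "det (\<chi> l. if l = a then g $ k else g $ l) = 0"
      by (intro det_identical_rows[of k a]) (auto simp: row_def vec_eq_iff)
    then show ?thesis using False by (simp add: mat_def)
  qed
  finally show "(g ** adj g) $ k $ a = mat (det g) $ k $ a" .
qed

lemma adj_mult:
  assumes "det g \<noteq> 0"
  shows "adj g ** g = mat (det g)"
proof -
  let ?A = "\<chi> i j. adj g $ i $ j / det g"
  have "g ** ?A = mat 1"
  proof (rule vec_eq_iff[THEN iffD2], rule allI, rule vec_eq_iff[THEN iffD2], rule allI)
    fix k a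
    have "(g ** ?A) $ k $ a = (g ** adj g) $ k $ a / det g"
      by (simp add: matrix_matrix_mult_def sum_divide_distrib)
    then show "(g ** ?A) $ k $ a = mat 1 $ k $ a" using assms by (simp add: mult_adj mat_def)
  qed
  then have A: "?A ** g = mat 1" using matrix_left_right_inverse by blast
  show ?thesis
  proof (rule vec_eq_iff[THEN iffD2], rule allI, rule vec_eq_iff[THEN iffD2], rule allI)
    fix k a
    have "(adj g ** g) $ k $ a = det g * (?A ** g) $ k $ a"
      using assms by (simp add: matrix_matrix_mult_def sum_distrib_left)
    then show "(adj g ** g) $ k $ a = mat (det g) $ k $ a" by (simp add: A mat_def)
  qed
qed

section \<open>Bases adapted to a pair of disjoint planes\<close>

definition slot :: "7 \<Rightarrow> (3 + 3) option" where "slot = (SOME e. bij e)"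

lemma bij_slot: "bij slot"
proof -
  have "card (UNIV :: (3 + 3) option set) = 7" by (simp add: UNIV_option_conv card_image)
  then have "\<exists>e. bij_betw e (UNIV :: 7 set) (UNIV :: (3 + 3) option set)"
    by (intro finite_same_card_bij) auto
  then show ?thesis unfolding slot_def by (rule someI_ex)
qed

definition unslot :: "(3 + 3) option \<Rightarrow> 7" where "unslot = inv slot"

lemma slot_unslot [simp]: "slot (unslot s) = s" "unslot (slot a) = a"
  using bij_slot by (simp_all add: unslot_def bij_is_surj surj_f_inv_f bij_is_inj)

text \<open>7 = 3 + 3 + 1: the rows of two planes and one more vector. For disjoint planes and a
  vector outside their sum this is a change of basis.\<close>

definition gmat :: "complex ^ 7 ^ 3 \<Rightarrow> complex ^ 7 ^ 3 \<Rightarrow> complex ^ 7 \<Rightarrow> complex ^ 7 ^ 7" where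
  "gmat B B' v = (\<chi> a. case slot a of None \<Rightarrow> v | Some (Inl i) \<Rightarrow> B $ i | Some (Inr i) \<Rightarrow> B' $ i)"

lemma gmat_nth: "gmat B B' v $ unslot (Some (Inl i)) = B $ i" "gmat B B' v $ unslot (Some (Inr i)) = B' $ i"
  "gmat B B' v $ unslot None = v"
  by (simp_all add: gmat_def)

lemma sum_slots:
  fixes f :: "7 \<Rightarrow> 'b::comm_monoid_add"
  shows "(\<Sum>a\<in>UNIV. f a) = f (unslot None) + ((\<Sum>i\<in>UNIV. f (unslot (Some (Inl i)))) + (\<Sum>i\<in>UNIV. f (unslot (Some (Inr i)))))"
proof -
  have "bij unslot" using bij_slot by (simp add: unslot_def bij_imp_bij_inv)
  then have "(\<Sum>a\<in>UNIV. f a) = (\<Sum>s\<in>UNIV. f (unslot s))" by (rule sum.reindex_bij_betw[symmetric])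
  also have "\<dots> = f (unslot None) + (\<Sum>s\<in>UNIV. f (unslot (Some s)))"
    by (simp add: UNIV_option_conv sum.reindex)
  also have "(\<Sum>s\<in>UNIV. f (unslot (Some s))) = (\<Sum>i\<in>UNIV. f (unslot (Some (Inl i)))) + (\<Sum>i\<in>UNIV. f (unslot (Some (Inr i))))"
    by (simp add: UNIV_Plus_UNIV[symmetric] sum.Plus del: UNIV_Plus_UNIV)
  finally show ?thesis .
qed

lemma det_gmat_iff:
  "det (gmat B B' v) \<noteq> 0 \<longleftrightarrow> (\<forall>t t' s. (\<Sum>i\<in>UNIV. t i *s B $ i) + (\<Sum>i\<in>UNIV. t' i *s B' $ i) + s *s v = 0 \<longrightarrow>
     (\<forall>i. t i = 0) \<and> (\<forall>i. t' i = 0) \<and> s = 0)"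
  (is "_ \<longleftrightarrow> ?R")
proof -
  let ?g = "gmat B B' v"
  have rw: "row a ?g = ?g $ a" for a by (simp add: row_def)
  have "det ?g \<noteq> 0 \<longleftrightarrow> (\<exists>C. ?g ** C = mat 1)"
    by (simp add: invertible_det_nz[symmetric] invertible_right_inverse)
  also have "\<dots> \<longleftrightarrow> (\<forall>u. (\<Sum>a\<in>UNIV. u a *s row a ?g) = 0 \<longrightarrow> (\<forall>a. u a = 0))"
    by (rule matrix_right_invertible_independent_rows)
  also have "\<dots> \<longleftrightarrow> ?R"
  proof
    assume L: "\<forall>u. (\<Sum>a\<in>UNIV. u a *s row a ?g) = 0 \<longrightarrow> (\<forall>a. u a = 0)"
    show ?R
    proof (intro allI impI)
      fix t t' s
      assume z: "(\<Sum>i\<in>UNIV. t i *s B $ i) + (\<Sum>i\<in>UNIV. t' i *s B' $ i) + s *s v = 0"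
      define u where "u = (\<lambda>a. case slot a of None \<Rightarrow> s | Some (Inl i) \<Rightarrow> t i | Some (Inr i) \<Rightarrow> t' i)"
      have uv: "u (unslot None) = s" "u (unslot (Some (Inl i))) = t i" "u (unslot (Some (Inr i))) = t' i" for i
        by (simp_all add: u_def)
      have "(\<Sum>a\<in>UNIV. u a *s row a ?g) = 0"
        unfolding rw sum_slots[of "\<lambda>a. u a *s ?g $ a"] gmat_nth uv using z by (simp add: add_ac)
      then have "\<forall>a. u a = 0" using L by blast
      then show "(\<forall>i. t i = 0) \<and> (\<forall>i. t' i = 0) \<and> s = 0" by (metis uv)
    qed
  next
    assume R: ?R
    show "\<forall>u. (\<Sum>a\<in>UNIV. u a *s row a ?g) = 0 \<longrightarrow> (\<forall>a. u a = 0)"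
    proof (intro allI impI)
      fix u a assume z: "(\<Sum>a\<in>UNIV. u a *s row a ?g) = 0"
      have e: "(\<Sum>i\<in>UNIV. u (unslot (Some (Inl i))) *s B $ i) + (\<Sum>i\<in>UNIV. u (unslot (Some (Inr i))) *s B' $ i) + u (unslot None) *s v = 0"
        using z unfolding rw sum_slots[of "\<lambda>a. u a *s ?g $ a"] gmat_nth by (simp add: add_ac)
      have "(\<forall>i. u (unslot (Some (Inl i))) = 0) \<and> (\<forall>i. u (unslot (Some (Inr i))) = 0) \<and> u (unslot None) = 0"
        by (rule R[THEN spec, of "\<lambda>i. u (unslot (Some (Inl i)))", THEN spec, of "\<lambda>i. u (unslot (Some (Inr i)))",
            THEN spec, of "u (unslot None)", THEN mp, OF e])
      moreover have "a = unslot None \<or> (\<exists>i. a = unslot (Some (Inl i))) \<or> (\<exists>i. a = unslot (Some (Inr i)))"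
      proof (cases "slot a")
        case None
        then have "a = unslot None" using slot_unslot(2)[of a] by simp
        then show ?thesis by simp
      next
        case (Some s)
        then have a: "a = unslot (Some s)" using slot_unslot(2)[of a] by simp
        show ?thesis by (cases s) (auto simp: a)
      qed
      ultimately show "u a = 0" by auto
    qed
  qed
  finally show ?thesis .
qed

text \<open>Cubics containing two fixed disjoint coordinate planes: a linear condition, so these
  tensors form a vector space.\<close>

definition block_tensors :: "tensor set" where
  "block_tensors = {c. \<forall>i j k.
     polar c (axis (unslot (Some (Inl i))) 1) (axis (unslot (Some (Inl j))) 1) (axis (unslot (Some (Inl k))) 1) = 0 \<and>
     polar c (axis (unslot (Some (Inr i))) 1) (axis (unslot (Some (Inr j))) 1) (axis (unslot (Some (Inr k))) 1) = 0}"

text \<open>A basis through both planes moves every disjoint pair to the two coordinate planes. The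
  adjugate is det times the inverse, and this factor only rescales the tensor.\<close>

lemma disjoint_pairs_eq:
  "disjoint_pairs U = (\<lambda>(B, B', v, c). (pullm c (adj (gmat B B' v)), B, B')) `
     {(B, B', v, c). c \<in> block_tensors \<and> det (gmat B B' v) \<noteq> 0 \<and> pullm c (adj (gmat B B' v)) \<in> U}"
  (is "_ = ?m ` ?D")
proof
  show "?m ` ?D \<subseteq> disjoint_pairs U"
  proof clarify
    fix B B' v c
    assume c: "c \<in> block_tensors" and d: "det (gmat B B' v) \<noteq> 0" and U: "pullm c (adj (gmat B B' v)) \<in> U"
    let ?g = "gmat B B' v"
    let ?c = "pullm c (adj ?g)"
    have ind: "(\<Sum>i\<in>UNIV. t i *s B $ i) + (\<Sum>i\<in>UNIV. t' i *s B' $ i) + s *s v = 0 \<Longrightarrow>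
       (\<forall>i. t i = 0) \<and> (\<forall>i. t' i = 0) \<and> s = 0" for t t' s
      using d unfolding det_gmat_iff by blast
    have ra: "rmul (?g $ a) (adj ?g) = det ?g *s axis a 1" for a
      unfolding rmul_row mult_adj by (simp add: vec_eq_iff mat_def axis_def)
    have rB: "rmul (B $ i) (adj ?g) = det ?g *s axis (unslot (Some (Inl i))) 1"
      "rmul (B' $ i) (adj ?g) = det ?g *s axis (unslot (Some (Inr i))) 1" for i
      using ra[of "unslot (Some (Inl i))"] ra[of "unslot (Some (Inr i))"] by (simp_all only: gmat_nth)
    have van: "vanishes ?c B" "vanishes ?c B'"
      using c unfolding vanishes_def polar_pullm rB polar_scale block_tensors_def by simp_all
    have fr: "frame B" "frame B'"
    proof -
      show "frame B" unfolding frame_def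
      proof (intro allI impI)
        fix t i assume "(\<Sum>i\<in>UNIV. t i *s B $ i) = 0"
        then show "t i = 0" using ind[of t "\<lambda>_. 0" 0] by simp
      qed
      show "frame B'" unfolding frame_def
      proof (intro allI impI)
        fix t i assume "(\<Sum>i\<in>UNIV. t i *s B' $ i) = 0"
        then show "t i = 0" using ind[of "\<lambda>_. 0" t 0] by simp
      qed
    qed
    have "fspan B \<inter> fspan B' \<subseteq> {0}"
    proof
      fix x assume "x \<in> fspan B \<inter> fspan B'"
      then have "x \<in> fspan B" "x \<in> fspan B'" by auto
      then obtain t t' where t: "x = (\<Sum>i\<in>UNIV. t i *s B $ i)" "x = (\<Sum>i\<in>UNIV. t' i *s B' $ i)"
        unfolding fspan_def by (elim rangeE)
      have "(\<Sum>i\<in>UNIV. (- t' i) *s B' $ i) = - x" unfolding t(2) by (simp add: sum_negf vec_eq_iff)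
      then have "(\<Sum>i\<in>UNIV. t i *s B $ i) + (\<Sum>i\<in>UNIV. (- t' i) *s B' $ i) + 0 *s v = 0" using t(1) by simp
      then have "\<forall>i. t i = 0" using ind[of t "\<lambda>i. - t' i" 0] by simp
      then show "x \<in> {0}" using t(1) by simp
    qed
    then have "vec.dim (fspan B \<inter> fspan B') = 0" by (rule vec.dim_eq_0[THEN iffD2])
    then show "(?c, B, B') \<in> disjoint_pairs U"
      using van fr U unfolding disjoint_pairs_def plane_pairs_def plane_frames_def mem_Collect_eq prod.case by (intro conjI)
  qed
  show "disjoint_pairs U \<subseteq> ?m ` ?D"
  proof
    fix p assume p: "p \<in> disjoint_pairs U"
    obtain c B B' where pe: "p = (c, B, B')" by (cases p)
    have m: "c \<in> U" "frame B" "vanishes c B" "frame B'" "vanishes c B'" "vec.dim (fspan B \<inter> fspan B') = 0"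
      using p by (auto simp: pe disjoint_pairs_def plane_pairs_def plane_frames_def)
    have int0: "fspan B \<inter> fspan B' \<subseteq> {0}" using m(6) by (rule vec.dim_eq_0[THEN iffD1])
    let ?S = "{x + y | x y. x \<in> fspan B \<and> y \<in> fspan B'}"
    have "vec.dim ?S = 6"
      using vec.dim_sums_Int[OF subspace_fspan subspace_fspan, of B B'] dim_fspan[OF m(2)] dim_fspan[OF m(4)] m(6) by simp
    moreover have "vec.dim (UNIV :: (complex ^ 7) set) = 7" by (simp only: vec_dim_card) simp
    ultimately have "vec.dim ?S \<noteq> vec.dim (UNIV :: (complex ^ 7) set)" by simp
    then have "?S \<noteq> UNIV" by (rule contrapos_nn) (rule arg_cong)
    then obtain v where v: "v \<notin> ?S" by blast
    let ?g = "gmat B B' v"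
    have det: "det ?g \<noteq> 0"
      unfolding det_gmat_iff
    proof (intro allI impI)
      fix t t' s
      assume z: "(\<Sum>i\<in>UNIV. t i *s B $ i) + (\<Sum>i\<in>UNIV. t' i *s B' $ i) + s *s v = 0"
      define x where "x = (\<Sum>i\<in>UNIV. t i *s B $ i)"
      define y where "y = (\<Sum>i\<in>UNIV. t' i *s B' $ i)"
      have xy: "x \<in> fspan B" "y \<in> fspan B'" unfolding x_def y_def by (rule fspanI)+
      have s: "s = 0"
      proof (rule ccontr)
        assume "s \<noteq> 0"
        have "s *s v = - x - y"
          using z unfolding x_def[symmetric] y_def[symmetric] by (simp add: eq_neg_iff_add_eq_0 algebra_simps)
        then have "(1 / s) *s (s *s v) = (1 / s) *s (- x - y)" by simp
        then have "v = (- 1 / s) *s x + (- 1 / s) *s y"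
          using \<open>s \<noteq> 0\<close> by (simp add: vec_eq_iff diff_divide_distrib)
        moreover have "(- 1 / s) *s x \<in> fspan B" "(- 1 / s) *s y \<in> fspan B'"
          by (rule vec.subspace_scale[OF subspace_fspan xy(1)], rule vec.subspace_scale[OF subspace_fspan xy(2)])
        ultimately show False using v by blast
      qed
      have xy0: "x = - y" using z s unfolding x_def[symmetric] y_def[symmetric] by (simp add: eq_neg_iff_add_eq_0)
      have "x \<in> fspan B'" unfolding xy0 by (rule vec.subspace_neg[OF subspace_fspan xy(2)])
      then have "x = 0" using xy(1) int0 by blast
      then have "x = 0" "y = 0" using xy0 by auto
      then show "(\<forall>i. t i = 0) \<and> (\<forall>i. t' i = 0) \<and> s = 0"
        using s m(2)[unfolded frame_def, THEN spec, of t] m(4)[unfolded frame_def, THEN spec, of t'] by (simp add: x_def y_def)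
    qed
    define d where "d = det ?g"
    have d: "d \<noteq> 0" using det by (simp add: d_def)
    \<comment> \<open>The adjugate composed with ?g is d times the identity; it acts in three
      arguments, so the factor to divide by is d^3.\<close>
    define c' where "c' = cs3 (1 / d ^ 3) (pullm c ?g)"
    have "c' \<in> block_tensors"
      using m(3,5) unfolding block_tensors_def mem_Collect_eq c'_def polar_tensor_scale polar_pullm rmul_axis gmat_nth
      by (simp add: vanishes_def)
    moreover have "pullm c' (adj ?g) = c"
    proof -
      have e: "(adj ?g ** ?g) $ a = d *s axis a 1" for a
        unfolding adj_mult[OF det] by (simp add: d_def vec_eq_iff mat_def axis_def)
      have "pullm c' (adj ?g) $ a $ b $ h = 1 / d ^ 3 * pullm (pullm c ?g) (adj ?g) $ a $ b $ h" for a b h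
        unfolding c'_def by (simp add: pullm_def[of _ "adj ?g"] tri_tensor_scale)
      moreover have "pullm (pullm c ?g) (adj ?g) $ a $ b $ h = d ^ 3 * c $ a $ b $ h" for a b h
        unfolding pullm_pullm by (simp add: pullm_def e tri_scale tri_axis power3_eq_cube)
      ultimately show ?thesis using d by (simp add: vec_eq_iff)
    qed
    ultimately have "(B, B', v, c') \<in> ?D" "p = ?m (B, B', v, c')" using det m(1) by (auto simp: pe)
    then show "p \<in> ?m ` ?D" by blast
  qed
qed

section \<open>Connectedness of the space of generic cubics with two of their planes\<close>

definition generic :: "(7 \<Rightarrow>\<^sub>0 nat, complex) mpoly \<Rightarrow> tensor set" where
  "generic \<Phi> = {c. mp_eval \<Phi> (Poly_Mapping.lookup (form c)) \<noteq> 0}"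

lemma continuous_on_det:
  fixes M :: "'t::topological_space \<Rightarrow> complex ^ 'n ^ 'n"
  assumes "\<And>i j. continuous_on S (\<lambda>t. M t $ i $ j)"
  shows "continuous_on S (\<lambda>t. det (M t))"
  unfolding det_def by (intro continuous_intros assms)

lemma holomorphic_on_det:
  fixes M :: "complex \<Rightarrow> complex ^ 'n ^ 'n"
  assumes "\<And>i j. (\<lambda>t. M t $ i $ j) holomorphic_on S"
  shows "(\<lambda>t. det (M t)) holomorphic_on S"
  unfolding det_def by (intro holomorphic_intros assms)

lemma holomorphic_on_pullm:
  fixes c :: "complex \<Rightarrow> tensor" and M :: "complex \<Rightarrow> complex ^ 7 ^ 7"
  assumes "\<And>a b d. (\<lambda>z. c z $ a $ b $ d) holomorphic_on S" "\<And>a b. (\<lambda>z. M z $ a $ b) holomorphic_on S"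
  shows "(\<lambda>z. pullm (c z) (M z) $ a $ b $ d) holomorphic_on S"
  unfolding pullm_def tri_def by (simp, intro holomorphic_intros assms)

lemma gmat_entry: "gmat B B' v $ a $ b = (case slot a of None \<Rightarrow> v $ b | Some (Inl i) \<Rightarrow> B $ i $ b | Some (Inr i) \<Rightarrow> B' $ i $ b)"
  by (simp add: gmat_def split: option.split sum.split)

lemma adj_entry: "adj g $ b $ a = det (\<chi> k. if k = a then axis b 1 else g $ k)"
  by (simp add: adj_def)

lemma continuous_on_pairs_map:
  "continuous_on S (\<lambda>(B, B', v, c). (pullm c (adj (gmat B B' v)), B, B'))"
proof -
  let ?g = "\<lambda>p. gmat (fst p) (fst (snd p)) (fst (snd (snd p)))"
  have g: "continuous_on S (\<lambda>p. ?g p $ a $ b)" for a b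
    unfolding gmat_entry
  proof (cases "slot a")
    case None
    then show "continuous_on S (\<lambda>p. case slot a of None \<Rightarrow> fst (snd (snd p)) $ b
       | Some (Inl i) \<Rightarrow> fst p $ i $ b | Some (Inr i) \<Rightarrow> fst (snd p) $ i $ b)"
      by (auto intro!: continuous_intros)
  next
    case (Some s)
    then show "continuous_on S (\<lambda>p. case slot a of None \<Rightarrow> fst (snd (snd p)) $ b
       | Some (Inl i) \<Rightarrow> fst p $ i $ b | Some (Inr i) \<Rightarrow> fst (snd p) $ i $ b)"
      by (cases s) (auto intro!: continuous_intros)
  qed
  have "continuous_on S (\<lambda>p. adj (?g p) $ b $ a)" for a b
    unfolding adj_entry
  proof (rule continuous_on_det)
    show "continuous_on S (\<lambda>p. (\<chi> k. if k = a then axis b 1 else ?g p $ k) $ i $ j)" for i j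
      using g by (cases "i = a") auto
  qed
  then have A: "continuous_on S (\<lambda>p. adj (?g p) $ a)" for a
    by (subst vec_lambda_eta[symmetric]) (intro continuous_on_vec_lambda)
  have "continuous_on S (\<lambda>p. pullm (snd (snd (snd p))) (adj (?g p)))"
    unfolding pullm_def by (intro continuous_on_vec_lambda continuous_on_tri A continuous_intros)
  then show ?thesis unfolding case_prod_unfold by (intro continuous_on_Pair continuous_intros)
qed

lemma connected_disjoint_pairs: "connected (disjoint_pairs (generic \<Phi>))"
proof -
  let ?S = "{(B :: complex ^ 7 ^ 3, B' :: complex ^ 7 ^ 3, v :: complex ^ 7, c). c \<in> block_tensors}"
  \<comment> \<open>Invertibility and genericity are merged into one nonvanishing condition on a
    vector space; it is entire along complex lines because \<open>adj\<close> is polynomial.\<close>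
  let ?\<Psi> = "\<lambda>(B, B', v, c). det (gmat B B' v) * mp_eval \<Phi> (Poly_Mapping.lookup (form (pullm c (adj (gmat B B' v)))))"
  have "connected {p \<in> ?S. ?\<Psi> p \<noteq> 0}"
  proof (rule connected_nonzero_set)
    fix x y assume "x \<in> ?S" "y \<in> ?S"
    then obtain B0 B0' v0 c0 B1 B1' v1 c1 where
      x: "x = (B0, B0', v0, c0)" "c0 \<in> block_tensors" and y: "y = (B1, B1', v1, c1)" "c1 \<in> block_tensors"
      by auto
    define l where "l = (\<lambda>z. (\<chi> i a. (1 - z) * B0 $ i $ a + z * B1 $ i $ a, \<chi> i a. (1 - z) * B0' $ i $ a + z * B1' $ i $ a,
        \<chi> a. (1 - z) * v0 $ a + z * v1 $ a, cs3 (1 - z) c0 + cs3 z c1))"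
    have "l 0 = x" "l 1 = y" by (simp_all add: l_def x y vec_eq_iff)
    moreover have "\<forall>z. l z \<in> ?S"
      using x(2) y(2) by (simp add: l_def block_tensors_def polar_add polar_tensor_scale)
    moreover have "continuous_on UNIV l"
      unfolding l_def cs3_def cs2_def
      by (intro continuous_on_Pair continuous_on_vec_lambda continuous_intros continuous_on_cmul_vec)
    moreover have "(\<lambda>z. ?\<Psi> (l z)) holomorphic_on UNIV"
    proof -
      define B where "B = (\<lambda>z. \<chi> i a. (1 - z) * B0 $ i $ a + z * B1 $ i $ a)"
      define B' where "B' = (\<lambda>z. \<chi> i a. (1 - z) * B0' $ i $ a + z * B1' $ i $ a)"
      define v where "v = (\<lambda>z. \<chi> a. (1 - z) * v0 $ a + z * v1 $ a)"
      define c where "c = (\<lambda>z. cs3 (1 - z) c0 + cs3 z c1)"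
      have h: "(\<lambda>z. B z $ i $ a) holomorphic_on UNIV" "(\<lambda>z. B' z $ i $ a) holomorphic_on UNIV"
        "(\<lambda>z. v z $ a) holomorphic_on UNIV" for i a
        unfolding B_def B'_def v_def by (simp_all, (intro holomorphic_intros)+)
      have hc: "(\<lambda>z. c z $ a $ b $ d) holomorphic_on UNIV" for a b d
        unfolding c_def by (simp, intro holomorphic_intros)
      have g: "(\<lambda>z. gmat (B z) (B' z) (v z) $ a $ b) holomorphic_on UNIV" for a b
      proof (cases "slot a")
        case None
        then show ?thesis unfolding gmat_entry using h by simp
      next
        case (Some s)
        then show ?thesis unfolding gmat_entry using h by (cases s) simp_all
      qed
      have A: "(\<lambda>z. adj (gmat (B z) (B' z) (v z)) $ b $ a) holomorphic_on UNIV" for a b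
        unfolding adj_entry
      proof (rule holomorphic_on_det)
        show "(\<lambda>z. (\<chi> k. if k = a then axis b 1 else gmat (B z) (B' z) (v z) $ k) $ i $ j) holomorphic_on UNIV" for i j
          using g by (cases "i = a") auto
      qed
      have "(\<lambda>z. det (gmat (B z) (B' z) (v z)) *
         mp_eval \<Phi> (Poly_Mapping.lookup (form (pullm (c z) (adj (gmat (B z) (B' z) (v z))))))) holomorphic_on UNIV"
        by (intro holomorphic_on_mult holomorphic_on_det g holomorphic_on_mp_eval holomorphic_on_lookup_form
            holomorphic_on_pullm hc A)
      then show ?thesis by (simp add: l_def B_def B'_def v_def c_def)
    qed
    ultimately show "\<exists>l. l 0 = x \<and> l 1 = y \<and> (\<forall>z. l z \<in> ?S) \<and> continuous_on UNIV l \<and> (\<lambda>z. ?\<Psi> (l z)) holomorphic_on UNIV"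
      by blast
  qed
  moreover have "{p \<in> ?S. ?\<Psi> p \<noteq> 0} =
     {(B, B', v, c). c \<in> block_tensors \<and> det (gmat B B' v) \<noteq> 0 \<and> pullm c (adj (gmat B B' v)) \<in> generic \<Phi>}"
    by (auto simp: generic_def)
  ultimately show ?thesis
    unfolding disjoint_pairs_eq by (intro connected_continuous_image continuous_on_pairs_map) simp
qed

lemma connected_generic: "connected (generic \<Phi>)"
proof -
  have "connected {c \<in> UNIV. mp_eval \<Phi> (Poly_Mapping.lookup (form c)) \<noteq> 0}"
  proof (rule connected_nonzero_set)
    fix x y :: tensor
    let ?l = "\<lambda>z. cs3 (1 - z) x + cs3 z y"
    have "?l 0 = x" "?l 1 = y" by (simp_all add: vec_eq_iff)
    moreover have "continuous_on UNIV ?l"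
      unfolding cs3_def cs2_def by (intro continuous_on_vec_lambda continuous_intros continuous_on_cmul_vec)
    moreover have "(\<lambda>z. mp_eval \<Phi> (Poly_Mapping.lookup (form (?l z)))) holomorphic_on UNIV"
      by (intro holomorphic_on_mp_eval holomorphic_on_lookup_form) (simp, intro holomorphic_intros)
    ultimately show "\<exists>l. l 0 = x \<and> l 1 = y \<and> (\<forall>z. l z \<in> UNIV) \<and> continuous_on UNIV l \<and>
        (\<lambda>z. mp_eval \<Phi> (Poly_Mapping.lookup (form (l z)))) holomorphic_on UNIV"
      by (intro exI[of _ ?l]) simp
  qed
  then show ?thesis by (simp add: generic_def)
qed

lemma open_generic: "open (generic \<Phi>)"
proof -
  have "continuous_on UNIV (\<lambda>c. Poly_Mapping.lookup (form c) m)" for m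
  proof -
    have "continuous_on UNIV (\<lambda>c :: tensor. c $ a $ b $ d when mon3 a b d = m)" for a b d
      by (cases "mon3 a b d = m") (auto intro!: continuous_intros)
    then show ?thesis unfolding lookup_form by (intro continuous_intros)
  qed
  then have "continuous_on UNIV (\<lambda>c. mp_eval \<Phi> (Poly_Mapping.lookup (form c)))"
    unfolding mp_eval_eq mon_val_def by (intro continuous_intros)
  then show ?thesis unfolding generic_def by (intro open_Collect_neq) auto
qed

theorem connected_plane_frames:
  assumes "\<And>c. c \<in> generic \<Phi> \<Longrightarrow> nonsingular c \<and> tangency_free c" and c: "c \<in> generic \<Phi>"
  shows "connected (plane_frames c)"
proof (rule plane_frames_connected_if[OF _ _ c])
  show "regular_point c B" if "c \<in> generic \<Phi>" "B \<in> plane_frames c" for c B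
    using assms(1)[OF that(1)] that(2) by (intro regular_point_if_generic) (auto simp: plane_frames_def)
  have "connected (plane_pairs (generic \<Phi>))"
  proof (rule connected_intermediate_closure[OF connected_disjoint_pairs[of \<Phi>]])
    show "disjoint_pairs (generic \<Phi>) \<subseteq> plane_pairs (generic \<Phi>)" by (auto simp: disjoint_pairs_def)
    show "plane_pairs (generic \<Phi>) \<subseteq> closure (disjoint_pairs (generic \<Phi>))"
      by (rule disjoint_pairs_dense[OF open_generic])
  qed
  then show "connected {(c, x, y). c \<in> generic \<Phi> \<and> x \<in> plane_frames c \<and> y \<in> plane_frames c}"
    by (simp add: plane_pairs_def)
qed

section \<open>Existence of planes\<close>

text \<open>On the complex line from c1 to a generic c2, the nongeneric parameters are countable,
  while those near 0 are uncountable.\<close>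

lemma open_generic_dense:
  assumes V: "open V" "c1 \<in> V" and ne: "c2 \<in> generic \<Phi>"
  obtains c where "c \<in> V" "c \<in> generic \<Phi>"
proof -
  let ?l = "\<lambda>z. cs3 (1 - z) c1 + cs3 z c2"
  let ?g = "\<lambda>z. mp_eval \<Phi> (Poly_Mapping.lookup (form (?l z)))"
  have "?l 0 = c1" "?l 1 = c2" by (simp_all add: vec_eq_iff)
  note l01 = this
  have cont: "continuous_on UNIV ?l"
    unfolding cs3_def cs2_def by (intro continuous_on_vec_lambda continuous_intros continuous_on_cmul_vec)
  have "?g holomorphic_on UNIV"
    by (intro holomorphic_on_mp_eval holomorphic_on_lookup_form) (simp, intro holomorphic_intros)
  then have cz: "countable {z. ?g z = 0}"
    by (rule countable_zeros_entire[of _ 1]) (use ne l01 in \<open>simp add: generic_def\<close>)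
  have "open (?l -` V)" using continuous_on_open_vimage[OF open_UNIV] cont V(1) by auto
  moreover have "0 \<in> ?l -` V" using l01 V(2) by simp
  ultimately obtain e where e: "e > 0" "ball 0 e \<subseteq> ?l -` V" unfolding open_contains_ball by blast
  have "\<not> ball 0 e \<subseteq> {z. ?g z = 0}"
    using uncountable_ball[OF e(1), of "0 :: complex"] countable_subset cz by blast
  with e(2) have "\<not> ?l -` V \<subseteq> {z. ?g z = 0}" by blast
  then obtain z where "?l z \<in> V" "?g z \<noteq> 0" by blast
  then show thesis by (intro that[of "?l z"]) (auto simp: generic_def)
qed

text \<open>Marks the products x_i x_j y_l of the sample cubic, each under one ordering of i and j
  only.\<close>

definition sample_mon :: "3 \<Rightarrow> 3 \<Rightarrow> 4 \<Rightarrow> bool" where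
  "sample_mon i j l \<longleftrightarrow> (l = 1 \<and> i = 1 \<and> j = 1) \<or> (l = 2 \<and> i = 2 \<and> j = 2) \<or> (l = 3 \<and> i = 3 \<and> j = 3)
     \<or> (l = 4 \<and> i = 1 \<and> j = 2)"

text \<open>The cubic \<open>x\<^sub>1\<^sup>2 y\<^sub>1 + x\<^sub>2\<^sup>2 y\<^sub>2 + x\<^sub>3\<^sup>2 y\<^sub>3 + x\<^sub>1 x\<^sub>2 y\<^sub>4\<close> contains the plane \<open>y = 0\<close>.\<close>

lemma ex_regular_plane: "\<exists>c B. B \<in> plane_frames c \<and> regular_point c B"
proof -
  have "\<exists>\<pi>. bij_betw \<pi> (UNIV :: (3 + 4) set) (UNIV :: 7 set)"
    by (intro finite_same_card_bij) auto
  then obtain \<pi> :: "3 + 4 \<Rightarrow> 7" where \<pi>: "bij \<pi>" by blast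
  then have inv [simp]: "inv \<pi> (\<pi> s) = s" and inj: "\<pi> s = \<pi> s' \<longleftrightarrow> s = s'" for s s'
    by (simp_all add: bij_is_inj inj_eq)
  \<comment> \<open>The entries 6 cancel the denominator of \<open>polar\<close>.\<close>
  define c :: tensor where "c = (\<chi> a b d. case (inv \<pi> a, inv \<pi> b, inv \<pi> d) of
      (Inl i, Inl j, Inr l) \<Rightarrow> if sample_mon i j l then 6 else 0 | _ \<Rightarrow> 0)"
  define B :: "complex ^ 7 ^ 3" where "B = (\<chi> i. axis (\<pi> (Inl i)) 1)"
  have v: "vanishes c B"
    by (simp add: vanishes_def B_def polar_def tri_axis c_def)
  have p: "polar c (B $ i) (B $ j) (axis (\<pi> (Inr l)) 1) =
      (if sample_mon i j l then 1 else 0) + (if sample_mon j i l then 1 else 0)" for i j l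
    by (simp add: B_def polar_def tri_axis c_def)
  have fr: "frame B"
    unfolding frame_def
  proof (intro allI impI)
    fix t :: "3 \<Rightarrow> complex" and i
    assume "(\<Sum>i\<in>UNIV. t i *s B $ i) = 0"
    then have "(\<Sum>j\<in>UNIV. t j *s B $ j) $ \<pi> (Inl i) = 0" by simp
    moreover have "(\<Sum>j\<in>UNIV. t j *s B $ j) $ \<pi> (Inl i) = (\<Sum>j\<in>UNIV. if j = i then t j else 0)"
      unfolding sum_component by (intro sum.cong refl) (auto simp: B_def axis_def inj)
    ultimately show "t i = 0" by simp
  qed
  have "regular_point c B"
    unfolding regular_point_def
  proof (intro allI impI)
    fix a :: "3 \<Rightarrow> 3 \<Rightarrow> 3 \<Rightarrow> complex" and i j k
    assume sym: "\<forall>i j k. a i j k = a j i k \<and> a i j k = a i k j"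
      and z: "\<forall>k v. (\<Sum>i\<in>UNIV. \<Sum>j\<in>UNIV. a i j k * polar c (B $ i) (B $ j) v) = 0"
    have z': "(\<Sum>i\<in>UNIV. \<Sum>j\<in>UNIV. a i j k * ((if sample_mon i j l then 1 else 0) + (if sample_mon j i l then 1 else 0))) = 0" for k l
      using z[THEN spec, of k, THEN spec, of "axis (\<pi> (Inr l)) 1"] unfolding p .
    \<comment> \<open>This is why the four quadrics were chosen: every cubic monomial in three
      variables is divisible by x_1^2, x_2^2, x_3^2 or x_1 x_2, so all entries of \<open>a\<close>
      vanish.\<close>
    have d: "a 1 1 k = 0" "a 2 2 k = 0" "a 3 3 k = 0" "a 1 2 k + a 2 1 k = 0" for k
      using z'[of k 1] z'[of k 2] z'[of k 3] z'[of k 4]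
      by (simp_all add: sum_UNIV_3 sample_mon_def)
    have s: "a i j k = a j i k" "a i j k = a i k j" for i j k using sym by blast+
    have d12: "a 1 2 k = 0" for k using d(4)[of k] s(1)[of 2 1 k] by simp
    have "\<forall>i j k. a i j k = 0"
      unfolding forall_3 using d d12 s by metis
    then show "a i j k = 0" by blast
  qed
  then show ?thesis using fr v by (auto simp: plane_frames_def)
qed

lemma plane_frames_nonempty:
  assumes gen: "\<And>c. c \<in> generic \<Phi> \<Longrightarrow> nonsingular c \<and> tangency_free c" and c: "c \<in> generic \<Phi>"
  shows "plane_frames c \<noteq> {}"
proof -
  let ?G = "generic \<Phi>"
  let ?A = "{c \<in> ?G. plane_frames c \<noteq> {}}"
  have reg: "regular_point c B" if "c \<in> ?G" "B \<in> plane_frames c" for c B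
    using gen[OF that(1)] that(2) by (intro regular_point_if_generic) (auto simp: plane_frames_def)
  have "openin (top_of_set ?G) ?A"
  proof (subst openin_subopen, intro ballI)
    fix c0 assume "c0 \<in> ?A"
    then obtain B0 where c0: "c0 \<in> ?G" "B0 \<in> plane_frames c0" by blast
    obtain V where V: "open V" "c0 \<in> V" "\<And>c. c \<in> V \<Longrightarrow> \<exists>B\<in>UNIV. B \<in> plane_frames c"
      by (rule plane_frames_persist[OF reg[OF c0] c0(2) open_UNIV UNIV_I]) (rule that)
    show "\<exists>T. openin (top_of_set ?G) T \<and> c0 \<in> T \<and> T \<subseteq> ?A"
      using V c0 by (intro exI[of _ "?G \<inter> V"]) auto
  qed
  moreover have "openin (top_of_set ?G) (?G - ?A)"
  proof (subst openin_subopen, intro ballI)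
    fix c0 assume "c0 \<in> ?G - ?A"
    then have c0: "c0 \<in> ?G" "plane_frames c0 = {}" by auto
    \<comment> \<open>Having no plane is an open condition, because every plane has an orthonormal
      frame and these form a compact set.\<close>
    have "\<not> vanishes c0 z" if "z \<in> stiefel" for z
      using c0(2) stiefel_frame[OF that] by (auto simp: plane_frames_def)
    note none = this
    obtain V where V: "open V" "c0 \<in> V" "\<And>c z. c \<in> V \<Longrightarrow> z \<in> stiefel \<Longrightarrow> \<not> vanishes c z"
      by (rule compact_vanishing_persist[OF compact_stiefel none]) (assumption, rule that)
    have "plane_frames c = {}" if "c \<in> V" for c
    proof (rule ccontr)
      assume "plane_frames c \<noteq> {}"
      then obtain B where B: "B \<in> plane_frames c" by blast
      then have "gs B \<in> stiefel" by (intro gs_stiefel) (simp add: plane_frames_def)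
      then show False using V(3)[OF that] vanishes_gs[OF B] by blast
    qed
    then show "\<exists>T. openin (top_of_set ?G) T \<and> c0 \<in> T \<and> T \<subseteq> ?G - ?A"
      using V(1,2) c0 by (intro exI[of _ "?G \<inter> V"]) auto
  qed
  moreover have "?A \<noteq> {}"
  proof -
    \<comment> \<open>The sample cubic may fail to be generic. Its regular plane persists on an open
      set of cubics, and that set contains a generic one.\<close>
    obtain c1 B1 where c1: "B1 \<in> plane_frames c1" "regular_point c1 B1" using ex_regular_plane by blast
    obtain V where V: "open V" "c1 \<in> V" "\<And>c. c \<in> V \<Longrightarrow> \<exists>B\<in>UNIV. B \<in> plane_frames c"
      by (rule plane_frames_persist[OF c1(2,1) open_UNIV UNIV_I]) (rule that)
    obtain c' where "c' \<in> V" "c' \<in> ?G" by (rule open_generic_dense[OF V(1,2) c])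
    then show ?thesis using V(3) by blast
  qed
  ultimately have "?A = ?G"
    using connected_generic[of \<Phi>] unfolding connected_clopen closedin_def topspace_euclidean_subtopology by blast
  then show ?thesis using c by blast
qed

section \<open>Charts of the Grassmannian\<close>

definition gr_mat :: "(3 + 4 \<Rightarrow> 7) \<Rightarrow> (chart_var \<Rightarrow> complex) \<Rightarrow> complex ^ 7 ^ 3" where
  "gr_mat \<pi> A = (\<chi> i. gr_row \<pi> A i)"

lemma gr_mat_nth:
  assumes "bij \<pi>"
  shows "gr_mat \<pi> A $ i $ \<pi> (Inl l) = (if l = i then 1 else 0)" "gr_mat \<pi> A $ i $ \<pi> (Inr j) = A (i, j)"
  using assms by (simp_all add: gr_mat_def gr_row_def gr_entry_def bij_is_inj)

lemma fspan_gr_mat: "fspan (gr_mat \<pi> A) = gr_chart \<pi> A"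
proof -
  have "range (($) (gr_mat \<pi> A)) = range (gr_row \<pi> A)" by (simp add: gr_mat_def image_def)
  then show ?thesis unfolding span_frame[symmetric] gr_chart_def by simp
qed

lemma mult_nth_rows: "(T ** B) $ i = (\<Sum>l\<in>UNIV. T $ i $ l *s B $ l)"
  for T :: "complex ^ 3 ^ 3" and B :: "complex ^ 7 ^ 3"
  by (simp add: vec_eq_iff matrix_matrix_mult_def)

lemma fspan_subset_iff: "fspan B \<subseteq> fspan B' \<longleftrightarrow> (\<exists>T. B = T ** B')"
proof
  assume "fspan B \<subseteq> fspan B'"
  then have "B $ i \<in> fspan B'" for i using fspan_nth[of B] by blast
  then have "\<forall>i. \<exists>t :: 3 \<Rightarrow> complex. B $ i = (\<Sum>l\<in>UNIV. t l *s B' $ l)"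
    unfolding fspan_def image_iff by blast
  then obtain t where "\<And>i. B $ i = (\<Sum>l\<in>UNIV. t i l *s B' $ l)" by metis
  then have "B = (\<chi> i l. t i l) ** B'" by (subst vec_eq_iff) (simp add: mult_nth_rows)
  then show "\<exists>T. B = T ** B'" ..
next
  assume "\<exists>T. B = T ** B'"
  then obtain T where T: "B = T ** B'" ..
  have "B $ i \<in> fspan B'" for i unfolding T mult_nth_rows by (rule fspanI)
  then have "vec.span (range (($) B)) \<subseteq> fspan B'"
    by (intro vec.span_minimal subspace_fspan) auto
  then show "fspan B \<subseteq> fspan B'" by (simp only: span_frame)
qed

lemma fspan_mult:
  assumes "T' ** T = mat 1"
  shows "fspan (T ** B) = fspan B"
proof
  show "fspan (T ** B) \<subseteq> fspan B" by (auto simp: fspan_subset_iff)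
  have "B = T' ** (T ** B)" by (simp add: matrix_mul_assoc assms)
  then show "fspan B \<subseteq> fspan (T ** B)" unfolding fspan_subset_iff ..
qed

lemma mat7_eqI:
  assumes "bij (\<pi> :: 3 + 4 \<Rightarrow> 7)" "\<And>i l. B $ i $ \<pi> (Inl l) = B' $ i $ \<pi> (Inl l)" "\<And>i j. B $ i $ \<pi> (Inr j) = B' $ i $ \<pi> (Inr j)"
  shows "B = (B' :: complex ^ 7 ^ 3)"
proof (rule vec_eq_iff[THEN iffD2], rule allI, rule vec_eq_iff[THEN iffD2], rule allI)
  fix i k
  obtain s where "k = \<pi> s" using assms(1) by (meson bij_pointE)
  then show "B $ i $ k = B' $ i $ k" using assms(2,3) by (cases s) auto
qed

text \<open>The numerators in Cramer's rule for the chart coordinates of the row space of B: pivot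
  column i is exchanged for the nonpivot column j.\<close>

definition chart_minor :: "(3 + 4 \<Rightarrow> 7) \<Rightarrow> complex ^ 7 ^ 3 \<Rightarrow> chart_var \<Rightarrow> complex" where
  "chart_minor \<pi> B = (\<lambda>(i, j). minor B ((\<lambda>l. \<pi> (Inl l))(i := \<pi> (Inr j))))"

text \<open>Cramer's rule for B = M ** \<open>gr_mat \<pi> A\<close>, where M is necessarily the
  pivot block of B. Chart coordinates thereby become ratios of minors of any frame.\<close>

lemma fspan_eq_chart_iff:
  assumes \<pi>: "bij \<pi>"
  shows "fspan B = gr_chart \<pi> A \<longleftrightarrow> minor B (\<lambda>l. \<pi> (Inl l)) \<noteq> 0 \<and>
     A = (\<lambda>v. chart_minor \<pi> B v / minor B (\<lambda>l. \<pi> (Inl l)))"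
proof -
  define M where "M = (\<chi> i l. B $ i $ \<pi> (Inl l))"
  have D: "minor B (\<lambda>l. \<pi> (Inl l)) = det M" by (simp add: minor_def M_def)
  have X: "chart_minor \<pi> B (i, j) = det (\<chi> i' l. if l = i then (\<chi> i'. B $ i' $ \<pi> (Inr j)) $ i' else M $ i' $ l)" for i j
    unfolding chart_minor_def minor_def M_def by (auto intro!: arg_cong[where f = det] simp: vec_eq_iff)
  have cr: "det M \<noteq> 0 \<Longrightarrow> M *v (\<chi> i. A (i, j)) = (\<chi> i'. B $ i' $ \<pi> (Inr j)) \<longleftrightarrow> (\<forall>i. A (i, j) = chart_minor \<pi> B (i, j) / det M)" for j
    unfolding cramer X by (simp add: vec_eq_iff)
  have mult: "(T ** gr_mat \<pi> A) $ i $ \<pi> (Inl l) = T $ i $ l"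
    "(T ** gr_mat \<pi> A) $ i $ \<pi> (Inr j) = (T *v (\<chi> i. A (i, j))) $ i" for T :: "complex ^ 3 ^ 3" and i l j
    by (simp_all add: matrix_matrix_mult_def matrix_vector_mult_def gr_mat_nth[OF \<pi>] mult_delta_right)
  show ?thesis
  proof
    assume "fspan B = gr_chart \<pi> A"
    then have eq: "fspan B = fspan (gr_mat \<pi> A)" by (simp add: fspan_gr_mat)
    then obtain T where T: "B = T ** gr_mat \<pi> A" using fspan_subset_iff[of B "gr_mat \<pi> A"] by auto
    obtain T' where T': "gr_mat \<pi> A = T' ** B" using eq fspan_subset_iff[of "gr_mat \<pi> A" B] by auto
    have MT: "M = T" by (simp add: vec_eq_iff M_def T mult)
    have "T' ** M = mat 1"
    proof (rule vec_eq_iff[THEN iffD2], rule allI, rule vec_eq_iff[THEN iffD2], rule allI)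
      fix i l
      have "(T' ** M) $ i $ l = (T' ** B) $ i $ \<pi> (Inl l)" by (simp add: matrix_matrix_mult_def M_def)
      also have "\<dots> = mat 1 $ i $ l" by (simp add: T'[symmetric] gr_mat_nth[OF \<pi>] mat_def)
      finally show "(T' ** M) $ i $ l = mat 1 $ i $ l" .
    qed
    then have "det T' * det M = 1" by (metis det_mul det_I)
    then have d: "det M \<noteq> 0" by auto
    moreover have "M *v (\<chi> i. A (i, j)) = (\<chi> i'. B $ i' $ \<pi> (Inr j))" for j
      by (simp add: vec_eq_iff MT T mult)
    ultimately have "A (i, j) = chart_minor \<pi> B (i, j) / det M" for i j using cr by blast
    then show "minor B (\<lambda>l. \<pi> (Inl l)) \<noteq> 0 \<and> A = (\<lambda>v. chart_minor \<pi> B v / minor B (\<lambda>l. \<pi> (Inl l)))"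
      using d by (auto simp: D)
  next
    assume R: "minor B (\<lambda>l. \<pi> (Inl l)) \<noteq> 0 \<and> A = (\<lambda>v. chart_minor \<pi> B v / minor B (\<lambda>l. \<pi> (Inl l)))"
    then have d: "det M \<noteq> 0" by (simp add: D)
    have "M *v (\<chi> i. A (i, j)) = (\<chi> i'. B $ i' $ \<pi> (Inr j))" for j
      using cr[OF d, of j] R by (simp add: D)
    then have e: "(M *v (\<chi> i. A (i, j))) $ i' = B $ i' $ \<pi> (Inr j)" for i' j by simp
    have "B = M ** gr_mat \<pi> A"
      by (rule mat7_eqI[OF \<pi>]) (simp_all add: mult e, simp add: M_def)
    moreover obtain M' where "M' ** M = mat 1"
      using d by (metis invertible_det_nz invertible_def)
    ultimately show "fspan B = gr_chart \<pi> A" using fspan_mult by (metis fspan_gr_mat)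
  qed
qed

lemma frame_in_chart:
  assumes "frame B"
  obtains \<pi> A where "bij \<pi>" "fspan B = gr_chart \<pi> A"
proof -
  obtain \<pi> T T' where \<pi>: "bij (\<pi> :: 3 + 4 \<Rightarrow> 7)" and T: "T ** T' = mat 1" "T' ** T = mat 1"
    and piv: "\<And>i j. (T ** B) $ i $ \<pi> (Inl j) = (if i = j then 1 else 0)"
    by (rule frame_pivots[OF assms]) (rule that)
  have "(\<chi> i j. (T ** B) $ i $ \<pi> (Inl j)) = mat 1" by (simp add: vec_eq_iff mat_def piv)
  then have "minor (T ** B) (\<lambda>l. \<pi> (Inl l)) \<noteq> 0" unfolding minor_def by simp
  then have "fspan (T ** B) = gr_chart \<pi> (\<lambda>v. chart_minor \<pi> (T ** B) v / minor (T ** B) (\<lambda>l. \<pi> (Inl l)))"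
    using fspan_eq_chart_iff[OF \<pi>] by blast
  then show thesis using that[OF \<pi>] fspan_mult[OF T(2)] by metis
qed

lemma Gr37_frame:
  assumes "W \<in> Gr37"
  obtains B where "frame B" "W = fspan B"
proof -
  have W: "vec.subspace W" "vec.dim W = 3" using assms by (auto simp: Gr37_def)
  obtain S where S: "S \<subseteq> W" "vec.independent S" "W \<subseteq> vec.span S" "card S = vec.dim W"
    by (rule vec.basis_exists)
  have "finite S" using S(2) by (rule vec.finiteI_independent)
  then have "\<exists>e. bij_betw e (UNIV :: 3 set) S" using S(4) W(2) by (intro finite_same_card_bij) auto
  then obtain e where e: "bij_betw e (UNIV :: 3 set) S" ..
  define B where "B = (\<chi> i. e i)"
  have Bn: "($) B = e" by (simp add: B_def fun_eq_iff)
  have inj: "inj e" and ran: "range e = S" using e by (auto simp: bij_betw_def)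
  have "frame B"
    unfolding frame_def
  proof (intro allI impI)
    fix t :: "3 \<Rightarrow> complex" and i
    assume z: "(\<Sum>i\<in>UNIV. t i *s B $ i) = 0"
    have "(\<Sum>v\<in>S. t (inv e v) *s v) = (\<Sum>i\<in>UNIV. t (inv e (e i)) *s e i)"
      unfolding ran[symmetric] by (rule sum.reindex[OF inj, unfolded o_def])
    also have "\<dots> = 0" using z inj by (simp add: Bn)
    finally have "\<forall>v\<in>S. t (inv e v) = 0"
      using S(2) \<open>finite S\<close> by (auto simp: vec.dependent_finite)
    then have "t (inv e (e i)) = 0" using ran by blast
    then show "t i = 0" using inj by simp
  qed
  moreover have "W = fspan B"
    unfolding span_frame[symmetric] Bn ran using S(1,3) vec.span_minimal[OF S(1) W(1)] by blast
  ultimately show thesis by (rule that)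
qed

lemma planes_form: "planes (form c) = fspan ` plane_frames c"
proof
  show "planes (form c) \<subseteq> fspan ` plane_frames c"
  proof
    fix W assume W: "W \<in> planes (form c)"
    then obtain B where B: "frame B" "W = fspan B" by (auto simp: planes_def elim: Gr37_frame)
    have "vanishes c B" using W B(2) by (intro vanishes_if_cubic) (auto simp: planes_def mp_eval_form)
    then show "W \<in> fspan ` plane_frames c" using B by (auto simp: plane_frames_def)
  qed
  show "fspan ` plane_frames c \<subseteq> planes (form c)"
    by (auto simp: planes_def plane_frames_def Gr37_def subspace_fspan dim_fspan mp_eval_form polar_fspan)
qed

section \<open>Irreducibility\<close>

text \<open>Holomorphy is tested on curves only, which is enough to reduce the identity theorem on
  the manifold of frames to one variable.\<close>

definition curve_holomorphic :: "(complex ^ 7 ^ 3 \<Rightarrow> complex) \<Rightarrow> bool" where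
  "curve_holomorphic G \<longleftrightarrow>
     (\<forall>\<beta> S. (\<forall>i k. (\<lambda>z. \<beta> z $ i $ k) holomorphic_on S) \<longrightarrow> (\<lambda>z. G (\<beta> z)) holomorphic_on S)"

text \<open>Z, the interior of the zero set of G in the frames, is clopen. If a local product meets
  Z, every other point of it is joined to a point of Z by a complex line in the coordinates, and the
  one-variable identity theorem applies.\<close>

lemma plane_frames_identity:
  assumes reg: "\<And>B. B \<in> plane_frames c \<Longrightarrow> regular_point c B" and conn: "connected (plane_frames c)"
    and G: "curve_holomorphic G"
    and T: "open T" "B1 \<in> T" "B1 \<in> plane_frames c" "\<And>B. B \<in> T \<Longrightarrow> B \<in> plane_frames c \<Longrightarrow> G B = 0"
    and B: "B \<in> plane_frames c"
  shows "G B = 0"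
proof -
  let ?F = "plane_frames c"
  define Z where "Z = {B \<in> ?F. \<exists>T. open T \<and> B \<in> T \<and> (\<forall>B'\<in>T \<inter> ?F. G B' = 0)}"
  have loc: "\<exists>O1. open O1 \<and> B0 \<in> O1 \<and> (O1 \<inter> Z \<noteq> {} \<longrightarrow> (\<forall>B\<in>O1 \<inter> ?F. G B = 0))" if B0: "B0 \<in> ?F" for B0
  proof -
    have N: "open (UNIV \<times> {B. frame B} :: (tensor \<times> (complex ^ 7 ^ 3)) set)" "(c, B0) \<in> UNIV \<times> {B. frame B}"
      using B0 by (auto simp: plane_frames_def intro!: open_Times open_frame)
    have van: "vanishes c B0" using B0 by (simp add: plane_frames_def)
    obtain \<delta> b0 O' h and K :: "(complex ^ 7 ^ 3) set" where d: "\<delta> > 0" "subspace K" "\<And>z b. b \<in> K \<Longrightarrow> cs2 z b \<in> K" and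
      O': "open O'" "O' \<subseteq> UNIV \<times> {B. frame B}" "(c, B0) \<in> O'"
      and h1: "\<And>c' b. c' \<in> ball c \<delta> \<Longrightarrow> b \<in> K \<inter> ball b0 \<delta> \<Longrightarrow> (c', h (c', b)) \<in> O' \<and> vanishes c' (h (c', b))"
      and h2: "\<And>c' B. (c', B) \<in> O' \<Longrightarrow> vanishes c' B \<Longrightarrow> c' \<in> ball c \<delta> \<and> (\<exists>b\<in>K \<inter> ball b0 \<delta>. B = h (c', b))"
      and cont: "continuous_on (ball c \<delta> \<times> ball b0 \<delta>) h"
      and hol: "\<And>c' b d i x. c' \<in> ball c \<delta> \<Longrightarrow> (\<lambda>z. h (c', b + cs2 z d) $ i $ x) holomorphic_on {z. b + cs2 z d \<in> ball b0 \<delta>}"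
      by (rule local_product[OF reg[OF B0] van N]) (rule that)
    have cb: "c \<in> ball c \<delta>" using d(1) by simp
    have fr: "h (c, b) \<in> ?F" if "b \<in> K \<inter> ball b0 \<delta>" for b
      using h1[OF cb that] O'(2) by (auto simp: plane_frames_def)
    define O1 where "O1 = {B. (c, B) \<in> O'}"
    have "O1 = (\<lambda>B. (c, B)) -` O'" by (auto simp: O1_def)
    moreover have "open ((\<lambda>B. (c, B)) -` O')" by (intro open_vimage O'(1) continuous_intros)
    ultimately have "open O1" by simp
    moreover have "B0 \<in> O1" using O'(3) by (simp add: O1_def)
    moreover have "G B = 0" if B: "B \<in> O1" "B \<in> ?F" and Z1: "B1 \<in> O1" "B1 \<in> Z" for B B1
    proof -
      obtain b where b: "b \<in> K \<inter> ball b0 \<delta>" "B = h (c, b)" using h2[of c B] B by (auto simp: O1_def plane_frames_def)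
      obtain b1 where b1: "b1 \<in> K \<inter> ball b0 \<delta>" "B1 = h (c, b1)"
        using h2[of c B1] Z1 by (auto simp: O1_def plane_frames_def Z_def)
      obtain T where T: "open T" "B1 \<in> T" "\<forall>B'\<in>T \<inter> ?F. G B' = 0" using Z1(2) by (auto simp: Z_def)
      \<comment> \<open>The complex line through b1 and b stays in K because K is a complex
        subspace. Its parameters inside the ball form a convex open set D, hence a connected
        one.\<close>
      define l where "l = (\<lambda>z. b1 + cs2 z (b - b1))"
      define D where "D = {z. l z \<in> ball b0 \<delta>}"
      have l01: "l 0 = b1" "l 1 = b" by (simp_all add: l_def vec_eq_iff)
      have lK: "l z \<in> K" for z
        unfolding l_def using b(1) b1(1) by (intro subspace_add d subspace_diff) auto
      have lcont: "continuous_on S l" for S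
        unfolding l_def cs2_def by (intro continuous_on_add continuous_on_const continuous_on_vec_lambda continuous_on_cmul_vec continuous_on_id)
      have D01: "0 \<in> D" "1 \<in> D" using b(1) b1(1) l01 by (simp_all add: D_def)
      have "D = l -` ball b0 \<delta>" by (auto simp: D_def)
      then have openD: "open D" using continuous_on_open_vimage[OF open_UNIV] lcont by (metis Int_UNIV_right open_ball)
      have "convex D"
      proof (rule convexI)
        fix x y and u v :: real assume xy: "x \<in> D" "y \<in> D" and uv: "0 \<le> u" "0 \<le> v" "u + v = 1"
        have u: "u = 1 - v" using uv(3) by simp
        have "l (u *\<^sub>R x + v *\<^sub>R y) = u *\<^sub>R l x + v *\<^sub>R l y"
          unfolding l_def u by (simp add: vec_eq_iff complex_eq_iff algebra_simps)
        then show "u *\<^sub>R x + v *\<^sub>R y \<in> D"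
          using convexD[OF convex_ball, of "l x" b0 \<delta> "l y" u v] xy uv by (simp add: D_def)
      qed
      then have connD: "connected D" by (rule convex_connected)
      have hcont: "continuous_on D (\<lambda>z. h (c, l z))"
        using d(1) by (intro continuous_on_compose2[OF cont] continuous_intros lcont) (auto simp: D_def)
      define E where "E = (\<lambda>z. h (c, l z)) -` T \<inter> D"
      have "open E" unfolding E_def using continuous_on_open_vimage[OF openD] hcont T(1) by blast
      moreover have "0 \<in> E" using D01 T(2) b1(2) l01 by (simp add: E_def)
      moreover have "G (h (c, l z)) = 0" if "z \<in> E" for z
        using that T(3) fr[of "l z"] lK by (auto simp: E_def D_def)
      moreover have "(\<lambda>z. G (h (c, l z))) holomorphic_on D"
        using G[unfolded curve_holomorphic_def, THEN spec, of "\<lambda>z. h (c, l z)", THEN spec, of D] hol[OF cb, of b1 "b - b1"]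
        unfolding D_def l_def by blast
      ultimately have "G (h (c, l 1)) = 0"
        using openD connD D01 analytic_continuation_open[of E D "\<lambda>z. G (h (c, l z))" "\<lambda>_. 0" 1]
        by (auto simp: E_def)
      then show ?thesis using l01 b(2) by simp
    qed
    ultimately show ?thesis by (intro exI[of _ O1]) blast
  qed
  have "openin (top_of_set ?F) Z"
  proof (subst openin_subopen, intro ballI)
    fix B assume "B \<in> Z"
    then obtain T where "B \<in> ?F" "open T" "B \<in> T" "\<forall>B'\<in>T \<inter> ?F. G B' = 0" by (auto simp: Z_def)
    then show "\<exists>T. openin (top_of_set ?F) T \<and> B \<in> T \<and> T \<subseteq> Z"
      by (intro exI[of _ "?F \<inter> T"]) (auto simp: Z_def)
  qed
  moreover have "openin (top_of_set ?F) (?F - Z)"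
  proof (subst openin_subopen, intro ballI)
    fix B0 assume B0: "B0 \<in> ?F - Z"
    then obtain O1 where O1: "open O1" "B0 \<in> O1" "O1 \<inter> Z \<noteq> {} \<longrightarrow> (\<forall>B\<in>O1 \<inter> ?F. G B = 0)" using loc by blast
    then have "O1 \<inter> Z = {}" using B0 by (auto simp: Z_def)
    then show "\<exists>T. openin (top_of_set ?F) T \<and> B0 \<in> T \<and> T \<subseteq> ?F - Z"
      using O1 B0 by (intro exI[of _ "?F \<inter> O1"]) auto
  qed
  moreover have "B1 \<in> Z" using T by (auto simp: Z_def)
  moreover have "Z \<subseteq> ?F" by (auto simp: Z_def)
  ultimately have "Z = ?F"
    using conn unfolding connected_clopen closedin_def topspace_euclidean_subtopology by blast
  then show ?thesis using B by (auto simp: Z_def)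
qed

lemma curve_holomorphic_minor: "curve_holomorphic (\<lambda>B. minor B K)"
  unfolding curve_holomorphic_def minor_def by (intro allI impI holomorphic_on_det) simp

text \<open>Chart coordinates are ratios of minors. Multiplying by powers of the pivot minor clears
  the denominators, and one more factor makes G vanish outside the chart.\<close>

lemma chart_nonzero_locus:
  assumes \<pi>: "bij \<pi>"
  obtains G where "curve_holomorphic G" "continuous_on UNIV G"
    "\<And>B. fspan B \<in> gr_chart \<pi> ` {A. mp_eval F A \<noteq> 0} \<longleftrightarrow> G B \<noteq> 0"
proof -
  let ?D = "\<lambda>B. minor B (\<lambda>l. \<pi> (Inl l))"
  \<comment> \<open>Any common bound for the degrees of the monomials of F would do; the sum of the
    degrees is one.\<close>
  define N where "N = (\<Sum>m\<in>Poly_Mapping.keys F. mon_degree m)"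
  define G where "G = (\<lambda>B. ?D B * (\<Sum>m\<in>Poly_Mapping.keys F. Poly_Mapping.lookup F m * (?D B ^ (N - mon_degree m) * mon_val (chart_minor \<pi> B) m)))"
  have chol: "curve_holomorphic G"
    unfolding curve_holomorphic_def G_def mon_val_def
  proof (intro allI impI holomorphic_intros)
    fix \<beta> :: "complex \<Rightarrow> complex ^ 7 ^ 3" and S assume b: "\<forall>i k. (\<lambda>z. \<beta> z $ i $ k) holomorphic_on S"
    have m: "(\<lambda>z. minor (\<beta> z) K) holomorphic_on S" for K
      using curve_holomorphic_minor b unfolding curve_holomorphic_def by blast
    show "(\<lambda>z. minor (\<beta> z) (\<lambda>l. \<pi> (Inl l))) holomorphic_on S" by (rule m)
    then show "(\<lambda>z. minor (\<beta> z) (\<lambda>l. \<pi> (Inl l))) holomorphic_on S" .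
    show "(\<lambda>z. chart_minor \<pi> (\<beta> z) v) holomorphic_on S" for v
      unfolding chart_minor_def by (cases v) (simp add: m)
  qed
  have cm: "continuous_on UNIV (\<lambda>B. minor B K)" for K
    unfolding minor_def by (intro continuous_on_det) (auto intro!: continuous_intros)
  have cx: "continuous_on UNIV (\<lambda>B. chart_minor \<pi> B v)" for v
    unfolding chart_minor_def by (cases v) (simp add: cm)
  have cont: "continuous_on UNIV G"
    unfolding G_def mon_val_def by (intro continuous_intros cm cx)
  have "G B \<noteq> 0 \<longleftrightarrow> ?D B \<noteq> 0 \<and> mp_eval F (\<lambda>v. chart_minor \<pi> B v / ?D B) \<noteq> 0" for B
  proof (cases "?D B = 0")
    case True then show ?thesis by (simp add: G_def)
  next
    case False
    have "?D B ^ (N - mon_degree m) * mon_val (chart_minor \<pi> B) m = ?D B ^ N * mon_val (\<lambda>v. chart_minor \<pi> B v / ?D B) m"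
      if "m \<in> Poly_Mapping.keys F" for m
    proof -
      have "mon_degree m \<le> N" unfolding N_def by (rule member_le_sum[OF that]) auto
      then have "?D B ^ N = ?D B ^ (N - mon_degree m) * ?D B ^ mon_degree m" by (simp add: power_add[symmetric])
      moreover have "?D B ^ mon_degree m = (\<Prod>i\<in>Poly_Mapping.keys m. ?D B ^ Poly_Mapping.lookup m i)"
        by (simp add: mon_degree_def power_sum)
      moreover have "(\<Prod>i\<in>Poly_Mapping.keys m. ?D B ^ Poly_Mapping.lookup m i) * mon_val (\<lambda>v. chart_minor \<pi> B v / ?D B) m
          = mon_val (chart_minor \<pi> B) m"
        using False by (simp add: mon_val_def prod.distrib[symmetric] power_divide)
      ultimately show ?thesis by (simp add: mult.assoc)
    qed
    then have "(\<Sum>m\<in>Poly_Mapping.keys F. Poly_Mapping.lookup F m * (?D B ^ (N - mon_degree m) * mon_val (chart_minor \<pi> B) m)) =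
        (\<Sum>m\<in>Poly_Mapping.keys F. Poly_Mapping.lookup F m * (?D B ^ N * mon_val (\<lambda>v. chart_minor \<pi> B v / ?D B) m))"
      by (intro sum.cong refl) simp
    then have "G B = ?D B * (?D B ^ N * mp_eval F (\<lambda>v. chart_minor \<pi> B v / ?D B))"
      unfolding G_def by (simp only: mp_eval_eq sum_distrib_left mult.left_commute)
    then show ?thesis using False by simp
  qed
  moreover have "fspan B \<in> gr_chart \<pi> ` {A. mp_eval F A \<noteq> 0} \<longleftrightarrow> ?D B \<noteq> 0 \<and> mp_eval F (\<lambda>v. chart_minor \<pi> B v / ?D B) \<noteq> 0" for B
    unfolding image_iff mem_Collect_eq Bex_def using fspan_eq_chart_iff[OF \<pi>, of B] by metis
  ultimately show thesis using that[OF chol cont] by blast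
qed

text \<open>Density is meant in the Euclidean topology relative to F. For open sets this dichotomy
  passes to finite intersections and to unions, so it extends from basic Zariski open sets to
  all.\<close>

definition empty_or_dense :: "'a::topological_space set \<Rightarrow> 'a set \<Rightarrow> bool" where
  "empty_or_dense F T \<longleftrightarrow> F \<inter> T = {} \<or> (\<forall>T'. open T' \<longrightarrow> F \<inter> T' \<noteq> {} \<longrightarrow> F \<inter> T \<inter> T' \<noteq> {})"

lemma empty_or_denseD:
  "empty_or_dense F T \<Longrightarrow> F \<inter> T \<noteq> {} \<Longrightarrow> open T' \<Longrightarrow> F \<inter> T' \<noteq> {} \<Longrightarrow> F \<inter> T \<inter> T' \<noteq> {}"
  unfolding empty_or_dense_def by blast

lemma empty_or_dense_Int:
  assumes "empty_or_dense F T1" "empty_or_dense F T2" "open T1"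
  shows "empty_or_dense F (T1 \<inter> T2)"
proof (cases "F \<inter> (T1 \<inter> T2) = {}")
  case True
  then show ?thesis unfolding empty_or_dense_def by (rule disjI1)
next
  case False
  have "F \<inter> (T1 \<inter> T2) \<inter> T' \<noteq> {}" if T': "open T'" "F \<inter> T' \<noteq> {}" for T'
  proof -
    have "F \<inter> T1 \<inter> T' \<noteq> {}" by (rule empty_or_denseD[OF assms(1) _ T']) (use False in blast)
    then have "F \<inter> T2 \<inter> (T1 \<inter> T') \<noteq> {}"
      by (intro empty_or_denseD[OF assms(2)] open_Int assms(3) T') (use False in blast)+
    then show ?thesis by blast
  qed
  then show ?thesis unfolding empty_or_dense_def by blast
qed

lemma empty_or_dense_UN:
  assumes "\<And>i. i \<in> I \<Longrightarrow> empty_or_dense F (T i)"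
  shows "empty_or_dense F (\<Union>i\<in>I. T i)"
proof (cases "\<forall>i\<in>I. F \<inter> T i = {}")
  case True
  then show ?thesis unfolding empty_or_dense_def by blast
next
  case False
  then obtain i where i: "i \<in> I" "F \<inter> T i \<noteq> {}" by blast
  have "F \<inter> (\<Union>i\<in>I. T i) \<inter> T' \<noteq> {}" if "open T'" "F \<inter> T' \<noteq> {}" for T'
    using empty_or_denseD[OF assms[OF i(1)] i(2) that] i(1) by blast
  then show ?thesis unfolding empty_or_dense_def by blast
qed

text \<open>Induction over the generated topology. On a basic set G is nonzero, and if G vanishes on
  some nonempty open set of plane frames, the identity theorem makes it vanish on all of
  them.\<close>

lemma zariski_open_frames:
  assumes reg: "\<And>B. B \<in> plane_frames c \<Longrightarrow> regular_point c B" and conn: "connected (plane_frames c)"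
    and O': "openin gr_zariski O'"
  shows "\<exists>T. open T \<and> {B \<in> plane_frames c. fspan B \<in> O'} = plane_frames c \<inter> T \<and> empty_or_dense (plane_frames c) T"
proof -
  let ?F = "plane_frames c"
  have "generate_topology_on {gr_chart \<pi> ` {A. mp_eval F A \<noteq> 0} | \<pi> F. bij \<pi>} O'"
    using O' unfolding gr_zariski_def openin_topology_generated_by_iff .
  then show ?thesis
  proof induction
    case Empty
    show ?case by (intro exI[of _ "{}"]) (simp add: empty_or_dense_def)
  next
    case (Int a b)
    obtain T1 where T1: "open T1" "{B \<in> ?F. fspan B \<in> a} = ?F \<inter> T1" "empty_or_dense ?F T1" using Int.IH(1) by blast
    obtain T2 where T2: "open T2" "{B \<in> ?F. fspan B \<in> b} = ?F \<inter> T2" "empty_or_dense ?F T2" using Int.IH(2) by blast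
    have "{B \<in> ?F. fspan B \<in> a \<inter> b} = ?F \<inter> (T1 \<inter> T2)" using T1(2) T2(2) by blast
    then show ?case using T1 T2 by (intro exI[of _ "T1 \<inter> T2"]) (simp add: empty_or_dense_Int open_Int)
  next
    case (UN k)
    then have "\<forall>O1\<in>k. \<exists>T. open T \<and> {B \<in> ?F. fspan B \<in> O1} = ?F \<inter> T \<and> empty_or_dense ?F T" by blast
    then obtain T where T: "\<forall>O1\<in>k. open (T O1) \<and> {B \<in> ?F. fspan B \<in> O1} = ?F \<inter> T O1 \<and> empty_or_dense ?F (T O1)"
      by (rule bchoice[THEN exE])
    have "{B \<in> ?F. fspan B \<in> \<Union>k} = (\<Union>O1\<in>k. {B \<in> ?F. fspan B \<in> O1})" by blast
    also have "\<dots> = (\<Union>O1\<in>k. ?F \<inter> T O1)" using T by (intro SUP_cong refl) simp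
    finally have "{B \<in> ?F. fspan B \<in> \<Union>k} = ?F \<inter> (\<Union>O1\<in>k. T O1)" by (simp only: Int_UN_distrib)
    moreover have "empty_or_dense ?F (\<Union>O1\<in>k. T O1)" by (rule empty_or_dense_UN) (use T in simp)
    moreover have "open (\<Union>O1\<in>k. T O1)" by (rule open_UN) (use T in simp)
    ultimately show ?case by blast
  next
    case (Basis s)
    then obtain \<pi> F where s: "bij \<pi>" "s = gr_chart \<pi> ` {A. mp_eval F A \<noteq> 0}" by blast
    obtain G where G: "curve_holomorphic G" "continuous_on UNIV G"
      "\<And>B. fspan B \<in> gr_chart \<pi> ` {A. mp_eval F A \<noteq> 0} \<longleftrightarrow> G B \<noteq> 0"
      by (rule chart_nonzero_locus[OF s(1), of F]) (rule that)
    have "{B \<in> ?F. fspan B \<in> s} = ?F \<inter> {B. G B \<noteq> 0}" unfolding s(2) G(3) by blast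
    moreover have "open {B. G B \<noteq> 0}" using G(2) by (intro open_Collect_neq) auto
    moreover have "empty_or_dense ?F {B. G B \<noteq> 0}"
      unfolding empty_or_dense_def
    proof (rule disjCI)
      assume "\<not> (\<forall>T'. open T' \<longrightarrow> ?F \<inter> T' \<noteq> {} \<longrightarrow> ?F \<inter> {B. G B \<noteq> 0} \<inter> T' \<noteq> {})"
      then obtain T' B1 where T': "open T'" "B1 \<in> T'" "B1 \<in> ?F" "?F \<inter> {B. G B \<noteq> 0} \<inter> T' = {}" by blast
      have z: "G B = 0" if "B \<in> T'" "B \<in> ?F" for B using T'(4) that by blast
      have "G B = 0" if "B \<in> ?F" for B
        by (rule plane_frames_identity[OF reg conn G(1) T'(1-3) z that])
      then show "?F \<inter> {B. G B \<noteq> 0} = {}" by blast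
    qed
    ultimately show ?case by blast
  qed
qed

lemma irreducible_planes:
  assumes reg: "\<And>B. B \<in> plane_frames c \<Longrightarrow> regular_point c B" and conn: "connected (plane_frames c)"
    and ne: "plane_frames c \<noteq> {}"
  shows "irreducible_space (subtopology gr_zariski (planes (form c)))"
proof -
  let ?X = "planes (form c)"
  have "W \<in> topspace gr_zariski" if W: "W \<in> ?X" for W
  proof -
    obtain B where B: "B \<in> plane_frames c" "W = fspan B" using W[unfolded planes_form] by blast
    have "frame B" using B(1) by (simp add: plane_frames_def)
    then obtain \<pi> A where "bij \<pi>" "W = gr_chart \<pi> A"
      unfolding B(2) by (rule frame_in_chart)
    then have "W \<in> gr_chart \<pi> ` {A. mp_eval 1 A \<noteq> 0}" by simp
    then show ?thesis
      unfolding gr_zariski_def topology_generated_by_topspace using \<open>bij \<pi>\<close> by blast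
  qed
  then have top: "topspace (subtopology gr_zariski ?X) = ?X" by auto
  show ?thesis
    unfolding irreducible_space_def top
  proof (intro conjI allI impI)
    show "?X \<noteq> {}" using ne by (simp add: planes_form)
    fix A1 A2
    assume cl: "closedin (subtopology gr_zariski ?X) A1" "closedin (subtopology gr_zariski ?X) A2"
      and un: "A1 \<union> A2 = ?X"
    have op: "\<exists>O1. openin gr_zariski O1 \<and> ?X - A = ?X \<inter> O1" if "closedin (subtopology gr_zariski ?X) A" for A
      using that unfolding closedin_def top openin_subtopology by blast
    obtain O1 O2 where O12: "openin gr_zariski O1" "?X - A1 = ?X \<inter> O1" "openin gr_zariski O2" "?X - A2 = ?X \<inter> O2"
      using op[OF cl(1)] op[OF cl(2)] by blast
    have fr: "\<exists>T. open T \<and> {B \<in> plane_frames c. fspan B \<in> O'} = plane_frames c \<inter> T \<and> empty_or_dense (plane_frames c) T"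
      if "openin gr_zariski O'" for O'
      by (rule zariski_open_frames[OF _ conn that]) (rule reg)
    show "A1 = ?X \<or> A2 = ?X"
    proof (rule ccontr)
      assume "\<not> ?thesis"
      then have "?X \<inter> O1 \<noteq> {}" "?X \<inter> O2 \<noteq> {}" using un O12 by blast+
      note ne12 = this[unfolded planes_form]
      obtain B1 B2 where B12: "B1 \<in> plane_frames c" "fspan B1 \<in> O1" "B2 \<in> plane_frames c" "fspan B2 \<in> O2"
        using ne12 by blast
      obtain T1 where T1: "open T1" "{B \<in> plane_frames c. fspan B \<in> O1} = plane_frames c \<inter> T1"
        "empty_or_dense (plane_frames c) T1"
        using fr[OF O12(1)] by (elim exE conjE) (rule that)
      obtain T2 where T2: "open T2" "{B \<in> plane_frames c. fspan B \<in> O2} = plane_frames c \<inter> T2"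
        using fr[OF O12(3)] by (elim exE conjE) (rule that)
      have "plane_frames c \<inter> T1 \<noteq> {}" "plane_frames c \<inter> T2 \<noteq> {}" using T1(2) T2(2) B12 by blast+
      then have "plane_frames c \<inter> T1 \<inter> T2 \<noteq> {}" by (intro empty_or_denseD T1(3) T2(1))
      then obtain B where "B \<in> plane_frames c" "fspan B \<in> O1" "fspan B \<in> O2" using T1(2) T2(2) by blast
      moreover from this(1) have "fspan B \<in> ?X" unfolding planes_form by (rule imageI)
      ultimately show False using O12 un by blast
    qed
  qed
qed

section \<open>Smoothness\<close>

lemma ideal_gen_base:
  assumes "q \<in> G"
  shows "q \<in> ideal_gen G"
proof -
  have "module ((*) :: 'a \<Rightarrow> 'a \<Rightarrow> 'a)" by standard (auto simp: algebra_simps)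
  then show ?thesis unfolding ideal_gen_def using assms by (rule module.span_base)
qed

text \<open>The coefficient of the monomial m in the ternary cubic with terms f i j k t_i t_j
  t_k.\<close>

definition sum_mon3 :: "(3 \<Rightarrow>\<^sub>0 nat) \<Rightarrow> (3 \<Rightarrow> 3 \<Rightarrow> 3 \<Rightarrow> 'a::comm_monoid_add) \<Rightarrow> 'a" where
  "sum_mon3 m f = (\<Sum>i\<in>UNIV. \<Sum>j\<in>UNIV. \<Sum>k\<in>UNIV. f i j k when mon3 i j k = m)"

lemma sum_mon3_swap:
  "sum_mon3 m (\<lambda>i j k. f j i k) = sum_mon3 m f" "sum_mon3 m (\<lambda>i j k. f i k j) = sum_mon3 m f"
proof -
  show "sum_mon3 m (\<lambda>i j k. f j i k) = sum_mon3 m f"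
    unfolding sum_mon3_def by (subst sum.swap) (simp add: mon3_perm(1))
  have "sum_mon3 m (\<lambda>i j k. f i k j) = (\<Sum>i\<in>UNIV. \<Sum>k\<in>UNIV. \<Sum>j\<in>UNIV. f i k j when mon3 i j k = m)"
    unfolding sum_mon3_def by (intro sum.cong refl sum.swap)
  also have "\<dots> = sum_mon3 m f" unfolding sum_mon3_def by (simp add: mon3_perm(2)[of _ _ "_ :: 3"])
  finally show "sum_mon3 m (\<lambda>i j k. f i k j) = sum_mon3 m f" .
qed

lemma sum_mon3_cmult: "sum_mon3 m (\<lambda>i j k. r * f i j k) = r * sum_mon3 m f" for r :: complex
  unfolding sum_mon3_def sum_distrib_left by (intro sum.cong refl) (simp add: when_def)

lemma sum_mon3_add: "sum_mon3 m (\<lambda>i j k. f i j k + f' i j k) = sum_mon3 m f + sum_mon3 m f'"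
  unfolding sum_mon3_def sum.distrib[symmetric] by (intro sum.cong refl) (simp add: when_def)

text \<open>Coefficients of a cubic form do not change under symmetrisation: the six permuted sums
  coincide.\<close>

lemma sum_mon3_tri:
  "sum_mon3 m (\<lambda>i j k. tri c (B $ i) (B $ j) (B $ k)) = sum_mon3 m (\<lambda>i j k. polar c (B $ i) (B $ j) (B $ k))"
proof -
  let ?t = "\<lambda>i j k. tri c (B $ i) (B $ j) (B $ k)"
  have s: "sum_mon3 m (\<lambda>i j k. ?t i k j) = sum_mon3 m ?t" "sum_mon3 m (\<lambda>i j k. ?t j i k) = sum_mon3 m ?t"
    using sum_mon3_swap[of m ?t] by simp_all
  have s': "sum_mon3 m (\<lambda>i j k. ?t j k i) = sum_mon3 m ?t" "sum_mon3 m (\<lambda>i j k. ?t k i j) = sum_mon3 m ?t"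
    using sum_mon3_swap(1)[of m "\<lambda>i j k. ?t i k j"] sum_mon3_swap(2)[of m "\<lambda>i j k. ?t j i k"] s by simp_all
  have s'': "sum_mon3 m (\<lambda>i j k. ?t k j i) = sum_mon3 m ?t"
    using sum_mon3_swap(1)[of m "\<lambda>i j k. ?t k i j"] s' by simp
  have "sum_mon3 m (\<lambda>i j k. polar c (B $ i) (B $ j) (B $ k)) =
     sum_mon3 m (\<lambda>i j k. (1/6) * (?t i j k + ?t i k j + ?t j i k + ?t j k i + ?t k i j + ?t k j i))"
    by (simp add: polar_def)
  also have "\<dots> = sum_mon3 m ?t"
    unfolding sum_mon3_cmult sum_mon3_add s s' s'' by simp
  finally show ?thesis by simp
qed

lemma sum_product_3:
  fixes X :: "'i \<Rightarrow> 'a::comm_semiring_0"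
  shows "(\<Sum>i\<in>I. X i) * (\<Sum>j\<in>J. Y j) * (\<Sum>k\<in>K. Z k) = (\<Sum>i\<in>I. \<Sum>j\<in>J. \<Sum>k\<in>K. X i * Y j * Z k)"
  unfolding sum_product[of X I Y J] unfolding sum_distrib_right unfolding sum_distrib_left ..

text \<open>Expanding the cubic in the dual frame t turns the formal section into polar values of
  the chart rows, so the equations of the zero scheme become comparable with
  \<open>regular_point\<close>.\<close>

lemma lookup_planes_section:
  "mp_eval (Poly_Mapping.lookup (planes_section \<pi> (form c)) m) A =
     sum_mon3 m (\<lambda>i j k. polar c (gr_mat \<pi> A $ i) (gr_mat \<pi> A $ j) (gr_mat \<pi> A $ k))"
proof -
  let ?h = "\<lambda>c. mp_const (mp_const c) :: (3, (chart_var, complex) mpoly) mpoly"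
  let ?g = "gr_entry \<pi>"
  let ?x = "\<lambda>k. \<Sum>i\<in>UNIV. mp_const (?g i k) * mp_var i :: (3, (chart_var, complex) mpoly) mpoly"
  have h: "ring_map ?h"
    by (simp add: ring_map_def mp_const_def single_add mult_single)
  have x: "?x k = (\<Sum>i\<in>UNIV. Poly_Mapping.single (Poly_Mapping.single i 1) (?g i k))" for k
    by (simp add: mp_const_def mp_var_def mult_single)
  have xxx: "?x a * ?x b * ?x d = (\<Sum>i\<in>UNIV. \<Sum>j\<in>UNIV. \<Sum>k\<in>UNIV. Poly_Mapping.single (mon3 i j k) (?g i a * ?g j b * ?g k d))" for a b d
    unfolding x sum_product_3 by (simp only: mult_single mon3_def)
  have "planes_section \<pi> (form c) = (\<Sum>a\<in>UNIV. \<Sum>b\<in>UNIV. \<Sum>d\<in>UNIV. ?h (c $ a $ b $ d) * (?x a * ?x b * ?x d))"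
    unfolding planes_section_def form_def mp_subst_sum[OF h] mp_subst_single[OF h] mon_val_mon3 ..
  also have "\<dots> = (\<Sum>a\<in>UNIV. \<Sum>b\<in>UNIV. \<Sum>d\<in>UNIV. \<Sum>i\<in>UNIV. \<Sum>j\<in>UNIV. \<Sum>k\<in>UNIV.
     Poly_Mapping.single (mon3 i j k) (mp_const (c $ a $ b $ d) * (?g i a * ?g j b * ?g k d)))"
    unfolding xxx by (simp add: sum_distrib_left mp_const_def[of "mp_const _"] mult_single)
  finally have s: "planes_section \<pi> (form c) = \<dots>" .
  have w: "mp_eval (p when Q) A = (mp_eval p A when Q)" for p :: "(chart_var, complex) mpoly" and Q
    by (simp add: when_def)
  have gr: "gr_mat \<pi> A $ i $ k = mp_eval (?g i k) A" for i k
    by (simp add: gr_mat_def gr_row_def)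
  have "mp_eval (Poly_Mapping.lookup (planes_section \<pi> (form c)) m) A =
     (\<Sum>a\<in>UNIV. \<Sum>b\<in>UNIV. \<Sum>d\<in>UNIV. sum_mon3 m (\<lambda>i j k. c $ a $ b $ d * (gr_mat \<pi> A $ i $ a * gr_mat \<pi> A $ j $ b * gr_mat \<pi> A $ k $ d)))"
    unfolding s lookup_sum lookup_single mp_eval_sum w mp_eval_mult mp_eval_const gr[symmetric] sum_mon3_def ..
  also have "\<dots> = sum_mon3 m (\<lambda>i j k. tri c (gr_mat \<pi> A $ i) (gr_mat \<pi> A $ j) (gr_mat \<pi> A $ k))"
  proof -
    have sw: "(\<Sum>a\<in>X. sum_mon3 m (f a)) = sum_mon3 m (\<lambda>i j k. \<Sum>a\<in>X. f a i j k)" for f :: "7 \<Rightarrow> 3 \<Rightarrow> 3 \<Rightarrow> 3 \<Rightarrow> complex" and X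
      by (induction X rule: infinite_finite_induct) (auto simp: sum_mon3_add sum_mon3_def)
    show ?thesis unfolding sw tri_def ..
  qed
  finally show ?thesis by (simp only: sum_mon3_tri)
qed

lemma gr_mat_upd:
  assumes \<pi>: "bij \<pi>"
  shows "gr_mat \<pi> (A((l, j) := A (l, j) + s)) $ i = gr_mat \<pi> A $ i + (if i = l then s else 0) *s axis (\<pi> (Inr j)) 1"
proof (rule vec_eq_iff[THEN iffD2], rule allI)
  fix k
  obtain r where k: "k = \<pi> r" using \<pi> by (meson bij_pointE)
  have inj: "\<pi> r = \<pi> r' \<longleftrightarrow> r = r'" for r r' using \<pi> by (simp add: bij_is_inj inj_eq)
  show "gr_mat \<pi> (A((l, j) := A (l, j) + s)) $ i $ k =
     (gr_mat \<pi> A $ i + (if i = l then s else 0) *s axis (\<pi> (Inr j)) 1) $ k"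
    unfolding k by (cases r) (auto simp: gr_mat_nth[OF \<pi>] axis_def inj)
qed

text \<open>The variable (l, j) moves row l alone, along one nonpivot axis. The factor 3 collects
  the Leibniz terms, which agree by symmetry.\<close>

lemma pderiv_planes_section:
  assumes \<pi>: "bij \<pi>"
  shows "mp_eval (mp_pderiv (l, j) (Poly_Mapping.lookup (planes_section \<pi> (form c)) m)) A =
     3 * (\<Sum>i\<in>UNIV. \<Sum>i'\<in>UNIV. polar c (gr_mat \<pi> A $ i) (gr_mat \<pi> A $ i') (axis (\<pi> (Inr j)) 1) when mon3 i i' l = m)"
proof -
  let ?R = "gr_mat \<pi> A" and ?e = "axis (\<pi> (Inr j)) 1 :: complex ^ 7"
  let ?u = "\<lambda>i. if i = l then 1 else 0 :: complex"
  let ?q = "Poly_Mapping.lookup (planes_section \<pi> (form c)) m"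
  let ?a = "A (l, j)"
  let ?P = "\<lambda>i k i'. polar c (?R $ i) (?R $ k) ?e * ?u i'"
  let ?D = "\<lambda>i k i'. ?P k i' i + (?P i i' k + ?P i k i')"
  have row: "gr_mat \<pi> (A((l, j) := z)) $ i = ?R $ i + ((z - ?a) * ?u i) *s ?e" for z i
    using gr_mat_upd[OF \<pi>, of A l j "z - ?a" i] by simp
  have der: "((\<lambda>z. polar c (gr_mat \<pi> (A((l, j) := z)) $ i) (gr_mat \<pi> (A((l, j) := z)) $ k) (gr_mat \<pi> (A((l, j) := z)) $ i'))
     has_field_derivative ?D i k i') (at ?a)" for i k i'
    unfolding row polar_add polar_scale
    by (rule derivative_eq_intros refl | simp)+ (simp add: polar_commute algebra_simps)
  have "((\<lambda>z. mp_eval ?q (A((l, j) := z))) has_field_derivative sum_mon3 m ?D) (at ?a)"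
    unfolding lookup_planes_section sum_mon3_def
  proof (intro DERIV_sum)
    fix i k i'
    show "((\<lambda>z. polar c (gr_mat \<pi> (A((l, j) := z)) $ i) (gr_mat \<pi> (A((l, j) := z)) $ k) (gr_mat \<pi> (A((l, j) := z)) $ i')
        when mon3 i k i' = m) has_field_derivative (?D i k i' when mon3 i k i' = m)) (at ?a)"
      using der[of i k i'] by (cases "mon3 i k i' = m") auto
  qed
  with mp_pderiv_eval[where p = ?q and x = A and i = "(l, j)"]
  have "mp_eval (mp_pderiv (l, j) ?q) A = sum_mon3 m ?D" by (rule DERIV_unique)
  also have "\<dots> = sum_mon3 m (\<lambda>i k i'. ?P k i' i) + (sum_mon3 m (\<lambda>i k i'. ?P i i' k) + sum_mon3 m ?P)"
    by (simp only: sum_mon3_add)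
  also have "sum_mon3 m (\<lambda>i k i'. ?P i i' k) = sum_mon3 m ?P" by (rule sum_mon3_swap(2))
  also have "sum_mon3 m (\<lambda>i k i'. ?P k i' i) = sum_mon3 m ?P"
    using sum_mon3_swap(1)[of m "\<lambda>i k i'. ?P i i' k"] sum_mon3_swap(2)[of m ?P] by simp
  also have "sum_mon3 m ?P + (sum_mon3 m ?P + sum_mon3 m ?P) = 3 * sum_mon3 m ?P" by simp
  also have "sum_mon3 m ?P = (\<Sum>i\<in>UNIV. \<Sum>i'\<in>UNIV. polar c (?R $ i) (?R $ i') ?e when mon3 i i' l = m)"
  proof -
    have "(\<Sum>k\<in>UNIV. ?P i i' k when mon3 i i' k = m) = (polar c (?R $ i) (?R $ i') ?e when mon3 i i' l = m)" for i i'
    proof -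
      have "(\<Sum>k\<in>UNIV. ?P i i' k when mon3 i i' k = m) =
         (\<Sum>k\<in>UNIV. if k = l then (polar c (?R $ i) (?R $ i') ?e when mon3 i i' l = m) else 0)"
        by (intro sum.cong refl) (auto simp: when_def)
      then show ?thesis by simp
    qed
    then show ?thesis unfolding sum_mon3_def by simp
  qed
  finally show ?thesis .
qed

lemma card_cubic_monomials:
  "finite {m :: 3 \<Rightarrow>\<^sub>0 nat. mon_degree m = 3}" "card {m :: 3 \<Rightarrow>\<^sub>0 nat. mon_degree m = 3} = 10"
proof -
  let ?M = "{m :: 3 \<Rightarrow>\<^sub>0 nat. mon_degree m = 3}"
  \<comment> \<open>A ternary cubic monomial is determined by its first two exponents p and q, with
    p + q at most 3.\<close>
  let ?S = "SIGMA p:{..3}. {..3 - p :: nat}"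
  let ?f = "\<lambda>(p, q). Poly_Mapping.single 1 p + Poly_Mapping.single 2 q + Poly_Mapping.single (3 :: 3) (3 - p - q :: nat)"
  have deg: "mon_degree m = Poly_Mapping.lookup m 1 + Poly_Mapping.lookup m 2 + Poly_Mapping.lookup m (3 :: 3)" for m
    using mon_degree_superset[of UNIV m] by (simp add: sum_UNIV_3)
  have inj: "inj_on ?f ?S"
  proof (rule inj_onI)
    fix x y assume eq: "?f x = ?f y"
    obtain p q p' q' where x: "x = (p, q)" "y = (p', q')" by (cases x, cases y)
    have "Poly_Mapping.lookup (?f x) 1 = Poly_Mapping.lookup (?f y) 1"
      "Poly_Mapping.lookup (?f x) 2 = Poly_Mapping.lookup (?f y) 2" using eq by simp_all
    then show "x = y" by (simp add: x lookup_add lookup_single when_def)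
  qed
  have "?f ` ?S = ?M"
  proof
    show "?f ` ?S \<subseteq> ?M" by (auto simp: mon_degree_add)
    show "?M \<subseteq> ?f ` ?S"
    proof
      fix m assume m: "m \<in> ?M"
      have "m = ?f (Poly_Mapping.lookup m 1, Poly_Mapping.lookup m 2)"
      proof (rule poly_mapping_eqI)
        fix k :: 3
        show "Poly_Mapping.lookup m k = Poly_Mapping.lookup (?f (Poly_Mapping.lookup m 1, Poly_Mapping.lookup m 2)) k"
          using m exhaust_3[of k] by (auto simp: deg lookup_add lookup_single when_def)
      qed
      moreover have "(Poly_Mapping.lookup m 1, Poly_Mapping.lookup m 2) \<in> ?S" using m by (auto simp: deg)
      ultimately show "m \<in> ?f ` ?S" by (rule image_eqI)
    qed
  qed
  moreover have "card ?S = 10" by (simp add: card_SigmaI eval_nat_numeral)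
  ultimately show "finite ?M" "card ?M = 10" using card_image[OF inj] by (auto intro: card_ge_0_finite)
qed

text \<open>Since 12 - 2 = 10, the ten equations themselves can be the local generators, with
  denominator 1. A linear relation between their differentials is a linear form on ternary cubics
  killing the image of the differential, and \<open>regular_point\<close> excludes it.\<close>

lemma smooth_at_plane:
  assumes \<pi>: "bij \<pi>" and van: "vanishes c (gr_mat \<pi> A)" and reg: "regular_point c (gr_mat \<pi> A)"
  shows "smooth_at (planes_eqs \<pi> (form c)) 2 A"
proof -
  let ?M = "{m :: 3 \<Rightarrow>\<^sub>0 nat. mon_degree m = 3}"
  let ?R = "gr_mat \<pi> A"
  let ?s = "Poly_Mapping.lookup (planes_section \<pi> (form c))"
  have cardv: "CARD(chart_var) = 12" by simp
  have "\<exists>\<mu>. bij_betw \<mu> {..<10 :: nat} ?M"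
    by (intro finite_same_card_bij) (simp_all add: card_cubic_monomials)
  then obtain \<mu> where \<mu>: "bij_betw \<mu> {..<10 :: nat} ?M" ..
  have eqs: "planes_eqs \<pi> (form c) = (\<lambda>j. ?s (\<mu> j)) ` {..<10}"
  proof -
    have "planes_eqs \<pi> (form c) = ?s ` ?M" by (auto simp: planes_eqs_def)
    also have "?M = \<mu> ` {..<10}" using \<mu> by (simp add: bij_betw_def)
    finally show ?thesis by (simp only: image_image)
  qed
  have zero: "mp_eval q A = 0" if "q \<in> planes_eqs \<pi> (form c)" for q
    using that van by (auto simp: planes_eqs_def lookup_planes_section sum_mon3_def vanishes_def)
  have indep: "\<forall>j<10. a j = 0"
    if a: "\<forall>v. (\<Sum>j<10. a j * mp_eval (mp_pderiv v (?s (\<mu> j))) A) = 0" for a :: "nat \<Rightarrow> complex"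
  proof -
    define \<alpha> where "\<alpha> = (\<lambda>m. a (the_inv_into {..<10} \<mu> m))"
    have \<alpha>\<mu>: "\<alpha> (\<mu> j) = a j" if "j < 10" for j
      using \<mu> that by (simp add: \<alpha>_def the_inv_into_f_f bij_betw_def)
    define L where "L = (\<lambda>l v. \<Sum>i\<in>UNIV. \<Sum>i'\<in>UNIV. \<alpha> (mon3 i i' l) * polar c (?R $ i) (?R $ i') v)"
    have e: "L l (axis (\<pi> (Inr j)) 1) = 0" for l j
    proof -
      let ?p = "\<lambda>i i'. polar c (?R $ i) (?R $ i') (axis (\<pi> (Inr j)) 1)"
      have "0 = (\<Sum>n<10. a n * (3 * (\<Sum>i\<in>UNIV. \<Sum>i'\<in>UNIV. ?p i i' when mon3 i i' l = \<mu> n)))"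
        using a[THEN spec, of "(l, j)"] unfolding pderiv_planes_section[OF \<pi>] by simp
      also have "\<dots> = (\<Sum>n<10. \<alpha> (\<mu> n) * (3 * (\<Sum>i\<in>UNIV. \<Sum>i'\<in>UNIV. ?p i i' when mon3 i i' l = \<mu> n)))"
        by (intro sum.cong refl) (simp add: \<alpha>\<mu>)
      also have "\<dots> = (\<Sum>m\<in>?M. \<alpha> m * (3 * (\<Sum>i\<in>UNIV. \<Sum>i'\<in>UNIV. ?p i i' when mon3 i i' l = m)))"
        by (rule sum.reindex_bij_betw[OF \<mu>])
      also have "\<dots> = 3 * (\<Sum>m\<in>?M. \<Sum>i\<in>UNIV. \<Sum>i'\<in>UNIV. \<alpha> m * (?p i i' when mon3 i i' l = m))"
        by (simp add: sum_distrib_left mult_ac)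
      also have "(\<Sum>m\<in>?M. \<Sum>i\<in>UNIV. \<Sum>i'\<in>UNIV. \<alpha> m * (?p i i' when mon3 i i' l = m)) =
         (\<Sum>i\<in>UNIV. \<Sum>i'\<in>UNIV. \<Sum>m\<in>?M. \<alpha> m * (?p i i' when mon3 i i' l = m))"
        by (subst sum.swap, intro sum.cong refl, rule sum.swap)
      also have "\<dots> = L l (axis (\<pi> (Inr j)) 1)"
        unfolding L_def
      proof (intro sum.cong refl)
        fix i i' :: 3
        have "(\<Sum>m\<in>?M. \<alpha> m * (?p i i' when mon3 i i' l = m)) = (\<Sum>m\<in>?M. if m = mon3 i i' l then \<alpha> (mon3 i i' l) * ?p i i' else 0)"
          by (intro sum.cong refl) (auto simp: when_def)
        also have "\<dots> = \<alpha> (mon3 i i' l) * ?p i i'" using card_cubic_monomials(1) by simp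
        finally show "(\<Sum>m\<in>?M. \<alpha> m * (?p i i' when mon3 i i' l = m)) = \<alpha> (mon3 i i' l) * ?p i i'" .
      qed
      finally show ?thesis by simp
    qed
    have Ladd: "L l (v + w) = L l v + L l w" for l v w
      by (simp add: L_def polar_add sum.distrib distrib_left)
    have Lscale: "L l (r *s v) = r * L l v" for l r v
      by (simp add: L_def polar_scale sum_distrib_left mult_ac)
    have L0: "L l 0 = 0" for l using Lscale[of l 0 0] by simp
    have Lsum: "L l (sum f X) = (\<Sum>x\<in>X. L l (f x))" for l f and X :: "'z set"
      by (induction X rule: infinite_finite_induct) (auto simp: Ladd L0)
    \<comment> \<open>The chart only tests nonpivot axes. Moves inside the plane leave the equations
      unchanged, and the rows of ?R together with the nonpivot axes span C^7, so the relation holds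
      in every direction.\<close>
    have LR: "L l (?R $ i) = 0" for l i
      using van by (simp add: L_def vanishes_def)
    have ax: "L l (axis x 1) = 0" for l x
    proof -
      obtain r where r: "x = \<pi> r" using \<pi> by (meson bij_pointE)
      show ?thesis
      proof (cases r)
        case (Inr j) then show ?thesis using e r by simp
      next
        case (Inl i)
        have inj: "\<pi> r = \<pi> r' \<longleftrightarrow> r = r'" for r r' using \<pi> by (simp add: bij_is_inj inj_eq)
        have "?R $ i = axis x 1 + (\<Sum>j\<in>UNIV. A (i, j) *s axis (\<pi> (Inr j)) 1)"
        proof (rule vec_eq_iff[THEN iffD2], rule allI)
          fix y
          obtain t where t: "y = \<pi> t" using \<pi> by (meson bij_pointE)
          show "?R $ i $ y = (axis x 1 + (\<Sum>j\<in>UNIV. A (i, j) *s axis (\<pi> (Inr j)) 1)) $ y"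
            unfolding t r Inl by (cases t) (auto simp: gr_mat_nth[OF \<pi>] axis_def inj mult_delta_right)
        qed
        then have "L l (?R $ i) = L l (axis x 1) + L l (\<Sum>j\<in>UNIV. A (i, j) *s axis (\<pi> (Inr j)) 1)"
          by (simp only: Ladd)
        then show ?thesis by (simp add: LR Lsum Lscale e)
      qed
    qed
    have "L l v = 0" for l v
    proof -
      have "L l v = L l (\<Sum>x\<in>UNIV. v $ x *s axis x 1)" by (simp only: vec7_expansion[symmetric])
      then show ?thesis by (simp only: Lsum Lscale ax) simp
    qed
    then have 1: "\<forall>k v. (\<Sum>i\<in>UNIV. \<Sum>j\<in>UNIV. \<alpha> (mon3 i j k) * polar c (?R $ i) (?R $ j) v) = 0"
      by (simp add: L_def)
    have 2: "\<forall>i j k. \<alpha> (mon3 i j k) = \<alpha> (mon3 j i k) \<and> \<alpha> (mon3 i j k) = \<alpha> (mon3 i k j)"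
      by (metis mon3_perm)
    have z: "\<forall>i j k. \<alpha> (mon3 i j k) = 0"
      using reg[unfolded regular_point_def, THEN spec, of "\<lambda>i j k. \<alpha> (mon3 i j k)"] 1 2 by blast
    show ?thesis
    proof (intro allI impI)
      fix j :: nat assume j: "j < 10"
      then have "mon_degree (\<mu> j) = 3" using \<mu> by (auto simp: bij_betw_def)
      then obtain i1 i2 i3 where "\<mu> j = mon3 i1 i2 i3" by (rule mon_degree_3E)
      then show "a j = 0" using z \<alpha>\<mu>[OF j] by metis
    qed
  qed
  show ?thesis
    unfolding smooth_at_def cardv
  proof (intro conjI exI[of _ "\<lambda>j. ?s (\<mu> j)"] exI[of _ 1])
    show "\<forall>q\<in>planes_eqs \<pi> (form c). mp_eval q A = 0" using zero by blast
    show "\<forall>j<12 - 2. ?s (\<mu> j) \<in> ideal_gen (planes_eqs \<pi> (form c))"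
      by (auto simp: eqs intro!: ideal_gen_base)
    show "\<forall>q\<in>planes_eqs \<pi> (form c). 1 * q \<in> ideal_gen ((\<lambda>j. ?s (\<mu> j)) ` {..<12 - 2})"
      by (auto simp: eqs intro!: ideal_gen_base)
    show "\<forall>a. (\<forall>i. (\<Sum>j<12 - 2. a j * mp_eval (mp_pderiv i (?s (\<mu> j))) A) = 0) \<longrightarrow> (\<forall>j<12 - 2. a j = 0)"
      using indep by simp
  qed simp_all
qed

section \<open>Pluecker equations\<close>

lemma homogeneous_single: "mon_degree m = d \<Longrightarrow> homogeneous d (Poly_Mapping.single m a)"
  by (simp add: homogeneous_def)

lemma homogeneous_add: "homogeneous d p \<Longrightarrow> homogeneous d q \<Longrightarrow> homogeneous d (p + q)"
  using Poly_Mapping.keys_add[of p q] unfolding homogeneous_def by blast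

lemma homogeneous_0: "homogeneous d 0"
  by (simp add: homogeneous_def)

lemma homogeneous_sum: "(\<And>i. i \<in> A \<Longrightarrow> homogeneous d (P i)) \<Longrightarrow> homogeneous d (sum P A)"
  by (induction A rule: infinite_finite_induct) (auto intro: homogeneous_add simp: homogeneous_0)

lemma frame_if_dim:
  assumes "fspan B \<in> Gr37"
  shows "frame B"
proof -
  obtain B' where B': "frame B'" "fspan B = fspan B'" using assms by (rule Gr37_frame)
  then obtain T where T: "B' = T ** B" using fspan_subset_iff[of B' B] by auto
  obtain C where "B' ** C = mat 1" using B'(1) unfolding frame_iff_right_inverse ..
  then have "T ** (B ** C) = mat 1" unfolding T by (simp add: matrix_mul_assoc)
  then have "B ** (C ** T) = mat 1" by (simp add: matrix_mul_assoc matrix_left_right_inverse)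
  then show ?thesis unfolding frame_iff_right_inverse ..
qed

text \<open>If \<open>x\<close> is the Pluecker vector of \<open>B\<close>, the rows of this matrix lie in the row space of \<open>B\<close>, and they span it
  when \<open>x K \<noteq> 0\<close>.\<close>

definition plucker_rows :: "((3 \<Rightarrow> 7) \<Rightarrow> complex) \<Rightarrow> (3 \<Rightarrow> 7) \<Rightarrow> complex ^ 7 ^ 3" where
  "plucker_rows x K = (\<chi> i l. x (K(i := l)))"

definition adj3 :: "complex ^ 3 ^ 3 \<Rightarrow> complex ^ 3 ^ 3" where
  "adj3 M = (\<chi> i r. det (\<chi> a j. if j = i then (if a = r then 1 else 0) else M $ a $ j))"

text \<open>A minor is linear in its i-th column; replacing that column by column l of B and
  expanding along it gives the entries of the adjugate times B.\<close>

lemma plucker_rows_minor: "plucker_rows (minor B) K = adj3 (\<chi> i j. B $ i $ K j) ** B"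
proof -
  have "minor B (K(i := l)) = (adj3 (\<chi> i j. B $ i $ K j) ** B) $ i $ l" for i l
    using exhaust_3[of i]
    by (elim disjE; simp add: minor_def adj3_def matrix_matrix_mult_def det_3 sum_UNIV_3 algebra_simps)
  then show ?thesis by (simp add: vec_eq_iff plucker_rows_def)
qed

lemma det_adj3: "det (adj3 M) = det M ^ 2"
  by (simp add: adj3_def det_3 power2_eq_square algebra_simps)

lemma minor_mult: "minor (T ** B) L = det T * minor B L"
proof -
  have "(\<chi> i j. (T ** B) $ i $ L j) = T ** (\<chi> i j. B $ i $ L j)"
    by (simp add: vec_eq_iff matrix_matrix_mult_def)
  then show ?thesis by (simp add: minor_def det_mul)
qed

text \<open>The cubic relation stating that x_K^2 x_L is the minor with columns L of
  \<open>plucker_rows x K\<close>. It comes from det (adj M) = (det M)^2, and these relations cut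
  out the cone of the Grassmannian as a set.\<close>

definition plucker_relation :: "(3 \<Rightarrow> 7) \<Rightarrow> (3 \<Rightarrow> 7) \<Rightarrow> (3 \<Rightarrow> 7, complex) mpoly" where
  "plucker_relation K L = Poly_Mapping.single (mon3 K K L) 1 + (\<Sum>p\<in>{p. p permutes UNIV}.
     Poly_Mapping.single (mon3 (K(1 := L (p 1))) (K(2 := L (p 2))) (K(3 := L (p 3)))) (- of_int (sign p)))"

lemma prod_UNIV_3: "(\<Prod>i\<in>UNIV. g i) = g 1 * g 2 * g (3 :: 3)"
  unfolding UNIV_3 by (simp add: mult.assoc)

lemma plucker_relation_eval:
  "mp_eval (plucker_relation K L) x = x K ^ 2 * x L - minor (plucker_rows x K) L"
proof -
  have "minor (plucker_rows x K) L = (\<Sum>p\<in>{p. p permutes UNIV}. of_int (sign p) *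
      (x (K(1 := L (p 1))) * x (K(2 := L (p 2))) * x (K(3 := L (p 3)))))"
    by (simp add: minor_def det_def plucker_rows_def prod_UNIV_3 mult.assoc)
  then show ?thesis
    by (simp add: plucker_relation_def power2_eq_square sum_negf)
qed

text \<open>Expresses that the rows of \<open>plucker_rows x K\<close> satisfy the equations of the
  cubic; each such row is linear in x, so the relation has degree 3.\<close>

definition cubic_relation :: "tensor \<Rightarrow> (3 \<Rightarrow> 7) \<Rightarrow> 3 \<Rightarrow> 3 \<Rightarrow> 3 \<Rightarrow> (3 \<Rightarrow> 7, complex) mpoly" where
  "cubic_relation c K i j k = (\<Sum>a\<in>UNIV. \<Sum>b\<in>UNIV. \<Sum>d\<in>UNIV.
     Poly_Mapping.single (mon3 (K(i := a)) (K(j := b)) (K(k := d))) (polar c (axis a 1) (axis b 1) (axis d 1)))"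

lemma polar_coordinates:
  "polar c x y z = (\<Sum>a\<in>UNIV. \<Sum>b\<in>UNIV. \<Sum>d\<in>UNIV. polar c (axis a 1) (axis b 1) (axis d 1) * (x $ a * y $ b * z $ d))"
proof -
  have "polar c x y z = polar c (\<Sum>a\<in>UNIV. x $ a *s axis a 1) (\<Sum>b\<in>UNIV. y $ b *s axis b 1) (\<Sum>d\<in>UNIV. z $ d *s axis d 1)"
    by (simp only: vec7_expansion[symmetric])
  then show ?thesis unfolding polar_sum3 polar_scale by (simp only: mult_ac)
qed

lemma cubic_relation_eval:
  "mp_eval (cubic_relation c K i j k) x =
     polar c (plucker_rows x K $ i) (plucker_rows x K $ j) (plucker_rows x K $ k)"
  by (subst polar_coordinates) (simp add: cubic_relation_def plucker_rows_def)

lemma plucker_eq_minor: "plucker B = minor (\<chi> i. B i)"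
  by (simp add: fun_eq_iff plucker_def minor_def)

lemma span_range_rows: "vec.span (range B) = fspan (\<chi> i. B i)"
  unfolding span_frame[symmetric] by (simp add: image_def)

text \<open>Plucker vectors of planes satisfy the relations by \<open>plucker_rows_minor\<close>.
  Conversely, at a solution with x_K nonzero, the matrix \<open>plucker_rows x K\<close> has minors
  x_K^2 x_L, so it is a frame of the required plane up to scaling.\<close>

lemma plucker_cone_planes:
  "plucker_cone (planes (form c)) =
     proj_zero_locus (range (\<lambda>(K, L). plucker_relation K L) \<union> range (\<lambda>(K, i, j, k). cubic_relation c K i j k))"
    (is "?L = ?R")
proof -
  have R: "x \<in> ?R \<longleftrightarrow> x \<noteq> (\<lambda>_. 0) \<and> (\<forall>K L. x K ^ 2 * x L = minor (plucker_rows x K) L) \<and>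
      (\<forall>K. vanishes c (plucker_rows x K))" for x
    by (simp add: proj_zero_locus_def ball_Un plucker_relation_eval cubic_relation_eval vanishes_def)
  show ?thesis
  proof (intro equalityI subsetI)
    fix x assume "x \<in> ?L"
    then obtain B0 where B0: "x = plucker B0" "vec.span (range B0) \<in> planes (form c)"
      by (auto simp: plucker_cone_def)
    define B where "B = (\<chi> i. B0 i)"
    have x: "x = minor B" using B0(1) by (simp add: B_def plucker_eq_minor)
    have W: "fspan B \<in> planes (form c)" using B0(2) by (simp add: B_def span_range_rows)
    then have fr: "frame B" by (intro frame_if_dim) (simp add: planes_def)
    have van: "vanishes c B" using W by (intro vanishes_if_cubic) (auto simp: planes_def mp_eval_form)
    have "x \<noteq> (\<lambda>_. 0)" using fr by (auto simp: frame_iff_minor x fun_eq_iff)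
    moreover have "x K ^ 2 * x L = minor (plucker_rows x K) L" for K L
      unfolding x plucker_rows_minor minor_mult det_adj3 by (simp add: minor_def)
    moreover have "vanishes c (plucker_rows x K)" for K
      unfolding x plucker_rows_minor by (rule vanishes_matrix_mult[OF van])
    ultimately show "x \<in> ?R" unfolding R by blast
  next
    fix x assume "x \<in> ?R"
    then have x: "x \<noteq> (\<lambda>_. 0)" "\<And>K L. x K ^ 2 * x L = minor (plucker_rows x K) L"
      "\<And>K. vanishes c (plucker_rows x K)" unfolding R by blast+
    obtain K where K: "x K \<noteq> 0" using x(1) by auto
    \<comment> \<open>Scaling a single row by 1 / x_K^2 makes the minors equal to x on the nose, as
      the cone consists of exact coordinate vectors.\<close>
    define T :: "complex ^ 3 ^ 3" where "T = (\<chi> i j. if i = j then (if i = 1 then 1 / x K ^ 2 else 1) else 0)"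
    define B where "B = T ** plucker_rows x K"
    have "det T = 1 / x K ^ 2" by (simp add: T_def det_3)
    then have m: "minor B L = x L" for L
      using K unfolding B_def minor_mult x(2)[symmetric] by simp
    have "frame B" using K m unfolding frame_iff_minor by metis
    moreover have "vanishes c B" unfolding B_def by (rule vanishes_matrix_mult[OF x(3)])
    ultimately have "fspan B \<in> planes (form c)" by (auto simp: planes_form plane_frames_def)
    moreover have "(\<chi> i. B $ i) = B" by (simp add: vec_eq_iff)
    ultimately have "vec.span (range (($) B)) \<in> planes (form c)" "plucker (($) B) = x"
      using m by (simp_all add: span_frame plucker_eq_minor fun_eq_iff)
    then show "x \<in> ?L" unfolding plucker_cone_def by blast
  qed
qed

lemma plucker_projective_planes: "plucker_projective (planes (form c))"
  unfolding plucker_projective_def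
proof (intro conjI exI)
  show "planes (form c) \<subseteq> Gr37" by (auto simp: planes_def)
  show "plucker_cone (planes (form c)) = proj_zero_locus
     (range (\<lambda>(K, L). plucker_relation K L) \<union> range (\<lambda>(K, i, j, k). cubic_relation c K i j k))"
    by (rule plucker_cone_planes)
  show "\<forall>F\<in>range (\<lambda>(K, L). plucker_relation K L) \<union> range (\<lambda>(K, i, j, k). cubic_relation c K i j k). \<exists>d. homogeneous d F"
    by (auto simp: plucker_relation_def cubic_relation_def
        intro!: exI[of _ 3] homogeneous_add homogeneous_sum homogeneous_single)
qed

section \<open>Planes in a general cubic\<close>

theorem corollary2p19:
  shows "\<exists>U. openin cubic_zariski U \<and> U \<noteq> {} \<and>
           (\<forall>f\<in>U. planes_smooth_projective_surface f)"
proof -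
  obtain \<Phi> f0 where f0: "f0 \<in> cubic_forms" "mp_eval \<Phi> (Poly_Mapping.lookup f0) \<noteq> 0"
    and \<Phi>: "\<And>c. mp_eval \<Phi> (Poly_Mapping.lookup (form c)) \<noteq> 0 \<Longrightarrow> nonsingular c \<and> tangency_free c"
    by (rule generic_nonsingular_tangency_free) (rule that)
  have gen: "nonsingular c \<and> tangency_free c" if "c \<in> generic \<Phi>" for c
    using that by (intro \<Phi>) (simp add: generic_def)
  let ?U = "{f \<in> cubic_forms. mp_eval \<Phi> (Poly_Mapping.lookup f) \<noteq> 0}"
  have "openin cubic_zariski ?U"
    unfolding cubic_zariski_def by (rule topology_generated_by_Basis) blast
  moreover have "?U \<noteq> {}" using f0 by blast
  moreover have "planes_smooth_projective_surface f" if U: "f \<in> ?U" for f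
  proof -
    have "f \<in> cubic_forms" using U by blast
    then obtain c where f: "f = form c" by (rule cubic_form_eq_form)
    then have c: "c \<in> generic \<Phi>" using U by (simp add: generic_def)
    have reg: "regular_point c B" if "B \<in> plane_frames c" for B
      using gen[OF c] that by (intro regular_point_if_generic) (auto simp: plane_frames_def)
    have "irreducible_space (subtopology gr_zariski (planes (form c)))"
    proof (rule irreducible_planes)
      show "regular_point c B" if "B \<in> plane_frames c" for B by (rule reg[OF that])
      show "connected (plane_frames c)" by (rule connected_plane_frames[OF _ c]) (rule gen)
      show "plane_frames c \<noteq> {}" by (rule plane_frames_nonempty[OF _ c]) (rule gen)
    qed
    moreover have "\<exists>\<pi> A. bij \<pi> \<and> W = gr_chart \<pi> A \<and> smooth_at (planes_eqs \<pi> (form c)) 2 A" if W: "W \<in> planes (form c)" for W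
    proof -
      have "W \<in> Gr37" using W by (simp add: planes_def)
      then obtain B where B: "frame B" "W = fspan B" by (rule Gr37_frame)
      obtain \<pi> A where \<pi>: "bij \<pi>" "fspan B = gr_chart \<pi> A" by (rule frame_in_chart[OF B(1)])
      have WA: "W = fspan (gr_mat \<pi> A)" using B(2) \<pi>(2) by (simp add: fspan_gr_mat)
      then have fr: "frame (gr_mat \<pi> A)" using \<open>W \<in> Gr37\<close> by (intro frame_if_dim) simp
      have van: "vanishes c (gr_mat \<pi> A)"
        using W WA by (intro vanishes_if_cubic) (simp add: planes_def mp_eval_form)
      have "smooth_at (planes_eqs \<pi> (form c)) 2 A"
        by (rule smooth_at_plane[OF \<pi>(1) van reg]) (simp add: plane_frames_def fr van)
      then show ?thesis using \<pi>(1) WA by (auto simp: fspan_gr_mat)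
    qed
    ultimately show ?thesis
      unfolding planes_smooth_projective_surface_def f by (blast intro: plucker_projective_planes)
  qed
  ultimately show ?thesis by blast
qed

end
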